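(* Let $n\ge1$, let $\rho^+,\rho^-$ be partitions, let $\bar\lambda$ be a balanced $n$-colored Young diagram, and let $\lambda=(\lambda_0,\dots,\lambda_{n-1})$ be the $n$-quotient of $\bar\lambda$. After the change of variables $v_i\leftrightarrow q_i$ ($1\le i\le n-1$), with $q=q_0q_1\cdots q_{n-1}$, \[ \tilde P^{\mathcal{X}}_{\rho^+,\rho^-,\bar\lambda}(\mathbf{q})=\frac{\tilde P^Y_{\rho^+,\rho^-,\lambda}(q,\mathbf{v})}{\tilde P^Y_{\emptyset,\emptyset,\emptyset}(q,\mathbf{v})}\left(\prod_{k=0}^{n-1}\ \prod_{(i,j)\in\lambda_k}\left((-1)^{n-k-1}q^{(n-k-1)(i-j)}\prod_{l=k+1}^{n-1}q_l^{\,n-l} \right)\right). \]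
   Context: **Partitions.** A partition $\rho=(\rho_0\ge\rho_1\ge\cdots)$ is viewed as a Young diagram in English notation, with rows and columns indexed from $0$; $(i,j)$ is the box in row $i$, column $j$. $|\rho|$ is the number of boxes and $\rho'$ the conjugate. The $l$-th diagonal is the set of boxes with $j-i=l$. An $n$-colored Young diagram $\bar\lambda$ is a Young diagram whose boxes in the $l$-th diagonal have color $l\bmod n$. It is *balanced* if it has the same number of boxes of each color. A border strip is a connected collection of boxes containing no $2\times2$ square and lying along the southeast border of the diagram (so that removing it leaves a Young diagram); its height $ht$ is the number of rows it occupies minus one. A balanced $\bar\lambda$ can be decomposed by successively removing border strips $\nu_1,\dots,\nu_d$ with $n$ boxes each, $d=|\bar\lambda|/n$, and \[ \frac{\chi_{\bar\lambda}(n^d)}{\dim(\lambda)}:=(-1)^{\sum_i ht(\nu_i)}, \] which is independent of the decomposition. **Slope sequences and quotients.** For a partition $\rho$ let $S(\rho)=\{\rho_0-1,\rho_1-2,\rho_2-3,\dots\}$ and $\rho(t)=+1$ if $t\in S(\rho)$, $\rho(t)=-1$ otherwise ($t\in\mathbb{Z}$). The $n$-tuple $\lambda=(\lambda_0,\dots,\lambda_{n-1})$ is the $n$-quotient of $\bar\lambda$ if $\bar\lambda(t)=\lambda_{\underline t}\left(\frac{t-\underline t}{n}\right)$ for all $t\in\mathbb{Z}$, where $\underline t\in\{0,\dots,n-1\}$ is $t\bmod n$. **Vertex operators.** On the free module generated by all partitions over formal Laurent series in the $q_i$, for a monomial $x$, put \[ \Gamma_{+1}(x)\tau=\sum_{\sigma\prec\tau}x^{|\tau|-|\sigma|}\sigma,\qquad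 \Gamma_{-1}(x)\tau=\sum_{\sigma\succ\tau}x^{|\sigma|-|\tau|}\sigma, \] where $\tau\succ\sigma$ means $\tau_0\ge\sigma_0\ge\tau_1\ge\sigma_1\ge\cdots$. $\langle\sigma|O|\tau\rangle$ is the coefficient of $\sigma$ in $O\tau$. **Orbifold vertex.** Let $\mathbf{q}=(q_0,\dots,q_{n-1})$ with indices mod $n$, $q=q_0\cdots q_{n-1}$, and define $\mathfrak{q}_t$ ($t\in\mathbb{Z}$) by $\mathfrak{q}_0=1$, $\mathfrak{q}_t=q_t\mathfrak{q}_{t-1}$. Then \[ V^{n}_{\rho^+,\rho^-,\bar\lambda}(\mathbf{q}):=q_0^{-|\rho^+|}\left\langle(\rho^-)'\,\Big|\, \prod_{t\in\mathbb{Z}}^{\rightarrow}\Gamma_{\bar\lambda(t)}\left(\mathfrak{q}_t^{-\bar\lambda(t)} \right) \Big|\, \rho^+ \right\rangle,\qquad P^{n}_{\rho^+,\rho^-,\bar\lambda}(\mathbf{q})=\frac{V^{n}_{\rho^+,\rho^-,\bar\lambda}(\mathbf{q})}{V^{n}_{\emptyset,\emptyset,\emptyset}(\mathbf{q})}, \] where the arrow means that $t$ increases from left to right. For $\mathcal{X}=[\mathbb{C}^3/\mathbb{Z}_n]$ (weights $(1,-1,0)$) write $P^{\mathcal{X}}:=P^n$. For $n=1$ this gives $P^1_{\rho^+,\rho^-,\lambda}(q)$ with $\mathfrak{q}_t=q^t$, for arbitrary partitions. **Resolution vertex.** With $\mathbf{v}=(v_1,\dots,v_{n-1})$, \[ P^Y_{\rho^+,\rho^-,(\lambda_0,\dots,\lambda_{n-1})}(q,\mathbf{v}):=\sum_{\tau_1,\dots,\tau_{n-1}}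 P^1_{\tau_1,\rho^-,\lambda_0}(q)(qv_1)^{|\tau_1|}P^1_{\tau_2,\tau_1',\lambda_1}(q)(qv_2)^{|\tau_2|}\cdots (qv_{n-1})^{|\tau_{n-1}|}P^1_{\rho^+,\tau_{n-1}',\lambda_{n-1}}(q), \] the sum being over all $(n-1)$-tuples of partitions. In $P^Y_{\emptyset,\emptyset,\emptyset}$ the last $\emptyset$ is the $n$-tuple $(\emptyset,\dots,\emptyset)$. **Normalized series.** \[ \tilde P^{\mathcal{X}}_{\rho^+,\rho^-,\bar\lambda}(\mathbf{q}):=\left(\frac{\chi_{\bar\lambda}(n^d)}{\dim(\lambda)}\prod_{(i,j)\in\bar\lambda}q_{j-i}^{i}\right)P^{\mathcal{X}}_{\rho^+,\rho^-,\bar\lambda}(\mathbf{q}),\qquad \tilde P^Y_{\rho^+,\rho^-,(\lambda_0,\dots,\lambda_{n-1})}:= \left(\prod_{k}\prod_{(i,j)\in\lambda_k}q^{i}\right)P^Y_{\rho^+,\rho^-,(\lambda_0,\dots,\lambda_{n-1})}. \] **Meaning of the equality.** The quotient of $\tilde P^Y$'s is a power series in $\mathbf{v}$ with coefficients rational in $q$, and it is the expansion of a rational function; the substitution $v_i=q_i$ and the equality are understood at the level of rational functions in $q_0,\dots,q_{n-1}$. *)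

theory Defs
  imports
    "HOL-Analysis.Infinite_Sum"
    "HOL-Computational_Algebra.Formal_Laurent_Series"
    "HOL-Computational_Algebra.Fraction_Field"
    "HOL-Library.Poly_Mapping"
    "HOL-Library.FuncSet"
begin

section \<open>Partitions\<close>

typedef partition = "{f :: nat \<Rightarrow> nat. antimono f \<and> finite {i. f i \<noteq> 0}}"
  morphisms row Partition
  by (rule exI[of _ "\<lambda>_. 0"]) (simp add: antimono_def)

setup_lifting type_definition_partition

lift_definition empty_partition :: partition is "\<lambda>_. 0"
  by (simp add: antimono_def)

lift_definition conj_partition :: "partition \<Rightarrow> partition" is "\<lambda>f j. card {i. j < f i}"
proof -
  fix f :: "nat \<Rightarrow> nat"
  assume f: "antimono f \<and> finite {i. f i \<noteq> 0}"
  have fin: "finite {i. j < f i}" for j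
    by (rule finite_subset[of _ "{i. f i \<noteq> 0}"]) (use f in auto)
  have "antimono (\<lambda>j. card {i. j < f i})"
    by (intro antimonoI card_mono fin) auto
  moreover have "{j. card {i. j < f i} \<noteq> 0} \<subseteq> {..<f 0}"
  proof
    fix j assume "j \<in> {j. card {i. j < f i} \<noteq> 0}"
    then have "{i. j < f i} \<noteq> {}" by force
    then obtain i where i: "j < f i" by auto
    have "f i \<le> f 0" using f antimonoD[of f 0 i] by simp
    with i show "j \<in> {..<f 0}" by simp
  qed
  ultimately show "antimono (\<lambda>j. card {i. j < f i}) \<and> finite {j. card {i. j < f i} \<noteq> 0}"
    using finite_subset by blast
qed

definition boxes :: "partition \<Rightarrow> (nat \<times> nat) set" where
  "boxes \<rho> = {(i, j). j < row \<rho> i}"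

definition psize :: "partition \<Rightarrow> nat" where
  "psize \<rho> = card (boxes \<rho>)"

text \<open>\<open>interlaces \<tau> \<sigma>\<close> is $\tau \succ \sigma$.\<close>

definition interlaces :: "partition \<Rightarrow> partition \<Rightarrow> bool" where
  "interlaces \<tau> \<sigma> \<longleftrightarrow> (\<forall>i. row \<sigma> i \<le> row \<tau> i \<and> row \<tau> (Suc i) \<le> row \<sigma> i)"

definition balanced :: "nat \<Rightarrow> partition \<Rightarrow> bool" where
  "balanced n \<rho> \<longleftrightarrow> (\<forall>c\<in>{0..<int n}. \<forall>c'\<in>{0..<int n}.
     card {(i, j) \<in> boxes \<rho>. (int j - int i) mod int n = c} =
     card {(i, j) \<in> boxes \<rho>. (int j - int i) mod int n = c'})"


section \<open>Border strips\<close>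

definition adjacent :: "nat \<times> nat \<Rightarrow> nat \<times> nat \<Rightarrow> bool" where
  "adjacent a b \<longleftrightarrow>
     \<bar>int (fst a) - int (fst b)\<bar> + \<bar>int (snd a) - int (snd b)\<bar> = 1"

definition connected_boxes :: "(nat \<times> nat) set \<Rightarrow> bool" where
  "connected_boxes \<nu> \<longleftrightarrow>
     (\<forall>a\<in>\<nu>. \<forall>b\<in>\<nu>. (a, b) \<in> {(x, y). x \<in> \<nu> \<and> y \<in> \<nu> \<and> adjacent x y}\<^sup>*)"

definition border_strip :: "partition \<Rightarrow> (nat \<times> nat) set \<Rightarrow> bool" where
  "border_strip \<rho> \<nu> \<longleftrightarrow> \<nu> \<noteq> {} \<and> \<nu> \<subseteq> boxes \<rho> \<and> connected_boxes \<nu> \<and>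
     \<not> (\<exists>i j. {(i, j), (Suc i, j), (i, Suc j), (Suc i, Suc j)} \<subseteq> \<nu>) \<and>
     (\<exists>\<sigma>. boxes \<sigma> = boxes \<rho> - \<nu>)"

definition strip_height :: "(nat \<times> nat) set \<Rightarrow> nat" where
  "strip_height \<nu> = card (fst ` \<nu>) - 1"

inductive strip_decomposition :: "nat \<Rightarrow> partition \<Rightarrow> (nat \<times> nat) set list \<Rightarrow> bool" for n where
  Nil: "strip_decomposition n empty_partition []"
| Cons: "border_strip \<rho> \<nu> \<Longrightarrow> card \<nu> = n \<Longrightarrow> boxes \<sigma> = boxes \<rho> - \<nu> \<Longrightarrow>
         strip_decomposition n \<sigma> \<nu>s \<Longrightarrow> strip_decomposition n \<rho> (\<nu> # \<nu>s)"

text \<open>The sign $\chi_{\bar\lambda}(n^d)/\dim(\lambda)$.  For balanced \<open>\<rho>\<close> a decomposition exists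
  and the sign does not depend on the one that is picked.\<close>

definition chi_sign :: "nat \<Rightarrow> partition \<Rightarrow> int" where
  "chi_sign n \<rho> = (-1) ^ (\<Sum>\<nu>\<leftarrow>(SOME \<nu>s. strip_decomposition n \<rho> \<nu>s). strip_height \<nu>)"


section \<open>Slope sequences and quotients\<close>

definition slope_set :: "partition \<Rightarrow> int set" where
  "slope_set \<rho> = {int (row \<rho> i) - int i - 1 | i. True}"

definition slope :: "partition \<Rightarrow> int \<Rightarrow> int" where
  "slope \<rho> t = (if t \<in> slope_set \<rho> then 1 else -1)"

text \<open>Only the components \<open>l 0, \<dots>, l (n - 1)\<close> of the tuple \<open>l\<close> matter.\<close>

definition is_quotient :: "nat \<Rightarrow> partition \<Rightarrow> (nat \<Rightarrow> partition) \<Rightarrow> bool" where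
  "is_quotient n \<rho> l \<longleftrightarrow>
     (\<forall>t. slope \<rho> t = slope (l (nat (t mod int n))) ((t - t mod int n) div int n))"


section \<open>Vertex operators\<close>

text \<open>A (formal, possibly infinite) combination of partitions is its coefficient function
  \<open>partition \<Rightarrow> 'a\<close>.  The ring \<open>'a\<close> of coefficients will be a field of Laurent series with its
  adic topology.\<close>

definition basis_vector :: "partition \<Rightarrow> partition \<Rightarrow> 'a::zero_neq_one" where
  "basis_vector \<tau> = (\<lambda>\<sigma>. if \<sigma> = \<tau> then 1 else 0)"

text \<open>\<open>Gamma_coeff s x \<sigma> \<tau>\<close> is the matrix coefficient
  $\langle\sigma|\Gamma_s(x)|\tau\rangle$ for $s = \pm 1$.\<close>

definition Gamma_coeff :: "int \<Rightarrow> 'a::comm_ring_1 \<Rightarrow> partition \<Rightarrow> partition \<Rightarrow> 'a" where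
  "Gamma_coeff s x \<sigma> \<tau> =
     (if s = 1
      then (if interlaces \<tau> \<sigma> then x ^ (psize \<tau> - psize \<sigma>) else 0)
      else (if interlaces \<sigma> \<tau> then x ^ (psize \<sigma> - psize \<tau>) else 0))"

definition Gamma :: "int \<Rightarrow> 'a \<Rightarrow> (partition \<Rightarrow> 'a) \<Rightarrow> partition \<Rightarrow> 'a::{field, t2_space}" where
  "Gamma s x f = (\<lambda>\<sigma>. \<Sum>\<^sub>\<infinity>\<tau>. Gamma_coeff s x \<sigma> \<tau> * f \<tau>)"


section \<open>The orbifold vertex\<close>

definition cyc :: "nat \<Rightarrow> (nat \<Rightarrow> 'a) \<Rightarrow> int \<Rightarrow> 'a" where
  "cyc n q t = q (nat (t mod int n))"

definition frak_q :: "nat \<Rightarrow> (nat \<Rightarrow> 'a) \<Rightarrow> int \<Rightarrow> 'a::field" where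
  "frak_q n q t = (\<Prod>s\<in>{1..t}. cyc n q s) / (\<Prod>s\<in>{t + 1..0}. cyc n q s)"

lemma frak_q_0: "frak_q n q 0 = 1"
  by (simp add: frak_q_def)

lemma frak_q_rec:
  assumes "\<And>i. q i \<noteq> 0"
  shows "frak_q n q t = cyc n q t * frak_q n q (t - 1)"
proof (cases "t \<ge> 1")
  case True
  then have "{1..t} = insert t {1..t - 1}" by auto
  with True show ?thesis by (simp add: frak_q_def)
next
  case False
  then have "{t..0} = insert t {t + 1..0}" by auto
  moreover have "cyc n q t \<noteq> 0" using assms by (simp add: cyc_def)
  ultimately show ?thesis using False by (simp add: frak_q_def)
qed

text \<open>The product over all \<open>t\<close> is the limit of the products over \<open>-N \<le> t \<le> N\<close>; \<open>foldr\<close> applies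
  the operator with the largest \<open>t\<close> first, i.e. \<open>t\<close> increases from left to right.\<close>

definition V :: "nat \<Rightarrow> (nat \<Rightarrow> 'a) \<Rightarrow> partition \<Rightarrow> partition \<Rightarrow> partition \<Rightarrow> 'a::{field, t2_space}"
  where
  "V n q \<rho>p \<rho>m \<rho> = q 0 powi (- int (psize \<rho>p)) *
     lim (\<lambda>N. foldr (\<lambda>t. Gamma (slope \<rho> t) (frak_q n q t powi (- slope \<rho> t)))
                    [- int N..int N] (basis_vector \<rho>p) (conj_partition \<rho>m))"

definition P :: "nat \<Rightarrow> (nat \<Rightarrow> 'a) \<Rightarrow> partition \<Rightarrow> partition \<Rightarrow> partition \<Rightarrow> 'a::{field, t2_space}"
  where
  "P n q \<rho>p \<rho>m \<rho> =
     V n q \<rho>p \<rho>m \<rho> / V n q empty_partition empty_partition empty_partition"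


section \<open>Formal series in several variables\<close>

text \<open>\<open>'c gseries\<close> is the field $\mathrm{Frac}(c[x_0,x_1,\dots])((z))$, and \<open>gvar i\<close> is the
  series $x_i z$.  Formal Laurent series in several variables $u_i$ (with total degree bounded
  below and finitely many monomials in each total degree) embed into it by $u_i \mapsto x_i z$: the
  coefficient of $z^m$ is the homogeneous part of degree $m$.  The embedding is compatible with
  infinite sums, and it extends to an embedding of the rational functions in the $u_i$, because
  the \<open>gvar i\<close> are algebraically independent over \<open>'c\<close>.\<close>

type_synonym 'c gseries = "((nat \<Rightarrow>\<^sub>0 nat) \<Rightarrow>\<^sub>0 'c) fract fls"

definition gconst :: "'c::idom \<Rightarrow> 'c gseries" where
  "gconst c = fls_const (Fract (Poly_Mapping.single 0 c) 1)"

definition gvar :: "nat \<Rightarrow> 'c::idom gseries" where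
  "gvar i = fls_const (Fract (Poly_Mapping.single (Poly_Mapping.single i 1) 1) 1) * fls_X"

text \<open>Polynomials with integer coefficients and their values; every rational function over the
  rationals is a quotient of two such polynomials.\<close>

type_synonym mpoly_int = "(nat \<Rightarrow>\<^sub>0 nat) \<Rightarrow>\<^sub>0 int"

definition mpoly_vars :: "mpoly_int \<Rightarrow> nat set" where
  "mpoly_vars p = (\<Union>m\<in>Poly_Mapping.keys p. Poly_Mapping.keys m)"

definition mpoly_eval :: "(nat \<Rightarrow> 'a) \<Rightarrow> mpoly_int \<Rightarrow> 'a::comm_ring_1" where
  "mpoly_eval y p = (\<Sum>m\<in>Poly_Mapping.keys p. of_int (Poly_Mapping.lookup p m) *
     (\<Prod>i\<in>Poly_Mapping.keys m. y i ^ Poly_Mapping.lookup m i))"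


section \<open>The two normalized series\<close>

text \<open>On the orbifold side the variables $q_0,\dots,q_{n-1}$ are \<open>gvar 0, \<dots>, gvar (n - 1)\<close>, with
  rational coefficients.\<close>

definition qX :: "nat \<Rightarrow> rat gseries" where
  "qX n = (\<Prod>k<n. gvar k)"

definition PX_tilde :: "nat \<Rightarrow> partition \<Rightarrow> partition \<Rightarrow> partition \<Rightarrow> rat gseries" where
  "PX_tilde n \<rho>p \<rho>m \<rho> =
     of_int (chi_sign n \<rho>) * (\<Prod>(i, j)\<in>boxes \<rho>. cyc n gvar (int j - int i) ^ i) *
     P n gvar \<rho>p \<rho>m \<rho>"

text \<open>On the resolution side, $q$ is the variable of the coefficient field \<open>rat fls\<close>, in which
  the vertices $P^1$ live, and $v_1,\dots,v_{n-1}$ are \<open>gvar 1, \<dots>, gvar (n - 1)\<close>.  Thus the sum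
  over the $\tau$'s is a power series in the $v_i$ over the Laurent series in $q$.\<close>

definition P1 :: "partition \<Rightarrow> partition \<Rightarrow> partition \<Rightarrow> rat fls" where
  "P1 \<rho>p \<rho>m \<rho> = P 1 (\<lambda>_. fls_X) \<rho>p \<rho>m \<rho>"

definition qY :: "rat fls gseries" where
  "qY = gconst fls_X"

definition PY :: "nat \<Rightarrow> partition \<Rightarrow> partition \<Rightarrow> (nat \<Rightarrow> partition) \<Rightarrow> rat fls gseries" where
  "PY n \<rho>p \<rho>m l = (\<Sum>\<^sub>\<infinity>\<tau>\<in>PiE {1..<n} (\<lambda>_. UNIV).
     (\<Prod>k<n. gconst (P1 (if k = n - 1 then \<rho>p else \<tau> (k + 1))
                         (if k = 0 then \<rho>m else conj_partition (\<tau> k)) (l k))) *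
     (\<Prod>k\<in>{1..<n}. (qY * gvar k) ^ psize (\<tau> k)))"

definition PY_tilde :: "nat \<Rightarrow> partition \<Rightarrow> partition \<Rightarrow> (nat \<Rightarrow> partition) \<Rightarrow> rat fls gseries" where
  "PY_tilde n \<rho>p \<rho>m l = (\<Prod>k<n. \<Prod>(i, j)\<in>boxes (l k). qY ^ i) * PY n \<rho>p \<rho>m l"

end

theory Submission
  imports Defs "HOL-Analysis.Elementary_Metric_Spaces"
begin

text \<open>Both sides have a closed form, and the two closed forms differ by an explicit monomial.

Read a slope sequence as a configuration of particles, the integers \<open>t \<in> slope_set \<rho>\<close>, and holes, the
other integers.  In the vertex every particle carries an annihilation operator and every hole a
creation operator.  Moving the annihilation operators to the right of the creation operators
(\<open>normal_ordering\<close>) leaves a finite matrix element times one factor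
\<open>1 / (1 - frak_q t' / frak_q t)\<close> for each particle \<open>t\<close> and hole \<open>t' > t\<close>.  In the quotient by the
empty vertex all but finitely many of these factors cancel, because a partition has as many
particles at nonnegative as holes at negative positions (\<open>pair_product\<close>).  As
\<open>frak_q (n m + k)\<close> is $q^m q_1 \cdots q_k$, the operators fall into \<open>n\<close> blocks according to the
residue \<open>k\<close>; block \<open>k\<close> sees the particles and holes of the component \<open>l k\<close> of the quotient, with variables
that are powers of $q$ up to the common factor $q_1 \cdots q_k$.  This is \<open>P_formula\<close>.

On the resolution side each factor $P^1$ is such a matrix element with a single block, and the sum over
the partitions $\tau_k$ composes the operators of consecutive blocks.  Moving the annihilation operators of
the earlier blocks past the creation operators of the later ones (\<open>chain_has_sum\<close>) gives the same matrix
element, and the same factors for pairs inside one block (\<open>PY_ratio\<close>).  For two blocks \<open>k < K\<close> the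
resolution orders all particles of \<open>k\<close> before all holes of \<open>K\<close>, whereas the orbifold goes by the
position \<open>t\<close>.  The corresponding factors are \<open>1 - x\<close> on one side and \<open>1 - 1 / x\<close> on the other, so that the
quotient of both sides is a product of monomials \<open>- x\<close>, the \<open>swap_monomial\<close>
(\<open>inverse_pair_product_factor\<close>).

It remains to identify this monomial, times the sign and the box weights, with the monomial of the theorem.
Removing a border strip of \<open>n\<close> boxes moves one particle from \<open>t + n\<close> to \<open>t\<close>, and thereby removes one
box from one component of the quotient.  Each of these moves changes both monomials by the same factor
(\<open>move_weight\<close>), and induction on the number of strips finishes the computation
(\<open>sign_box_identity\<close>).

The two fields of series contain the rational functions in different ways.  Both closed forms are the same
expression, built by field operations from the variables, so that they are the values of the same
quotient of polynomials (\<open>same_rat_res_expr\<close>).\<close>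

section \<open>Laurent series: orders, limits and infinite sums\<close>

text \<open>The condition that \<open>f\<close> vanishes to order \<open>d\<close>, in a form that includes \<open>f = 0\<close>.\<close>

definition ord_ge :: "int \<Rightarrow> 'a::zero fls \<Rightarrow> bool" where
  "ord_ge d f \<longleftrightarrow> (\<forall>m<d. fls_nth f m = 0)"

lemma ord_ge_iff: "ord_ge d f \<longleftrightarrow> f = 0 \<or> d \<le> fls_subdegree f"
proof
  assume "ord_ge d f"
  then show "f = 0 \<or> d \<le> fls_subdegree f"
    unfolding ord_ge_def using nth_fls_subdegree_nonzero[of f] not_le by blast
qed (auto simp: ord_ge_def)

lemma ord_ge_0 [simp]: "ord_ge d 0"
  by (simp add: ord_ge_def)

lemma ord_ge_1 [simp]: "ord_ge d (1 :: 'a::zero_neq_one fls) \<longleftrightarrow> d \<le> 0"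
  by (auto simp: ord_ge_iff)

lemma ord_ge_subdegree [simp]: "ord_ge (fls_subdegree f) f"
  by (simp add: ord_ge_iff)

lemma ord_ge_mono: "ord_ge d f \<Longrightarrow> e \<le> d \<Longrightarrow> ord_ge e f"
  by (simp add: ord_ge_def)

lemma ord_ge_add: "ord_ge d f \<Longrightarrow> ord_ge d g \<Longrightarrow> ord_ge d (f + g)" for f g :: "'a::monoid_add fls"
  by (simp add: ord_ge_def)

lemma ord_ge_diff: "ord_ge d f \<Longrightarrow> ord_ge d g \<Longrightarrow> ord_ge d (f - g)" for f g :: "'a::group_add fls"
  by (simp add: ord_ge_def)

lemma ord_ge_minus: "ord_ge d (- f) \<longleftrightarrow> ord_ge d f" for f :: "'a::group_add fls"
  by (simp add: ord_ge_def)

lemma ord_ge_sum: "(\<And>i. i \<in> I \<Longrightarrow> ord_ge d (f i)) \<Longrightarrow> ord_ge d (sum f I)"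
  for f :: "_ \<Rightarrow> 'a::comm_monoid_add fls"
  by (induction I rule: infinite_finite_induct) (auto intro: ord_ge_add)

lemma ord_ge_mult:
  fixes f g :: "'a::semiring_0 fls"
  assumes "ord_ge a f" "ord_ge b g"
  shows "ord_ge (a + b) (f * g)"
proof (cases "f * g = 0")
  case False
  then have "f \<noteq> 0" "g \<noteq> 0" by auto
  with assms have "a \<le> fls_subdegree f" "b \<le> fls_subdegree g" by (auto simp: ord_ge_iff)
  moreover have "fls_subdegree f + fls_subdegree g \<le> fls_subdegree (f * g)"
    using False by (rule fls_mult_subdegree_ge)
  ultimately show ?thesis by (simp add: ord_ge_iff)
qed simp

lemma ord_ge_mult_le:
  fixes f g :: "'a::semiring_0 fls"
  shows "ord_ge a f \<Longrightarrow> ord_ge b g \<Longrightarrow> d \<le> a + b \<Longrightarrow> ord_ge d (f * g)"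
  using ord_ge_mult ord_ge_mono by blast

lemma ord_ge_power: "ord_ge a f \<Longrightarrow> ord_ge (int n * a) (f ^ n)" for f :: "'a::comm_semiring_1 fls"
proof (induction n)
  case (Suc n)
  have "ord_ge (a + int n * a) (f * f ^ n)" by (rule ord_ge_mult[OF Suc.prems Suc.IH[OF Suc.prems]])
  then show ?case by (simp add: distrib_right)
qed simp

text \<open>The metric on Laurent series is the adic one.  Its limits are described by orders alone, which is the form in which
convergence is established everywhere below.\<close>

lemma fls_tendsto_iff:
  fixes l :: "'a::group_add fls"
  shows "(f \<longlongrightarrow> l) F \<longleftrightarrow> (\<forall>d. \<forall>\<^sub>F x in F. ord_ge d (f x - l))"
proof
  assume L: "(f \<longlongrightarrow> l) F"
  show "\<forall>d. \<forall>\<^sub>F x in F. ord_ge d (f x - l)"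
  proof
    fix d :: int
    have "\<forall>\<^sub>F x in F. dist (f x) l < inverse (2 ^ nat d)"
      using L by (rule tendstoD) simp
    then show "\<forall>\<^sub>F x in F. ord_ge d (f x - l)"
    proof eventually_elim
      case (elim x)
      show ?case
      proof (cases "f x = l")
        case False
        have le1: "inverse (2 ^ nat d) \<le> (1::real)"
          by (simp add: divide_simps)
        have ge0: "0 \<le> fls_subdegree (f x - l)"
        proof (rule ccontr)
          assume *: "\<not> ?thesis"
          have "(1::real) \<le> 2 ^ nat (- fls_subdegree (f x - l))" by simp
          with * False elim le1 show False by (simp add: dist_fls_def)
        qed
        with False elim have "inverse (2 ^ nat (fls_subdegree (f x - l))) < (inverse (2 ^ nat d) :: real)"
          by (simp add: dist_fls_def)
        then have "(2::real) ^ nat d < 2 ^ nat (fls_subdegree (f x - l))" by simp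
        then have "nat d < nat (fls_subdegree (f x - l))" by simp
        then show ?thesis by (simp add: ord_ge_iff)
      qed simp
    qed
  qed
next
  assume R: "\<forall>d. \<forall>\<^sub>F x in F. ord_ge d (f x - l)"
  show "(f \<longlongrightarrow> l) F"
  proof (rule tendstoI)
    fix e :: real assume "0 < e"
    then obtain n where n: "inverse (2 ^ n) < e"
      using real_arch_pow_inv[of e "1/2"] by (auto simp: power_one_over inverse_eq_divide)
    have "\<forall>\<^sub>F x in F. ord_ge (int n) (f x - l)" using R by blast
    then show "\<forall>\<^sub>F x in F. dist (f x) l < e"
    proof eventually_elim
      case (elim x)
      show ?case
      proof (cases "f x = l")
        case False
        with elim have *: "int n \<le> fls_subdegree (f x - l)" by (auto simp: ord_ge_iff)
        then have "(2::real) ^ n \<le> 2 ^ nat (fls_subdegree (f x - l))" by (intro power_increasing) auto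
        then have "inverse (2 ^ nat (fls_subdegree (f x - l))) \<le> (inverse (2 ^ n) :: real)"
          by (intro le_imp_inverse_le) auto
        then have "inverse (2 ^ nat (fls_subdegree (f x - l))) < e" using n by (rule le_less_trans)
        with * False show ?thesis by (simp add: dist_fls_def)
      qed (use \<open>0 < e\<close> in simp)
    qed
  qed
qed

instance fls :: (ab_group_add) topological_comm_monoid_add
proof
  fix a b :: "'a fls"
  have "\<forall>\<^sub>F x in nhds a \<times>\<^sub>F nhds b. ord_ge d (fst x + snd x - (a + b))" for d
  proof -
    have "((\<lambda>x. x) \<longlongrightarrow> a) (nhds a)" "((\<lambda>x. x) \<longlongrightarrow> b) (nhds b)" by (simp_all add: tendsto_ident_at filterlim_ident)
    then have "\<forall>\<^sub>F x in nhds a. ord_ge d (x - a)" "\<forall>\<^sub>F x in nhds b. ord_ge d (x - b)"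
      unfolding fls_tendsto_iff by blast+
    then have "\<forall>\<^sub>F x in nhds a \<times>\<^sub>F nhds b. ord_ge d (fst x - a) \<and> ord_ge d (snd x - b)"
      by (auto simp: eventually_prod_filter)
    then show ?thesis
      by eventually_elim (use ord_ge_add in \<open>fastforce simp: algebra_simps\<close>)
  qed
  then show "((\<lambda>x. fst x + snd x) \<longlongrightarrow> a + b) (nhds a \<times>\<^sub>F nhds b)"
    by (simp add: fls_tendsto_iff)
qed

instance fls :: (ab_group_add) topological_ab_group_add
proof
  fix a :: "'a fls"
  have "((\<lambda>x. x) \<longlongrightarrow> a) (nhds a)" by (simp add: filterlim_ident)
  then show "(uminus \<longlongrightarrow> - a) (nhds a)"
    unfolding fls_tendsto_iff
    by (metis (no_types, lifting) eventually_mono minus_diff_minus ord_ge_minus)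
qed

instance fls :: (ring) topological_semigroup_mult
proof
  fix a b :: "'a fls"
  have "\<forall>\<^sub>F x in nhds a \<times>\<^sub>F nhds b. ord_ge d (fst x * snd x - a * b)" for d
  proof -
    define c where "c = max 0 (max (- fls_subdegree a) (- fls_subdegree b))"
    have c: "0 \<le> c" "ord_ge (- c) a" "ord_ge (- c) b"
      by (auto simp: c_def ord_ge_iff)
    have "((\<lambda>x. x) \<longlongrightarrow> a) (nhds a)" "((\<lambda>x. x) \<longlongrightarrow> b) (nhds b)" by (simp_all add: filterlim_ident)
    then have "\<forall>\<^sub>F x in nhds a. ord_ge (max 0 d + c) (x - a)" "\<forall>\<^sub>F x in nhds b. ord_ge (max 0 d + c) (x - b)"
      unfolding fls_tendsto_iff by blast+
    then have "\<forall>\<^sub>F x in nhds a \<times>\<^sub>F nhds b. ord_ge (max 0 d + c) (fst x - a) \<and> ord_ge (max 0 d + c) (snd x - b)"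
      by (auto simp: eventually_prod_filter)
    then show ?thesis
    proof eventually_elim
      case (elim x)
      have "ord_ge d ((fst x - a) * (snd x - b))"
        by (rule ord_ge_mult_le[OF conjunct1[OF elim] conjunct2[OF elim]]) (use c in auto)
      moreover have "ord_ge d ((fst x - a) * b)"
        by (rule ord_ge_mult_le[OF conjunct1[OF elim] c(3)]) auto
      moreover have "ord_ge d (a * (snd x - b))"
        by (rule ord_ge_mult_le[OF c(2) conjunct2[OF elim]]) auto
      moreover have "fst x * snd x - a * b = (fst x - a) * (snd x - b) + (fst x - a) * b + a * (snd x - b)"
        by (simp add: algebra_simps)
      ultimately show ?case by (metis ord_ge_add)
    qed
  qed
  then show "((\<lambda>x. fst x * snd x) \<longlongrightarrow> a * b) (nhds a \<times>\<^sub>F nhds b)"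
    by (simp add: fls_tendsto_iff)
qed

lemma ord_ge_limit:
  fixes l :: "'a::group_add fls"
  assumes "(f \<longlongrightarrow> l) F" "F \<noteq> bot" "\<forall>\<^sub>F x in F. ord_ge d (f x)"
  shows "ord_ge d l"
proof -
  have "\<forall>\<^sub>F x in F. ord_ge d (f x - l)" using assms(1) by (simp add: fls_tendsto_iff)
  with assms(3) have "\<forall>\<^sub>F x in F. ord_ge d l"
    by eventually_elim (auto simp: ord_ge_def)
  then show ?thesis using assms(2) by simp
qed

lemma fls_has_sumI:
  fixes f :: "'i \<Rightarrow> 'a::ab_group_add fls"
  assumes "\<And>d. \<exists>E. finite E \<and> E \<subseteq> I \<and> (\<forall>i\<in>I - E. ord_ge d (f i)) \<and> ord_ge d (sum f E - s)"
  shows "(f has_sum s) I"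
  unfolding has_sum_def fls_tendsto_iff
proof
  fix d
  obtain E where "finite E \<and> E \<subseteq> I \<and> (\<forall>i\<in>I - E. ord_ge d (f i)) \<and> ord_ge d (sum f E - s)"
    using assms[of d] ..
  then have E: "finite E" "E \<subseteq> I" "\<forall>i\<in>I - E. ord_ge d (f i)" "ord_ge d (sum f E - s)"
    by simp_all
  show "\<forall>\<^sub>F F in finite_subsets_at_top I. ord_ge d (sum f F - s)"
    unfolding eventually_finite_subsets_at_top
  proof (intro exI[of _ E] conjI allI impI)
    fix F assume F: "finite F \<and> E \<subseteq> F \<and> F \<subseteq> I"
    have "sum f F - s = sum f (F - E) + (sum f E - s)"
      using F sum.subset_diff[of E F f] by simp
    moreover have "ord_ge d (sum f (F - E))" by (rule ord_ge_sum) (use F E in auto)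
    ultimately show "ord_ge d (sum f F - s)" using E(4) by (simp only: ord_ge_add)
  qed (use E(1,2) in auto)
qed

text \<open>A family of Laurent series is summable as soon as only finitely many members matter for each
  coefficient; the limit is assembled coefficient by coefficient.\<close>

lemma fls_summable:
  fixes f :: "'i \<Rightarrow> 'a::ab_group_add fls"
  assumes fin: "\<And>d. finite {i\<in>I. \<not> ord_ge d (f i)}"
  shows "f summable_on I"
proof -
  define E where "E d = {i\<in>I. \<not> ord_ge d (f i)}" for d
  have finE: "finite (E d)" for d using fin by (simp add: E_def)
  define b where "b = Min (insert 0 ((\<lambda>i. fls_subdegree (f i)) ` E 0))"
  have b: "ord_ge b (f i)" if "i \<in> I" for i
  proof (cases "i \<in> E 0")
    case True
    then have "b \<le> fls_subdegree (f i)" unfolding b_def by (intro Min_le) (auto simp: finE)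
    then show ?thesis by (simp add: ord_ge_iff)
  next
    case False
    moreover have "b \<le> 0" unfolding b_def by (intro Min_le) (auto simp: finE)
    ultimately show ?thesis using that ord_ge_mono by (auto simp: E_def)
  qed
  define s where "s = Abs_fls (\<lambda>m. \<Sum>i\<in>E (m + 1). fls_nth (f i) m)"
  have s: "fls_nth s m = (\<Sum>i\<in>E (m + 1). fls_nth (f i) m)" for m
    unfolding s_def
  proof (rule nth_Abs_fls_lower_bound)
    show "\<forall>k<b. (\<Sum>i\<in>E (k + 1). fls_nth (f i) k) = 0"
      using b by (auto simp: ord_ge_def E_def intro!: sum.neutral)
  qed
  have "(f has_sum s) I"
  proof (rule fls_has_sumI)
    fix d
    have "ord_ge d (sum f (E d) - s)"
      unfolding ord_ge_def
    proof (intro allI impI)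
      fix m assume m: "m < d"
      have "(\<Sum>i\<in>E d. fls_nth (f i) m) = (\<Sum>i\<in>E (m + 1). fls_nth (f i) m)"
      proof (rule sum.mono_neutral_right)
        show "E (m + 1) \<subseteq> E d" using m ord_ge_mono by (force simp: E_def)
        show "\<forall>i\<in>E d - E (m + 1). fls_nth (f i) m = 0" by (auto simp: E_def ord_ge_def)
      qed (rule finE)
      then show "fls_nth (sum f (E d) - s) m = 0"
        by (simp add: s fls_nth_sum)
    qed
    then show "\<exists>E. finite E \<and> E \<subseteq> I \<and> (\<forall>i\<in>I - E. ord_ge d (f i)) \<and> ord_ge d (sum f E - s)"
      by (intro exI[of _ "E d"]) (use finE in \<open>auto simp: E_def\<close>)
  qed
  then show ?thesis by (auto simp: summable_on_def)
qed

text \<open>In an ultrametric, consecutive differences that tend to zero suffice: the increments are then a summable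
family.\<close>

lemma fls_convergentI:
  fixes X :: "nat \<Rightarrow> 'a::ab_group_add fls"
  assumes "\<And>d. \<exists>N. \<forall>n\<ge>N. ord_ge d (X (Suc n) - X n)"
  obtains L where "X \<longlonglongrightarrow> L"
proof -
  have "(\<lambda>n. X (Suc n) - X n) summable_on UNIV"
  proof (rule fls_summable)
    fix d
    obtain N where N: "\<forall>n\<ge>N. ord_ge d (X (Suc n) - X n)" using assms[of d] ..
    have "n < N" if "\<not> ord_ge d (X (Suc n) - X n)" for n
      by (rule ccontr) (use N that in \<open>simp add: not_less\<close>)
    then have "{n \<in> UNIV. \<not> ord_ge d (X (Suc n) - X n)} \<subseteq> {..<N}" by blast
    then show "finite {n \<in> UNIV. \<not> ord_ge d (X (Suc n) - X n)}" by (rule finite_subset) simp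
  qed
  then obtain s where "((\<lambda>n. X (Suc n) - X n) has_sum s) UNIV" by (auto simp: summable_on_def)
  then have "(\<lambda>n. X (Suc n) - X n) sums s" by (rule has_sum_imp_sums)
  then have "(\<lambda>n. X n - X 0) \<longlonglongrightarrow> s" by (simp add: sums_def sum_lessThan_telescope)
  then have "(\<lambda>n. (X n - X 0) + X 0) \<longlonglongrightarrow> s + X 0" by (intro tendsto_add) auto
  then show ?thesis using that by simp
qed

section \<open>Partitions and interlacing\<close>

lemma row_antimono: "i \<le> j \<Longrightarrow> row \<rho> j \<le> row \<rho> i"
  using row[of \<rho>] by (simp add: antimono_def)

lemma finite_row_support: "finite {i. row \<rho> i \<noteq> 0}"
  using row[of \<rho>] by simp

lemma row_Partition: "antimono f \<Longrightarrow> finite {i. f i \<noteq> 0} \<Longrightarrow> row (Partition f) = f"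
  by (simp add: Partition_inverse)

lemma partition_eqI: "(\<And>i. row \<rho> i = row \<sigma> i) \<Longrightarrow> \<rho> = \<sigma>"
  by (metis ext row_inject)

lemma row_empty [simp]: "row empty_partition i = 0"
  by transfer simp

lemma rows_eventually_0: obtains K where "\<And>i. i \<ge> K \<Longrightarrow> row \<rho> i = 0"
proof -
  obtain K where "\<forall>i\<in>{i. row \<rho> i \<noteq> 0}. i < K"
    using finite_row_support[of \<rho>] finite_nat_set_iff_bounded by blast
  then show ?thesis by (intro that[of K]) force
qed

lemma rows_eventually_0_list:
  obtains K where "\<And>\<rho> i. \<rho> \<in> set \<rho>s \<Longrightarrow> i \<ge> K \<Longrightarrow> row \<rho> i = 0"
proof -
  have "\<exists>K. \<forall>\<rho>\<in>set \<rho>s. \<forall>i\<ge>K. row \<rho> i = 0"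
  proof (induction \<rho>s)
    case (Cons a \<rho>s)
    then obtain K where K: "\<forall>\<rho>\<in>set \<rho>s. \<forall>i\<ge>K. row \<rho> i = 0" ..
    obtain K' where "\<And>i. i \<ge> K' \<Longrightarrow> row a i = 0" using rows_eventually_0[of a] by metis
    with K show ?case by (intro exI[of _ "max K K'"]) auto
  qed simp
  then show ?thesis using that by metis
qed

lemma boxes_eq_Sigma: "(\<And>i. i \<ge> K \<Longrightarrow> row \<rho> i = 0) \<Longrightarrow> boxes \<rho> = Sigma {..<K} (\<lambda>i. {..<row \<rho> i})"
  by (auto simp: boxes_def) (metis not_less_zero not_less)

lemma finite_boxes [simp]: "finite (boxes \<rho>)"
proof -
  obtain K where "\<And>i. i \<ge> K \<Longrightarrow> row \<rho> i = 0" using rows_eventually_0 by metis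
  then show ?thesis by (simp add: boxes_eq_Sigma[of K])
qed

lemma psize_eq_sum: "(\<And>i. i \<ge> K \<Longrightarrow> row \<rho> i = 0) \<Longrightarrow> psize \<rho> = (\<Sum>i<K. row \<rho> i)"
  by (simp add: psize_def boxes_eq_Sigma[of K])

lemma boxes_inject: "boxes \<rho> = boxes \<sigma> \<longleftrightarrow> \<rho> = \<sigma>"
proof
  assume "boxes \<rho> = boxes \<sigma>"
  then have "j < row \<rho> i \<longleftrightarrow> j < row \<sigma> i" for i j by (auto simp: boxes_def set_eq_iff)
  then show "\<rho> = \<sigma>" by (intro partition_eqI) (meson linorder_neqE_nat less_irrefl)
qed simp

lemma boxes_empty [simp]: "boxes empty_partition = {}"
  by (simp add: boxes_def)

lemma psize_empty [simp]: "psize empty_partition = 0"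
  by (simp add: psize_def)

lemma psize_eq_0_iff [simp]: "psize \<rho> = 0 \<longleftrightarrow> \<rho> = empty_partition"
proof
  assume "psize \<rho> = 0"
  then have "boxes \<rho> = boxes empty_partition" by (simp add: psize_def)
  then show "\<rho> = empty_partition" by (simp only: boxes_inject)
qed simp

text \<open>The crude bound that makes the set of partitions of bounded size finite, so that sums over partitions of
bounded size are sums over finite sets.\<close>

lemma boxes_subset_square: "boxes \<rho> \<subseteq> {..<psize \<rho>} \<times> {..<psize \<rho>}"
proof
  fix b assume b: "b \<in> boxes \<rho>"
  obtain i j where [simp]: "b = (i, j)" by force
  have "{0..i} \<times> {0..j} \<subseteq> boxes \<rho>"
    using b row_antimono[of _ i \<rho>] by (fastforce simp: boxes_def)
  then have "card ({0..i} \<times> {0..j}) \<le> psize \<rho>"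
    unfolding psize_def by (intro card_mono) auto
  then have "Suc i * Suc j \<le> psize \<rho>" by simp
  moreover have "Suc i \<le> Suc i * Suc j" "Suc j \<le> Suc i * Suc j" by simp_all
  ultimately have "Suc i \<le> psize \<rho>" "Suc j \<le> psize \<rho>" using le_trans by blast+
  then show "b \<in> {..<psize \<rho>} \<times> {..<psize \<rho>}" by simp
qed

lemma finite_psize_le [simp]: "finite {\<rho>. psize \<rho> \<le> N}"
proof (rule finite_imageD)
  have "boxes \<rho> \<subseteq> {..<N} \<times> {..<N}" if "psize \<rho> \<le> N" for \<rho>
    using boxes_subset_square[of \<rho>] that by fastforce
  then have "boxes ` {\<rho>. psize \<rho> \<le> N} \<subseteq> Pow ({..<N} \<times> {..<N})" by blast
  then show "finite (boxes ` {\<rho>. psize \<rho> \<le> N})" by (rule finite_subset) simp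
  show "inj_on boxes {\<rho>. psize \<rho> \<le> N}" by (simp add: inj_on_def boxes_inject)
qed

lemma finite_psize_less [simp]: "finite {\<rho>. psize \<rho> < N}"
  by (rule finite_subset[OF _ finite_psize_le[of N]]) auto

lemma finite_psize_eq [simp]: "finite {\<rho>. psize \<rho> = N}"
  by (rule finite_subset[OF _ finite_psize_le[of N]]) auto

lemma less_row_conj_iff: "i < row (conj_partition \<rho>) j \<longleftrightarrow> j < row \<rho> i"
proof -
  have "row (conj_partition \<rho>) j = card {i. j < row \<rho> i}" by transfer simp
  moreover have "{i. j < row \<rho> i} = {..<card {i. j < row \<rho> i}}"
  proof -
    have fin: "finite {i. j < row \<rho> i}"
      by (rule finite_subset[OF _ finite_row_support[of \<rho>]]) auto
    define c where "c = (LEAST i. \<not> j < row \<rho> i)"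
    have ex: "\<exists>i. \<not> j < row \<rho> i"
      using rows_eventually_0[of \<rho>] by (metis not_less_zero order_refl)
    have c: "\<not> j < row \<rho> c" unfolding c_def by (rule LeastI_ex) (rule ex)
    have "j < row \<rho> i \<longleftrightarrow> i < c" for i
    proof (cases "i < c")
      case True
      then have "\<not> \<not> j < row \<rho> i" unfolding c_def by (rule not_less_Least)
      with True show ?thesis by simp
    next
      case False
      then have "row \<rho> i \<le> row \<rho> c" by (intro row_antimono) simp
      with False c show ?thesis by simp
    qed
    then have "{i. j < row \<rho> i} = {..<c}" by auto
    then show ?thesis by simp
  qed
  ultimately show ?thesis by auto
qed

lemma conj_conj [simp]: "conj_partition (conj_partition \<rho>) = \<rho>"
proof (rule partition_eqI)
  fix i
  have "j < row (conj_partition (conj_partition \<rho>)) i \<longleftrightarrow> j < row \<rho> i" for j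
    by (simp add: less_row_conj_iff)
  then show "row (conj_partition (conj_partition \<rho>)) i = row \<rho> i"
    by (meson linorder_neqE_nat less_irrefl)
qed

lemma conj_empty [simp]: "conj_partition empty_partition = empty_partition"
proof (rule partition_eqI)
  fix i
  have "\<not> j < row (conj_partition empty_partition) i" for j
    by (simp add: less_row_conj_iff)
  then show "row (conj_partition empty_partition) i = row empty_partition i" by (metis gr0I row_empty)
qed

lemma interlaces_refl [simp]: "interlaces \<rho> \<rho>"
  by (simp add: interlaces_def row_antimono)

lemma psize_mono:
  assumes "\<And>i. row \<sigma> i \<le> row \<tau> i"
  shows "psize \<sigma> \<le> psize \<tau>" "psize \<sigma> = psize \<tau> \<Longrightarrow> \<sigma> = \<tau>"
proof -
  have sub: "boxes \<sigma> \<subseteq> boxes \<tau>"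
    using assms by (auto simp: boxes_def intro: less_le_trans)
  then show "psize \<sigma> \<le> psize \<tau>" unfolding psize_def by (intro card_mono) auto
  show "\<sigma> = \<tau>" if "psize \<sigma> = psize \<tau>"
    using card_subset_eq[OF _ sub] that by (simp add: psize_def boxes_inject)
qed

lemma interlaces_psize:
  assumes "interlaces \<tau> \<sigma>"
  shows "psize \<sigma> \<le> psize \<tau>" "psize \<sigma> = psize \<tau> \<Longrightarrow> \<sigma> = \<tau>"
  using psize_mono[of \<sigma> \<tau>] assms by (auto simp: interlaces_def)

text \<open>A partition interlacing with both \<open>\<sigma>\<close> and \<open>\<tau>\<close> is a choice of rows in consecutive
  intervals.  Reflecting each row in its interval exchanges common upper and common lower
  neighbours, up to the first row, which is bounded only for the lower ones.\<close>

lemma card_common_interlacing: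
  "card {\<kappa>. interlaces \<kappa> \<sigma> \<and> interlaces \<kappa> \<tau> \<and> psize \<kappa> = N} =
   card {\<mu>. interlaces \<sigma> \<mu> \<and> interlaces \<tau> \<mu> \<and> psize \<sigma> + psize \<tau> \<le> psize \<mu> + N}"
    (is "card ?A = card ?B")
proof -
  define lo where "lo i = max (row \<sigma> i) (row \<tau> i)" for i
  define hi where "hi i = min (row \<sigma> i) (row \<tau> i)" for i
  have hi_lo: "hi i \<le> lo i" and lo_plus_hi: "lo i + hi i = row \<sigma> i + row \<tau> i" for i
    by (auto simp: lo_def hi_def)
  \<comment> \<open>\<open>dn\<close> reflects the rows from the second one on; \<open>up\<close> inverts it and chooses the first row so as to reach
    size \<open>N\<close>, which is possible if and only if the inequality on the right-hand side holds.\<close>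
  define dn where "dn \<kappa> = Partition (\<lambda>i. lo (Suc i) + hi i - row \<kappa> (Suc i))" for \<kappa>
  define up where "up \<mu> = Partition (case_nat (lo 0 + (psize \<mu> + N - psize \<sigma> - psize \<tau>))
      (\<lambda>i. lo (Suc i) + hi i - row \<mu> i))" for \<mu>
  have upper: "interlaces \<kappa> \<sigma> \<and> interlaces \<kappa> \<tau> \<longleftrightarrow>
      (\<forall>i. lo i \<le> row \<kappa> i \<and> row \<kappa> (Suc i) \<le> hi i)" for \<kappa>
    by (auto simp: interlaces_def lo_def hi_def)
  have lower: "interlaces \<sigma> \<mu> \<and> interlaces \<tau> \<mu> \<longleftrightarrow>
      (\<forall>i. row \<mu> i \<le> hi i \<and> lo (Suc i) \<le> row \<mu> i)" for \<mu>
    by (auto simp: interlaces_def lo_def hi_def)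
  obtain K where K: "\<And>i. i \<ge> K \<Longrightarrow> row \<sigma> i = 0 \<and> row \<tau> i = 0"
    using rows_eventually_0_list[of "[\<sigma>, \<tau>]"] by (metis list.set_intros)
  have size: "psize \<kappa> + psize \<mu> + lo 0 = psize \<sigma> + psize \<tau> + row \<kappa> 0"
    if \<kappa>\<mu>: "\<And>i. row \<kappa> (Suc i) + row \<mu> i = lo (Suc i) + hi i" for \<kappa> \<mu>
  proof -
    have z: "row \<kappa> (Suc i) = 0" "row \<mu> i = 0" if "i \<ge> K" for i
      using \<kappa>\<mu>[of i] K[of i] K[of "Suc i"] that by (auto simp: lo_def hi_def)
    then have z': "row \<kappa> i = 0" if "i \<ge> Suc K" for i
      using that by (cases i) auto
    have "psize \<kappa> + psize \<mu> = (\<Sum>i<Suc K. row \<kappa> i) + (\<Sum>i<K. row \<mu> i)"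
      using psize_eq_sum[of "Suc K" \<kappa>] psize_eq_sum[of K \<mu>] z z' by simp
    also have "\<dots> = row \<kappa> 0 + (\<Sum>i<K. row \<kappa> (Suc i) + row \<mu> i)"
      unfolding sum.lessThan_Suc_shift by (simp add: sum.distrib)
    also have "\<dots> = row \<kappa> 0 + (\<Sum>i<K. lo (Suc i) + hi i)" by (simp only: \<kappa>\<mu>)
    finally have 1: "psize \<kappa> + psize \<mu> + lo 0 = row \<kappa> 0 + (\<Sum>i<Suc K. lo i) + (\<Sum>i<K. hi i)"
      unfolding sum.lessThan_Suc_shift by (simp add: sum.distrib)
    have "lo K = 0" using K[of K] by (simp add: lo_def)
    then have "(\<Sum>i<Suc K. lo i) + (\<Sum>i<K. hi i) = (\<Sum>i<K. row \<sigma> i + row \<tau> i)"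
      by (simp add: sum.distrib[symmetric] lo_plus_hi)
    also have "\<dots> = psize \<sigma> + psize \<tau>"
      using K by (simp add: sum.distrib psize_eq_sum[of K])
    finally show ?thesis using 1 by simp
  qed
  have A: "row (dn \<kappa>) i = lo (Suc i) + hi i - row \<kappa> (Suc i)" "dn \<kappa> \<in> ?B" "up (dn \<kappa>) = \<kappa>"
    if \<kappa>: "\<kappa> \<in> ?A" for \<kappa> i
  proof -
    have b: "lo i \<le> row \<kappa> i" "row \<kappa> (Suc i) \<le> hi i" for i using \<kappa> upper[of \<kappa>] by auto
    have r: "row (dn \<kappa>) = (\<lambda>i. lo (Suc i) + hi i - row \<kappa> (Suc i))"
      unfolding dn_def
    proof (rule row_Partition)
      show "antimono (\<lambda>i. lo (Suc i) + hi i - row \<kappa> (Suc i))"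
        unfolding antimono_iff_le_Suc
      proof
        fix i
        show "lo (Suc (Suc i)) + hi (Suc i) - row \<kappa> (Suc (Suc i)) \<le> lo (Suc i) + hi i - row \<kappa> (Suc i)"
          using b[of i] b[of "Suc i"] b[of "Suc (Suc i)"] hi_lo[of "Suc i"] by linarith
      qed
      show "finite {i. lo (Suc i) + hi i - row \<kappa> (Suc i) \<noteq> 0}"
      proof (rule finite_subset[of _ "{..<K}"])
        show "{i. lo (Suc i) + hi i - row \<kappa> (Suc i) \<noteq> 0} \<subseteq> {..<K}"
        proof
          fix i assume i: "i \<in> {i. lo (Suc i) + hi i - row \<kappa> (Suc i) \<noteq> 0}"
          show "i \<in> {..<K}"
          proof (rule ccontr)
            assume "i \<notin> {..<K}"
            then show False using i K[of i] K[of "Suc i"] by (simp add: lo_def hi_def)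
          qed
        qed
      qed simp
    qed
    show "row (dn \<kappa>) i = lo (Suc i) + hi i - row \<kappa> (Suc i)" by (simp add: r)
    have rel: "row \<kappa> (Suc i) + row (dn \<kappa>) i = lo (Suc i) + hi i" for i
      using b[of i] b[of "Suc i"] by (simp add: r)
    have sz: "psize \<kappa> + psize (dn \<kappa>) + lo 0 = psize \<sigma> + psize \<tau> + row \<kappa> 0"
      by (rule size) (rule rel)
    have "row (dn \<kappa>) i \<le> hi i \<and> lo (Suc i) \<le> row (dn \<kappa>) i" for i
      using b[of i] b[of "Suc i"] rel[of i] by linarith
    moreover have "psize \<sigma> + psize \<tau> \<le> psize (dn \<kappa>) + N"
      using sz \<kappa> b(1)[of 0] by simp
    ultimately show "dn \<kappa> \<in> ?B" using lower by simp
    have "case_nat (lo 0 + (psize (dn \<kappa>) + N - psize \<sigma> - psize \<tau>))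
          (\<lambda>i. lo (Suc i) + hi i - row (dn \<kappa>) i) = row \<kappa>"
    proof
      fix i
      show "(case i of 0 \<Rightarrow> lo 0 + (psize (dn \<kappa>) + N - psize \<sigma> - psize \<tau>)
              | Suc i \<Rightarrow> lo (Suc i) + hi i - row (dn \<kappa>) i) = row \<kappa> i"
        using sz \<kappa> b(1)[of 0] rel[of "i - 1"] by (cases i) auto
    qed
    then show "up (dn \<kappa>) = \<kappa>" by (simp add: up_def row_inverse)
  qed
  have B: "up \<mu> \<in> ?A" "dn (up \<mu>) = \<mu>" if \<mu>: "\<mu> \<in> ?B" for \<mu>
  proof -
    have b: "row \<mu> i \<le> hi i" "lo (Suc i) \<le> row \<mu> i" for i using \<mu> lower[of \<mu>] by auto
    define f where "f = case_nat (lo 0 + (psize \<mu> + N - psize \<sigma> - psize \<tau>))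
          (\<lambda>i. lo (Suc i) + hi i - row \<mu> i)"
    have r: "row (up \<mu>) = f"
      unfolding up_def f_def[symmetric]
    proof (rule row_Partition)
      show "antimono f"
        unfolding antimono_iff_le_Suc
      proof
        fix i
        show "f (Suc i) \<le> f i"
          using b[of i] b[of "i - 1"] hi_lo[of i] by (cases i) (auto simp: f_def)
      qed
      show "finite {i. f i \<noteq> 0}"
      proof (rule finite_subset[of _ "{..K}"])
        show "{i. f i \<noteq> 0} \<subseteq> {..K}"
        proof
          fix i assume i: "i \<in> {i. f i \<noteq> 0}"
          show "i \<in> {..K}"
          proof (rule ccontr)
            assume "i \<notin> {..K}"
            then obtain k where "i = Suc k" "k \<ge> K" by (cases i) auto
            then show False using i K[of i] K[of k] by (simp add: lo_def hi_def f_def)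
          qed
        qed
      qed simp
    qed
    have rel: "row (up \<mu>) (Suc i) + row \<mu> i = lo (Suc i) + hi i" for i
      using b[of i] by (simp add: r f_def)
    have sz: "psize (up \<mu>) + psize \<mu> + lo 0 = psize \<sigma> + psize \<tau> + row (up \<mu>) 0"
      by (rule size) (rule rel)
    have "lo i \<le> row (up \<mu>) i \<and> row (up \<mu>) (Suc i) \<le> hi i" for i
      using b[of i] b[of "i - 1"] by (cases i) (auto simp: r f_def)
    moreover have "psize (up \<mu>) = N"
      using sz \<mu> by (simp add: r f_def)
    ultimately show *: "up \<mu> \<in> ?A" using upper[of "up \<mu>"] by simp
    show "dn (up \<mu>) = \<mu>"
      using rel by (intro partition_eqI) (simp add: A(1)[OF *] flip: rel)
  qed
  have "bij_betw dn ?A ?B"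
    by (rule bij_betw_byWitness[where f' = up]) (use A B in blast)+
  then show ?thesis by (rule bij_betw_same_card)
qed

text \<open>The same reflection, now with the first row bounded as well, is the Bender--Knuth
  involution.\<close>

lemma bij_between_interlacing:
  obtains f where "bij_betw f {\<kappa>. interlaces \<sigma> \<kappa> \<and> interlaces \<kappa> \<tau>} {\<kappa>. interlaces \<sigma> \<kappa> \<and> interlaces \<kappa> \<tau>}"
    "\<And>\<kappa>. interlaces \<sigma> \<kappa> \<Longrightarrow> interlaces \<kappa> \<tau> \<Longrightarrow> psize (f \<kappa>) + psize \<kappa> = psize \<sigma> + psize \<tau>"
proof -
  let ?A = "{\<kappa>. interlaces \<sigma> \<kappa> \<and> interlaces \<kappa> \<tau>}"
  \<comment> \<open>The row \<open>i\<close> of an intermediate partition ranges over the interval from \<open>lo i\<close> to \<open>hi i\<close>.\<close>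
  define lo where "lo i = max (row \<tau> i) (row \<sigma> (Suc i))" for i
  define hi where "hi = case_nat (row \<sigma> 0) (\<lambda>i. min (row \<sigma> (Suc i)) (row \<tau> i))"
  have mid: "\<kappa> \<in> ?A \<longleftrightarrow> (\<forall>i. lo i \<le> row \<kappa> i \<and> row \<kappa> i \<le> hi i)" for \<kappa>
  proof -
    have "(\<forall>i. row \<kappa> i \<le> hi i) \<longleftrightarrow> (\<forall>i. row \<kappa> i \<le> row \<sigma> i \<and> row \<kappa> (Suc i) \<le> row \<tau> i)"
      unfolding hi_def by (auto split: nat.splits simp: all_conj_distrib) (metis nat.exhaust)
    then show ?thesis by (auto simp: interlaces_def lo_def)
  qed
  have hi_lo: "hi (Suc i) \<le> lo i" for i by (auto simp: lo_def hi_def)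
  define f where "f \<kappa> = Partition (\<lambda>i. lo i + hi i - row \<kappa> i)" for \<kappa>
  obtain K where K: "\<And>i. i \<ge> K \<Longrightarrow> row \<sigma> i = 0 \<and> row \<tau> i = 0"
    using rows_eventually_0_list[of "[\<sigma>, \<tau>]"] by (metis list.set_intros)
  have z: "lo i = 0" "hi i = 0" if "i \<ge> Suc K" for i
    using that K[of i] K[of "Suc i"] K[of "i - 1"] by (cases i; auto simp: lo_def hi_def)+
  have A: "f \<kappa> \<in> ?A" "f (f \<kappa>) = \<kappa>" "psize (f \<kappa>) + psize \<kappa> = psize \<sigma> + psize \<tau>" if \<kappa>: "\<kappa> \<in> ?A" for \<kappa>
  proof -
    have b: "lo i \<le> row \<kappa> i" "row \<kappa> i \<le> hi i" for i using \<kappa> mid[of \<kappa>] by auto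
    have r: "row (f \<kappa>) = (\<lambda>i. lo i + hi i - row \<kappa> i)"
      unfolding f_def
    proof (rule row_Partition)
      show "antimono (\<lambda>i. lo i + hi i - row \<kappa> i)"
        unfolding antimono_iff_le_Suc
      proof
        fix i
        show "lo (Suc i) + hi (Suc i) - row \<kappa> (Suc i) \<le> lo i + hi i - row \<kappa> i"
          using b[of i] b[of "Suc i"] hi_lo[of i] by linarith
      qed
      show "finite {i. lo i + hi i - row \<kappa> i \<noteq> 0}"
      proof (rule finite_subset[of _ "{..K}"])
        show "{i. lo i + hi i - row \<kappa> i \<noteq> 0} \<subseteq> {..K}"
        proof
          fix i assume i: "i \<in> {i. lo i + hi i - row \<kappa> i \<noteq> 0}"
          show "i \<in> {..K}"
          proof (rule ccontr)
            assume "i \<notin> {..K}"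
            then show False using i z[of i] by simp
          qed
        qed
      qed simp
    qed
    have rel: "row (f \<kappa>) i + row \<kappa> i = lo i + hi i" for i using b[of i] by (simp add: r)
    have "lo i \<le> row (f \<kappa>) i \<and> row (f \<kappa>) i \<le> hi i" for i using b[of i] rel[of i] by linarith
    then show *: "f \<kappa> \<in> ?A" unfolding mid by blast
    have "lo i + hi i - row (f \<kappa>) i = row \<kappa> i" for i using rel[of i] by linarith
    then have "f (f \<kappa>) = Partition (row \<kappa>)" by (simp add: f_def[of "f \<kappa>"])
    then show "f (f \<kappa>) = \<kappa>" by (simp add: row_inverse)
    have z': "row (f \<kappa>) i = 0" "row \<kappa> i = 0" if "i \<ge> Suc K" for i using rel[of i] z[of i] that by auto
    have "psize (f \<kappa>) + psize \<kappa> = (\<Sum>i<Suc K. row (f \<kappa>) i) + (\<Sum>i<Suc K. row \<kappa> i)"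
      using psize_eq_sum[of "Suc K" \<kappa>] psize_eq_sum[of "Suc K" "f \<kappa>"] z' by simp
    also have "\<dots> = (\<Sum>i<Suc K. lo i + hi i)" by (simp only: sum.distrib[symmetric] rel)
    also have "\<dots> = (\<Sum>i<Suc K. lo i) + (\<Sum>i<Suc K. hi i)" by (rule sum.distrib)
    also have "(\<Sum>i<Suc K. lo i) = (\<Sum>i<K. lo i)" using K[of K] K[of "Suc K"] by (simp add: lo_def)
    also have "(\<Sum>i<Suc K. hi i) = row \<sigma> 0 + (\<Sum>i<K. min (row \<sigma> (Suc i)) (row \<tau> i))"
      unfolding sum.lessThan_Suc_shift by (simp add: hi_def)
    also have "(\<Sum>i<K. lo i) + (row \<sigma> 0 + (\<Sum>i<K. min (row \<sigma> (Suc i)) (row \<tau> i))) =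
        row \<sigma> 0 + (\<Sum>i<K. lo i + min (row \<sigma> (Suc i)) (row \<tau> i))" by (simp add: sum.distrib)
    also have "(\<Sum>i<K. lo i + min (row \<sigma> (Suc i)) (row \<tau> i)) = (\<Sum>i<K. row \<sigma> (Suc i) + row \<tau> i)"
      by (intro sum.cong) (auto simp: lo_def)
    also have "row \<sigma> 0 + \<dots> = (\<Sum>i<Suc K. row \<sigma> i) + (\<Sum>i<K. row \<tau> i)"
      unfolding sum.lessThan_Suc_shift by (simp add: sum.distrib)
    also have "\<dots> = psize \<sigma> + psize \<tau>"
      using K psize_eq_sum[of "Suc K" \<sigma>] psize_eq_sum[of K \<tau>] by simp
    finally show "psize (f \<kappa>) + psize \<kappa> = psize \<sigma> + psize \<tau>" .
  qed
  have "bij_betw f ?A ?A"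
    by (rule bij_betw_byWitness[where f' = f]) (use A in blast)+
  with A(3) show ?thesis using that by simp
qed

section \<open>Matrices of vertex operators\<close>

text \<open>Every operator is graded by the number of boxes.  A creation operator only adds boxes, which makes its
matrix triangular; products of such matrices are finite sums over every ring.\<close>

definition unitri :: "(partition \<Rightarrow> partition \<Rightarrow> 'a::zero_neq_one) \<Rightarrow> bool" where
  "unitri A \<longleftrightarrow> (\<forall>\<sigma> \<tau>. psize \<sigma> \<le> psize \<tau> \<longrightarrow> A \<sigma> \<tau> = (if \<sigma> = \<tau> then 1 else 0))"

definition idm :: "partition \<Rightarrow> partition \<Rightarrow> 'a::zero_neq_one" where
  "idm \<sigma> \<tau> = (if \<sigma> = \<tau> then 1 else 0)"

definition mmul :: "(partition \<Rightarrow> partition \<Rightarrow> 'a) \<Rightarrow> (partition \<Rightarrow> partition \<Rightarrow> 'a) \<Rightarrow>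
    partition \<Rightarrow> partition \<Rightarrow> 'a::comm_ring_1" where
  "mmul A B \<sigma> \<tau> = (\<Sum>\<kappa> | psize \<kappa> \<le> psize \<sigma>. A \<sigma> \<kappa> * B \<kappa> \<tau>)"

text \<open>Conjugation by \<open>s\<close> to the power of the number of boxes.  Rescaling the argument of a vertex operator is the
same as conjugating it (\<open>scal_Hs\<close>).\<close>

definition scal :: "'a \<Rightarrow> (partition \<Rightarrow> partition \<Rightarrow> 'a) \<Rightarrow> partition \<Rightarrow> partition \<Rightarrow> 'a::comm_ring_1" where
  "scal s A \<sigma> \<tau> = s ^ (psize \<sigma> - psize \<tau>) * A \<sigma> \<tau>"

text \<open>The creation operator with argument \<open>x\<close>.  Its transpose is the annihilation operator with argument \<open>x\<close>;
annihilation operators are therefore stored as transposed, again triangular, matrices.\<close>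

definition Hs :: "'a \<Rightarrow> partition \<Rightarrow> partition \<Rightarrow> 'a::comm_ring_1" where
  "Hs x \<sigma> \<tau> = (if interlaces \<sigma> \<tau> then x ^ (psize \<sigma> - psize \<tau>) else 0)"

fun Hl :: "'a list \<Rightarrow> partition \<Rightarrow> partition \<Rightarrow> 'a::comm_ring_1" where
  "Hl [] = idm"
| "Hl (x # xs) = mmul (Hs x) (Hl xs)"

lemma unitriD: "unitri A \<Longrightarrow> psize \<sigma> \<le> psize \<tau> \<Longrightarrow> A \<sigma> \<tau> = (if \<sigma> = \<tau> then 1 else 0)"
  by (simp add: unitri_def)

lemma unitri_0: "unitri A \<Longrightarrow> psize \<sigma> < psize \<tau> \<Longrightarrow> A \<sigma> \<tau> = 0"
  using unitriD[of A \<sigma> \<tau>] by auto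

lemma unitri_diag: "unitri A \<Longrightarrow> A \<sigma> \<sigma> = 1"
  by (simp add: unitriD)

lemma unitri_idm [simp]: "unitri idm"
  by (simp add: unitri_def idm_def)

lemma mmul_extend:
  assumes "unitri A" "psize \<sigma> \<le> N"
  shows "mmul A B \<sigma> \<tau> = (\<Sum>\<kappa> | psize \<kappa> \<le> N. A \<sigma> \<kappa> * B \<kappa> \<tau>)"
  unfolding mmul_def
proof (rule sum.mono_neutral_left)
  show "\<forall>\<kappa>\<in>{\<kappa>. psize \<kappa> \<le> N} - {\<kappa>. psize \<kappa> \<le> psize \<sigma>}. A \<sigma> \<kappa> * B \<kappa> \<tau> = 0"
    using unitri_0[OF assms(1)] by simp
qed (use assms in auto)

lemma unitri_mmul:
  fixes A B :: "partition \<Rightarrow> partition \<Rightarrow> 'a::comm_ring_1"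
  assumes "unitri A" "unitri B"
  shows "unitri (mmul A B)"
  unfolding unitri_def
proof (intro allI impI)
  fix \<sigma> \<tau> assume le: "psize \<sigma> \<le> psize \<tau>"
  have "mmul A B \<sigma> \<tau> = (\<Sum>\<kappa> | psize \<kappa> \<le> psize \<sigma>. if \<kappa> = \<tau> then A \<sigma> \<kappa> else 0)"
    unfolding mmul_def
  proof (rule sum.cong)
    fix \<kappa> assume "\<kappa> \<in> {\<kappa>. psize \<kappa> \<le> psize \<sigma>}"
    then show "A \<sigma> \<kappa> * B \<kappa> \<tau> = (if \<kappa> = \<tau> then A \<sigma> \<kappa> else 0)"
      using le unitriD[OF assms(2), of \<kappa> \<tau>] by simp
  qed simp
  also have "\<dots> = (if psize \<tau> \<le> psize \<sigma> then A \<sigma> \<tau> else 0)"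
    by (simp add: sum.delta)
  also have "\<dots> = (if \<sigma> = \<tau> then 1 else 0)"
    using unitriD[OF assms(1) le] by auto
  finally show "mmul A B \<sigma> \<tau> = (if \<sigma> = \<tau> then 1 else 0)" .
qed

lemma mmul_assoc:
  assumes "unitri B"
  shows "mmul (mmul A B) C = mmul A (mmul B C)"
proof (intro ext)
  fix \<sigma> \<tau>
  let ?P = "{\<kappa>. psize \<kappa> \<le> psize \<sigma>}"
  have "mmul A (mmul B C) \<sigma> \<tau> = (\<Sum>\<pi>\<in>?P. A \<sigma> \<pi> * (\<Sum>\<kappa>\<in>?P. B \<pi> \<kappa> * C \<kappa> \<tau>))"
    unfolding mmul_def[of A] by (intro sum.cong refl) (simp add: mmul_extend[OF assms])
  also have "\<dots> = (\<Sum>\<kappa>\<in>?P. (\<Sum>\<pi>\<in>?P. A \<sigma> \<pi> * B \<pi> \<kappa>) * C \<kappa> \<tau>)"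
    unfolding sum_distrib_left sum_distrib_right by (subst sum.swap) (simp add: mult_ac)
  also have "\<dots> = mmul (mmul A B) C \<sigma> \<tau>" by (simp add: mmul_def)
  finally show "mmul (mmul A B) C \<sigma> \<tau> = mmul A (mmul B C) \<sigma> \<tau>" ..
qed

lemma mmul_idm_left [simp]: "mmul idm A = A"
proof (intro ext)
  fix \<sigma> \<tau>
  have "mmul idm A \<sigma> \<tau> = (\<Sum>\<kappa> | psize \<kappa> \<le> psize \<sigma>. if \<kappa> = \<sigma> then A \<kappa> \<tau> else 0)"
    unfolding mmul_def idm_def by (intro sum.cong) auto
  then show "mmul idm A \<sigma> \<tau> = A \<sigma> \<tau>" by (simp add: sum.delta)
qed

lemma mmul_idm_right [simp]:
  assumes "unitri A"
  shows "mmul A idm = A"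
proof (intro ext)
  fix \<sigma> \<tau>
  have "mmul A idm \<sigma> \<tau> = (\<Sum>\<kappa> | psize \<kappa> \<le> psize \<sigma>. if \<kappa> = \<tau> then A \<sigma> \<kappa> else 0)"
    unfolding mmul_def idm_def by (intro sum.cong) auto
  also have "\<dots> = (if psize \<tau> \<le> psize \<sigma> then A \<sigma> \<tau> else 0)" by (simp add: sum.delta)
  also have "\<dots> = A \<sigma> \<tau>" using unitri_0[OF assms, of \<sigma> \<tau>] by auto
  finally show "mmul A idm \<sigma> \<tau> = A \<sigma> \<tau>" .
qed

lemma unitri_Hs [simp]: "unitri (Hs x)"
  unfolding unitri_def Hs_def using interlaces_psize by fastforce

lemma unitri_Hl [simp]: "unitri (Hl xs)"
  by (induction xs) (auto intro: unitri_mmul)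

lemma unitri_scal [simp]: "unitri A \<Longrightarrow> unitri (scal s A)"
  unfolding unitri_def scal_def by auto

lemma scal_mmul:
  assumes "unitri A" "unitri B"
  shows "scal s (mmul A B) = mmul (scal s A) (scal s B)"
proof (intro ext)
  fix \<sigma> \<tau>
  show "scal s (mmul A B) \<sigma> \<tau> = mmul (scal s A) (scal s B) \<sigma> \<tau>"
    unfolding scal_def mmul_def sum_distrib_left
  proof (rule sum.cong)
    fix \<kappa> assume \<kappa>: "\<kappa> \<in> {\<kappa>. psize \<kappa> \<le> psize \<sigma>}"
    show "s ^ (psize \<sigma> - psize \<tau>) * (A \<sigma> \<kappa> * B \<kappa> \<tau>) =
          s ^ (psize \<sigma> - psize \<kappa>) * A \<sigma> \<kappa> * (s ^ (psize \<kappa> - psize \<tau>) * B \<kappa> \<tau>)"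
    proof (cases "psize \<kappa> < psize \<tau>")
      case True
      then show ?thesis by (simp add: unitri_0[OF assms(2)])
    next
      case False
      then have "psize \<sigma> - psize \<tau> = (psize \<sigma> - psize \<kappa>) + (psize \<kappa> - psize \<tau>)" using \<kappa> by simp
      then show ?thesis by (simp add: power_add mult_ac)
    qed
  qed simp
qed

lemma scal_idm [simp]: "scal s idm = idm"
  by (intro ext) (simp add: scal_def idm_def)

lemma scal_1 [simp]: "scal 1 A = A"
  by (intro ext) (simp add: scal_def)

lemma scal_Hs: "scal s (Hs x) = Hs (s * x)"
  by (intro ext) (simp add: scal_def Hs_def power_mult_distrib)

lemma scal_Hl: "scal s (Hl xs) = Hl (map ((*) s) xs)"
  by (induction xs) (simp_all add: scal_mmul scal_Hs)

lemma Hl_append: "Hl (xs @ ys) = mmul (Hl xs) (Hl ys)"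
  by (induction xs) (simp_all add: mmul_assoc)

text \<open>By the Bender--Knuth involution creation operators commute, so that only the multiset of the
  arguments matters.\<close>

lemma Hs_commute: "mmul (Hs x) (Hs y) = mmul (Hs y) (Hs x)"
proof (intro ext)
  fix \<sigma> \<tau>
  let ?A = "{\<kappa>. interlaces \<sigma> \<kappa> \<and> interlaces \<kappa> \<tau>}"
  have *: "mmul (Hs x) (Hs y) \<sigma> \<tau> = (\<Sum>\<kappa>\<in>?A. x ^ (psize \<sigma> - psize \<kappa>) * y ^ (psize \<kappa> - psize \<tau>))" for x y :: 'a
    unfolding mmul_def
  proof (rule sum.mono_neutral_cong_right)
    show "?A \<subseteq> {\<kappa>. psize \<kappa> \<le> psize \<sigma>}" using interlaces_psize by auto
  qed (auto simp: Hs_def)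
  obtain f where f: "bij_betw f ?A ?A"
    "\<And>\<kappa>. interlaces \<sigma> \<kappa> \<Longrightarrow> interlaces \<kappa> \<tau> \<Longrightarrow> psize (f \<kappa>) + psize \<kappa> = psize \<sigma> + psize \<tau>"
    using bij_between_interlacing by blast
  have "(\<Sum>\<kappa>\<in>?A. y ^ (psize \<sigma> - psize \<kappa>) * x ^ (psize \<kappa> - psize \<tau>)) =
        (\<Sum>\<kappa>\<in>?A. y ^ (psize \<sigma> - psize (f \<kappa>)) * x ^ (psize (f \<kappa>) - psize \<tau>))"
    by (rule sum.reindex_bij_betw[OF f(1), symmetric])
  also have "\<dots> = (\<Sum>\<kappa>\<in>?A. x ^ (psize \<sigma> - psize \<kappa>) * y ^ (psize \<kappa> - psize \<tau>))"
  proof (rule sum.cong)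
    fix \<kappa> assume \<kappa>: "\<kappa> \<in> ?A"
    then have "psize \<sigma> - psize (f \<kappa>) = psize \<kappa> - psize \<tau>" "psize (f \<kappa>) - psize \<tau> = psize \<sigma> - psize \<kappa>"
      using f(2)[of \<kappa>] by auto
    then show "y ^ (psize \<sigma> - psize (f \<kappa>)) * x ^ (psize (f \<kappa>) - psize \<tau>) =
        x ^ (psize \<sigma> - psize \<kappa>) * y ^ (psize \<kappa> - psize \<tau>)" by (simp add: mult.commute)
  qed simp
  finally show "mmul (Hs x) (Hs y) \<sigma> \<tau> = mmul (Hs y) (Hs x) \<sigma> \<tau>" by (simp add: *)
qed

lemma Hl_move_front: "Hl (xs @ x # ys) = Hl (x # xs @ ys)"
proof (induction xs)
  case (Cons a xs)
  have "Hl ((a # xs) @ x # ys) = mmul (Hs a) (mmul (Hs x) (Hl (xs @ ys)))"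
    using Cons by simp
  also have "\<dots> = mmul (Hs x) (mmul (Hs a) (Hl (xs @ ys)))"
    by (simp add: mmul_assoc[symmetric] Hs_commute[of a x])
  finally show ?case by simp
qed simp

lemma Hl_mset_cong: "mset xs = mset ys \<Longrightarrow> Hl xs = Hl ys"
proof (induction xs arbitrary: ys)
  case (Cons x xs)
  then have "x \<in> set ys" by (metis list.set_intros(1) set_mset_mset)
  then obtain ys1 ys2 where ys: "ys = ys1 @ x # ys2" by (meson split_list)
  with Cons.prems have "mset xs = mset (ys1 @ ys2)" by simp
  then have "Hl xs = Hl (ys1 @ ys2)" by (rule Cons.IH)
  then show ?case unfolding ys Hl_move_front by simp
qed simp

section \<open>Commutation of annihilation and creation operators\<close>

definition icoeff :: "'a::zero fps \<Rightarrow> int \<Rightarrow> 'a" where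
  "icoeff c k = (if k < 0 then 0 else fps_nth c (nat k))"

text \<open>\<open>comm_rel B A c\<close> is the operator identity $B^T z^{|\cdot|} A = c(z)\, A^{(z)} z^{|\cdot|} B^{T (z)}$
  between the annihilation operator with transposed matrix \<open>B\<close> and the creation operator \<open>A\<close>,
  read off one coefficient of $z$ at a time.  Each coefficient is an identity of finite sums, which
  makes sense over every ring, passes to limits, and can be evaluated at any \<open>z\<close> for which the
  series converge.\<close>

definition comm_rel :: "(partition \<Rightarrow> partition \<Rightarrow> 'a) \<Rightarrow> (partition \<Rightarrow> partition \<Rightarrow> 'a) \<Rightarrow>
    'a::comm_ring_1 fps \<Rightarrow> bool" where
  "comm_rel B A c \<longleftrightarrow> (\<forall>\<sigma> \<tau> N. (\<Sum>\<kappa> | psize \<kappa> = N. B \<kappa> \<sigma> * A \<kappa> \<tau>) =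
     (\<Sum>\<mu> | psize \<mu> \<le> psize \<sigma>.
        icoeff c (int (psize \<mu>) + int N - int (psize \<sigma>) - int (psize \<tau>)) * A \<sigma> \<mu> * B \<tau> \<mu>))"

lemma comm_relD:
  "comm_rel B A c \<Longrightarrow> (\<Sum>\<kappa> | psize \<kappa> = N. B \<kappa> \<sigma> * A \<kappa> \<tau>) =
     (\<Sum>\<mu> | psize \<mu> \<le> psize \<sigma>.
        icoeff c (int (psize \<mu>) + int N - int (psize \<sigma>) - int (psize \<tau>)) * A \<sigma> \<mu> * B \<tau> \<mu>)"
  by (simp add: comm_rel_def)

lemma sum_psize_restrict:
  assumes "\<And>\<mu>. n < psize \<mu> \<Longrightarrow> f \<mu> = 0" "n \<le> m"
  shows "(\<Sum>\<mu> | psize \<mu> \<le> m. f \<mu>) = (\<Sum>\<mu> | psize \<mu> \<le> n. f \<mu>)"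
proof (rule sum.mono_neutral_right)
  show "\<forall>\<mu>\<in>{\<mu>. psize \<mu> \<le> m} - {\<mu>. psize \<mu> \<le> n}. f \<mu> = 0" using assms(1) by simp
qed (use assms(2) in auto)

text \<open>Both sides are symmetric in \<open>A\<close> and \<open>B\<close> up to the range of the sum, which triangularity makes irrelevant.\<close>

lemma comm_rel_sym:
  assumes "unitri A" "unitri B" "comm_rel B A c"
  shows "comm_rel A B c"
  unfolding comm_rel_def
proof (intro allI)
  fix \<sigma> \<tau> N
  let ?f = "\<lambda>\<mu>. icoeff c (int (psize \<mu>) + int N - int (psize \<sigma>) - int (psize \<tau>)) * (A \<tau> \<mu> * B \<sigma> \<mu>)"
  have "(\<Sum>\<kappa> | psize \<kappa> = N. A \<kappa> \<sigma> * B \<kappa> \<tau>) = (\<Sum>\<mu> | psize \<mu> \<le> psize \<tau>. ?f \<mu>)"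
    using comm_relD[OF assms(3), where N = N and \<sigma> = \<tau> and \<tau> = \<sigma>] by (simp add: mult_ac algebra_simps)
  also have "\<dots> = (\<Sum>\<mu> | psize \<mu> \<le> psize \<sigma>. ?f \<mu>)"
  proof (cases "psize \<sigma> \<le> psize \<tau>")
    case True
    then show ?thesis by (intro sum_psize_restrict) (simp_all add: unitri_0[OF assms(2)])
  next
    case False
    then show ?thesis by (intro sum_psize_restrict[symmetric]) (simp_all add: unitri_0[OF assms(1)])
  qed
  finally show "(\<Sum>\<kappa> | psize \<kappa> = N. A \<kappa> \<sigma> * B \<kappa> \<tau>) =
     (\<Sum>\<mu> | psize \<mu> \<le> psize \<sigma>.
        icoeff c (int (psize \<mu>) + int N - int (psize \<sigma>) - int (psize \<tau>)) * B \<sigma> \<mu> * A \<tau> \<mu>)"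
    by (simp add: mult_ac)
qed

text \<open>The Cauchy product for coefficients with integer index: the cutoff \<open>N\<close> is harmless, since one of the factors
has negative index beyond it.\<close>

lemma icoeff_mult:
  fixes f g :: "'a::comm_ring_1 fps"
  assumes "0 \<le> b" "a \<le> int N"
  shows "(\<Sum>p\<le>N. icoeff f (a - int p) * icoeff g (int p - b)) = icoeff (f * g) (a - b)"
proof (cases "a < b")
  case True
  then have "icoeff f (a - int p) * icoeff g (int p - b) = 0" for p
    by (cases "a < int p") (auto simp: icoeff_def)
  then show ?thesis using True by (simp add: icoeff_def)
next
  case False
  have "(\<Sum>p\<le>N. icoeff f (a - int p) * icoeff g (int p - b)) =
        (\<Sum>p\<in>{nat b..nat a}. icoeff f (a - int p) * icoeff g (int p - b))"
    using assms by (intro sum.mono_neutral_right) (auto simp: icoeff_def)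
  also have "\<dots> = (\<Sum>i=0..nat (a - b). fps_nth f i * fps_nth g (nat (a - b) - i))"
    by (rule sum.reindex_bij_witness[of _ "\<lambda>i. nat a - i" "\<lambda>p. nat a - p"])
       (use False assms in \<open>auto simp: icoeff_def nat_diff_distrib intro!: arg_cong2[of _ _ _ _ "(*)"] arg_cong[of _ _ "fps_nth _"]\<close>)
  also have "\<dots> = icoeff (f * g) (a - b)"
    using False by (simp add: icoeff_def fps_mult_nth)
  finally show ?thesis .
qed

lemma sum_psize_group:
  fixes f :: "nat \<Rightarrow> 'a::comm_ring_1"
  shows "(\<Sum>\<pi> | psize \<pi> \<le> N. f (psize \<pi>) * g \<pi>) = (\<Sum>p\<le>N. f p * (\<Sum>\<pi> | psize \<pi> = p. g \<pi>))"
proof -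
  have "(\<Sum>\<pi> | psize \<pi> \<le> N. f (psize \<pi>) * g \<pi>) =
        (\<Sum>p\<in>{..N}. \<Sum>\<pi> | \<pi> \<in> {\<pi>. psize \<pi> \<le> N} \<and> psize \<pi> = p. f (psize \<pi>) * g \<pi>)"
    by (rule sum.group[symmetric]) auto
  also have "\<dots> = (\<Sum>p\<le>N. f p * (\<Sum>\<pi> | psize \<pi> = p. g \<pi>))"
    by (rule sum.cong) (auto simp: sum_distrib_left intro!: sum.cong)
  finally show ?thesis .
qed

text \<open>Moving \<open>B\<close> past \<open>A1\<close> and then past \<open>A2\<close> multiplies the two scalars; at the level of coefficients the
grading of the intermediate partition is convolved.\<close>

lemma comm_rel_mmul_right:
  assumes un: "unitri A1" "unitri A2" and c1: "comm_rel B A1 c1" and c2: "comm_rel B A2 c2"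
  shows "comm_rel B (mmul A1 A2) (c1 * c2)"
  unfolding comm_rel_def
proof (intro allI)
  fix \<sigma> \<tau> N
  let ?P = "\<lambda>n. {\<kappa>. psize \<kappa> \<le> n}"
  let ?s = "\<lambda>\<kappa>. int (psize \<kappa>)"
  have "(\<Sum>\<kappa> | psize \<kappa> = N. B \<kappa> \<sigma> * mmul A1 A2 \<kappa> \<tau>) =
        (\<Sum>\<kappa> | psize \<kappa> = N. \<Sum>\<pi>\<in>?P N. B \<kappa> \<sigma> * (A1 \<kappa> \<pi> * A2 \<pi> \<tau>))"
    by (simp add: mmul_def sum_distrib_left)
  also have "\<dots> = (\<Sum>\<pi>\<in>?P N. (\<Sum>\<kappa> | psize \<kappa> = N. B \<kappa> \<sigma> * A1 \<kappa> \<pi>) * A2 \<pi> \<tau>)"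
    by (subst sum.swap) (simp add: sum_distrib_left sum_distrib_right mult_ac)
  also have "\<dots> = (\<Sum>\<pi>\<in>?P N. (\<Sum>\<mu>\<in>?P (psize \<sigma>). icoeff c1 (?s \<mu> + int N - ?s \<sigma> - ?s \<pi>) * A1 \<sigma> \<mu> * B \<pi> \<mu>) * A2 \<pi> \<tau>)"
    by (simp only: comm_relD[OF c1])
  also have "\<dots> = (\<Sum>\<mu>\<in>?P (psize \<sigma>). A1 \<sigma> \<mu> * (\<Sum>\<pi>\<in>?P N. icoeff c1 (?s \<mu> + int N - ?s \<sigma> - ?s \<pi>) * (B \<pi> \<mu> * A2 \<pi> \<tau>)))"
    unfolding sum_distrib_left sum_distrib_right by (subst sum.swap) (simp add: mult_ac)
  also have "\<dots> = (\<Sum>\<mu>\<in>?P (psize \<sigma>). A1 \<sigma> \<mu> * (\<Sum>\<nu>\<in>?P (psize \<sigma>).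
      icoeff (c1 * c2) (?s \<nu> + int N - ?s \<sigma> - ?s \<tau>) * A2 \<mu> \<nu> * B \<tau> \<nu>))"
  proof (rule sum.cong)
    fix \<mu> assume \<mu>: "\<mu> \<in> ?P (psize \<sigma>)"
    have "(\<Sum>\<pi>\<in>?P N. icoeff c1 (?s \<mu> + int N - ?s \<sigma> - ?s \<pi>) * (B \<pi> \<mu> * A2 \<pi> \<tau>)) =
          (\<Sum>p\<le>N. icoeff c1 (?s \<mu> + int N - ?s \<sigma> - int p) * (\<Sum>\<pi> | psize \<pi> = p. B \<pi> \<mu> * A2 \<pi> \<tau>))"
      by (rule sum_psize_group[of "\<lambda>p. icoeff c1 (?s \<mu> + int N - ?s \<sigma> - int p)"])
    also have "\<dots> = (\<Sum>p\<le>N. icoeff c1 (?s \<mu> + int N - ?s \<sigma> - int p) *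
        (\<Sum>\<nu>\<in>?P (psize \<mu>). icoeff c2 (?s \<nu> + int p - ?s \<mu> - ?s \<tau>) * A2 \<mu> \<nu> * B \<tau> \<nu>))"
      by (simp only: comm_relD[OF c2])
    also have "\<dots> = (\<Sum>\<nu>\<in>?P (psize \<mu>). (\<Sum>p\<le>N. icoeff c1 ((?s \<mu> + int N - ?s \<sigma>) - int p) *
        icoeff c2 (int p - (?s \<mu> + ?s \<tau> - ?s \<nu>))) * A2 \<mu> \<nu> * B \<tau> \<nu>)"
      unfolding sum_distrib_left sum_distrib_right by (subst sum.swap) (simp add: mult_ac algebra_simps)
    also have "\<dots> = (\<Sum>\<nu>\<in>?P (psize \<mu>). icoeff (c1 * c2) (?s \<nu> + int N - ?s \<sigma> - ?s \<tau>) * A2 \<mu> \<nu> * B \<tau> \<nu>)"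
    proof (rule sum.cong)
      fix \<nu> assume "\<nu> \<in> ?P (psize \<mu>)"
      then have "(\<Sum>p\<le>N. icoeff c1 ((?s \<mu> + int N - ?s \<sigma>) - int p) * icoeff c2 (int p - (?s \<mu> + ?s \<tau> - ?s \<nu>))) =
          icoeff (c1 * c2) ((?s \<mu> + int N - ?s \<sigma>) - (?s \<mu> + ?s \<tau> - ?s \<nu>))"
        using \<mu> by (intro icoeff_mult) auto
      also have "(?s \<mu> + int N - ?s \<sigma>) - (?s \<mu> + ?s \<tau> - ?s \<nu>) = ?s \<nu> + int N - ?s \<sigma> - ?s \<tau>" by simp
      finally show "(\<Sum>p\<le>N. icoeff c1 ((?s \<mu> + int N - ?s \<sigma>) - int p) * icoeff c2 (int p - (?s \<mu> + ?s \<tau> - ?s \<nu>))) * A2 \<mu> \<nu> * B \<tau> \<nu> =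
         icoeff (c1 * c2) (?s \<nu> + int N - ?s \<sigma> - ?s \<tau>) * A2 \<mu> \<nu> * B \<tau> \<nu>" by simp
    qed simp
    also have "\<dots> = (\<Sum>\<nu>\<in>?P (psize \<sigma>). icoeff (c1 * c2) (?s \<nu> + int N - ?s \<sigma> - ?s \<tau>) * A2 \<mu> \<nu> * B \<tau> \<nu>)"
      using \<mu> by (intro sum_psize_restrict[symmetric]) (simp_all add: unitri_0[OF un(2)])
    finally show "A1 \<sigma> \<mu> * (\<Sum>\<pi>\<in>?P N. icoeff c1 (?s \<mu> + int N - ?s \<sigma> - ?s \<pi>) * (B \<pi> \<mu> * A2 \<pi> \<tau>)) =
       A1 \<sigma> \<mu> * (\<Sum>\<nu>\<in>?P (psize \<sigma>). icoeff (c1 * c2) (?s \<nu> + int N - ?s \<sigma> - ?s \<tau>) * A2 \<mu> \<nu> * B \<tau> \<nu>)"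
      by simp
  qed simp
  also have "\<dots> = (\<Sum>\<nu>\<in>?P (psize \<sigma>). icoeff (c1 * c2) (?s \<nu> + int N - ?s \<sigma> - ?s \<tau>) * mmul A1 A2 \<sigma> \<nu> * B \<tau> \<nu>)"
    unfolding mmul_def sum_distrib_left sum_distrib_right by (subst sum.swap) (simp add: mult_ac)
  finally show "(\<Sum>\<kappa> | psize \<kappa> = N. B \<kappa> \<sigma> * mmul A1 A2 \<kappa> \<tau>) =
    (\<Sum>\<nu>\<in>?P (psize \<sigma>). icoeff (c1 * c2) (?s \<nu> + int N - ?s \<sigma> - ?s \<tau>) * mmul A1 A2 \<sigma> \<nu> * B \<tau> \<nu>)" .
qed

lemma comm_rel_mmul_left:
  assumes "unitri B1" "unitri B2" "unitri A" "comm_rel B1 A c1" "comm_rel B2 A c2"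
  shows "comm_rel (mmul B1 B2) A (c1 * c2)"
  by (rule comm_rel_sym[OF unitri_mmul[OF assms(1,2)] assms(3)
        comm_rel_mmul_right[OF assms(1,2) comm_rel_sym[OF assms(3,1,4)] comm_rel_sym[OF assms(3,2,5)]]])

lemma comm_rel_idm_left:
  assumes "unitri A"
  shows "comm_rel idm A 1"
  unfolding comm_rel_def
proof (intro allI)
  fix \<sigma> \<tau> N
  have "(\<Sum>\<kappa> | psize \<kappa> = N. idm \<kappa> \<sigma> * A \<kappa> \<tau>) = (\<Sum>\<kappa> | psize \<kappa> = N. if \<kappa> = \<sigma> then A \<kappa> \<tau> else 0)"
    by (intro sum.cong) (auto simp: idm_def)
  also have "\<dots> = (if psize \<sigma> = N then A \<sigma> \<tau> else 0)" by (simp add: sum.delta)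
  also have "\<dots> = (if psize \<tau> \<le> psize \<sigma> then icoeff 1 (int N - int (psize \<sigma>)) * A \<sigma> \<tau> else 0)"
    using unitri_0[OF assms, of \<sigma> \<tau>] by (simp add: icoeff_def)
  also have "\<dots> = (\<Sum>\<mu> | psize \<mu> \<le> psize \<sigma>. if \<mu> = \<tau> then icoeff 1 (int N - int (psize \<sigma>)) * A \<sigma> \<mu> else 0)"
    by (simp add: sum.delta)
  also have "\<dots> = (\<Sum>\<mu> | psize \<mu> \<le> psize \<sigma>.
        icoeff 1 (int (psize \<mu>) + int N - int (psize \<sigma>) - int (psize \<tau>)) * A \<sigma> \<mu> * idm \<tau> \<mu>)"
    by (intro sum.cong) (auto simp: idm_def)
  finally show "(\<Sum>\<kappa> | psize \<kappa> = N. idm \<kappa> \<sigma> * A \<kappa> \<tau>) = (\<Sum>\<mu> | psize \<mu> \<le> psize \<sigma>.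
        icoeff 1 (int (psize \<mu>) + int N - int (psize \<sigma>) - int (psize \<tau>)) * A \<sigma> \<mu> * idm \<tau> \<mu>)" .
qed

text \<open>The series $1 / (1 - a z)$.\<close>

definition geo :: "'a::comm_ring_1 \<Rightarrow> 'a fps" where
  "geo a = Abs_fps (\<lambda>i. a ^ i)"

lemma geo_mult: "geo a * (1 - fps_const a * fps_X) = 1"
proof (rule fps_ext)
  fix n
  show "fps_nth (geo a * (1 - fps_const a * fps_X)) n = fps_nth 1 n"
    by (cases n) (simp_all add: geo_def right_diff_distrib mult.assoc[symmetric] fps_mult_fps_X_commute[symmetric] mult.left_commute fps_mult_right_const_nth mult.commute[of _ fps_X])
qed

text \<open>The basic commutation relation.  Its coefficients count common upper and common lower neighbours of two
partitions, so that it is \<open>card_common_interlacing\<close>.\<close>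

lemma comm_rel_Hs: "comm_rel (Hs x) (Hs y) (geo (x * y))"
  unfolding comm_rel_def
proof (intro allI)
  fix \<sigma> \<tau> N
  let ?w = "x ^ (N - psize \<sigma>) * y ^ (N - psize \<tau>)"
  let ?A = "{\<kappa>. interlaces \<kappa> \<sigma> \<and> interlaces \<kappa> \<tau> \<and> psize \<kappa> = N}"
  let ?B = "{\<mu>. interlaces \<sigma> \<mu> \<and> interlaces \<tau> \<mu> \<and> psize \<sigma> + psize \<tau> \<le> psize \<mu> + N}"
  have "(\<Sum>\<kappa> | psize \<kappa> = N. Hs x \<kappa> \<sigma> * Hs y \<kappa> \<tau>) = (\<Sum>\<kappa>\<in>?A. ?w)"
    by (rule sum.mono_neutral_cong_right) (auto simp: Hs_def)
  also have "\<dots> = (\<Sum>\<mu>\<in>?B. ?w)" by (simp add: card_common_interlacing)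
  also have "\<dots> = (\<Sum>\<mu> | psize \<mu> \<le> psize \<sigma>.
        icoeff (geo (x * y)) (int (psize \<mu>) + int N - int (psize \<sigma>) - int (psize \<tau>)) * Hs y \<sigma> \<mu> * Hs x \<tau> \<mu>)"
  proof (rule sum.mono_neutral_cong_left)
    show "?B \<subseteq> {\<mu>. psize \<mu> \<le> psize \<sigma>}" using interlaces_psize by auto
    fix \<mu> assume \<mu>: "\<mu> \<in> ?B"
    define e where "e = psize \<mu> + N - psize \<sigma> - psize \<tau>"
    have le: "psize \<mu> \<le> psize \<sigma>" "psize \<mu> \<le> psize \<tau>" using \<mu> interlaces_psize by auto
    have "int (psize \<mu>) + int N - int (psize \<sigma>) - int (psize \<tau>) = int e" using \<mu> by (simp add: e_def)
    moreover have "N - psize \<sigma> = e + (psize \<tau> - psize \<mu>)" "N - psize \<tau> = e + (psize \<sigma> - psize \<mu>)"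
      using \<mu> le by (auto simp: e_def)
    ultimately show "?w = icoeff (geo (x * y)) (int (psize \<mu>) + int N - int (psize \<sigma>) - int (psize \<tau>)) * Hs y \<sigma> \<mu> * Hs x \<tau> \<mu>"
      using \<mu> by (simp add: icoeff_def geo_def Hs_def power_add power_mult_distrib mult_ac)
  qed (auto simp: icoeff_def Hs_def)
  finally show "(\<Sum>\<kappa> | psize \<kappa> = N. Hs x \<kappa> \<sigma> * Hs y \<kappa> \<tau>) = (\<Sum>\<mu> | psize \<mu> \<le> psize \<sigma>.
        icoeff (geo (x * y)) (int (psize \<mu>) + int N - int (psize \<sigma>) - int (psize \<tau>)) * Hs y \<sigma> \<mu> * Hs x \<tau> \<mu>)" .
qed

lemma comm_rel_Hl: "comm_rel (Hl xs) (Hl ys) (\<Prod>x\<leftarrow>xs. \<Prod>y\<leftarrow>ys. geo (x * y))"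
proof (induction xs)
  case Nil
  show ?case by (simp add: comm_rel_idm_left)
next
  case (Cons x xs)
  have "comm_rel (Hs x) (Hl ys) (\<Prod>y\<leftarrow>ys. geo (x * y))"
  proof (induction ys)
    case Nil
    show ?case by (simp add: comm_rel_sym comm_rel_idm_left)
  next
    case (Cons y ys)
    then show ?case by (simp add: comm_rel_mmul_right comm_rel_Hs)
  qed
  with Cons show ?case by (simp add: comm_rel_mmul_left)
qed

text \<open>Substitution of \<open>s z\<close> for \<open>z\<close>.\<close>

definition fps_dilate :: "'a::comm_ring_1 \<Rightarrow> 'a fps \<Rightarrow> 'a fps" where
  "fps_dilate s c = Abs_fps (\<lambda>i. s ^ i * fps_nth c i)"

lemma comm_rel_scal_left:
  assumes "unitri A" "unitri B" "comm_rel B A c"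
  shows "comm_rel (scal s B) A (fps_dilate s c)"
  unfolding comm_rel_def
proof (intro allI)
  fix \<sigma> \<tau> N
  have "(\<Sum>\<kappa> | psize \<kappa> = N. scal s B \<kappa> \<sigma> * A \<kappa> \<tau>) = s ^ (N - psize \<sigma>) * (\<Sum>\<kappa> | psize \<kappa> = N. B \<kappa> \<sigma> * A \<kappa> \<tau>)"
    by (simp add: scal_def sum_distrib_left mult_ac)
  also have "\<dots> = (\<Sum>\<mu> | psize \<mu> \<le> psize \<sigma>. s ^ (N - psize \<sigma>) * (
        icoeff c (int (psize \<mu>) + int N - int (psize \<sigma>) - int (psize \<tau>)) * A \<sigma> \<mu> * B \<tau> \<mu>))"
    by (simp only: comm_relD[OF assms(3)] sum_distrib_left)
  also have "\<dots> = (\<Sum>\<mu> | psize \<mu> \<le> psize \<sigma>.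
        icoeff (fps_dilate s c) (int (psize \<mu>) + int N - int (psize \<sigma>) - int (psize \<tau>)) * A \<sigma> \<mu> * scal s B \<tau> \<mu>)"
  proof (rule sum.cong)
    fix \<mu> assume \<mu>: "\<mu> \<in> {\<mu>. psize \<mu> \<le> psize \<sigma>}"
    define k where "k = int (psize \<mu>) + int N - int (psize \<sigma>) - int (psize \<tau>)"
    show "s ^ (N - psize \<sigma>) * (icoeff c (int (psize \<mu>) + int N - int (psize \<sigma>) - int (psize \<tau>)) * A \<sigma> \<mu> * B \<tau> \<mu>) =
      icoeff (fps_dilate s c) (int (psize \<mu>) + int N - int (psize \<sigma>) - int (psize \<tau>)) * A \<sigma> \<mu> * scal s B \<tau> \<mu>"
    proof (cases "k < 0 \<or> psize \<tau> < psize \<mu>")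
      case True
      then show ?thesis using unitri_0[OF assms(2), of \<tau> \<mu>]
        by (auto simp: icoeff_def k_def[symmetric] scal_def)
    next
      case False
      define e where "e = psize \<tau> - psize \<mu>"
      have "N - psize \<sigma> = nat k + e" using False by (auto simp: k_def e_def)
      with False show ?thesis
        by (simp add: icoeff_def k_def[symmetric] scal_def fps_dilate_def e_def[symmetric] power_add mult_ac)
    qed
  qed simp
  finally show "(\<Sum>\<kappa> | psize \<kappa> = N. scal s B \<kappa> \<sigma> * A \<kappa> \<tau>) = (\<Sum>\<mu> | psize \<mu> \<le> psize \<sigma>.
        icoeff (fps_dilate s c) (int (psize \<mu>) + int N - int (psize \<sigma>) - int (psize \<tau>)) * A \<sigma> \<mu> * scal s B \<tau> \<mu>)" .
qed

section \<open>Convergent matrix products\<close>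

text \<open>A matrix entry that adds \<open>j\<close> boxes vanishes to order \<open>a * j\<close>.  An annihilation and a creation matrix can be
multiplied as soon as their slopes \<open>a\<close> have a positive sum, even if one of them is negative.\<close>

definition hom_ord :: "int \<Rightarrow> (partition \<Rightarrow> partition \<Rightarrow> 'a::zero fls) \<Rightarrow> bool" where
  "hom_ord a A \<longleftrightarrow> (\<forall>\<sigma> \<tau>. ord_ge (a * (int (psize \<sigma>) - int (psize \<tau>))) (A \<sigma> \<tau>))"

lemma hom_ordD: "hom_ord a A \<Longrightarrow> ord_ge (a * (int (psize \<sigma>) - int (psize \<tau>))) (A \<sigma> \<tau>)"
  by (simp add: hom_ord_def)

lemma hom_ord_mmul:
  fixes A B :: "partition \<Rightarrow> partition \<Rightarrow> 'a::comm_ring_1 fls"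
  assumes "hom_ord a A" "hom_ord a B"
  shows "hom_ord a (mmul A B)"
  unfolding hom_ord_def mmul_def
proof (intro allI ord_ge_sum)
  fix \<sigma> \<tau> \<kappa>
  show "ord_ge (a * (int (psize \<sigma>) - int (psize \<tau>))) (A \<sigma> \<kappa> * B \<kappa> \<tau>)"
    by (rule ord_ge_mult_le[OF hom_ordD[OF assms(1)] hom_ordD[OF assms(2)]]) (simp add: algebra_simps)
qed

lemma hom_ord_idm: "hom_ord a idm"
  by (simp add: hom_ord_def idm_def)

lemma hom_ord_scal:
  fixes A :: "partition \<Rightarrow> partition \<Rightarrow> 'a::comm_ring_1 fls"
  assumes "hom_ord a A" "ord_ge b s" "unitri A"
  shows "hom_ord (a + b) (scal s A)"
  unfolding hom_ord_def
proof (intro allI)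
  fix \<sigma> \<tau>
  show "ord_ge ((a + b) * (int (psize \<sigma>) - int (psize \<tau>))) (scal s A \<sigma> \<tau>)"
  proof (cases "psize \<sigma> < psize \<tau>")
    case True
    then show ?thesis by (simp add: scal_def unitri_0[OF assms(3)])
  next
    case False
    show ?thesis unfolding scal_def
      by (rule ord_ge_mult_le[OF ord_ge_power[OF assms(2)] hom_ordD[OF assms(1)]])
         (use False in \<open>simp add: algebra_simps of_nat_diff\<close>)
  qed
qed

lemma hom_ord_Hs:
  fixes x :: "'a::comm_ring_1 fls"
  assumes "ord_ge a x"
  shows "hom_ord a (Hs x)"
  unfolding hom_ord_def
proof (intro allI)
  fix \<sigma> \<tau>
  show "ord_ge (a * (int (psize \<sigma>) - int (psize \<tau>))) (Hs x \<sigma> \<tau>)"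
  proof (cases "interlaces \<sigma> \<tau>")
    case True
    then have "int (psize \<sigma> - psize \<tau>) = int (psize \<sigma>) - int (psize \<tau>)"
      using interlaces_psize by auto
    then show ?thesis using True ord_ge_power[OF assms, of "psize \<sigma> - psize \<tau>"]
      by (simp add: Hs_def mult.commute)
  qed (simp add: Hs_def)
qed

lemma hom_ord_Hl:
  fixes xs :: "'a::comm_ring_1 fls list"
  shows "(\<And>x. x \<in> set xs \<Longrightarrow> ord_ge a x) \<Longrightarrow> hom_ord a (Hl xs)"
  by (induction xs) (simp_all add: hom_ord_idm hom_ord_mmul hom_ord_Hs)

lemma sum_psize_less: "(\<Sum>\<kappa> | psize \<kappa> < J. f \<kappa>) = (\<Sum>N<J. \<Sum>\<kappa> | psize \<kappa> = N. f \<kappa>)"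
proof -
  have "(\<Sum>\<kappa> | psize \<kappa> < J. f \<kappa>) = (\<Sum>N\<in>{..<J}. \<Sum>\<kappa> | \<kappa> \<in> {\<kappa>. psize \<kappa> < J} \<and> psize \<kappa> = N. f \<kappa>)"
    by (rule sum.group[symmetric]) auto
  also have "\<dots> = (\<Sum>N<J. \<Sum>\<kappa> | psize \<kappa> = N. f \<kappa>)"
    by (intro sum.cong) auto
  finally show ?thesis .
qed

text \<open>Summation over all partitions may be organized by size.\<close>

lemma has_sum_by_psize:
  fixes f :: "partition \<Rightarrow> 'a::ab_group_add fls"
  assumes lim: "(\<lambda>J. \<Sum>N<J. \<Sum>\<kappa> | psize \<kappa> = N. f \<kappa>) \<longlonglongrightarrow> s"
    and ord: "\<And>d. \<exists>J. \<forall>\<kappa>. J \<le> psize \<kappa> \<longrightarrow> ord_ge d (f \<kappa>)"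
  shows "(f has_sum s) UNIV"
proof (rule fls_has_sumI)
  fix d
  obtain J where J: "\<forall>\<kappa>. J \<le> psize \<kappa> \<longrightarrow> ord_ge d (f \<kappa>)" using ord[of d] ..
  have "\<forall>\<^sub>F J in sequentially. ord_ge d ((\<Sum>\<kappa> | psize \<kappa> < J. f \<kappa>) - s)"
    using lim by (simp add: fls_tendsto_iff sum_psize_less)
  then obtain M where M: "\<forall>J\<ge>M. ord_ge d ((\<Sum>\<kappa> | psize \<kappa> < J. f \<kappa>) - s)"
    by (auto simp: eventually_sequentially)
  let ?E = "{\<kappa>. psize \<kappa> < max J M}"
  have "\<forall>\<kappa>\<in>UNIV - ?E. ord_ge d (f \<kappa>)" using J by auto
  moreover have "ord_ge d (sum f ?E - s)" using M by simp
  ultimately show "\<exists>E. finite E \<and> E \<subseteq> UNIV \<and> (\<forall>i\<in>UNIV - E. ord_ge d (f i)) \<and> ord_ge d (sum f E - s)"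
    by (intro exI[of _ ?E]) simp
qed

text \<open>The value of a formal power series at $z = 1$.\<close>

definition evals_to :: "'a::{comm_ring_1} fls fps \<Rightarrow> 'a fls \<Rightarrow> bool" where
  "evals_to c C \<longleftrightarrow> fps_nth c sums C"

lemma evals_to_unique: "evals_to c C \<Longrightarrow> evals_to c D \<Longrightarrow> C = D"
  unfolding evals_to_def by (rule sums_unique2)

lemma evals_to_1: "evals_to 1 1"
proof -
  have "(\<Sum>i<n + 1. fps_nth (1::'a fls fps) i) = 1" for n by (simp add: sum.lessThan_Suc_shift del: sum.lessThan_Suc)
  then have "(\<lambda>n. \<Sum>i<n + 1. fps_nth (1::'a fls fps) i) \<longlonglongrightarrow> 1" by simp
  then show ?thesis unfolding evals_to_def sums_def by (rule LIMSEQ_offset)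
qed

lemma evals_to_linear_mult:
  assumes "evals_to c C"
  shows "evals_to ((1 - fps_const a * fps_X) * c) ((1 - a) * C)"
proof -
  let ?S = "\<lambda>n. \<Sum>i<n. fps_nth c i"
  have S: "?S \<longlonglongrightarrow> C" using assms by (simp add: evals_to_def sums_def)
  have e: "(\<Sum>i<n + 1. fps_nth ((1 - fps_const a * fps_X) * c) i) = ?S (n + 1) - a * ?S n" for n
    by (induction n) (simp_all add: left_diff_distrib mult.assoc algebra_simps)
  have L: "(\<lambda>n. ?S (n + 1) - a * ?S n) \<longlonglongrightarrow> C - a * C"
    using S by (intro tendsto_intros LIMSEQ_ignore_initial_segment)
  have "(1 - a) * C = C - a * C" by (simp add: left_diff_distrib)
  then have "(\<lambda>n. \<Sum>i<n + 1. fps_nth ((1 - fps_const a * fps_X) * c) i) \<longlonglongrightarrow> (1 - a) * C"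
    using L by (simp only: e)
  then show ?thesis unfolding evals_to_def sums_def by (rule LIMSEQ_offset)
qed

lemma evals_to_linear_prod:
  assumes "evals_to c C"
  shows "evals_to ((\<Prod>i\<in>I. (1 - fps_const (a i) * fps_X) ^ e i) * c) ((\<Prod>i\<in>I. (1 - a i) ^ e i) * C)"
proof -
  have pow: "evals_to ((1 - fps_const b * fps_X) ^ k * c) ((1 - b) ^ k * C)" if "evals_to c C" for b k c C
    by (induction k) (use that in \<open>auto simp: mult.assoc intro: evals_to_linear_mult\<close>)
  show ?thesis
    by (induction I rule: infinite_finite_induct) (use assms in \<open>auto simp: mult.assoc intro: pow\<close>)
qed

text \<open>Setting $z = 1$ in a commutation relation yields an infinite sum over all intermediate partitions.  The growth
conditions make the sum and the scalar series converge, and the scalar is a unit close to one.\<close>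

lemma comm_rel_evaluate:
  fixes A B :: "partition \<Rightarrow> partition \<Rightarrow> 'a::comm_ring_1 fls"
  assumes un: "unitri A" "unitri B" and rel: "comm_rel B A c"
    and ord: "hom_ord a A" "hom_ord b B" "a + b \<ge> 1"
  obtains C where "evals_to c C" "ord_ge 1 (C - 1)"
    "\<And>\<sigma> \<tau>. ((\<lambda>\<kappa>. B \<kappa> \<sigma> * A \<kappa> \<tau>) has_sum C * (\<Sum>\<mu> | psize \<mu> \<le> psize \<sigma>. A \<sigma> \<mu> * B \<tau> \<mu>)) UNIV"
proof -
  have term_ord: "ord_ge ((a + b) * int (psize \<kappa>) - b * int (psize \<sigma>) - a * int (psize \<tau>)) (B \<kappa> \<sigma> * A \<kappa> \<tau>)" for \<kappa> \<sigma> \<tau>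
    by (rule ord_ge_mult_le[OF hom_ordD[OF ord(2)] hom_ordD[OF ord(1)]]) (simp add: algebra_simps)
  have cnth: "fps_nth c i = (\<Sum>\<kappa> | psize \<kappa> = i. B \<kappa> empty_partition * A \<kappa> empty_partition)" for i
  proof -
    have "{\<mu>. psize \<mu> \<le> 0} = {empty_partition}" by auto
    then show ?thesis
      by (simp add: comm_relD[OF rel] icoeff_def unitri_diag[OF un(1)] unitri_diag[OF un(2)])
  qed
  have c_ord: "ord_ge (int i) (fps_nth c i)" for i
    unfolding cnth
  proof (rule ord_ge_sum)
    fix \<kappa> assume \<kappa>: "\<kappa> \<in> {\<kappa>. psize \<kappa> = i}"
    have "1 * int i \<le> (a + b) * int i" using ord(3) by (intro mult_right_mono) auto
    then show "ord_ge (int i) (B \<kappa> empty_partition * A \<kappa> empty_partition)"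
      using term_ord[of \<kappa> empty_partition empty_partition] \<kappa> by (auto intro: ord_ge_mono)
  qed
  have "fps_nth c summable_on UNIV"
  proof (rule fls_summable)
    fix d
    have "i < nat d" if "\<not> ord_ge d (fps_nth c i)" for i
      using c_ord[of i] that ord_ge_mono[of "int i" "fps_nth c i" d] by linarith
    then have "{i \<in> UNIV. \<not> ord_ge d (fps_nth c i)} \<subseteq> {..<nat d}" by blast
    then show "finite {i \<in> UNIV. \<not> ord_ge d (fps_nth c i)}" by (rule finite_subset) simp
  qed
  then obtain C where C: "(fps_nth c has_sum C) UNIV" by (auto simp: summable_on_def)
  then have ev: "fps_nth c sums C" by (rule has_sum_imp_sums)
  have "c0": "fps_nth c 0 = 1"
  proof -
    have "{\<kappa>. psize \<kappa> = 0} = {empty_partition}" by auto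
    then show ?thesis by (simp add: cnth unitri_diag[OF un(1)] unitri_diag[OF un(2)])
  qed
  have "ord_ge 1 (C - 1)"
  proof (rule ord_ge_limit)
    show "(\<lambda>n. (\<Sum>i<n. fps_nth c i) - 1) \<longlonglongrightarrow> C - 1"
      using ev unfolding sums_def by (intro tendsto_intros)
    have "ord_ge 1 ((\<Sum>i<n. fps_nth c i) - 1)" if n: "n \<ge> 1" for n
    proof -
      obtain m where "n = Suc m" using n by (cases n) auto
      then have "(\<Sum>i<n. fps_nth c i) - 1 = (\<Sum>i<m. fps_nth c (Suc i))"
        by (simp only: sum.lessThan_Suc_shift c0) simp
      also have "ord_ge 1 \<dots>"
      proof (rule ord_ge_sum)
        fix i show "ord_ge 1 (fps_nth c (Suc i))"
          by (rule ord_ge_mono[OF c_ord]) simp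
      qed
      finally show ?thesis .
    qed
    then show "\<forall>\<^sub>F n in sequentially. ord_ge 1 ((\<Sum>i<n. fps_nth c i) - 1)"
      by (auto simp: eventually_sequentially)
  qed simp
  moreover have "((\<lambda>\<kappa>. B \<kappa> \<sigma> * A \<kappa> \<tau>) has_sum C * (\<Sum>\<mu> | psize \<mu> \<le> psize \<sigma>. A \<sigma> \<mu> * B \<tau> \<mu>)) UNIV" for \<sigma> \<tau>
  proof (rule has_sum_by_psize)
    let ?k = "\<lambda>N \<mu>. int (psize \<mu>) + int N - int (psize \<sigma>) - int (psize \<tau>)"
    have "(\<lambda>J. \<Sum>\<mu> | psize \<mu> \<le> psize \<sigma>. (\<Sum>N<J. icoeff c (?k N \<mu>)) * (A \<sigma> \<mu> * B \<tau> \<mu>))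
        \<longlonglongrightarrow> (\<Sum>\<mu> | psize \<mu> \<le> psize \<sigma>. C * (A \<sigma> \<mu> * B \<tau> \<mu>))"
    proof (intro tendsto_sum tendsto_mult tendsto_const)
      fix \<mu> assume \<mu>: "\<mu> \<in> {\<mu>. psize \<mu> \<le> psize \<sigma>}"
      \<comment> \<open>The coefficient of $z^N$ starts with the index \<open>- e\<close>, so that the partial sums are those of \<open>c\<close>, shifted by \<open>e\<close>.\<close>
      define e where "e = psize \<sigma> + psize \<tau> - psize \<mu>"
      have k: "?k N \<mu> = int N - int e" for N using \<mu> by (simp add: e_def)
      have "(\<Sum>N<J + e. icoeff c (int N - int e)) = (\<Sum>i<J. fps_nth c i)" for J
      proof -
        have "(\<Sum>N<J + e. icoeff c (int N - int e)) = (\<Sum>N\<in>{e..<J + e}. icoeff c (int N - int e))"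
          by (rule sum.mono_neutral_right) (auto simp: icoeff_def)
        also have "\<dots> = (\<Sum>i<J. fps_nth c i)"
          by (rule sum.reindex_bij_witness[of _ "\<lambda>i. i + e" "\<lambda>N. N - e"])
             (auto simp: icoeff_def simp flip: of_nat_diff)
        finally show ?thesis .
      qed
      then have "(\<lambda>J. \<Sum>N<J + e. icoeff c (?k N \<mu>)) \<longlonglongrightarrow> C"
        using ev by (simp add: k sums_def)
      then show "(\<lambda>J. \<Sum>N<J. icoeff c (?k N \<mu>)) \<longlonglongrightarrow> C" by (rule LIMSEQ_offset)
    qed
    moreover have "(\<Sum>N<J. \<Sum>\<kappa> | psize \<kappa> = N. B \<kappa> \<sigma> * A \<kappa> \<tau>) =
        (\<Sum>\<mu> | psize \<mu> \<le> psize \<sigma>. (\<Sum>N<J. icoeff c (?k N \<mu>)) * (A \<sigma> \<mu> * B \<tau> \<mu>))" for J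
      unfolding comm_relD[OF rel] sum_distrib_right by (subst sum.swap) (simp add: mult_ac)
    ultimately show "(\<lambda>J. \<Sum>N<J. \<Sum>\<kappa> | psize \<kappa> = N. B \<kappa> \<sigma> * A \<kappa> \<tau>)
        \<longlonglongrightarrow> C * (\<Sum>\<mu> | psize \<mu> \<le> psize \<sigma>. A \<sigma> \<mu> * B \<tau> \<mu>)"
      by (simp add: sum_distrib_left)
  next
    fix d
    define J where "J = nat (d + b * int (psize \<sigma>) + a * int (psize \<tau>))"
    have "ord_ge d (B \<kappa> \<sigma> * A \<kappa> \<tau>)" if "J \<le> psize \<kappa>" for \<kappa>
    proof -
      have "1 * int (psize \<kappa>) \<le> (a + b) * int (psize \<kappa>)" using ord(3) by (intro mult_right_mono) auto
      then show ?thesis using that by (intro ord_ge_mono[OF term_ord]) (simp add: J_def)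
    qed
    then show "\<exists>J. \<forall>\<kappa>. J \<le> psize \<kappa> \<longrightarrow> ord_ge d (B \<kappa> \<sigma> * A \<kappa> \<tau>)" by blast
  qed
  ultimately show ?thesis using ev that by (simp add: evals_to_def)
qed

section \<open>Normal ordering of a product of vertex operators\<close>

definition hole_list :: "partition \<Rightarrow> int list \<Rightarrow> int list" where
  "hole_list \<rho> ts = filter (\<lambda>t. t \<notin> slope_set \<rho>) ts"

definition particle_list :: "partition \<Rightarrow> int list \<Rightarrow> int list" where
  "particle_list \<rho> ts = filter (\<lambda>t. t \<in> slope_set \<rho>) ts"

text \<open>The scalar that normal ordering produces.  Only an annihilation operator to the left of a creation operator has
to move, and \<open>ts\<close> lists the operators from left to right.\<close>

fun ordering_factor :: "partition \<Rightarrow> (int \<Rightarrow> 'a::field) \<Rightarrow> int list \<Rightarrow> 'a" where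
  "ordering_factor \<rho> y [] = 1"
| "ordering_factor \<rho> y (t # ts) =
    (if t \<in> slope_set \<rho> then (\<Prod>t'\<leftarrow>hole_list \<rho> ts. inverse (1 - y t' / y t)) else 1) * ordering_factor \<rho> y ts"

lemma Gamma_neg_unitri:
  fixes f :: "partition \<Rightarrow> 'a::{field,t2_space}"
  shows "Gamma (-1) x f \<sigma> = (\<Sum>\<kappa> | psize \<kappa> \<le> psize \<sigma>. Hs x \<sigma> \<kappa> * f \<kappa>)"
proof -
  have "Gamma (-1) x f \<sigma> = infsum (\<lambda>\<kappa>. Hs x \<sigma> \<kappa> * f \<kappa>) UNIV"
    by (simp add: Gamma_def Gamma_coeff_def Hs_def)
  also have "\<dots> = infsum (\<lambda>\<kappa>. Hs x \<sigma> \<kappa> * f \<kappa>) {\<kappa>. psize \<kappa> \<le> psize \<sigma>}"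
    by (rule infsum_cong_neutral) (use interlaces_psize(1) in \<open>auto simp: Hs_def\<close>)
  finally show ?thesis by simp
qed

lemma Gamma_pos_eq:
  fixes f :: "partition \<Rightarrow> 'a::{field,t2_space}"
  shows "Gamma 1 x f \<sigma> = infsum (\<lambda>\<kappa>. Hs x \<kappa> \<sigma> * f \<kappa>) UNIV"
  by (simp add: Gamma_def Gamma_coeff_def Hs_def)

lemma prod_list_geo_evals:
  fixes as :: "'a::comm_ring_1 fls list"
  assumes "evals_to (\<Prod>a\<leftarrow>as. geo a) C"
  shows "(\<Prod>a\<leftarrow>as. (1 - a)) * C = 1"
proof -
  have "evals_to ((\<Prod>a\<leftarrow>bs. 1 - fps_const a * fps_X) * c) ((\<Prod>a\<leftarrow>bs. 1 - a) * C)" if "evals_to c C" for bs c C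
    by (induction bs) (use that in \<open>auto simp: mult.assoc intro: evals_to_linear_mult\<close>)
  from this[OF assms, of as]
  have "evals_to ((\<Prod>a\<leftarrow>as. 1 - fps_const a * fps_X) * (\<Prod>a\<leftarrow>as. geo a)) ((\<Prod>a\<leftarrow>as. 1 - a) * C)" .
  moreover have "(\<Prod>a\<leftarrow>as. 1 - fps_const a * fps_X) * (\<Prod>a\<leftarrow>as. geo a) = 1"
  proof (induction as)
    case (Cons a as)
    have "(\<Prod>a\<leftarrow>a # as. 1 - fps_const a * fps_X) * (\<Prod>a\<leftarrow>a # as. geo a) =
      (geo a * (1 - fps_const a * fps_X)) * ((\<Prod>a\<leftarrow>as. 1 - fps_const a * fps_X) * (\<Prod>a\<leftarrow>as. geo a))"
      by (simp only: list.map prod_list.Cons mult_ac)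
    then show ?case by (simp only: geo_mult Cons mult_1)
  qed simp
  ultimately show ?thesis using evals_to_1 evals_to_unique by metis
qed

lemma has_sum_sum:
  fixes f :: "'i \<Rightarrow> 'j \<Rightarrow> 'a::topological_comm_monoid_add"
  assumes "\<And>i. i \<in> I \<Longrightarrow> (f i has_sum s i) A"
  shows "((\<lambda>x. \<Sum>i\<in>I. f i x) has_sum (\<Sum>i\<in>I. s i)) A"
  using assms by (induction I rule: infinite_finite_induct) (auto intro: has_sum_add)

text \<open>The operators are added from the right.  A new creation operator already stands in the right place; a new
annihilation operator has to pass the creation operators at larger positions, whose arguments
have higher order, so that the commutation relation may be evaluated at $z = 1$.\<close>

lemma normal_ordering:
  fixes y :: "int \<Rightarrow> 'a::field fls"
  assumes y: "\<And>t. y t \<noteq> 0" "\<And>t. fls_subdegree (y t) = t"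
  assumes "sorted_wrt (<) ts"
  shows "foldr (\<lambda>t. Gamma (slope \<rho> t) (y t powi (- slope \<rho> t))) ts (basis_vector \<tau>) \<sigma> =
    ordering_factor \<rho> y ts * (\<Sum>\<mu> | psize \<mu> \<le> psize \<sigma>.
      Hl (map y (hole_list \<rho> ts)) \<sigma> \<mu> * Hl (map (\<lambda>t. inverse (y t)) (particle_list \<rho> ts)) \<tau> \<mu>)"
  using assms(3)
proof (induction ts arbitrary: \<sigma>)
  case Nil
  have "(\<Sum>\<mu> | psize \<mu> \<le> psize \<sigma>. idm \<sigma> \<mu> * idm \<tau> \<mu>) = mmul idm (\<lambda>\<mu> \<tau>. idm \<tau> \<mu> :: 'a fls) \<sigma> \<tau>"
    by (simp only: mmul_def)
  then show ?case by (simp add: basis_vector_def hole_list_def particle_list_def) (simp add: idm_def)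
next
  case (Cons t ts)
  define Z where "Z = ordering_factor \<rho> y ts"
  define A where "A = Hl (map y (hole_list \<rho> ts))"
  define Q where "Q = Hl (map (\<lambda>t. inverse (y t)) (particle_list \<rho> ts))"
  define f where "f = foldr (\<lambda>t. Gamma (slope \<rho> t) (y t powi (- slope \<rho> t))) ts (basis_vector \<tau>)"
  have un: "unitri A" "unitri Q" by (simp_all add: A_def Q_def)
  have f: "f \<sigma> = Z * (\<Sum>\<mu> | psize \<mu> \<le> psize \<sigma>. A \<sigma> \<mu> * Q \<tau> \<mu>)" for \<sigma>
    using Cons by (simp add: Z_def A_def Q_def f_def)
  \<comment> \<open>The sum may also be cut off at the size of \<open>\<tau>\<close>, which makes its range independent of the summation variable
    of the next operator.\<close>
  have f': "f \<sigma> = Z * (\<Sum>\<mu> | psize \<mu> \<le> psize \<tau>. A \<sigma> \<mu> * Q \<tau> \<mu>)" for \<sigma>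
  proof -
    have "(\<Sum>\<mu> | psize \<mu> \<le> psize \<sigma>. A \<sigma> \<mu> * Q \<tau> \<mu>) = (\<Sum>\<mu> | psize \<mu> \<le> psize \<tau>. A \<sigma> \<mu> * Q \<tau> \<mu>)"
    proof (cases "psize \<sigma> \<le> psize \<tau>")
      case True
      then show ?thesis by (intro sum_psize_restrict[symmetric]) (simp_all add: unitri_0[OF un(1)])
    next
      case False
      then show ?thesis by (intro sum_psize_restrict) (simp_all add: unitri_0[OF un(2)])
    qed
    then show ?thesis using f by simp
  qed
  have step: "foldr (\<lambda>t. Gamma (slope \<rho> t) (y t powi (- slope \<rho> t))) (t # ts) (basis_vector \<tau>) \<sigma> =
      Gamma (slope \<rho> t) (y t powi (- slope \<rho> t)) f \<sigma>" by (simp add: f_def)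
  show ?case
  proof (cases "t \<in> slope_set \<rho>")
    case False
    have "Gamma (slope \<rho> t) (y t powi (- slope \<rho> t)) f \<sigma> = (\<Sum>\<kappa> | psize \<kappa> \<le> psize \<sigma>. Hs (y t) \<sigma> \<kappa> * f \<kappa>)"
      using False by (simp add: slope_def Gamma_neg_unitri)
    also have "\<dots> = Z * (\<Sum>\<mu> | psize \<mu> \<le> psize \<tau>. mmul (Hs (y t)) A \<sigma> \<mu> * Q \<tau> \<mu>)"
      unfolding f' mmul_def sum_distrib_left sum_distrib_right by (subst sum.swap) (simp add: mult_ac)
    also have "(\<Sum>\<mu> | psize \<mu> \<le> psize \<tau>. mmul (Hs (y t)) A \<sigma> \<mu> * Q \<tau> \<mu>) =
       (\<Sum>\<mu> | psize \<mu> \<le> psize \<sigma>. mmul (Hs (y t)) A \<sigma> \<mu> * Q \<tau> \<mu>)"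
    proof (cases "psize \<sigma> \<le> psize \<tau>")
      case True
      then show ?thesis by (intro sum_psize_restrict) (simp_all add: unitri_0[OF unitri_mmul[OF unitri_Hs un(1)]])
    next
      case False
      then show ?thesis by (intro sum_psize_restrict[symmetric]) (simp_all add: unitri_0[OF un(2)])
    qed
    finally show ?thesis unfolding step using False
      by (simp add: hole_list_def particle_list_def Z_def A_def Q_def)
  next
    case True
    define x where "x = inverse (y t)"
    define as where "as = map (\<lambda>t'. y t' / y t) (hole_list \<rho> ts)"
    have rel: "comm_rel (Hs x) A (\<Prod>a\<leftarrow>as. geo a)"
    proof -
      have "comm_rel (Hl [x]) A (\<Prod>x\<leftarrow>[x]. \<Prod>y\<leftarrow>map y (hole_list \<rho> ts). geo (x * y))"
        unfolding A_def by (rule comm_rel_Hl)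
      then show ?thesis by (simp add: as_def x_def comp_def field_simps)
    qed
    have ordx: "hom_ord (- t) (Hs x)"
      by (rule hom_ord_Hs) (simp add: ord_ge_iff x_def y fls_inverse_subdegree)
    have ordA: "hom_ord (t + 1) A"
      unfolding A_def
    proof (rule hom_ord_Hl)
      fix z assume "z \<in> set (map y (hole_list \<rho> ts))"
      then obtain t' where "t' \<in> set ts" "z = y t'" by (auto simp: hole_list_def)
      then show "ord_ge (t + 1) z" using Cons.prems by (auto simp: ord_ge_iff y)
    qed
    obtain C where C: "evals_to (\<Prod>a\<leftarrow>as. geo a) C" "ord_ge 1 (C - 1)"
      "\<And>\<sigma> \<tau>. ((\<lambda>\<kappa>. Hs x \<kappa> \<sigma> * A \<kappa> \<tau>) has_sum C * (\<Sum>\<mu> | psize \<mu> \<le> psize \<sigma>. A \<sigma> \<mu> * Hs x \<tau> \<mu>)) UNIV"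
      by (rule comm_rel_evaluate[OF un(1) unitri_Hs rel ordA ordx]) auto
    have "(\<Prod>a\<leftarrow>as. (1 - a)) * C = 1" by (rule prod_list_geo_evals[OF C(1)])
    then have "C = inverse (\<Prod>a\<leftarrow>as. (1 - a))" by (metis inverse_unique)
    also have "\<dots> = (\<Prod>a\<leftarrow>as. inverse (1 - a))" by (induction as) auto
    finally have Ceq: "C = (\<Prod>t'\<leftarrow>hole_list \<rho> ts. inverse (1 - y t' / y t))"
      by (simp add: as_def comp_def)
    have "((\<lambda>\<kappa>. \<Sum>\<mu> | psize \<mu> \<le> psize \<tau>. (Z * Q \<tau> \<mu>) * (Hs x \<kappa> \<sigma> * A \<kappa> \<mu>)) has_sum
       (\<Sum>\<mu> | psize \<mu> \<le> psize \<tau>. (Z * Q \<tau> \<mu>) * (C * (\<Sum>\<nu> | psize \<nu> \<le> psize \<sigma>. A \<sigma> \<nu> * Hs x \<mu> \<nu>)))) UNIV"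
      by (intro has_sum_sum has_sum_cmult_right C)
    moreover have "(\<Sum>\<mu> | psize \<mu> \<le> psize \<tau>. (Z * Q \<tau> \<mu>) * (Hs x \<kappa> \<sigma> * A \<kappa> \<mu>)) = Hs x \<kappa> \<sigma> * f \<kappa>" for \<kappa>
      unfolding f' sum_distrib_left by (simp add: mult_ac)
    moreover have "(\<Sum>\<mu> | psize \<mu> \<le> psize \<tau>. (Z * Q \<tau> \<mu>) * (C * (\<Sum>\<nu> | psize \<nu> \<le> psize \<sigma>. A \<sigma> \<nu> * Hs x \<mu> \<nu>))) =
       C * Z * (\<Sum>\<nu> | psize \<nu> \<le> psize \<sigma>. A \<sigma> \<nu> * mmul Q (Hs x) \<tau> \<nu>)"
      unfolding mmul_def sum_distrib_left by (subst sum.swap) (simp add: mult_ac)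
    ultimately have "((\<lambda>\<kappa>. Hs x \<kappa> \<sigma> * f \<kappa>) has_sum
       C * Z * (\<Sum>\<nu> | psize \<nu> \<le> psize \<sigma>. A \<sigma> \<nu> * mmul Q (Hs x) \<tau> \<nu>)) UNIV" by simp
    then have "infsum (\<lambda>\<kappa>. Hs x \<kappa> \<sigma> * f \<kappa>) UNIV = C * Z * (\<Sum>\<nu> | psize \<nu> \<le> psize \<sigma>. A \<sigma> \<nu> * mmul Q (Hs x) \<tau> \<nu>)"
      by (rule infsumI)
    moreover have "mmul Q (Hs x) = Hl (map (\<lambda>t. inverse (y t)) (particle_list \<rho> (t # ts)))"
    proof -
      have "mmul Q (Hs x) = Hl (map (\<lambda>t. inverse (y t)) (particle_list \<rho> ts) @ [x])"
        unfolding Hl_append by (simp add: Q_def)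
      also have "\<dots> = Hl (x # map (\<lambda>t. inverse (y t)) (particle_list \<rho> ts))"
        by (rule Hl_mset_cong) simp
      finally show ?thesis using True by (simp add: particle_list_def x_def)
    qed
    ultimately show ?thesis unfolding step using True
      by (simp add: slope_def Gamma_pos_eq x_def power_int_minus Ceq Z_def A_def hole_list_def)
  qed
qed

section \<open>Units close to one\<close>

lemma near_1_mult:
  fixes f g :: "'a::comm_ring_1 fls"
  assumes "ord_ge d (f - 1)" "ord_ge d (g - 1)" "0 \<le> d"
  shows "ord_ge d (f * g - 1)"
proof -
  have "f * g - 1 = (f - 1) * (g - 1) + (f - 1) + (g - 1)" by (simp add: algebra_simps)
  moreover have "ord_ge d ((f - 1) * (g - 1))"
    by (rule ord_ge_mult_le[OF assms(1,2)]) (use assms in simp)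
  ultimately show ?thesis using assms by (simp only: ord_ge_add)
qed

lemma near_1_subdegree:
  fixes f :: "'a::comm_ring_1 fls"
  assumes "ord_ge 1 (f - 1)"
  shows "fls_subdegree f = 0" "f \<noteq> 0"
proof -
  have *: "fls_nth f m = (if m = 0 then 1 else 0)" if "m < 1" for m
  proof -
    have "fls_nth (f - 1) m = 0" using assms that by (simp add: ord_ge_def)
    then show ?thesis by simp
  qed
  show "fls_subdegree f = 0"
    by (rule fls_subdegree_eqI) (use * in auto)
  show "f \<noteq> 0" using *[of 0] by auto
qed

lemma near_1_inverse:
  fixes f :: "'a::field fls"
  assumes "ord_ge d (f - 1)" "1 \<le> d"
  shows "ord_ge d (inverse f - 1)"
proof -
  have f: "fls_subdegree f = 0" "f \<noteq> 0" using near_1_subdegree[of f] assms ord_ge_mono by blast+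
  then have "inverse f - 1 = inverse f * - (f - 1)" by (simp add: algebra_simps)
  moreover have "ord_ge 0 (inverse f)" using f by (simp add: ord_ge_iff fls_inverse_subdegree)
  ultimately show ?thesis using assms ord_ge_minus by (metis ord_ge_mult add_0)
qed

lemma one_minus_ord:
  fixes x :: "'a::field fls"
  assumes "ord_ge 1 x"
  shows "1 - x \<noteq> 0" "ord_ge 0 (inverse (1 - x))" "ord_ge 0 (1 - x)"
proof -
  have "ord_ge 1 ((1 - x) - 1)" using assms ord_ge_minus[of 1 x] by simp
  from near_1_subdegree[OF this] show "1 - x \<noteq> 0" "ord_ge 0 (inverse (1 - x))" "ord_ge 0 (1 - x)"
    by (simp_all add: ord_ge_iff fls_inverse_subdegree)
qed

section \<open>Creation operators of a set of arguments\<close>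

text \<open>By \<open>Hl_mset_cong\<close> the order of the arguments does not matter; sorting merely picks one.\<close>

definition Hset :: "(int \<Rightarrow> 'a) \<Rightarrow> int set \<Rightarrow> partition \<Rightarrow> partition \<Rightarrow> 'a::comm_ring_1" where
  "Hset f H = Hl (map f (sorted_list_of_set H))"

lemma unitri_Hset [simp]: "unitri (Hset f H)"
  by (simp add: Hset_def)

lemma mset_sorted_list_of_set: "mset (sorted_list_of_set (A :: int set)) = mset_set A"
proof (cases "finite A")
  case True
  then have "mset_set (set (sorted_list_of_set A)) = mset (sorted_list_of_set A)"
    by (intro mset_set_set) simp
  with True show ?thesis by simp
qed simp

lemma Hl_eq_Hset: "distinct ts \<Longrightarrow> Hl (map f ts) = Hset f (set ts)"
  unfolding Hset_def by (rule Hl_mset_cong) (simp add: mset_set_set mset_sorted_list_of_set)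

lemma Hset_empty [simp]: "Hset f {} = idm"
  by (simp add: Hset_def)

lemma Hset_singleton: "Hset f {m} = Hs (f m)"
  by (simp add: Hset_def)

lemma Hset_Un:
  assumes "finite A" "finite B" "A \<inter> B = {}"
  shows "Hset f (A \<union> B) = mmul (Hset f A) (Hset f B)"
  unfolding Hset_def Hl_append[symmetric]
  by (rule Hl_mset_cong) (simp add: assms mset_set_Union mset_sorted_list_of_set)

lemma Hset_image:
  assumes "finite H" "inj_on g H"
  shows "Hset f (g ` H) = Hset (\<lambda>m. f (g m)) H"
  unfolding Hset_def
proof (rule Hl_mset_cong)
  have "mset (map f (sorted_list_of_set (g ` H))) = image_mset f (mset_set (g ` H))"
    by (simp add: mset_sorted_list_of_set)
  also have "mset_set (g ` H) = image_mset g (mset_set H)"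
    using assms by (simp add: image_mset_mset_set)
  also have "image_mset f (image_mset g (mset_set H)) = mset (map (\<lambda>m. f (g m)) (sorted_list_of_set H))"
    by (simp add: multiset.map_comp comp_def mset_sorted_list_of_set)
  finally show "mset (map f (sorted_list_of_set (g ` H))) = mset (map (\<lambda>m. f (g m)) (sorted_list_of_set H))" .
qed

lemma scal_Hset: "scal s (Hset f H) = Hset (\<lambda>m. s * f m) H"
  by (simp add: Hset_def scal_Hl comp_def)

section \<open>Geometric progressions of arguments\<close>

text \<open>The creation operator with arguments $1, Q, Q^2, \dots$.  Peeling off the argument \<open>1\<close> leaves
  the same operator with all arguments multiplied by \<open>Q\<close>; this determines the matrix
  recursively, with entries that are rational functions of \<open>Q\<close>, namely principal
  specializations of skew Schur functions.\<close>

function hgeo :: "'a::field \<Rightarrow> partition \<Rightarrow> partition \<Rightarrow> 'a" where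
  "hgeo Q \<sigma> \<tau> = (if psize \<sigma> \<le> psize \<tau> then (if \<sigma> = \<tau> then 1 else 0)
     else (\<Sum>\<kappa>\<in>{\<kappa>. psize \<kappa> < psize \<sigma>}. Hs 1 \<sigma> \<kappa> * (Q ^ (psize \<kappa> - psize \<tau>) * hgeo Q \<kappa> \<tau>)) /
       (1 - Q ^ (psize \<sigma> - psize \<tau>)))"
  by auto
termination by (relation "measure (\<lambda>(Q, \<sigma>, \<tau>). psize \<sigma>)") auto

declare hgeo.simps [simp del]

lemma unitri_hgeo [simp]: "unitri (hgeo Q)"
  by (simp add: unitri_def hgeo.simps)

text \<open>The defining property of the geometric progression.  The term \<open>\<kappa> = \<sigma>\<close> of the product is
\<open>Q ^ (psize \<sigma> - psize \<tau>) * hgeo Q \<sigma> \<tau>\<close>, and the recursion solves for it.\<close>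

lemma hgeo_shift:
  assumes "\<And>j. 0 < j \<Longrightarrow> Q ^ j \<noteq> 1"
  shows "mmul (Hs 1) (scal Q (hgeo Q)) = hgeo Q"
proof (intro ext)
  fix \<sigma> \<tau>
  show "mmul (Hs 1) (scal Q (hgeo Q)) \<sigma> \<tau> = hgeo Q \<sigma> \<tau>"
  proof (cases "psize \<sigma> \<le> psize \<tau>")
    case True
    then show ?thesis
      by (simp add: unitriD[OF unitri_mmul[OF unitri_Hs unitri_scal[OF unitri_hgeo]]] unitriD[OF unitri_hgeo])
  next
    case False
    let ?f = "\<lambda>\<kappa>. Hs 1 \<sigma> \<kappa> * (Q ^ (psize \<kappa> - psize \<tau>) * hgeo Q \<kappa> \<tau>)"
    let ?j = "psize \<sigma> - psize \<tau>"
    have "mmul (Hs 1) (scal Q (hgeo Q)) \<sigma> \<tau> = (\<Sum>\<kappa> | psize \<kappa> \<le> psize \<sigma>. ?f \<kappa>)"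
      by (simp add: mmul_def scal_def)
    also have "\<dots> = (\<Sum>\<kappa>\<in>insert \<sigma> {\<kappa>. psize \<kappa> < psize \<sigma>}. ?f \<kappa>)"
      by (rule sum.mono_neutral_right) (auto simp: unitriD[OF unitri_Hs])
    also have "\<dots> = Q ^ ?j * hgeo Q \<sigma> \<tau> + (\<Sum>\<kappa>\<in>{\<kappa>. psize \<kappa> < psize \<sigma>}. ?f \<kappa>)"
      by (simp add: unitri_diag[OF unitri_Hs])
    also have "(\<Sum>\<kappa>\<in>{\<kappa>. psize \<kappa> < psize \<sigma>}. ?f \<kappa>) = hgeo Q \<sigma> \<tau> * (1 - Q ^ ?j)"
      using False assms[of ?j] by (subst (2) hgeo.simps) simp
    finally show ?thesis by (simp add: algebra_simps)
  qed
qed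

lemma power_ne_1:
  fixes Q :: "'a::field fls"
  assumes "ord_ge 1 Q" "0 < j"
  shows "Q ^ j \<noteq> 1" "ord_ge 1 (Q ^ j)"
proof -
  have "ord_ge (int j * 1) (Q ^ j)" using assms by (intro ord_ge_power) simp
  then show "ord_ge 1 (Q ^ j)" using assms by (auto intro: ord_ge_mono)
  then show "Q ^ j \<noteq> 1" using one_minus_ord(1) by fastforce
qed

lemma ord_hgeo:
  fixes Q :: "'a::field fls"
  assumes "ord_ge 1 Q"
  shows "ord_ge 0 (hgeo Q \<sigma> \<tau>)"
proof (induction "psize \<sigma>" arbitrary: \<sigma> rule: less_induct)
  case less
  show ?case
  proof (cases "psize \<sigma> \<le> psize \<tau>")
    case True
    then show ?thesis by (simp add: unitriD[OF unitri_hgeo])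
  next
    case False
    have Qpow: "ord_ge 0 (Q ^ i)" for i
      using ord_ge_power[OF assms, of i] by (auto intro: ord_ge_mono)
    have "ord_ge 0 (\<Sum>\<kappa>\<in>{\<kappa>. psize \<kappa> < psize \<sigma>}. Hs 1 \<sigma> \<kappa> * (Q ^ (psize \<kappa> - psize \<tau>) * hgeo Q \<kappa> \<tau>))"
    proof (rule ord_ge_sum)
      fix \<kappa> assume "\<kappa> \<in> {\<kappa>. psize \<kappa> < psize \<sigma>}"
      then have 1: "ord_ge 0 (Q ^ (psize \<kappa> - psize \<tau>) * hgeo Q \<kappa> \<tau>)"
        using less Qpow by (intro ord_ge_mult_le[of 0 _ 0]) auto
      have 2: "ord_ge 0 (Hs (1::'a fls) \<sigma> \<kappa>)" by (simp add: Hs_def)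
      show "ord_ge 0 (Hs 1 \<sigma> \<kappa> * (Q ^ (psize \<kappa> - psize \<tau>) * hgeo Q \<kappa> \<tau>))"
        by (rule ord_ge_mult_le[OF 2 1]) simp
    qed
    moreover have "ord_ge 0 (inverse (1 - Q ^ (psize \<sigma> - psize \<tau>)))"
      using False by (intro one_minus_ord power_ne_1 assms) simp
    ultimately show ?thesis
      using False by (subst hgeo.simps) (auto simp: divide_inverse intro: ord_ge_mult_le[of 0 _ 0])
  qed
qed

lemma Hset_prefix_Suc:
  fixes Q :: "'a::field"
  assumes "Q \<noteq> 0"
  shows "Hset (\<lambda>m. Q powi m) {0..<int (Suc M)} = mmul (Hs 1) (scal Q (Hset (\<lambda>m. Q powi m) {0..<int M}))"
proof -
  have "{0..<int (Suc M)} = {0} \<union> (\<lambda>m. m + 1) ` {0..<int M}"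
    by (auto simp: image_iff)
  then have "Hset (\<lambda>m. Q powi m) {0..<int (Suc M)} =
     mmul (Hset (\<lambda>m. Q powi m) {0}) (Hset (\<lambda>m. Q powi m) ((\<lambda>m. m + 1) ` {0..<int M}))"
    by (simp only:) (rule Hset_Un; force)
  also have "Hset (\<lambda>m. Q powi m) ((\<lambda>m. m + 1) ` {0..<int M}) = Hset (\<lambda>m. Q * Q powi m) {0..<int M}"
    using assms by (subst Hset_image) (auto simp: power_int_add mult.commute)
  finally show ?thesis by (simp add: Hset_singleton scal_Hset)
qed

text \<open>Both the finite progression and \<open>hgeo Q\<close> satisfy the same recursion, and each recursion step scales the
discrepancy by a positive power of \<open>Q\<close>.\<close>

lemma Hset_prefix_approx:
  fixes Q :: "'a::field fls"
  assumes Q: "Q \<noteq> 0" "ord_ge 1 Q"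
  shows "ord_ge (int M) (Hset (\<lambda>m. Q powi m) {0..<int M} \<sigma> \<tau> - hgeo Q \<sigma> \<tau>)"
proof (induction M arbitrary: \<sigma> \<tau>)
  case 0
  have "ord_ge 0 (idm \<sigma> \<tau> :: 'a fls)" by (simp add: idm_def)
  then show ?case using ord_hgeo[OF Q(2)] by (simp add: ord_ge_diff)
next
  case (Suc M)
  define g where "g = Hset (\<lambda>m. Q powi m) {0..<int M}"
  have "Hset (\<lambda>m. Q powi m) {0..<int (Suc M)} \<sigma> \<tau> - hgeo Q \<sigma> \<tau> =
     mmul (Hs 1) (scal Q g) \<sigma> \<tau> - mmul (Hs 1) (scal Q (hgeo Q)) \<sigma> \<tau>"
    using Hset_prefix_Suc[OF Q(1)] hgeo_shift[of Q] power_ne_1[OF Q(2)] by (simp add: g_def)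
  also have "\<dots> = (\<Sum>\<kappa> | psize \<kappa> \<le> psize \<sigma>. Hs 1 \<sigma> \<kappa> * (Q ^ (psize \<kappa> - psize \<tau>) * (g \<kappa> \<tau> - hgeo Q \<kappa> \<tau>)))"
    by (simp add: mmul_def scal_def sum_subtractf[symmetric] right_diff_distrib)
  also have "ord_ge (int (Suc M)) \<dots>"
  proof (rule ord_ge_sum)
    fix \<kappa>
    have 1: "ord_ge (int (Suc M)) (Q ^ (psize \<kappa> - psize \<tau>) * (g \<kappa> \<tau> - hgeo Q \<kappa> \<tau>))"
    proof (cases "psize \<kappa> \<le> psize \<tau>")
      case True
      then show ?thesis by (simp add: g_def unitriD[OF unitri_hgeo] unitriD[OF unitri_Hset])
    next
      case False
      show ?thesis
        by (rule ord_ge_mult_le[OF power_ne_1(2)[OF Q(2)] Suc[of \<kappa> \<tau>, folded g_def]]) (use False in auto)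
    qed
    have 2: "ord_ge 0 (Hs (1::'a fls) \<sigma> \<kappa>)" by (simp add: Hs_def)
    show "ord_ge (int (Suc M)) (Hs 1 \<sigma> \<kappa> * (Q ^ (psize \<kappa> - psize \<tau>) * (g \<kappa> \<tau> - hgeo Q \<kappa> \<tau>)))"
      by (rule ord_ge_mult_le[OF 2 1]) simp
  qed
  finally show ?case .
qed

definition mconv :: "(nat \<Rightarrow> partition \<Rightarrow> partition \<Rightarrow> 'a) \<Rightarrow> (partition \<Rightarrow> partition \<Rightarrow> 'a::topological_space) \<Rightarrow> bool" where
  "mconv X A \<longleftrightarrow> (\<forall>\<sigma> \<tau>. (\<lambda>N. X N \<sigma> \<tau>) \<longlonglongrightarrow> A \<sigma> \<tau>)"

lemma mconvD: "mconv X A \<Longrightarrow> (\<lambda>N. X N \<sigma> \<tau>) \<longlonglongrightarrow> A \<sigma> \<tau>"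
  by (simp add: mconv_def)

lemma mconv_const [simp]: "mconv (\<lambda>_. A) A"
  by (simp add: mconv_def)

lemma mconv_mmul:
  fixes A B :: "partition \<Rightarrow> partition \<Rightarrow> 'a::comm_ring_1 fls"
  shows "mconv X A \<Longrightarrow> mconv Y B \<Longrightarrow> mconv (\<lambda>N. mmul (X N) (Y N)) (mmul A B)"
  unfolding mconv_def mmul_def by (auto intro!: tendsto_sum tendsto_mult)

lemma mconv_scal:
  fixes A :: "partition \<Rightarrow> partition \<Rightarrow> 'a::comm_ring_1 fls"
  shows "mconv X A \<Longrightarrow> mconv (\<lambda>N. scal s (X N)) (scal s A)"
  unfolding mconv_def scal_def by (auto intro!: tendsto_mult)

lemma mconv_eventually_eq:
  assumes "mconv X A" "\<forall>\<^sub>F N in sequentially. X N = Y N"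
  shows "mconv Y A"
  unfolding mconv_def
proof (intro allI)
  fix \<sigma> \<tau>
  show "(\<lambda>N. Y N \<sigma> \<tau>) \<longlonglongrightarrow> A \<sigma> \<tau>"
    by (rule Lim_transform_eventually[OF mconvD[OF assms(1)]])
       (use assms(2) in eventually_elim, simp)
qed

lemma mconv_prefix:
  fixes Q :: "'a::field fls"
  assumes "Q \<noteq> 0" "ord_ge 1 Q"
  shows "mconv (\<lambda>M. Hset (\<lambda>m. Q powi m) {0..<int M}) (hgeo Q)"
  unfolding mconv_def fls_tendsto_iff
proof (intro allI)
  fix \<sigma> \<tau> d
  show "\<forall>\<^sub>F M in sequentially. ord_ge d (Hset (\<lambda>m. Q powi m) {0..<int M} \<sigma> \<tau> - hgeo Q \<sigma> \<tau>)"
    unfolding eventually_sequentially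
    by (intro exI[of _ "nat d"] allI impI ord_ge_mono[OF Hset_prefix_approx[OF assms]]) simp
qed

text \<open>The shape of the set of holes of a partition, and of the set of negated particles.\<close>

definition cofin_above :: "nat \<Rightarrow> int set \<Rightarrow> bool" where
  "cofin_above L H \<longleftrightarrow> (\<forall>m\<ge>int L. m \<in> H) \<and> (\<forall>m<(- int L). m \<notin> H)"

text \<open>The product of the creation operators with arguments \<open>Q powi m\<close>, \<open>m \<in> H\<close>, for a set \<open>H\<close> that contains everything
from \<open>L\<close> on and nothing below \<open>-L\<close>.  The infinite tail is a rescaled \<open>hgeo\<close>, so that all matrix entries are
rational in \<open>Q\<close>; \<open>mconv_creation_block\<close> shows that it is the limit of the finite products.\<close>

definition creation_block :: "'a::field \<Rightarrow> nat \<Rightarrow> int set \<Rightarrow> partition \<Rightarrow> partition \<Rightarrow> 'a" where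
  "creation_block Q L H = mmul (Hset (\<lambda>m. Q powi m) (H \<inter> {- int L..<int L})) (scal (Q ^ L) (hgeo Q))"

lemma unitri_creation_block [simp]: "unitri (creation_block Q L H)"
  by (simp add: creation_block_def unitri_mmul)

lemma mconv_creation_block:
  fixes Q :: "'a::field fls"
  assumes Q: "Q \<noteq> 0" "ord_ge 1 Q" and H: "cofin_above L H"
    and lo: "\<forall>\<^sub>F N in sequentially. lo N \<le> - int L" and hi: "filterlim hi at_top sequentially"
  shows "mconv (\<lambda>N. Hset (\<lambda>m. Q powi m) (H \<inter> {lo N..hi N})) (creation_block Q L H)"
proof -
  let ?M = "\<lambda>N. nat (hi N + 1 - int L)"
  let ?h = "Hset (\<lambda>m. Q powi m)"
  have "filterlim ?M at_top sequentially"
  proof (rule filterlim_at_top[THEN iffD2], rule allI)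
    fix Z :: nat
    have "\<forall>\<^sub>F N in sequentially. int Z + int L \<le> hi N" using hi by (simp add: filterlim_at_top)
    then show "\<forall>\<^sub>F N in sequentially. Z \<le> ?M N" by eventually_elim simp
  qed
  then have "mconv (\<lambda>N. ?h {0..<int (?M N)}) (hgeo Q)"
    unfolding mconv_def by (intro allI filterlim_compose[OF mconvD[OF mconv_prefix[OF Q]]])
  then have "mconv (\<lambda>N. mmul (?h (H \<inter> {- int L..<int L})) (scal (Q ^ L) (?h {0..<int (?M N)}))) (creation_block Q L H)"
    unfolding creation_block_def by (intro mconv_mmul mconv_scal mconv_const)
  then show ?thesis
  proof (rule mconv_eventually_eq)
    have "\<forall>\<^sub>F N in sequentially. int L \<le> hi N" using hi by (simp add: filterlim_at_top)
    with lo show "\<forall>\<^sub>F N in sequentially. mmul (?h (H \<inter> {- int L..<int L})) (scal (Q ^ L) (?h {0..<int (?M N)})) = ?h (H \<inter> {lo N..hi N})"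
    proof eventually_elim
      case (elim N)
      have ge: "- int L \<le> m" if "m \<in> H" for m
        using H that unfolding cofin_above_def by (meson not_le)
      then have "lo N \<le> m" if "m \<in> H" for m
        using elim(1) that order_trans by blast
      with ge have "H \<inter> {lo N..hi N} = H \<inter> {- int L..<int L} \<union> {int L..hi N}"
        using elim H by (auto simp: cofin_above_def)
      moreover have "{int L..hi N} = (\<lambda>m. m + int L) ` {0..<int (?M N)}"
      proof -
        have "{0..<int (?M N)} = {0..hi N - int L}" using elim by auto
        then show ?thesis by simp
      qed
      moreover have "?h (H \<inter> {- int L..<int L} \<union> {int L..hi N}) = mmul (?h (H \<inter> {- int L..<int L})) (?h {int L..hi N})"
        by (rule Hset_Un) auto
      moreover have "?h ((\<lambda>m. m + int L) ` {0..<int (?M N)}) = scal (Q ^ L) (?h {0..<int (?M N)})"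
        using Q by (subst Hset_image) (auto simp: scal_Hset power_int_add mult.commute)
      ultimately show ?case by simp
    qed
  qed
qed

section \<open>Slope sets and pair counts\<close>

text \<open>The slope sequences of partitions, up to a cutoff: everything below \<open>-L\<close> is occupied, nothing from \<open>L\<close> on, and
the charge is zero, that is, exactly half of the window in between is occupied.\<close>

definition slope_like :: "nat \<Rightarrow> int set \<Rightarrow> bool" where
  "slope_like L S \<longleftrightarrow> (\<forall>m\<ge>int L. m \<notin> S) \<and> (\<forall>m<(- int L). m \<in> S) \<and> card (S \<inter> {- int L..}) = L"

lemma slope_like_less: "slope_like L S \<Longrightarrow> m \<in> S \<Longrightarrow> m < int L"
  by (rule ccontr) (simp add: slope_like_def)

lemma slope_like_ge: "slope_like L S \<Longrightarrow> m \<notin> S \<Longrightarrow> - int L \<le> m"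
  by (rule ccontr) (simp add: slope_like_def)

lemma slope_like_finite: "slope_like L S \<Longrightarrow> finite (S \<inter> {a..})"
  by (rule finite_subset[of _ "{a..int L}"]) (auto dest: slope_like_less)

lemma slope_like_mono:
  assumes "slope_like L S" "L \<le> L'"
  shows "slope_like L' S"
proof -
  have "S \<inter> {- int L'..} = S \<inter> {- int L..} \<union> {- int L'..<- int L}"
    using assms by (auto simp: slope_like_def)
  then have "card (S \<inter> {- int L'..}) = L + (L' - L)"
    using slope_like_finite[OF assms(1)] assms
    by (simp add: slope_like_def card_Un_disjoint disjoint_iff nat_diff_distrib)
  then show ?thesis using assms by (auto simp: slope_like_def)
qed

lemma slope_like_slope_set: obtains L where "slope_like L (slope_set \<rho>)"
proof -
  obtain K0 where K0: "\<And>i. i \<ge> K0 \<Longrightarrow> row \<rho> i = 0" using rows_eventually_0 by metis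
  define L where "L = max K0 (row \<rho> 0)"
  define s where "s i = int (row \<rho> i) - int i - 1" for i
  have S: "slope_set \<rho> = range s" by (auto simp: slope_set_def s_def)
  have dec: "s j < s i" if "i < j" for i j
    using row_antimono[of i j \<rho>] that by (simp add: s_def)
  have z: "s i = - int i - 1" if "i \<ge> L" for i using K0[of i] that by (simp add: s_def L_def)
  have "m \<notin> slope_set \<rho>" if "m \<ge> int L" for m
  proof
    assume "m \<in> slope_set \<rho>"
    then obtain i where "m = s i" by (auto simp: S)
    then show False using that row_antimono[of 0 i \<rho>] by (simp add: s_def L_def)
  qed
  moreover have "m \<in> slope_set \<rho>" if "m < - int L" for m
  proof -
    have "m = s (nat (- m - 1))" using that z[of "nat (- m - 1)"] by simp
    then show ?thesis by (auto simp: S)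
  qed
  moreover have "slope_set \<rho> \<inter> {- int L..} = s ` {..<L}"
  proof -
    have "- int L \<le> s i \<longleftrightarrow> i < L" for i
    proof (cases "i < L")
      case True
      then have "s L < s i" by (rule dec)
      then show ?thesis using True z[of L] by simp
    qed (use z[of i] in simp)
    then show ?thesis by (auto simp: S)
  qed
  moreover have "inj_on s {..<L}"
    by (rule inj_onI) (metis dec less_irrefl linorder_neqE_nat)
  ultimately have "slope_like L (slope_set \<rho>)" by (simp add: slope_like_def card_image)
  then show ?thesis using that by blast
qed

lemma slope_set_empty: "slope_set empty_partition = {..<0}"
proof -
  have "m \<in> slope_set empty_partition" if "m < 0" for m
    unfolding slope_set_def using that by (auto intro!: exI[of _ "nat (- m - 1)"])
  then show ?thesis by (auto simp: slope_set_def)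
qed

lemma slope_like_empty: "slope_like L {..<0}"
proof -
  have "{..<0} \<inter> {- int L..} = {- int L..<0}" by auto
  then show ?thesis by (simp add: slope_like_def)
qed

lemma cofin_above_slope_like:
  assumes "slope_like L S"
  shows "cofin_above (Suc L) (- S)" "cofin_above (Suc L) (uminus ` S)"
proof -
  show "cofin_above (Suc L) (- S)" using assms by (auto simp: cofin_above_def slope_like_def)
  have "m \<in> uminus ` S" if "int (Suc L) \<le> m" for m
    using assms that by (intro image_eqI[of m uminus "- m"]) (auto simp: slope_like_def)
  moreover have "m \<notin> uminus ` S" if "m < - int (Suc L)" for m
    using slope_like_less[OF assms] that by force
  ultimately show "cofin_above (Suc L) (uminus ` S)" by (simp add: cofin_above_def)
qed

definition hcount :: "int set \<Rightarrow> int set \<Rightarrow> int \<Rightarrow> nat" where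
  "hcount S S' d = card {m. m \<in> S \<and> m + d \<notin> S'}"

text \<open>The part of \<open>hcount\<close> that is finite in total: by \<open>hcount_eq\<close> the remainder is \<open>nat d\<close> for every pair of
configurations, and cancels in a quotient by the empty configuration.\<close>

definition dcount :: "int set \<Rightarrow> int set \<Rightarrow> int \<Rightarrow> nat" where
  "dcount S S' d = (if 0 \<le> d then card {m. m \<notin> S \<and> m + d \<in> S'} else hcount S S' d)"

text \<open>Shifting one of the two configurations by \<open>d\<close> changes its charge by \<open>d\<close>; the difference between the two
counts is the difference of the charges.\<close>

lemma hcount_balance:
  assumes "slope_like L S" "slope_like L S'"
  shows "int (card {m. m \<in> S \<and> m + d \<notin> S'}) = int (card {m. m \<notin> S \<and> m + d \<in> S'}) + d"
proof -
  define K where "K = L + nat \<bar>d\<bar>"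
  define T where "T = {m. m + d \<in> S'}"
  have sl: "slope_like K S" "slope_like (nat (int K - d)) S'"
    using assms by (auto intro!: slope_like_mono[of L] simp: K_def)
  have cS: "card (S \<inter> {- int K..}) = K" using sl by (simp add: slope_like_def)
  have "T \<inter> {- int K..} = (\<lambda>m. m - d) ` (S' \<inter> {- int (nat (int K - d))..})"
    by (auto simp: T_def image_iff K_def intro!: bexI[of _ "_ + d"])
  then have cT: "card (T \<inter> {- int K..}) = nat (int K - d)"
    using sl by (simp add: slope_like_def card_image inj_on_def)
  have fS: "finite (S \<inter> {- int K..})" using assms slope_like_finite by blast
  have "T \<inter> {- int K..} \<subseteq> (\<lambda>m. m - d) ` (S' \<inter> {- int K + d..})"
    by (auto simp: T_def image_iff intro!: bexI[of _ "_ + d"])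
  then have fT: "finite (T \<inter> {- int K..})"
    using slope_like_finite[OF assms(2)] finite_surj by blast
  have "- int K \<le> m" if "m + d \<notin> S'" for m
    using slope_like_ge[OF assms(2) that] by (simp add: K_def)
  then have X: "{m. m \<in> S \<and> m + d \<notin> S'} = S \<inter> {- int K..} - S \<inter> T \<inter> {- int K..}"
    by (auto simp: T_def)
  have "- int K \<le> m" if "m \<notin> S" for m
    using slope_like_ge[OF assms(1) that] by (simp add: K_def)
  then have Y: "{m. m \<notin> S \<and> m + d \<in> S'} = T \<inter> {- int K..} - S \<inter> T \<inter> {- int K..}"
    by (auto simp: T_def)
  have "card {m. m \<in> S \<and> m + d \<notin> S'} = K - card (S \<inter> T \<inter> {- int K..})"
    unfolding X using cS fS by (subst card_Diff_subset) (auto intro: finite_subset[OF _ fS])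
  moreover have "card {m. m \<notin> S \<and> m + d \<in> S'} = nat (int K - d) - card (S \<inter> T \<inter> {- int K..})"
    unfolding Y using cT fT by (subst card_Diff_subset) (auto intro: finite_subset[OF _ fT])
  moreover have "card (S \<inter> T \<inter> {- int K..}) \<le> K"
    using card_mono[OF fS, of "S \<inter> T \<inter> {- int K..}"] cS by auto
  moreover have "card (S \<inter> T \<inter> {- int K..}) \<le> nat (int K - d)"
    using card_mono[OF fT, of "S \<inter> T \<inter> {- int K..}"] cT by auto
  moreover have "d \<le> int K" by (simp add: K_def)
  ultimately show ?thesis by (simp add: of_nat_diff)
qed

lemma hcount_eq:
  assumes "slope_like L S" "slope_like L S'"
  shows "hcount S S' d = dcount S S' d + nat d"
  using hcount_balance[OF assms, of d] by (cases "0 \<le> d") (simp_all add: hcount_def dcount_def)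

lemma dcount_empty: "dcount {..<0} {..<0} d = 0"
proof -
  have "{m::int. m \<notin> {..<0} \<and> m + d \<in> {..<0}} = {}" if "0 \<le> d" using that by auto
  moreover have "{m::int. m \<in> {..<0} \<and> m + d \<notin> {..<0}} = {}" if "\<not> 0 \<le> d" using that by auto
  ultimately show ?thesis unfolding dcount_def hcount_def by (metis card.empty)
qed

lemma dcount_eq_0:
  assumes "slope_like L S" "slope_like L S'" "2 * int L < \<bar>d\<bar>"
  shows "dcount S S' d = 0"
proof -
  have "{m. m \<notin> S \<and> m + d \<in> S'} = {}" if "0 \<le> d"
    using slope_like_less[OF assms(2)] slope_like_ge[OF assms(1)] assms(3) that by fastforce
  moreover have "{m. m \<in> S \<and> m + d \<notin> S'} = {}" if "\<not> 0 \<le> d"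
    using slope_like_less[OF assms(1)] slope_like_ge[OF assms(2)] assms(3) that by fastforce
  ultimately show ?thesis unfolding dcount_def hcount_def by (metis card.empty)
qed

definition gap_prod :: "(int \<Rightarrow> 'a) \<Rightarrow> int set \<Rightarrow> int set \<Rightarrow> 'a::comm_monoid_mult" where
  "gap_prod f I H = (\<Prod>m\<in>I. \<Prod>m'\<in>H. f (m' - m))"

lemma gap_prod_split:
  assumes "finite I" "finite H" "finite D"
  shows "gap_prod f I H = (\<Prod>d\<in>D. f d ^ card {m\<in>I. m + d \<in> H}) *
     (\<Prod>(m, m')\<in>{(m, m')\<in>I \<times> H. m' - m \<notin> D}. f (m' - m))"
proof -
  let ?A = "{(m, m')\<in>I \<times> H. m' - m \<in> D}" and ?B = "{(m, m')\<in>I \<times> H. m' - m \<notin> D}"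
  have fin: "finite (I \<times> H)" using assms by simp
  have "gap_prod f I H = (\<Prod>(m, m')\<in>I \<times> H. f (m' - m))"
    by (simp add: gap_prod_def prod.cartesian_product)
  also have "I \<times> H = ?A \<union> ?B" by auto
  also have "(\<Prod>(m, m')\<in>?A \<union> ?B. f (m' - m)) = (\<Prod>(m, m')\<in>?A. f (m' - m)) * (\<Prod>(m, m')\<in>?B. f (m' - m))"
    by (rule prod.union_disjoint) (auto intro: finite_subset[OF _ fin])
  also have "(\<Prod>(m, m')\<in>?A. f (m' - m)) =
      (\<Prod>d\<in>D. \<Prod>x\<in>{x\<in>?A. (case x of (m, m') \<Rightarrow> m' - m) = d}. case x of (m, m') \<Rightarrow> f (m' - m))"
    by (rule prod.group[symmetric]) (use assms in \<open>auto intro: finite_subset[OF _ fin]\<close>)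
  also have "\<dots> = (\<Prod>d\<in>D. f d ^ card {m\<in>I. m + d \<in> H})"
  proof (rule prod.cong)
    fix d assume d: "d \<in> D"
    have "(\<Prod>x\<in>{x\<in>?A. (case x of (m, m') \<Rightarrow> m' - m) = d}. case x of (m, m') \<Rightarrow> f (m' - m)) =
          (\<Prod>m\<in>{m\<in>I. m + d \<in> H}. f d)"
      by (rule prod.reindex_bij_witness[of _ "\<lambda>m. (m, m + d)" fst]) (use d in auto)
    then show "(\<Prod>x\<in>{x\<in>?A. (case x of (m, m') \<Rightarrow> m' - m) = d}. case x of (m, m') \<Rightarrow> f (m' - m)) =
       f d ^ card {m\<in>I. m + d \<in> H}" by simp
  qed simp
  finally show ?thesis .
qed

text \<open>Passing from the empty configuration to \<open>S\<close>, \<open>S'\<close> multiplies the product over all pairs of a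
  particle and a hole by finitely many factors, up to pairs whose distance is of the order of
  the cutoff.  The predicate \<open>E\<close> collects the values that are negligible.\<close>

lemma pair_product:
  fixes f :: "int \<Rightarrow> 'a::comm_monoid_mult"
  assumes sl: "slope_like L S" "slope_like L S'"
    and W: "finite W" "finite W'" "{- int M..<int M} \<subseteq> W" "{- int M..<int M} \<subseteq> W'" "3 * L \<le> M"
    and E: "E 1" "\<And>x y. E x \<Longrightarrow> E y \<Longrightarrow> E (x * y)" "\<And>d. int M - int L < d \<Longrightarrow> E (f d)"
  obtains r0 r1 where "E r0" "E r1"
    "gap_prod f (W \<inter> S) (W' - S') * r0 =
     (\<Prod>d\<in>{- 2 * int L..2 * int L}. f d ^ dcount S S' d) * gap_prod f (W \<inter> {..<0}) (W' - {..<0}) * r1"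
proof -
  have Eprod: "E (prod g X)" if "\<And>x. x \<in> X \<Longrightarrow> E (g x)" for g and X :: "(int \<times> int) set"
    using that by (induction X rule: infinite_finite_induct) (auto intro: E(1,2))
  \<comment> \<open>Distances above \<open>M - L\<close> are negligible.  At the other distances that occur the window does not cut off any pair, because
    particles lie below \<open>L\<close> and holes above \<open>-L\<close>.\<close>
  define D where "D = {- 2 * int L..int M - int L}"
  define r where "r S S' = (\<Prod>(m, m')\<in>{(m, m')\<in>(W \<inter> S) \<times> (W' - S'). m' - m \<notin> D}. f (m' - m))" for S S'
  have main: "gap_prod f (W \<inter> S) (W' - S') = (\<Prod>d\<in>D. f d ^ hcount S S' d) * r S S' \<and> E (r S S')"
    if sl: "slope_like L S" "slope_like L S'" for S S'
  proof
    have "gap_prod f (W \<inter> S) (W' - S') = (\<Prod>d\<in>D. f d ^ card {m\<in>W \<inter> S. m + d \<in> W' - S'}) * r S S'"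
      unfolding r_def by (rule gap_prod_split) (use W in \<open>auto simp: D_def\<close>)
    also have "(\<Prod>d\<in>D. f d ^ card {m\<in>W \<inter> S. m + d \<in> W' - S'}) = (\<Prod>d\<in>D. f d ^ hcount S S' d)"
    proof (rule prod.cong)
      fix d assume d: "d \<in> D"
      have "m \<in> W \<and> m + d \<in> W'" if "m \<in> S" "m + d \<notin> S'" for m
      proof -
        have "m < int L" "- int L \<le> m + d"
          using slope_like_less[OF sl(1)] slope_like_ge[OF sl(2)] that by auto
        then have "m \<in> {- int M..<int M}" "m + d \<in> {- int M..<int M}" using d W(5) by (auto simp: D_def)
        then show ?thesis using W by blast
      qed
      then have "{m\<in>W \<inter> S. m + d \<in> W' - S'} = {m. m \<in> S \<and> m + d \<notin> S'}" by auto
      then show "f d ^ card {m\<in>W \<inter> S. m + d \<in> W' - S'} = f d ^ hcount S S' d" by (simp add: hcount_def)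
    qed simp
    finally show "gap_prod f (W \<inter> S) (W' - S') = (\<Prod>d\<in>D. f d ^ hcount S S' d) * r S S'" .
    have "E (f (m' - m))" if "m \<in> S" "m' \<notin> S'" "m' - m \<notin> D" for m m'
    proof -
      have "m < int L" "- int L \<le> m'"
        using slope_like_less[OF sl(1)] slope_like_ge[OF sl(2)] that by auto
      then show ?thesis using that(3) by (intro E(3)) (auto simp: D_def)
    qed
    then show "E (r S S')" unfolding r_def by (intro Eprod) auto
  qed
  have hc: "(\<Prod>d\<in>D. f d ^ hcount S S' d) = (\<Prod>d\<in>D. f d ^ dcount S S' d) * (\<Prod>d\<in>D. f d ^ nat d)"
    if "slope_like L S" "slope_like L S'" for S S'
    by (simp add: hcount_eq[OF that] power_add prod.distrib)
  have "(\<Prod>d\<in>D. f d ^ dcount S S' d) = (\<Prod>d\<in>{- 2 * int L..2 * int L}. f d ^ dcount S S' d)"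
  proof (rule prod.mono_neutral_right)
    show "\<forall>d\<in>D - {- 2 * int L..2 * int L}. f d ^ dcount S S' d = 1"
    proof
      fix d assume "d \<in> D - {- 2 * int L..2 * int L}"
      then have "2 * int L < \<bar>d\<bar>" by auto
      then show "f d ^ dcount S S' d = 1" using dcount_eq_0[OF sl] by simp
    qed
  qed (use W(5) in \<open>auto simp: D_def\<close>)
  then have "gap_prod f (W \<inter> S) (W' - S') * r {..<0} {..<0} =
     (\<Prod>d\<in>{- 2 * int L..2 * int L}. f d ^ dcount S S' d) * gap_prod f (W \<inter> {..<0}) (W' - {..<0}) * r S S'"
    using main[OF sl] main[OF slope_like_empty slope_like_empty] hc[OF sl] hc[OF slope_like_empty slope_like_empty]
    by (simp add: dcount_empty mult_ac)
  then show ?thesis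
    using that main[OF sl] main[OF slope_like_empty slope_like_empty] by blast
qed

section \<open>The orbifold vertex in closed form\<close>

definition vprod :: "(nat \<Rightarrow> 'a) \<Rightarrow> nat \<Rightarrow> 'a::comm_monoid_mult" where
  "vprod q k = (\<Prod>i\<in>{1..k}. q i)"

lemma vprod_0 [simp]: "vprod q 0 = 1"
  by (simp add: vprod_def)

lemma vprod_Suc: "vprod q (Suc k) = vprod q k * q (Suc k)"
  by (simp add: vprod_def)

lemma vprod_nonzero: "(\<And>i. q i \<noteq> 0) \<Longrightarrow> vprod q k \<noteq> 0" for q :: "nat \<Rightarrow> 'a::field"
  by (simp add: vprod_def)

lemma prod_lessThan_vprod:
  assumes "1 \<le> n"
  shows "(\<Prod>k<n. q k) = q 0 * vprod q (n - 1)"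
proof -
  obtain n' where "n = Suc n'" using assms by (cases n) auto
  then show ?thesis by (simp add: prod.lessThan_Suc_shift vprod_def prod.atLeast1_atMost_eq del: prod.lessThan_Suc)
qed

lemma int_cases_divmod:
  assumes "1 \<le> n"
  obtains m k where "t = int n * m + int k" "k < n"
proof
  show "t = int n * (t div int n) + int (nat (t mod int n))" using assms by simp
  show "nat (t mod int n) < n" using assms by (simp add: nat_less_iff)
qed

lemma divmod_block:
  assumes "k < n"
  shows "(int n * m + int k) div int n = m" "(int n * m + int k) mod int n = int k"
  using assms by auto

text \<open>One period multiplies \<open>frak_q\<close> by the product of all variables.\<close>

lemma frak_q_block:
  fixes q :: "nat \<Rightarrow> 'a::field"
  assumes n: "1 \<le> n" and q: "\<And>i. q i \<noteq> 0" and k: "k < n"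
  shows "frak_q n q (int n * m + int k) = (\<Prod>k<n. q k) powi m * vprod q k"
proof -
  define Q where "Q = (\<Prod>k<n. q k)"
  have Q0: "Q \<noteq> 0" using q by (simp add: Q_def)
  define z where "z t = Q powi (t div int n) * vprod q (nat (t mod int n))" for t
  have z_block: "z (int n * m + int k) = Q powi m * vprod q k" if "k < n" for m k
    using that by (simp add: z_def divmod_block)
  have rec: "z t = cyc n q t * z (t - 1)" for t
  proof -
    obtain m k where t: "t = int n * m + int k" "k < n" using int_cases_divmod[OF n] by metis
    show ?thesis
    proof (cases k)
      case 0
      have "t - 1 = int n * (m - 1) + int (n - 1)" using n t 0 by (simp add: algebra_simps of_nat_diff)
      then have "z (t - 1) = Q powi (m - 1) * vprod q (n - 1)"
        using z_block[of "n - 1" "m - 1"] n by (simp only:)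
      moreover have "cyc n q t = q 0" using t 0 by (simp add: cyc_def)
      moreover have "q 0 * vprod q (n - 1) = Q" using prod_lessThan_vprod[OF n, of q] by (simp add: Q_def)
      ultimately have "cyc n q t * z (t - 1) = Q powi (m - 1) * Q" by (simp add: mult_ac)
      also have "\<dots> = Q powi m" using Q0 by (simp add: power_int_diff)
      finally show ?thesis using z_block[OF t(2)] t 0 by simp
    next
      case (Suc j)
      have "t - 1 = int n * m + int j" using t Suc by simp
      then have "z (t - 1) = Q powi m * vprod q j" using z_block[of j m] t(2) Suc by simp
      moreover have "cyc n q t = q k" using t by (simp add: cyc_def divmod_block)
      ultimately show ?thesis using z_block[OF t(2), of m] t(1) Suc by (simp add: vprod_Suc mult_ac)
    qed
  qed
  have "frak_q n q t = z t" for t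
  proof (induction t rule: int_induct[of _ 0])
    case base
    show ?case by (simp add: frak_q_0 z_def)
  next
    case (step1 i)
    then show ?case using rec[of "i + 1"] frak_q_rec[of q n "i + 1"] q by simp
  next
    case (step2 i)
    have "cyc n q i \<noteq> 0" using q by (simp add: cyc_def)
    then show ?case using step2 rec[of i] frak_q_rec[of q n i] q by simp
  qed
  then show ?thesis using z_block[OF k] by (simp add: Q_def)
qed

lemma frak_q_subdegree:
  fixes q :: "nat \<Rightarrow> 'a::field fls"
  assumes q: "\<And>i. q i \<noteq> 0" "\<And>i. fls_subdegree (q i) = 1"
  shows "frak_q n q t \<noteq> 0" "fls_subdegree (frak_q n q t) = t"
proof -
  have "frak_q n q t \<noteq> 0 \<and> fls_subdegree (frak_q n q t) = t"
  proof (induction t rule: int_induct[of _ 0])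
    case base
    show ?case by (simp add: frak_q_0)
  next
    case (step1 i)
    then show ?case using frak_q_rec[of q n "i + 1"] q by (simp add: cyc_def)
  next
    case (step2 i)
    have c: "cyc n q i \<noteq> 0" "fls_subdegree (cyc n q i) = 1" using q by (simp_all add: cyc_def)
    have e: "frak_q n q i = cyc n q i * frak_q n q (i - 1)" using frak_q_rec[of q n i] q by simp
    then have "frak_q n q (i - 1) \<noteq> 0" using step2 by auto
    then show ?case using c e step2 by simp
  qed
  then show "frak_q n q t \<noteq> 0" "fls_subdegree (frak_q n q t) = t" by blast+
qed

lemma le_div_int_iff:
  assumes "1 \<le> n"
  shows "m \<le> a div int n \<longleftrightarrow> int n * m \<le> a"
proof
  assume "m \<le> a div int n"
  then have "int n * m \<le> int n * (a div int n)" by (intro mult_left_mono) auto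
  also have "\<dots> \<le> a" using assms mult_div_mod_eq[of "int n" a] pos_mod_sign[of "int n" a] by linarith
  finally show "int n * m \<le> a" .
next
  assume le: "int n * m \<le> a"
  show "m \<le> a div int n"
  proof (rule ccontr)
    assume "\<not> ?thesis"
    then have "int n * (a div int n + 1) \<le> int n * m" by (intro mult_left_mono) auto
    moreover have "a < int n * (a div int n + 1)"
    proof -
      have "a mod int n < int n" using assms by simp
      then show ?thesis using mult_div_mod_eq[of "int n" a] unfolding distrib_left by linarith
    qed
    ultimately show False using le by linarith
  qed
qed

text \<open>The part of the cutoff \<open>[-N, N]\<close> that residue \<open>k\<close> sees, in the coordinate of the quotient.\<close>

definition window :: "nat \<Rightarrow> nat \<Rightarrow> nat \<Rightarrow> int set" where
  "window n N k = {m. int n * m + int k \<in> {- int N..int N}}"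

lemma window_eq:
  assumes "1 \<le> n"
  shows "window n N k = {- ((int N + int k) div int n)..(int N - int k) div int n}"
proof -
  have "- ((int N + int k) div int n) \<le> m \<longleftrightarrow> - m \<le> (int N + int k) div int n" for m by linarith
  then show ?thesis by (auto simp: window_def le_div_int_iff[OF assms])
qed

lemma window_bounds:
  assumes "1 \<le> n"
  shows "\<forall>\<^sub>F N in sequentially. - ((int N + int k) div int n) \<le> - int L"
    "filterlim (\<lambda>N. (int N - int k) div int n) at_top sequentially"
    "filterlim (\<lambda>N. (int N + int k) div int n) at_top sequentially"
proof -
  have "- ((int N + int k) div int n) \<le> - int L" if "n * L \<le> N" for N
  proof -
    have "int n * int L \<le> int N" using that by (metis of_nat_le_iff of_nat_mult)
    then show ?thesis using le_div_int_iff[OF assms, of "int L" "int N + int k"] by simp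
  qed
  then show "\<forall>\<^sub>F N in sequentially. - ((int N + int k) div int n) \<le> - int L"
    unfolding eventually_sequentially by blast
  show "filterlim (\<lambda>N. (int N - int k) div int n) at_top sequentially"
    unfolding filterlim_at_top eventually_sequentially
  proof
    fix Z :: int
    show "\<exists>N0. \<forall>N\<ge>N0. Z \<le> (int N - int k) div int n"
      by (intro exI[of _ "nat (int n * Z + int k)"]) (auto simp: le_div_int_iff[OF assms] nat_le_iff)
  qed
  show "filterlim (\<lambda>N. (int N + int k) div int n) at_top sequentially"
    unfolding filterlim_at_top eventually_sequentially
  proof
    fix Z :: int
    show "\<exists>N0. \<forall>N\<ge>N0. Z \<le> (int N + int k) div int n"
      by (intro exI[of _ "nat (int n * Z)"]) (auto simp: le_div_int_iff[OF assms] nat_le_iff)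
  qed
qed

lemma finite_window: "1 \<le> n \<Longrightarrow> finite (window n N k)"
  by (simp add: window_eq)

lemma window_superset:
  assumes "1 \<le> n" "k < n"
  shows "{- int (N div n)..<int (N div n)} \<subseteq> window n N k"
proof
  fix m assume m: "m \<in> {- int (N div n)..<int (N div n)}"
  have le: "int n * int (N div n) \<le> int N" by (metis of_nat_le_iff of_nat_mult times_div_less_eq_dividend)
  have "int n * (- int (N div n)) \<le> int n * m" using m by (intro mult_left_mono) auto
  moreover have "int n * (m + 1) \<le> int n * int (N div n)" using m by (intro mult_left_mono) auto
  ultimately show "m \<in> window n N k" using assms le by (simp add: window_def distrib_left)
qed

lemma finite_block:
  assumes "1 \<le> n" "finite T"
  shows "finite {m. int n * m + int k \<in> T}"
proof -
  have "inj (\<lambda>m. int n * m + int k)" using assms by (auto intro: injI)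
  from finite_vimageI[OF assms(2) this] show ?thesis by (simp add: vimage_def)
qed

lemma prod_blocks:
  assumes "1 \<le> n" "finite T"
  shows "prod f T = (\<Prod>k<n. \<Prod>m\<in>{m. int n * m + int k \<in> T}. f (int n * m + int k))"
proof -
  have "(\<Prod>k<n. \<Prod>m\<in>{m. int n * m + int k \<in> T}. f (int n * m + int k)) =
        (\<Prod>(k, m)\<in>Sigma {..<n} (\<lambda>k. {m. int n * m + int k \<in> T}). f (int n * m + int k))"
    using finite_block[OF assms] by (intro prod.Sigma) auto
  also have "\<dots> = prod f T"
    by (rule prod.reindex_bij_witness[of _ "\<lambda>t. (nat (t mod int n), t div int n)" "\<lambda>(k, m). int n * m + int k"])
       (use assms in \<open>auto simp: divmod_block nat_less_iff\<close>)
  finally show ?thesis ..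
qed

text \<open>The creation operators of the blocks \<open>0, \<dots>, k - 1\<close> from left to right, and, as transposed matrices, the
annihilation operators of these blocks.\<close>

primrec blocks :: "(nat \<Rightarrow> partition \<Rightarrow> partition \<Rightarrow> 'a) \<Rightarrow> nat \<Rightarrow> partition \<Rightarrow> partition \<Rightarrow> 'a::comm_ring_1" where
  "blocks M 0 = idm"
| "blocks M (Suc k) = mmul (blocks M k) (M k)"

primrec blocksR :: "(nat \<Rightarrow> partition \<Rightarrow> partition \<Rightarrow> 'a) \<Rightarrow> nat \<Rightarrow> partition \<Rightarrow> partition \<Rightarrow> 'a::comm_ring_1" where
  "blocksR M 0 = idm"
| "blocksR M (Suc k) = mmul (M k) (blocksR M k)"

lemma unitri_blocks: "(\<And>k. k < n \<Longrightarrow> unitri (M k)) \<Longrightarrow> unitri (blocks M n)"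
  by (induction n) (auto intro: unitri_mmul)

lemma unitri_blocksR: "(\<And>k. k < n \<Longrightarrow> unitri (M k)) \<Longrightarrow> unitri (blocksR M n)"
  by (induction n) (auto intro: unitri_mmul)

lemma mconv_blocks:
  fixes M :: "nat \<Rightarrow> partition \<Rightarrow> partition \<Rightarrow> 'a::comm_ring_1 fls"
  shows "(\<And>k. k < n \<Longrightarrow> mconv (\<lambda>N. X N k) (M k)) \<Longrightarrow> mconv (\<lambda>N. blocks (X N) n) (blocks M n)"
  by (induction n) (auto intro: mconv_mmul)

lemma mconv_blocksR:
  fixes M :: "nat \<Rightarrow> partition \<Rightarrow> partition \<Rightarrow> 'a::comm_ring_1 fls"
  shows "(\<And>k. k < n \<Longrightarrow> mconv (\<lambda>N. X N k) (M k)) \<Longrightarrow> mconv (\<lambda>N. blocksR (X N) n) (blocksR M n)"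
  by (induction n) (auto intro: mconv_mmul)

lemma Hset_blocks:
  assumes "1 \<le> n" "finite T"
  shows "Hset y T = blocks (\<lambda>k. Hset (\<lambda>m. y (int n * m + int k)) {m. int n * m + int k \<in> T}) n"
    "Hset y T = blocksR (\<lambda>k. Hset (\<lambda>m. y (int n * m + int k)) {m. int n * m + int k \<in> T}) n"
proof -
  let ?M = "\<lambda>k. Hset (\<lambda>m. y (int n * m + int k)) {m. int n * m + int k \<in> T}"
  have *: "Hset y {t\<in>T. t mod int n < int K} = blocks ?M K \<and> Hset y {t\<in>T. t mod int n < int K} = blocksR ?M K"
    if "K \<le> n" for K
    using that
  proof (induction K)
    case 0
    have "{t\<in>T. t mod int n < int 0} = {}" using assms by (auto simp: not_less)
    then show ?case by (simp only: Hset_empty blocks.simps blocksR.simps)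
  next
    case (Suc K)
    let ?A = "{t\<in>T. t mod int n < int K}" and ?B = "(\<lambda>m. int n * m + int K) ` {m. int n * m + int K \<in> T}"
    have "t \<in> ?B" if "t \<in> T" "t mod int n = int K" for t
    proof (rule image_eqI)
      show "t = int n * (t div int n) + int K" using that(2) mult_div_mod_eq[of "int n" t] by simp
      then show "t div int n \<in> {m. int n * m + int K \<in> T}" using that by simp
    qed
    then have "{t\<in>T. t mod int n = int K} = ?B"
      using Suc.prems by (auto simp: divmod_block)
    moreover have "{t\<in>T. t mod int n < int (Suc K)} = ?A \<union> {t\<in>T. t mod int n = int K}" by auto
    ultimately have "{t\<in>T. t mod int n < int (Suc K)} = ?A \<union> ?B" by (simp only:)
    moreover have "?A \<inter> ?B = {}" using Suc.prems by (auto simp: divmod_block)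
    moreover have "Hset y ?B = ?M K"
      using assms finite_block[OF assms] by (intro Hset_image) (auto intro: inj_onI)
    moreover have "finite ?A" "finite ?B" using assms finite_block[OF assms] by auto
    ultimately have e: "Hset y {t\<in>T. t mod int n < int (Suc K)} = mmul (Hset y ?A) (?M K)"
      "Hset y {t\<in>T. t mod int n < int (Suc K)} = mmul (?M K) (Hset y ?A)"
      using Hset_Un[of ?A ?B y] Hset_Un[of ?B ?A y] by (simp_all add: Un_commute Int_commute)
    have conj: "Hset y ?A = blocks ?M K \<and> Hset y ?A = blocksR ?M K"
      by (rule Suc.IH) (use Suc.prems in simp)
    note IH = conjunct1[OF conj, symmetric] conjunct2[OF conj, symmetric]
    show ?case unfolding blocks.simps blocksR.simps IH using e by (rule conjI)
  qed
  have "{t\<in>T. t mod int n < int n} = T" using assms by auto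
  then show "Hset y T = blocks ?M n" "Hset y T = blocksR ?M n" using *[of n] by auto
qed

lemma slope_set_quotient:
  assumes "is_quotient n \<rho> l" "k < n"
  shows "int n * m + int k \<in> slope_set \<rho> \<longleftrightarrow> m \<in> slope_set (l k)"
proof -
  have "slope \<rho> (int n * m + int k) = slope (l k) m"
    using assms(1)[unfolded is_quotient_def, rule_format, of "int n * m + int k"] assms(2)
    by (simp add: divmod_block)
  then show ?thesis by (auto simp: slope_def split: if_splits)
qed

lemma is_quotient_empty: "1 \<le> n \<Longrightarrow> is_quotient n empty_partition (\<lambda>_. empty_partition)"
proof -
  assume n: "1 \<le> n"
  have "(t - t mod int n) div int n = t div int n" for t
    using n by (simp add: minus_mod_eq_mult_div)
  moreover have "t < 0 \<longleftrightarrow> t div int n < 0" for t using le_div_int_iff[OF n, of 0 t] by simp linarith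
  ultimately show ?thesis by (simp add: is_quotient_def slope_def slope_set_empty)
qed

lemma is_quotient_1: "is_quotient 1 \<rho> (\<lambda>_. \<rho>)"
  by (simp add: is_quotient_def)

text \<open>The inverse of the ordering factor of a particle in block \<open>k\<close> and a hole in block \<open>k'\<close> that is \<open>d\<close> further in the
coordinate of the quotient.  It is \<open>1\<close> if the hole is not to the right of the particle.\<close>

definition pair_factor :: "'a::field \<Rightarrow> (nat \<Rightarrow> 'a) \<Rightarrow> nat \<Rightarrow> nat \<Rightarrow> nat \<Rightarrow> int \<Rightarrow> 'a" where
  "pair_factor Q v n k k' d = (if 0 < int n * d + int k' - int k then 1 - Q powi d * (v k' / v k) else 1)"

lemma ordering_factor_eq:
  assumes "sorted_wrt (<) ts"
  shows "ordering_factor \<rho> y ts = (\<Prod>t\<in>set ts \<inter> slope_set \<rho>. \<Prod>t'\<in>set ts - slope_set \<rho>.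
      if t < t' then inverse (1 - y t' / y t) else 1)"
  using assms
proof (induction ts)
  case (Cons t ts)
  let ?g = "\<lambda>t t'. if t < t' then inverse (1 - y t' / y t) else 1"
  have dist: "distinct (t # ts)" using Cons.prems by (metis strict_sorted_iff)
  have lt: "\<And>s. s \<in> set ts \<Longrightarrow> t < s" using Cons.prems by simp
  have IH: "ordering_factor \<rho> y ts = (\<Prod>s\<in>set ts \<inter> slope_set \<rho>. \<Prod>t'\<in>set ts - slope_set \<rho>. ?g s t')"
    using Cons by simp
  show ?case
  proof (cases "t \<in> slope_set \<rho>")
    case True
    have "(\<Prod>t'\<leftarrow>hole_list \<rho> ts. inverse (1 - y t' / y t)) = (\<Prod>t'\<in>set ts - slope_set \<rho>. ?g t t')"
    proof -
      have "(\<Prod>t'\<leftarrow>hole_list \<rho> ts. inverse (1 - y t' / y t)) = (\<Prod>t'\<in>set (hole_list \<rho> ts). inverse (1 - y t' / y t))"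
        using dist by (intro prod.distinct_set_conv_list[symmetric]) (simp add: hole_list_def)
      also have "\<dots> = (\<Prod>t'\<in>set ts - slope_set \<rho>. ?g t t')"
        by (rule prod.cong) (auto simp: hole_list_def lt)
      finally show ?thesis .
    qed
    moreover have "set (t # ts) \<inter> slope_set \<rho> = insert t (set ts \<inter> slope_set \<rho>)"
      "set (t # ts) - slope_set \<rho> = set ts - slope_set \<rho>" using True by auto
    moreover have "t \<notin> set ts \<inter> slope_set \<rho>" using dist by simp
    ultimately show ?thesis using True IH by simp
  next
    case False
    have "(\<Prod>t'\<in>insert t (set ts - slope_set \<rho>). ?g s t') = (\<Prod>t'\<in>set ts - slope_set \<rho>. ?g s t')"
      if "s \<in> set ts" for s
      using that lt[of s] dist by (subst prod.insert) auto
    moreover have "set (t # ts) \<inter> slope_set \<rho> = set ts \<inter> slope_set \<rho>"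
      "set (t # ts) - slope_set \<rho> = insert t (set ts - slope_set \<rho>)" using False by auto
    ultimately show ?thesis using False IH by simp
  qed
qed simp

text \<open>Units congruent to one form a group, hence products of many of them stay close to one.\<close>

lemma near_1_prod:
  fixes f :: "'i \<Rightarrow> 'a::comm_ring_1 fls"
  assumes "\<And>i. i \<in> I \<Longrightarrow> ord_ge d (f i - 1)" "0 \<le> d"
  shows "ord_ge d (prod f I - 1)"
  using assms by (induction I rule: infinite_finite_induct) (auto intro: near_1_mult)

text \<open>The matrix element that is left after normal ordering, with its \<open>n\<close> blocks of operators.\<close>

definition matel :: "'a::field \<Rightarrow> (nat \<Rightarrow> 'a) \<Rightarrow> nat \<Rightarrow> nat \<Rightarrow> (nat \<Rightarrow> int set) \<Rightarrow> partition \<Rightarrow> partition \<Rightarrow> 'a" where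
  "matel Q v n L S \<sigma> \<tau> = (\<Sum>\<mu> | psize \<mu> \<le> psize \<sigma>.
     blocks (\<lambda>k. scal (v k) (creation_block Q L (- S k))) n \<sigma> \<mu> *
     blocksR (\<lambda>k. scal (inverse (v k)) (creation_block Q L (uminus ` S k))) n \<tau> \<mu>)"

lemma matel_empty: "matel Q v n L S empty_partition empty_partition = 1"
proof -
  have "{\<mu>. psize \<mu> \<le> psize empty_partition} = {empty_partition}" by auto
  then show ?thesis unfolding matel_def
    by (simp add: unitri_diag unitri_blocks unitri_blocksR)
qed

definition pair_product_factor :: "'a::field \<Rightarrow> (nat \<Rightarrow> 'a) \<Rightarrow> nat \<Rightarrow> nat \<Rightarrow> (nat \<Rightarrow> int set) \<Rightarrow> 'a" where
  "pair_product_factor Q v n L S = (\<Prod>k<n. \<Prod>k'<n. \<Prod>d\<in>{- 2 * int L..2 * int L}.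
     pair_factor Q v n k k' d ^ dcount (S k) (S k') d)"

context
  fixes q :: "nat \<Rightarrow> 'a::field fls" and n :: nat
  assumes n: "1 \<le> n" and q0: "\<And>i. q i \<noteq> 0" and q1: "\<And>i. fls_subdegree (q i) = 1"
begin

abbreviation (input) "Q \<equiv> (\<Prod>k<n. q k)"
abbreviation (input) "v \<equiv> vprod q"
abbreviation (input) "y \<equiv> frak_q n q"

lemma Q_nonzero: "Q \<noteq> 0" using q0 by simp

lemma y_quot:
  assumes "k < n" "k' < n"
  shows "y (int n * m' + int k') / y (int n * m + int k) = Q powi (m' - m) * (v k' / v k)"
  unfolding frak_q_block[OF n q0 assms(1)] frak_q_block[OF n q0 assms(2)]
  by (simp add: power_int_diff[OF disjI1[OF Q_nonzero]])

lemma Q_ord: "ord_ge 1 Q"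
proof -
  have "Q = y (int n)" using frak_q_block[OF n q0, where k = 0 and m = 1] n by simp
  then show ?thesis using frak_q_subdegree[OF q0 q1, where n = n and t = "int n"] n by (simp add: ord_ge_iff)
qed

lemma y_quot_ord: "ord_ge (t' - t) (y t' / y t)"
  using frak_q_subdegree[OF q0 q1] by (simp add: ord_ge_iff fls_divide_subdegree)

lemma pair_factor_ord:
  assumes "k < n" "k' < n"
  shows "pair_factor Q v n k k' d \<noteq> 0" "1 \<le> d \<Longrightarrow> ord_ge d (pair_factor Q v n k k' d - 1)"
proof -
  let ?e = "int n * d + int k' - int k"
  have e: "ord_ge ?e (Q powi d * (v k' / v k))"
    using y_quot_ord[of "int n * d + int k'" "int n * 0 + int k"] y_quot[OF assms, of d 0] by simp
  show "pair_factor Q v n k k' d \<noteq> 0"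
    using one_minus_ord(1)[OF ord_ge_mono[OF e, of 1]] by (auto simp: pair_factor_def)
  show "ord_ge d (pair_factor Q v n k k' d - 1)" if "1 \<le> d"
  proof -
    have "0 \<le> (int n - 1) * (d - 1)" using that n by simp
    then have "d \<le> ?e" using assms by (simp add: algebra_simps)
    then have "ord_ge d (Q powi d * (v k' / v k))" using e ord_ge_mono by blast
    then show ?thesis using ord_ge_minus[of d "Q powi d * (v k' / v k)"] by (simp add: pair_factor_def)
  qed
qed

lemma ordering_factor_blocks:
  assumes "is_quotient n \<rho> l"
  shows "ordering_factor \<rho> y [- int N..int N] = inverse (\<Prod>k<n. \<Prod>k'<n.
     gap_prod (pair_factor Q v n k k') (window n N k \<inter> slope_set (l k)) (window n N k' - slope_set (l k')))"
proof -
  let ?T = "{- int N..int N}"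
  let ?g = "\<lambda>t t'. if t < t' then inverse (1 - y t' / y t) else 1"
  have "ordering_factor \<rho> y [- int N..int N] = (\<Prod>t\<in>?T \<inter> slope_set \<rho>. \<Prod>t'\<in>?T - slope_set \<rho>. ?g t t')"
    by (subst ordering_factor_eq) auto
  also have "\<dots> = (\<Prod>k<n. \<Prod>m\<in>{m. int n * m + int k \<in> ?T \<inter> slope_set \<rho>}.
      \<Prod>k'<n. \<Prod>m'\<in>{m. int n * m + int k' \<in> ?T - slope_set \<rho>}. ?g (int n * m + int k) (int n * m' + int k'))"
    by (subst prod_blocks[OF n], simp, subst prod_blocks[OF n], simp, simp)
  also have "\<dots> = (\<Prod>k<n. \<Prod>m\<in>window n N k \<inter> slope_set (l k).
      \<Prod>k'<n. \<Prod>m'\<in>window n N k' - slope_set (l k'). inverse (pair_factor Q v n k k' (m' - m)))"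
  proof (intro prod.cong)
    fix k k' m m' assume *: "k \<in> {..<n}" "k' \<in> {..<n}"
    show "{m. int n * m + int k \<in> ?T \<inter> slope_set \<rho>} = window n N k \<inter> slope_set (l k)"
      using * slope_set_quotient[OF assms] by (auto simp: window_def)
    show "{m. int n * m + int k' \<in> ?T - slope_set \<rho>} = window n N k' - slope_set (l k')"
      using * slope_set_quotient[OF assms] by (auto simp: window_def)
    show "?g (int n * m + int k) (int n * m' + int k') = inverse (pair_factor Q v n k k' (m' - m))"
      using * y_quot[of k k' m' m] by (simp add: pair_factor_def right_diff_distrib)
  qed simp_all
  also have "\<dots> = (\<Prod>k<n. \<Prod>k'<n. inverse (gap_prod (pair_factor Q v n k k') (window n N k \<inter> slope_set (l k)) (window n N k' - slope_set (l k'))))"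
    unfolding gap_prod_def by (subst prod.swap) (simp add: prod_inversef[unfolded comp_def, symmetric])
  finally show ?thesis by (simp add: prod_inversef[unfolded comp_def, symmetric])
qed

text \<open>For the empty partition all pairs of a particle and a hole are in normal-ordering position.  At distance \<open>d\<close>
the factor is congruent to one to order \<open>d\<close>, which gives convergence to a unit.\<close>

lemma empty_factor_limit:
  obtains Z where "(\<lambda>N. ordering_factor empty_partition y [- int N..int N]) \<longlonglongrightarrow> Z" "Z \<noteq> 0"
proof -
  \<comment> \<open>The pairs of a particle and a hole inside the cutoff.\<close>
  define X where "X N = {- int N..<0} \<times> {0..int N}" for N
  define g where "g = (\<lambda>(t, t'). inverse (1 - y t' / y t))"
  have g: "ord_ge (t' - t) (g (t, t') - 1)" if "t < t'" for t t'
  proof -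
    have "ord_ge (t' - t) ((1 - y t' / y t) - 1)"
      using y_quot_ord[of t' t] ord_ge_minus[of "t' - t" "y t' / y t"] by simp
    then show ?thesis unfolding g_def using near_1_inverse that by fastforce
  qed
  have eq: "ordering_factor empty_partition y [- int N..int N] = prod g (X N)" for N
  proof -
    have "ordering_factor empty_partition y [- int N..int N] =
       (\<Prod>t\<in>{- int N..<0}. \<Prod>t'\<in>{0..int N}. if t < t' then inverse (1 - y t' / y t) else 1)"
      by (subst ordering_factor_eq) (auto simp: slope_set_empty intro!: prod.cong)
    also have "\<dots> = (\<Prod>t\<in>{- int N..<0}. \<Prod>t'\<in>{0..int N}. inverse (1 - y t' / y t))"
      by (intro prod.cong) auto
    finally show ?thesis by (simp add: X_def g_def prod.cartesian_product)
  qed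
  have near: "ord_ge 1 (prod g (X N) - 1)" for N
  proof (rule near_1_prod)
    fix i assume "i \<in> X N"
    then obtain t t' where i: "i = (t, t')" "t < 0" "0 \<le> t'" by (auto simp: X_def)
    then show "ord_ge 1 (g i - 1)" using g[of t t'] ord_ge_mono[of "t' - t" _ 1] by simp
  qed simp
  have step: "ord_ge (int N) (prod g (X (Suc N)) - prod g (X N))" for N
  proof -
    have sub: "X N \<subseteq> X (Suc N)" by (auto simp: X_def)
    have "prod g (X (Suc N)) = prod g (X (Suc N) - X N) * prod g (X N)"
      by (rule prod.subset_diff[OF sub]) (simp add: X_def)
    then have "prod g (X (Suc N)) - prod g (X N) = (prod g (X (Suc N) - X N) - 1) * prod g (X N)"
      by (simp add: left_diff_distrib)
    moreover have "ord_ge (int N) (prod g (X (Suc N) - X N) - 1)"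
    proof (rule near_1_prod)
      fix i assume i: "i \<in> X (Suc N) - X N"
      obtain t t' where [simp]: "i = (t, t')" by force
      have "t < t'" "int N \<le> t' - t" using i by (auto simp: X_def)
      then show "ord_ge (int N) (g i - 1)" using g[of t t'] ord_ge_mono by auto
    qed simp
    moreover have "ord_ge 0 (prod g (X N))"
      using near[of N] near_1_subdegree[of "prod g (X N)"] by (simp add: ord_ge_iff)
    ultimately show ?thesis by (simp only:) (rule ord_ge_mult_le[of "int N" _ 0]; simp)
  qed
  obtain Z where Z: "(\<lambda>N. prod g (X N)) \<longlonglongrightarrow> Z"
  proof (rule fls_convergentI)
    fix d
    show "\<exists>N. \<forall>n\<ge>N. ord_ge d (prod g (X (Suc n)) - prod g (X n))"
      by (intro exI[of _ "nat d"] allI impI ord_ge_mono[OF step]) simp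
  qed
  have "ord_ge 1 (Z - 1)"
    by (rule ord_ge_limit[of "\<lambda>N. prod g (X N) - 1"]) (use Z near in \<open>auto intro!: tendsto_intros\<close>)
  then have "Z \<noteq> 0" using near_1_subdegree(2) by blast
  then show ?thesis using Z eq that by simp
qed

lemma mconv_holes:
  assumes l: "is_quotient n \<rho> l" and L: "\<And>k. k < n \<Longrightarrow> cofin_above L (- slope_set (l k))"
  shows "mconv (\<lambda>N. Hl (map y (hole_list \<rho> [- int N..int N])))
    (blocks (\<lambda>k. scal (v k) (creation_block Q L (- slope_set (l k)))) n)"
proof -
  let ?T = "\<lambda>N. {- int N..int N} - slope_set \<rho>"
  have 1: "Hl (map y (hole_list \<rho> [- int N..int N])) = blocks (\<lambda>k. Hset (\<lambda>m. y (int n * m + int k)) {m. int n * m + int k \<in> ?T N}) n" for N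
  proof -
    have "Hl (map y (hole_list \<rho> [- int N..int N])) = Hset y (set (hole_list \<rho> [- int N..int N]))"
      by (rule Hl_eq_Hset) (simp add: hole_list_def)
    also have "set (hole_list \<rho> [- int N..int N]) = ?T N" by (auto simp: hole_list_def)
    finally show ?thesis using Hset_blocks(1)[OF n, of "?T N" y] by simp
  qed
  have 2: "Hset (\<lambda>m. y (int n * m + int k)) {m. int n * m + int k \<in> ?T N} =
     scal (v k) (Hset (\<lambda>m. Q powi m) (- slope_set (l k) \<inter> {- ((int N + int k) div int n)..(int N - int k) div int n}))"
    if k: "k < n" for N k
  proof -
    have "{m. int n * m + int k \<in> ?T N} = - slope_set (l k) \<inter> window n N k"
      using slope_set_quotient[OF l k] by (auto simp: window_def)
    then show ?thesis
      unfolding scal_Hset window_eq[OF n] frak_q_block[OF n q0 k] by (simp add: mult.commute)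
  qed
  have "mconv (\<lambda>N. blocks (\<lambda>k. Hset (\<lambda>m. y (int n * m + int k)) {m. int n * m + int k \<in> ?T N}) n)
    (blocks (\<lambda>k. scal (v k) (creation_block Q L (- slope_set (l k)))) n)"
  proof (rule mconv_blocks)
    fix k assume k: "k < n"
    show "mconv (\<lambda>N. Hset (\<lambda>m. y (int n * m + int k)) {m. int n * m + int k \<in> ?T N})
      (scal (v k) (creation_block Q L (- slope_set (l k))))"
      unfolding 2[OF k] by (intro mconv_scal mconv_creation_block Q_nonzero Q_ord L k window_bounds[OF n])
  qed
  then show ?thesis by (simp only: 1)
qed

lemma mconv_particles:
  assumes l: "is_quotient n \<rho> l" and L: "\<And>k. k < n \<Longrightarrow> cofin_above L (uminus ` slope_set (l k))"
  shows "mconv (\<lambda>N. Hl (map (\<lambda>t. inverse (y t)) (particle_list \<rho> [- int N..int N])))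
    (blocksR (\<lambda>k. scal (inverse (v k)) (creation_block Q L (uminus ` slope_set (l k)))) n)"
proof -
  let ?T = "\<lambda>N. {- int N..int N} \<inter> slope_set \<rho>"
  have 1: "Hl (map (\<lambda>t. inverse (y t)) (particle_list \<rho> [- int N..int N])) =
    blocksR (\<lambda>k. Hset (\<lambda>m. inverse (y (int n * m + int k))) {m. int n * m + int k \<in> ?T N}) n" for N
  proof -
    have "Hl (map (\<lambda>t. inverse (y t)) (particle_list \<rho> [- int N..int N])) =
        Hset (\<lambda>t. inverse (y t)) (set (particle_list \<rho> [- int N..int N]))"
      by (rule Hl_eq_Hset) (simp add: particle_list_def)
    also have "set (particle_list \<rho> [- int N..int N]) = ?T N" by (auto simp: particle_list_def)
    finally show ?thesis using Hset_blocks(2)[OF n, of "?T N" "\<lambda>t. inverse (y t)"] by simp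
  qed
  have 2: "Hset (\<lambda>m. inverse (y (int n * m + int k))) {m. int n * m + int k \<in> ?T N} =
     scal (inverse (v k)) (Hset (\<lambda>m. Q powi m) (uminus ` slope_set (l k) \<inter> {- ((int N - int k) div int n)..(int N + int k) div int n}))"
    if k: "k < n" for N k
  proof -
    let ?W = "{m. int n * m + int k \<in> ?T N}"
    have W: "?W = slope_set (l k) \<inter> window n N k"
      using slope_set_quotient[OF l k] by (auto simp: window_def)
    have "uminus ` ?W = uminus ` slope_set (l k) \<inter> {- ((int N - int k) div int n)..(int N + int k) div int n}"
      unfolding W window_eq[OF n] by (auto simp: image_iff)
    then have "Hset (\<lambda>m. Q powi m) (uminus ` slope_set (l k) \<inter> {- ((int N - int k) div int n)..(int N + int k) div int n}) =
      Hset (\<lambda>m. Q powi m) (uminus ` ?W)" by simp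
    also have "\<dots> = Hset (\<lambda>m. Q powi (- m)) ?W"
    proof (rule Hset_image)
      show "finite ?W" unfolding W by (simp add: finite_window[OF n])
    qed (simp add: inj_on_def)
    finally have "scal (inverse (v k)) (Hset (\<lambda>m. Q powi m) (uminus ` slope_set (l k) \<inter> {- ((int N - int k) div int n)..(int N + int k) div int n})) =
      scal (inverse (v k)) (Hset (\<lambda>m. Q powi (- m)) ?W)" by (simp only:)
    also have "\<dots> = Hset (\<lambda>m. inverse (v k) * Q powi (- m)) ?W" by (rule scal_Hset)
    also have "\<dots> = Hset (\<lambda>m. inverse (y (int n * m + int k))) ?W"
      unfolding frak_q_block[OF n q0 k]
      by (rule arg_cong[of _ _ "\<lambda>f. Hset f ?W"], rule ext) (simp add: power_int_minus mult.commute)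
    finally show ?thesis ..
  qed
  have "mconv (\<lambda>N. blocksR (\<lambda>k. Hset (\<lambda>m. inverse (y (int n * m + int k))) {m. int n * m + int k \<in> ?T N}) n)
    (blocksR (\<lambda>k. scal (inverse (v k)) (creation_block Q L (uminus ` slope_set (l k)))) n)"
  proof (rule mconv_blocksR)
    fix k assume k: "k < n"
    have "\<forall>\<^sub>F N in sequentially. int L \<le> (int N - int k) div int n"
      using window_bounds(2)[OF n] by (simp add: filterlim_at_top)
    then have "\<forall>\<^sub>F N in sequentially. - ((int N - int k) div int n) \<le> - int L"
      by eventually_elim simp
    then show "mconv (\<lambda>N. Hset (\<lambda>m. inverse (y (int n * m + int k))) {m. int n * m + int k \<in> ?T N})
      (scal (inverse (v k)) (creation_block Q L (uminus ` slope_set (l k))))"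
      unfolding 2[OF k] by (intro mconv_scal mconv_creation_block Q_nonzero Q_ord L k window_bounds[OF n])
  qed
  then show ?thesis by (simp only: 1)
qed

text \<open>The comparison of \<open>pair_product\<close>, applied to each pair of blocks with a growing cutoff.\<close>

lemma ordering_factor_limit:
  assumes l: "is_quotient n \<rho> l" and L: "\<And>k. k < n \<Longrightarrow> slope_like L (slope_set (l k))"
    and Z: "(\<lambda>N. ordering_factor empty_partition y [- int N..int N]) \<longlonglongrightarrow> Z"
  shows "(\<lambda>N. ordering_factor \<rho> y [- int N..int N]) \<longlonglongrightarrow> Z * inverse (pair_product_factor Q v n L (\<lambda>k. slope_set (l k)))"
proof -
  define S where "S k = slope_set (l k)" for k
  define W where "W = window n"
  define G where "G = pair_product_factor Q v n L S"
  have G0: "G \<noteq> 0" using pair_factor_ord(1) by (auto simp: G_def pair_product_factor_def)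
  have ex: "\<exists>u. ord_ge (int (N div n) - int L) (u - 1) \<and>
      ordering_factor \<rho> y [- int N..int N] = ordering_factor empty_partition y [- int N..int N] * u * inverse G"
    if N: "n * (3 * L + 1) \<le> N" for N
  proof -
    define d where "d = int (N div n) - int L"
    have M: "3 * L + 1 \<le> N div n" using N n by (simp add: less_eq_div_iff_mult_less_eq mult.commute)
    then have d1: "1 \<le> d" by (simp add: d_def)
    let ?f = "\<lambda>k k'. pair_factor Q v n k k'"
    \<comment> \<open>Up to a unit that is close to one, the pairs of the blocks \<open>k\<close> and \<open>k'\<close> differ from those of the empty
      configuration by the factors with \<open>\<bar>e\<bar> \<le> 2 * L\<close>.\<close>
    define compares where "compares k k' r0 r1 \<longleftrightarrow> ord_ge d (r0 - 1) \<and> ord_ge d (r1 - 1) \<and>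
       gap_prod (?f k k') (W N k \<inter> S k) (W N k' - S k') * r0 =
        (\<Prod>e\<in>{- 2 * int L..2 * int L}. ?f k k' e ^ dcount (S k) (S k') e) * gap_prod (?f k k') (W N k \<inter> {..<0}) (W N k' - {..<0}) * r1" for k k' r0 r1
    have "\<exists>r0 r1. compares k k' r0 r1"
      if k: "k < n" "k' < n" for k k'
    proof -
      have near: "ord_ge d (?f k k' e - 1)" if "int (N div n) - int L < e" for e
      proof (rule ord_ge_mono[of e])
        show "ord_ge e (?f k k' e - 1)"
          by (rule pair_factor_ord(2)[OF k]) (use that d1 in \<open>simp add: d_def\<close>)
      qed (use that in \<open>simp add: d_def\<close>)
      show ?thesis unfolding compares_def
      proof (rule pair_product[of L "S k" "S k'" "W N k" "W N k'" "N div n" "\<lambda>x. ord_ge d (x - 1)" "?f k k'"])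
        show "slope_like L (S k)" "slope_like L (S k')" by (simp_all add: S_def L k)
        show "finite (W N k)" "finite (W N k')" by (simp_all add: W_def finite_window[OF n])
        show "{- int (N div n)..<int (N div n)} \<subseteq> W N k" "{- int (N div n)..<int (N div n)} \<subseteq> W N k'"
          unfolding W_def by (rule window_superset[OF n k(1)], rule window_superset[OF n k(2)])
        show "3 * L \<le> N div n" using M by simp
        show "ord_ge d (x * y - 1)" if "ord_ge d (x - 1)" "ord_ge d (y - 1)" for x y :: "'a fls"
          using near_1_mult[OF that] d1 by simp
        show "ord_ge d (?f k k' e - 1)" if "int (N div n) - int L < e" for e using near[OF that] .
      qed (simp, blast)
    qed
    then obtain r0 r1 where "\<And>k k'. k < n \<Longrightarrow> k' < n \<Longrightarrow> compares k k' (r0 k k') (r1 k k')"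
      by metis
    note r = this[unfolded compares_def]
    define R0 where "R0 = (\<Prod>k<n. \<Prod>k'<n. r0 k k')"
    define R1 where "R1 = (\<Prod>k<n. \<Prod>k'<n. r1 k k')"
    define A where "A = (\<Prod>k<n. \<Prod>k'<n. gap_prod (?f k k') (W N k \<inter> S k) (W N k' - S k'))"
    define A0 where "A0 = (\<Prod>k<n. \<Prod>k'<n. gap_prod (?f k k') (W N k \<inter> {..<0}) (W N k' - {..<0}))"
    have R: "ord_ge d (R0 - 1)" "ord_ge d (R1 - 1)"
      unfolding R0_def R1_def using r d1 by (auto intro!: near_1_prod)
    have R': "R0 \<noteq> 0" "R1 \<noteq> 0"
      using near_1_subdegree(2)[OF ord_ge_mono[OF R(1) d1]] near_1_subdegree(2)[OF ord_ge_mono[OF R(2) d1]] by simp_all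
    have eq: "A * R0 = G * A0 * R1"
      unfolding A_def R0_def R1_def A0_def G_def pair_product_factor_def prod.distrib[symmetric]
      using r by (intro prod.cong refl) auto
    have A: "A \<noteq> 0" "A0 \<noteq> 0"
      using pair_factor_ord(1) by (auto simp: A_def A0_def gap_prod_def W_def finite_window[OF n])
    have oA: "ordering_factor \<rho> y [- int N..int N] = inverse A"
      unfolding A_def W_def S_def by (rule ordering_factor_blocks[OF l])
    have oA0: "ordering_factor empty_partition y [- int N..int N] = inverse A0"
      using ordering_factor_blocks[OF is_quotient_empty[OF n], of N]
      by (simp add: A0_def W_def slope_set_empty)
    have "inverse A = inverse A0 * (R0 * inverse R1) * inverse G"
      using eq A R' G0 by (simp add: field_simps)
    moreover have "ord_ge d (R0 * inverse R1 - 1)"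
      using R d1 by (intro near_1_mult near_1_inverse) auto
    ultimately show ?thesis unfolding oA oA0 d_def by blast
  qed
  define u where "u N = (SOME u. ord_ge (int (N div n) - int L) (u - 1) \<and>
      ordering_factor \<rho> y [- int N..int N] = ordering_factor empty_partition y [- int N..int N] * u * inverse G)" for N
  have u: "ord_ge (int (N div n) - int L) (u N - 1)"
    "ordering_factor \<rho> y [- int N..int N] = ordering_factor empty_partition y [- int N..int N] * u N * inverse G"
    if "n * (3 * L + 1) \<le> N" for N
    using someI_ex[OF ex[OF that]] unfolding u_def by auto
  have "u \<longlonglongrightarrow> 1"
    unfolding fls_tendsto_iff eventually_sequentially
  proof (intro allI exI impI)
    fix d N assume N: "max (n * (3 * L + 1)) (n * (nat d + L)) \<le> N"
    then have "nat d + L \<le> N div n" using n by (simp add: less_eq_div_iff_mult_less_eq mult.commute)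
    then show "ord_ge d (u N - 1)" using N by (intro ord_ge_mono[OF u(1)]) auto
  qed
  then have "(\<lambda>N. ordering_factor empty_partition y [- int N..int N] * u N * inverse G) \<longlonglongrightarrow> Z * 1 * inverse G"
    using Z by (intro tendsto_intros)
  then have "(\<lambda>N. ordering_factor empty_partition y [- int N..int N] * u N * inverse G) \<longlonglongrightarrow> Z * inverse G" by simp
  then show ?thesis unfolding G_def[unfolded S_def, symmetric]
  proof (rule Lim_transform_eventually)
    show "\<forall>\<^sub>F N in sequentially. ordering_factor empty_partition y [- int N..int N] * u N * inverse G = ordering_factor \<rho> y [- int N..int N]"
      unfolding eventually_sequentially using u(2) by metis
  qed
qed

lemma V_limit:
  assumes l: "is_quotient n \<rho> l" and L: "\<And>k. k < n \<Longrightarrow> slope_like L (slope_set (l k))"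
    "\<And>k. k < n \<Longrightarrow> cofin_above L (- slope_set (l k))" "\<And>k. k < n \<Longrightarrow> cofin_above L (uminus ` slope_set (l k))"
    and Z: "(\<lambda>N. ordering_factor empty_partition y [- int N..int N]) \<longlonglongrightarrow> Z"
  shows "V n q \<rho>p \<rho>m \<rho> = q 0 powi (- int (psize \<rho>p)) *
    (Z * inverse (pair_product_factor Q v n L (\<lambda>k. slope_set (l k))) * matel Q v n L (\<lambda>k. slope_set (l k)) (conj_partition \<rho>m) \<rho>p)"
proof -
  have sorted: "sorted_wrt (<) [- int N..int N]" for N by (simp add: sorted_wrt_upto)
  have "(\<lambda>N. foldr (\<lambda>t. Gamma (slope \<rho> t) (y t powi (- slope \<rho> t))) [- int N..int N]
      (basis_vector \<rho>p) (conj_partition \<rho>m)) \<longlonglongrightarrow>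
    Z * inverse (pair_product_factor Q v n L (\<lambda>k. slope_set (l k))) * matel Q v n L (\<lambda>k. slope_set (l k)) (conj_partition \<rho>m) \<rho>p"
    unfolding normal_ordering[OF frak_q_subdegree[OF q0 q1] sorted] matel_def
    by (intro tendsto_mult tendsto_sum ordering_factor_limit l L Z mconvD[OF mconv_holes] mconvD[OF mconv_particles])
  then show ?thesis unfolding V_def by (simp only: limI)
qed

text \<open>The limit of \<open>ordering_factor\<close> for the empty partition appears in numerator and denominator.\<close>

theorem P_formula:
  assumes l: "is_quotient n \<rho> l" and L: "\<And>k. k < n \<Longrightarrow> slope_like L (slope_set (l k))"
    "\<And>k. k < n \<Longrightarrow> cofin_above L (- slope_set (l k))" "\<And>k. k < n \<Longrightarrow> cofin_above L (uminus ` slope_set (l k))"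
  shows "P n q \<rho>p \<rho>m \<rho> = q 0 powi (- int (psize \<rho>p)) *
    inverse (pair_product_factor Q v n L (\<lambda>k. slope_set (l k))) * matel Q v n L (\<lambda>k. slope_set (l k)) (conj_partition \<rho>m) \<rho>p"
proof -
  obtain Z where Z: "(\<lambda>N. ordering_factor empty_partition y [- int N..int N]) \<longlonglongrightarrow> Z" "Z \<noteq> 0"
    by (rule empty_factor_limit)
  have V: "V n q \<rho>p \<rho>m \<rho> = q 0 powi (- int (psize \<rho>p)) *
    (Z * inverse (pair_product_factor Q v n L (\<lambda>k. slope_set (l k))) * matel Q v n L (\<lambda>k. slope_set (l k)) (conj_partition \<rho>m) \<rho>p)"
    by (rule V_limit[OF l L Z(1)])
  have "V n q empty_partition empty_partition empty_partition = q 0 powi (- int (psize empty_partition)) *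
    (Z * inverse (pair_product_factor Q v n (Suc 0) (\<lambda>k. slope_set empty_partition)) *
      matel Q v n (Suc 0) (\<lambda>k. slope_set empty_partition) (conj_partition empty_partition) empty_partition)"
    by (rule V_limit[OF is_quotient_empty[OF n] _ _ _ Z(1)])
       (simp_all only: slope_set_empty slope_like_empty cofin_above_slope_like[OF slope_like_empty])
  also have "pair_product_factor Q v n (Suc 0) (\<lambda>k. slope_set empty_partition) = 1"
    by (simp add: pair_product_factor_def slope_set_empty dcount_empty)
  finally have "V n q empty_partition empty_partition empty_partition = Z"
    by (simp add: matel_empty)
  then show ?thesis unfolding P_def V using Z(2) by simp
qed

end

hide_const (open) Q v y

section \<open>Field homomorphisms\<close>

text \<open>Matrix elements are built by field operations, so that an embedding of fields transports them
from the coefficient field, in which the vertices $P^1$ live, to the field of series in all variables.\<close>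

definition field_hom :: "('a::field \<Rightarrow> 'b::field) \<Rightarrow> bool" where
  "field_hom h \<longleftrightarrow> (\<forall>a b. h (a + b) = h a + h b) \<and> (\<forall>a b. h (a * b) = h a * h b) \<and> h 1 = 1"

lemma field_hom_simps:
  assumes "field_hom h"
  shows "h (a + b) = h a + h b" "h (a * b) = h a * h b" "h 1 = 1" "h 0 = 0" "h (- a) = - h a"
    "h (a - b) = h a - h b" "h (inverse a) = inverse (h a)" "h (a / b) = h a / h b" "h (a ^ i) = h a ^ i"
    "h (a powi j) = h a powi j"
proof -
  show add: "h (a + b) = h a + h b" and mult: "h (a * b) = h a * h b" and one: "h 1 = 1" for a b
    using assms by (auto simp: field_hom_def)
  show zero: "h 0 = 0" using add[of 0 0] by (simp only: add_0_right add_cancel_right_right)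
  show minus: "h (- a) = - h a" for a using add[of a "- a"] zero by (simp add: eq_neg_iff_add_eq_0 add.commute)
  show "h (a - b) = h a - h b" using add[of a "- b"] minus by simp
  show inv: "h (inverse a) = inverse (h a)" for a
  proof (cases "a = 0")
    case False
    then have "h a * h (inverse a) = 1" using mult[of a "inverse a"] one by simp
    then show ?thesis by (metis inverse_unique)
  qed (simp add: zero)
  show "h (a / b) = h a / h b" by (simp add: divide_inverse mult inv)
  show pow: "h (a ^ i) = h a ^ i" for a i by (induction i) (simp_all add: mult one)
  show "h (a powi j) = h a powi j" by (simp add: power_int_def pow inv)
qed

lemma field_hom_sum:
  assumes h: "field_hom h"
  shows "h (sum f I) = (\<Sum>i\<in>I. h (f i))"
  by (induction I rule: infinite_finite_induct) (simp_all add: field_hom_simps[OF h])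

lemma field_hom_prod:
  assumes h: "field_hom h"
  shows "h (prod f I) = (\<Prod>i\<in>I. h (f i))"
  by (induction I rule: infinite_finite_induct) (simp_all add: field_hom_simps[OF h])

lemma field_hom_mmul:
  assumes h: "field_hom h"
  shows "h (mmul A B \<sigma> \<tau>) = mmul (\<lambda>\<sigma> \<tau>. h (A \<sigma> \<tau>)) (\<lambda>\<sigma> \<tau>. h (B \<sigma> \<tau>)) \<sigma> \<tau>"
  by (simp add: mmul_def field_hom_sum[OF h] field_hom_simps[OF h])

lemma field_hom_idm:
  assumes h: "field_hom h"
  shows "h (idm \<sigma> \<tau>) = idm \<sigma> \<tau>"
  by (simp add: idm_def field_hom_simps[OF h])

lemma field_hom_Hs:
  assumes h: "field_hom h"
  shows "h (Hs x \<sigma> \<tau>) = Hs (h x) \<sigma> \<tau>"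
  by (simp add: Hs_def field_hom_simps[OF h])

lemma field_hom_Hl:
  assumes h: "field_hom h"
  shows "h (Hl xs \<sigma> \<tau>) = Hl (map h xs) \<sigma> \<tau>"
  by (induction xs arbitrary: \<sigma> \<tau>) (simp_all add: field_hom_idm[OF h] field_hom_mmul[OF h] field_hom_Hs[OF h])

lemma field_hom_Hset:
  assumes h: "field_hom h"
  shows "h (Hset f H \<sigma> \<tau>) = Hset (\<lambda>m. h (f m)) H \<sigma> \<tau>"
  by (simp add: Hset_def field_hom_Hl[OF h] comp_def)

lemma field_hom_scal:
  assumes h: "field_hom h"
  shows "h (scal s A \<sigma> \<tau>) = scal (h s) (\<lambda>\<sigma> \<tau>. h (A \<sigma> \<tau>)) \<sigma> \<tau>"
  by (simp add: scal_def field_hom_simps[OF h])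

lemma field_hom_hgeo:
  assumes "field_hom h"
  shows "h (hgeo Q \<sigma> \<tau>) = hgeo (h Q) \<sigma> \<tau>"
proof (induction "psize \<sigma>" arbitrary: \<sigma> rule: less_induct)
  case less
  then have "h (\<Sum>\<kappa>\<in>{\<kappa>. psize \<kappa> < psize \<sigma>}. Hs 1 \<sigma> \<kappa> * (Q ^ (psize \<kappa> - psize \<tau>) * hgeo Q \<kappa> \<tau>)) =
     (\<Sum>\<kappa>\<in>{\<kappa>. psize \<kappa> < psize \<sigma>}. Hs 1 \<sigma> \<kappa> * (h Q ^ (psize \<kappa> - psize \<tau>) * hgeo (h Q) \<kappa> \<tau>))"
    by (simp add: field_hom_sum[OF assms] field_hom_simps[OF assms] field_hom_Hs[OF assms])
  then show ?case
    by (subst (1 2) hgeo.simps) (simp add: field_hom_simps[OF assms])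
qed

lemma field_hom_creation_block:
  assumes h: "field_hom h"
  shows "h (creation_block Q L H \<sigma> \<tau>) = creation_block (h Q) L H \<sigma> \<tau>"
  by (simp add: creation_block_def field_hom_mmul[OF h] field_hom_Hset[OF h] field_hom_scal[OF h] field_hom_hgeo[OF h] field_hom_simps[OF h])

lemma field_hom_comm_rel:
  assumes h: "field_hom h" and rel: "comm_rel B A c"
  shows "comm_rel (\<lambda>\<sigma> \<tau>. h (B \<sigma> \<tau>)) (\<lambda>\<sigma> \<tau>. h (A \<sigma> \<tau>)) (Abs_fps (\<lambda>i. h (fps_nth c i)))"
  unfolding comm_rel_def
proof (intro allI)
  fix \<sigma> \<tau> N
  have ic: "icoeff (Abs_fps (\<lambda>i. h (fps_nth c i))) k = h (icoeff c k)" for k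
    by (simp add: icoeff_def field_hom_simps[OF h])
  have "(\<Sum>\<kappa> | psize \<kappa> = N. h (B \<kappa> \<sigma>) * h (A \<kappa> \<tau>)) = h (\<Sum>\<kappa> | psize \<kappa> = N. B \<kappa> \<sigma> * A \<kappa> \<tau>)"
    by (simp add: field_hom_sum[OF h] field_hom_simps[OF h])
  also have "\<dots> = (\<Sum>\<mu> | psize \<mu> \<le> psize \<sigma>.
      icoeff (Abs_fps (\<lambda>i. h (fps_nth c i))) (int (psize \<mu>) + int N - int (psize \<sigma>) - int (psize \<tau>)) * h (A \<sigma> \<mu>) * h (B \<tau> \<mu>))"
    by (simp add: comm_relD[OF rel] field_hom_sum[OF h] field_hom_simps[OF h] ic)
  finally show "(\<Sum>\<kappa> | psize \<kappa> = N. h (B \<kappa> \<sigma>) * h (A \<kappa> \<tau>)) = (\<Sum>\<mu> | psize \<mu> \<le> psize \<sigma>.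
      icoeff (Abs_fps (\<lambda>i. h (fps_nth c i))) (int (psize \<mu>) + int N - int (psize \<sigma>) - int (psize \<tau>)) * h (A \<sigma> \<mu>) * h (B \<tau> \<mu>))" .
qed

lemma field_hom_fps_mult:
  assumes "field_hom h"
  shows "Abs_fps (\<lambda>i. h (fps_nth (a * b) i)) = Abs_fps (\<lambda>i. h (fps_nth a i)) * Abs_fps (\<lambda>i. h (fps_nth b i))"
  by (rule fps_ext) (simp add: fps_mult_nth field_hom_sum[OF assms] field_hom_simps[OF assms])

section \<open>Commutation for infinitely many arguments\<close>

text \<open>Coefficientwise convergence of the scalars in a commutation relation.\<close>

definition fconv :: "(nat \<Rightarrow> 'a fps) \<Rightarrow> 'a::topological_space fps \<Rightarrow> bool" where
  "fconv X c \<longleftrightarrow> (\<forall>i. (\<lambda>N. fps_nth (X N) i) \<longlonglongrightarrow> fps_nth c i)"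

lemma fconv_mult:
  fixes X Y :: "nat \<Rightarrow> 'a::comm_ring_1 fls fps"
  shows "fconv X c \<Longrightarrow> fconv Y d \<Longrightarrow> fconv (\<lambda>N. X N * Y N) (c * d)"
  unfolding fconv_def fps_mult_nth by (auto intro!: tendsto_sum tendsto_mult)

lemma fconv_unique:
  fixes c d :: "'a::t2_space fps"
  shows "fconv X c \<Longrightarrow> fconv X d \<Longrightarrow> c = d"
  unfolding fconv_def by (rule fps_ext) (use LIMSEQ_unique in blast)

lemma fconv_const: "fconv (\<lambda>_. c) c"
  by (simp add: fconv_def)

lemma comm_rel_nth:
  assumes "unitri A" "unitri B" "comm_rel B A c"
  shows "fps_nth c i = (\<Sum>\<kappa> | psize \<kappa> = i. B \<kappa> empty_partition * A \<kappa> empty_partition)"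
proof -
  have "{\<mu>. psize \<mu> \<le> 0} = {empty_partition}" by auto
  then show ?thesis
    by (simp add: comm_relD[OF assms(3)] icoeff_def unitri_diag[OF assms(1)] unitri_diag[OF assms(2)])
qed

text \<open>Each coefficient of a commutation relation is an identity of finite sums, and the scalar can be read off the entries at
the empty partition (\<open>comm_rel_nth\<close>); both therefore pass to the limit.\<close>

lemma comm_rel_limit:
  fixes A B :: "partition \<Rightarrow> partition \<Rightarrow> 'a::comm_ring_1 fls"
  assumes un: "\<And>N. unitri (X N)" "\<And>N. unitri (Y N)"
    and conv: "mconv X A" "mconv Y B" and rel: "\<And>N. comm_rel (Y N) (X N) (c N)"
  obtains C where "comm_rel B A C" "fconv c C"
proof -
  define C where "C = Abs_fps (\<lambda>i. \<Sum>\<kappa> | psize \<kappa> = i. B \<kappa> empty_partition * A \<kappa> empty_partition)"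
  have C: "fconv c C"
    unfolding fconv_def C_def comm_rel_nth[OF un rel]
    by (auto intro!: tendsto_sum tendsto_mult mconvD[OF conv(1)] mconvD[OF conv(2)])
  have ic: "(\<lambda>N. icoeff (c N) k) \<longlonglongrightarrow> icoeff C k" for k
    using C by (simp add: icoeff_def fconv_def)
  have "comm_rel B A C"
    unfolding comm_rel_def
  proof (intro allI)
    fix \<sigma> \<tau> M
    have "(\<lambda>N. \<Sum>\<kappa> | psize \<kappa> = M. Y N \<kappa> \<sigma> * X N \<kappa> \<tau>) \<longlonglongrightarrow> (\<Sum>\<kappa> | psize \<kappa> = M. B \<kappa> \<sigma> * A \<kappa> \<tau>)"
      by (intro tendsto_sum tendsto_mult mconvD[OF conv(1)] mconvD[OF conv(2)])
    moreover have "(\<lambda>N. \<Sum>\<kappa> | psize \<kappa> = M. Y N \<kappa> \<sigma> * X N \<kappa> \<tau>) \<longlonglongrightarrow>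
       (\<Sum>\<mu> | psize \<mu> \<le> psize \<sigma>. icoeff C (int (psize \<mu>) + int M - int (psize \<sigma>) - int (psize \<tau>)) * A \<sigma> \<mu> * B \<tau> \<mu>)"
      unfolding comm_relD[OF rel]
      by (intro tendsto_sum tendsto_mult ic mconvD[OF conv(1)] mconvD[OF conv(2)])
    ultimately show "(\<Sum>\<kappa> | psize \<kappa> = M. B \<kappa> \<sigma> * A \<kappa> \<tau>) =
       (\<Sum>\<mu> | psize \<mu> \<le> psize \<sigma>. icoeff C (int (psize \<mu>) + int M - int (psize \<sigma>) - int (psize \<tau>)) * A \<sigma> \<mu> * B \<tau> \<mu>)"
      by (rule LIMSEQ_unique)
  qed
  then show ?thesis using C that by blast
qed

text \<open>The series $1 - a z$.\<close>

definition lin :: "'a::comm_ring_1 \<Rightarrow> 'a fps" where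
  "lin a = 1 - fps_const a * fps_X"

lemma geo_lin: "geo a * lin a = 1"
  by (simp add: lin_def geo_mult)

lemma comm_rel_Hset:
  fixes Q :: "'a::field"
  assumes "Q \<noteq> 0" "finite I" "finite J"
  shows "comm_rel (Hset (\<lambda>m. Q powi m) (uminus ` I)) (Hset (\<lambda>m. Q powi m) J) (gap_prod (\<lambda>d. geo (Q powi d)) I J)"
proof -
  have eq: "Hset (\<lambda>m. Q powi m) (uminus ` I) = Hl (map (\<lambda>m. Q powi (- m)) (sorted_list_of_set I))"
    using Hset_image[OF assms(2), of uminus "\<lambda>m. Q powi m"] by (simp add: inj_on_def Hset_def)
  have "comm_rel (Hset (\<lambda>m. Q powi m) (uminus ` I)) (Hset (\<lambda>m. Q powi m) J)
    (\<Prod>x\<leftarrow>map (\<lambda>m. Q powi (- m)) (sorted_list_of_set I). \<Prod>y\<leftarrow>map (\<lambda>m. Q powi m) (sorted_list_of_set J). geo (x * y))"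
    unfolding eq unfolding Hset_def by (rule comm_rel_Hl)
  also have "(\<Prod>x\<leftarrow>map (\<lambda>m. Q powi (- m)) (sorted_list_of_set I). \<Prod>y\<leftarrow>map (\<lambda>m. Q powi m) (sorted_list_of_set J). geo (x * y)) =
     (\<Prod>m\<leftarrow>sorted_list_of_set I. \<Prod>m'\<leftarrow>sorted_list_of_set J. geo (Q powi (m' - m)))"
    using assms(1) by (simp add: comp_def power_int_diff power_int_minus field_simps)
  also have "\<dots> = gap_prod (\<lambda>d. geo (Q powi d)) I J"
    using assms(2,3) by (simp add: gap_prod_def prod.distinct_set_conv_list[symmetric])
  finally show ?thesis .
qed

lemma near_1_fps_mult:
  fixes x y :: "'a::comm_ring_1 fls fps"
  assumes "\<forall>i. ord_ge D (fps_nth (x - 1) i)" "\<forall>i. ord_ge D (fps_nth (y - 1) i)" "0 \<le> D"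
  shows "\<forall>i. ord_ge D (fps_nth (x * y - 1) i)"
proof
  fix i
  have "x * y - 1 = (x - 1) * (y - 1) + (x - 1) + (y - 1)" by (simp add: algebra_simps)
  then have "fps_nth (x * y - 1) i = fps_nth ((x - 1) * (y - 1)) i + fps_nth (x - 1) i + fps_nth (y - 1) i"
    by (metis fps_add_nth)
  moreover have "ord_ge D (fps_nth ((x - 1) * (y - 1)) i)"
    unfolding fps_mult_nth
  proof (rule ord_ge_sum)
    fix j
    show "ord_ge D (fps_nth (x - 1) j * fps_nth (y - 1) (i - j))"
      by (rule ord_ge_mult_le[OF spec[OF assms(1)] spec[OF assms(2)]]) (use assms(3) in simp)
  qed
  ultimately show "ord_ge D (fps_nth (x * y - 1) i)"
    using assms(1,2) ord_ge_add by metis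
qed

lemma fconv_1I:
  fixes r :: "nat \<Rightarrow> 'a::comm_ring_1 fls fps"
  assumes "\<And>N i. ord_ge (int N) (fps_nth (r N - 1) i)"
  shows "fconv r 1"
  unfolding fconv_def fls_tendsto_iff eventually_sequentially
proof (intro allI exI impI)
  fix i d N assume "nat d \<le> N"
  then have "ord_ge d (fps_nth (r N - 1) i)" by (intro ord_ge_mono[OF assms]) simp
  then show "ord_ge d (fps_nth (r N) i - fps_nth 1 i)" by simp
qed

text \<open>The commutation scalar of two infinite blocks has infinitely many factors.  Only its quotient by the scalar of the
empty configurations is computed: it is the inverse of a finite product of linear factors, by
\<open>pair_product\<close>.\<close>

lemma comm_rel_creation_block:
  fixes Q :: "'a::field fls"
  assumes Q: "Q \<noteq> 0" "ord_ge 1 Q"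
    and sl: "slope_like L S" "slope_like L S'"
    and co: "cofin_above L (uminus ` S)" "cofin_above L (- S')"
  obtains c where "comm_rel (creation_block Q L (uminus ` S)) (creation_block Q L (- S')) c"
    "\<And>c0. comm_rel (creation_block Q L (uminus ` {..<0})) (creation_block Q L (- {..<0})) c0 \<Longrightarrow> cofin_above L (uminus ` {..<0}) \<Longrightarrow>
      cofin_above L (- {..<0}) \<Longrightarrow> (\<Prod>d\<in>{- 2 * int L..2 * int L}. lin (Q powi d) ^ dcount S S' d) * c = c0"
proof -
  let ?h = "Hset (\<lambda>m. Q powi m)"
  define M where "M N = N + 3 * L" for N
  define W where "W N = {- int (M N)..int (M N)}" for N
  define cf where "cf S S' N = gap_prod (\<lambda>d. geo (Q powi d)) (W N \<inter> S) (W N - S')" for S S' N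
  have lim: "filterlim (\<lambda>N. int (M N)) at_top sequentially"
    unfolding filterlim_at_top eventually_sequentially
  proof
    fix Z :: int show "\<exists>N0. \<forall>N\<ge>N0. Z \<le> int (M N)"
      by (intro exI[of _ "nat Z"]) (auto simp: M_def)
  qed
  have ev: "\<forall>\<^sub>F N in sequentially. - int (M N) \<le> - int L" by (simp add: M_def)
  have conv: "mconv (\<lambda>N. ?h (H \<inter> W N)) (creation_block Q L H)" if "cofin_above L H" for H
    unfolding W_def by (rule mconv_creation_block[OF Q that ev lim])
  have img: "uminus ` S \<inter> W N = uminus ` (W N \<inter> S)" for S N
    by (auto simp: W_def image_iff)
  have relf: "comm_rel (?h (uminus ` S \<inter> W N)) (?h (- S' \<inter> W N)) (cf S S' N)" for S S' N
  proof -
    have "- S' \<inter> W N = W N - S'" by auto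
    then show ?thesis unfolding img cf_def by (simp only:) (rule comm_rel_Hset[OF Q(1)]; simp add: W_def)
  qed
  obtain c where c: "comm_rel (creation_block Q L (uminus ` S)) (creation_block Q L (- S')) c" "fconv (cf S S') c"
    using comm_rel_limit[OF _ _ conv[OF co(2)] conv[OF co(1)] relf] by auto
  have ratio: "(\<Prod>d\<in>{- 2 * int L..2 * int L}. lin (Q powi d) ^ dcount S S' d) * c = c0"
    if c0: "comm_rel (creation_block Q L (uminus ` {..<0})) (creation_block Q L (- {..<0})) c0"
      and co0: "cofin_above L (uminus ` {..<0})" "cofin_above L (- {..<0})" for c0
  proof -
    define R where "R = (\<Prod>d\<in>{- 2 * int L..2 * int L}. lin (Q powi d) ^ dcount S S' d)"
    obtain c0' where c0': "comm_rel (creation_block Q L (uminus ` {..<0})) (creation_block Q L (- {..<0})) c0'" "fconv (cf {..<0} {..<0}) c0'"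
      using comm_rel_limit[OF _ _ conv[OF co0(2)] conv[OF co0(1)] relf] by auto
    have "c0' = c0"
      by (rule fps_ext) (simp only: comm_rel_nth[OF unitri_creation_block unitri_creation_block c0] comm_rel_nth[OF unitri_creation_block unitri_creation_block c0'(1)])
    define near where "near N r \<longleftrightarrow> (\<forall>i. ord_ge (int N) (fps_nth (r - 1) i))" for N and r :: "'a fls fps"
    have "\<exists>r0 r1. near N r0 \<and> near N r1 \<and> cf {..<0} {..<0} N * r0 = R * cf S S' N * r1" for N
    proof -
      let ?f = "\<lambda>d. lin (Q powi d)"
      have near_lin: "near N (?f d)" if "int (M N) - int L < d" for d
        unfolding near_def
      proof
        fix i
        have "ord_ge (int (nat d) * 1) (Q ^ nat d)" by (rule ord_ge_power) (rule Q)
        then have "ord_ge (int N) (Q powi d)" using that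
          by (auto simp: power_int_def M_def intro: ord_ge_mono)
        then show "ord_ge (int N) (fps_nth (?f d - 1) i)"
          by (simp add: lin_def ord_ge_minus)
      qed
      have inv: "cf S S' N * gap_prod ?f (W N \<inter> S) (W N - S') = 1" for S S'
        by (simp add: cf_def gap_prod_def prod.distrib[symmetric] geo_lin)
      show ?thesis
      proof (rule pair_product[of L S S' "W N" "W N" "M N" "near N" ?f])
        show "near N (x * y)" if "near N x" "near N y" for x y
          using near_1_fps_mult[OF that[unfolded near_def]] by (simp add: near_def)
        fix r0 r1 assume r: "near N r0" "near N r1"
          "gap_prod ?f (W N \<inter> S) (W N - S') * r0 = (\<Prod>d\<in>{- 2 * int L..2 * int L}. ?f d ^ dcount S S' d) * gap_prod ?f (W N \<inter> {..<0}) (W N - {..<0}) * r1"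
        define p where "p = gap_prod ?f (W N \<inter> S) (W N - S')"
        define p0 where "p0 = gap_prod ?f (W N \<inter> {..<0}) (W N - {..<0})"
        have r': "p * r0 = R * p0 * r1" using r(3) by (simp only: p_def p0_def R_def)
        have "cf {..<0} {..<0} N * r0 = cf {..<0} {..<0} N * ((cf S S' N * p) * r0)"
          using inv[of S S'] by (simp add: p_def)
        also have "\<dots> = cf {..<0} {..<0} N * cf S S' N * (p * r0)" by (simp only: mult_ac)
        also have "\<dots> = R * cf S S' N * r1 * (cf {..<0} {..<0} N * p0)" by (simp only: r' mult_ac)
        also have "cf {..<0} {..<0} N * p0 = 1" using inv[of "{..<0}" "{..<0}"] by (simp only: p0_def)
        finally show ?thesis using r by auto
      qed (use sl near_lin in \<open>auto simp: W_def M_def near_def\<close>)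
    qed
    then obtain r0 r1 where r: "\<And>N. near N (r0 N) \<and> near N (r1 N) \<and> cf {..<0} {..<0} N * r0 N = R * cf S S' N * r1 N"
      by metis
    have near': "fconv r0 1" "fconv r1 1" using r by (auto intro!: fconv_1I simp: near_def)
    have "fconv (\<lambda>N. cf {..<0} {..<0} N * r0 N) (c0' * 1)" "fconv (\<lambda>N. R * cf S S' N * r1 N) (R * c * 1)"
      by (rule fconv_mult[OF c0'(2) near'(1)], rule fconv_mult[OF fconv_mult[OF fconv_const c(2)] near'(2)])
    then have "c0' * 1 = R * c * 1" using r fconv_unique by auto
    then show ?thesis using \<open>c0' = c0\<close> by (simp add: R_def)
  qed
  show ?thesis using that[OF c(1) ratio] by blast
qed

section \<open>Chains of blocks\<close>

text \<open>The matrix element of a creation operator \<open>A\<close> followed on the right by the annihilation operator whose transpose is \<open>B\<close>.\<close>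

definition block_el :: "(partition \<Rightarrow> partition \<Rightarrow> 'a) \<Rightarrow> (partition \<Rightarrow> partition \<Rightarrow> 'a) \<Rightarrow> partition \<Rightarrow> partition \<Rightarrow> 'a::comm_ring_1" where
  "block_el A B \<sigma> \<tau> = (\<Sum>\<mu> | psize \<mu> \<le> psize \<sigma>. A \<sigma> \<mu> * B \<tau> \<mu>)"

lemma block_el_swap:
  assumes "unitri A" "unitri B"
  shows "block_el A B \<sigma> \<tau> = (\<Sum>\<mu> | psize \<mu> \<le> psize \<tau>. A \<sigma> \<mu> * B \<tau> \<mu>)"
proof (cases "psize \<sigma> \<le> psize \<tau>")
  case True
  then show ?thesis unfolding block_el_def
    by (intro sum_psize_restrict[symmetric]) (simp_all add: unitri_0[OF assms(1)])
next
  case False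
  then show ?thesis unfolding block_el_def
    by (intro sum_psize_restrict) (simp_all add: unitri_0[OF assms(2)])
qed

lemma ord_block_el:
  fixes A B :: "partition \<Rightarrow> partition \<Rightarrow> 'a::comm_ring_1 fls"
  assumes "\<And>\<sigma> \<tau>. ord_ge 0 (A \<sigma> \<tau>)" "\<And>\<sigma> \<tau>. ord_ge 0 (B \<sigma> \<tau>)"
  shows "ord_ge 0 (block_el A B \<sigma> \<tau>)"
  unfolding block_el_def by (rule ord_ge_sum) (rule ord_ge_mult_le[OF assms]; simp)

lemma ord_ge_prod:
  fixes f :: "'i \<Rightarrow> 'a::comm_ring_1 fls"
  assumes "finite I" "\<And>i. i \<in> I \<Longrightarrow> ord_ge (e i) (f i)"
  shows "ord_ge (sum e I) (prod f I)"
  using assms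
proof (induction I rule: finite_induct)
  case (insert i I)
  have "ord_ge (e i + sum e I) (f i * prod f I)"
    by (rule ord_ge_mult) (use insert in auto)
  then show ?case using insert by simp
qed simp

text \<open>One summand of the sum over intermediate partitions: block \<open>k\<close> connects \<open>\<tau> k\<close> with \<open>\<tau> (k + 1)\<close>, where
\<open>\<sigma>\<close> and \<open>\<rho>\<close> take the place of the missing end points.\<close>

definition chain_term :: "(nat \<Rightarrow> partition \<Rightarrow> partition \<Rightarrow> 'a) \<Rightarrow> (nat \<Rightarrow> 'a) \<Rightarrow> nat \<Rightarrow> partition \<Rightarrow> partition \<Rightarrow>
    (nat \<Rightarrow> partition) \<Rightarrow> 'a::comm_ring_1" where
  "chain_term E g K \<sigma> \<rho> \<tau> =
     (\<Prod>k<K. E k (if k = 0 then \<sigma> else \<tau> k) (if k = K - 1 then \<rho> else \<tau> (k + 1))) *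
     (\<Prod>k\<in>{1..<K}. g k ^ psize (\<tau> k))"

lemma chain_term_Suc:
  assumes "1 \<le> K"
  shows "chain_term E g (Suc K) \<sigma> \<rho> (\<tau>(K := \<tau>')) = E K \<tau>' \<rho> * g K ^ psize \<tau>' * chain_term E g K \<sigma> \<tau>' \<tau>"
proof -
  have "(\<Prod>k<K. E k (if k = 0 then \<sigma> else (\<tau>(K := \<tau>')) k) (if k = Suc K - 1 then \<rho> else (\<tau>(K := \<tau>')) (k + 1))) =
        (\<Prod>k<K. E k (if k = 0 then \<sigma> else \<tau> k) (if k = K - 1 then \<tau>' else \<tau> (k + 1)))"
    using assms by (intro prod.cong) auto
  moreover have "(\<Prod>k\<in>{1..<Suc K}. g k ^ psize ((\<tau>(K := \<tau>')) k)) = (\<Prod>k\<in>{1..<K}. g k ^ psize (\<tau> k)) * g K ^ psize \<tau>'"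
    using assms by (simp add: prod.atLeastLessThan_Suc)
  ultimately show ?thesis
    using assms unfolding chain_term_def prod.lessThan_Suc by (simp add: mult_ac del: One_nat_def)
qed

lemma chain_term_summable:
  fixes E :: "nat \<Rightarrow> partition \<Rightarrow> partition \<Rightarrow> 'a::comm_ring_1 fls"
  assumes E: "\<And>k \<sigma> \<tau>. k < K \<Longrightarrow> ord_ge 0 (E k \<sigma> \<tau>)" and g: "\<And>k. 1 \<le> k \<Longrightarrow> k < K \<Longrightarrow> ord_ge 1 (g k)"
  shows "chain_term E g K \<sigma> \<rho> summable_on PiE {1..<K} (\<lambda>_. UNIV)"
proof (rule fls_summable)
  fix d
  have ord: "ord_ge (\<Sum>k\<in>{1..<K}. int (psize (\<tau> k))) (chain_term E g K \<sigma> \<rho> \<tau>)" for \<tau>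
  proof -
    have "ord_ge (\<Sum>k<K. 0) (\<Prod>k<K. E k (if k = 0 then \<sigma> else \<tau> k) (if k = K - 1 then \<rho> else \<tau> (k + 1)))"
      by (rule ord_ge_prod) (use E in auto)
    moreover have "ord_ge (\<Sum>k\<in>{1..<K}. int (psize (\<tau> k))) (\<Prod>k\<in>{1..<K}. g k ^ psize (\<tau> k))"
    proof (rule ord_ge_prod)
      fix k assume "k \<in> {1..<K}"
      then show "ord_ge (int (psize (\<tau> k))) (g k ^ psize (\<tau> k))"
        using ord_ge_power[OF g[of k], of "psize (\<tau> k)"] by simp
    qed simp
    ultimately show ?thesis unfolding chain_term_def by (intro ord_ge_mult_le[of 0]) auto
  qed
  have "{\<tau> \<in> PiE {1..<K} (\<lambda>_. UNIV). \<not> ord_ge d (chain_term E g K \<sigma> \<rho> \<tau>)} \<subseteq> PiE {1..<K} (\<lambda>_. {\<kappa>. psize \<kappa> \<le> nat d})"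
  proof
    fix \<tau> assume \<tau>: "\<tau> \<in> {\<tau> \<in> PiE {1..<K} (\<lambda>_. UNIV). \<not> ord_ge d (chain_term E g K \<sigma> \<rho> \<tau>)}"
    then have lt: "(\<Sum>k\<in>{1..<K}. int (psize (\<tau> k))) < d" using ord[of \<tau>] ord_ge_mono not_less by blast
    have "psize (\<tau> k) \<le> nat d" if "k \<in> {1..<K}" for k
    proof -
      have "int (psize (\<tau> k)) \<le> (\<Sum>k\<in>{1..<K}. int (psize (\<tau> k)))"
        by (rule member_le_sum) (use that in auto)
      then show ?thesis using lt by simp
    qed
    then show "\<tau> \<in> PiE {1..<K} (\<lambda>_. {\<kappa>. psize \<kappa> \<le> nat d})" using \<tau> by (auto simp: PiE_iff)
  qed
  then show "finite {\<tau> \<in> PiE {1..<K} (\<lambda>_. UNIV). \<not> ord_ge d (chain_term E g K \<sigma> \<rho> \<tau>)}"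
    by (rule finite_subset) (intro finite_PiE, auto)
qed

definition chain_el :: "(nat \<Rightarrow> 'a) \<Rightarrow> (nat \<Rightarrow> partition \<Rightarrow> partition \<Rightarrow> 'a) \<Rightarrow> (nat \<Rightarrow> partition \<Rightarrow> partition \<Rightarrow> 'a) \<Rightarrow>
    nat \<Rightarrow> partition \<Rightarrow> partition \<Rightarrow> 'a::field" where
  "chain_el v a b K = block_el (blocks (\<lambda>k. scal (v k) (a k)) K) (blocksR (\<lambda>k. scal (inverse (v k)) (b k)) K)"

text \<open>Summing over the intermediate partitions of a chain of blocks.  In each step the annihilation operators
collected so far are moved to the right through the creation operators of the next block, at the
cost of a scalar \<open>C K\<close>.  The weights \<open>g k ^ psize (\<tau> k)\<close> accumulate to the conjugations by
\<open>v k\<close>, the product of \<open>g 1, \<dots>, g k\<close>.\<close>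

lemma chain_has_sum:
  fixes a b :: "nat \<Rightarrow> partition \<Rightarrow> partition \<Rightarrow> 'a::field fls"
  assumes v: "v 0 = 1" "\<And>k. v (Suc k) = v k * g (Suc k)" "\<And>k. v k \<noteq> 0" and g: "\<And>k. ord_ge 1 (g k)"
    and un: "\<And>k. unitri (a k)" "\<And>k. unitri (b k)"
    and ord: "\<And>k \<sigma> \<tau>. ord_ge 0 (a k \<sigma> \<tau>)" "\<And>k \<sigma> \<tau>. ord_ge 0 (b k \<sigma> \<tau>)"
    and comm: "\<And>K \<mu> \<nu>. 1 \<le> K \<Longrightarrow> K < n \<Longrightarrow>
      ((\<lambda>\<tau>. blocksR (\<lambda>k. scal (inverse (v k)) (b k)) K \<tau> \<mu> * scal (v K) (a K) \<tau> \<nu>) has_sum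
       C K * (\<Sum>\<pi> | psize \<pi> \<le> psize \<mu>. scal (v K) (a K) \<mu> \<pi> * blocksR (\<lambda>k. scal (inverse (v k)) (b k)) K \<nu> \<pi>)) UNIV"
    and K: "1 \<le> K" "K \<le> n"
  shows "(chain_term (\<lambda>k. block_el (a k) (b k)) g K \<sigma> \<rho> has_sum
      ((\<Prod>k\<in>{1..<K}. C k) * v (K - 1) ^ psize \<rho> * chain_el v a b K \<sigma> \<rho>)) (PiE {1..<K} (\<lambda>_. UNIV))"
  using K
proof (induction K arbitrary: \<rho> rule: nat_induct_at_least)
  case base
  have "chain_term (\<lambda>k. block_el (a k) (b k)) g 1 \<sigma> \<rho> \<tau> = block_el (a 0) (b 0) \<sigma> \<rho>" for \<tau>
    by (simp add: chain_term_def)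
  then show ?case
    by (intro has_sum_finiteI) (simp_all add: chain_el_def v un)
next
  case (Suc K)
  let ?E = "\<lambda>k. block_el (a k) (b k)"
  let ?A = "blocks (\<lambda>k. scal (v k) (a k)) K" and ?B = "blocksR (\<lambda>k. scal (inverse (v k)) (b k)) K"
  let ?a = "scal (v K) (a K)" and ?b = "scal (inverse (v K)) (b K)"
  let ?T = "\<lambda>K. PiE {1..<K} (\<lambda>_. UNIV :: partition set)"
  have unA: "unitri ?A" "unitri ?B" by (auto intro: unitri_blocks unitri_blocksR simp: un)
  define CK where "CK = (\<Prod>k\<in>{1..<K}. C k)"
  define F where "F = (\<lambda>(\<tau>', \<tau>). chain_term ?E g (Suc K) \<sigma> \<rho> (\<tau>(K := \<tau>')))"
  have F: "F (\<tau>', \<tau>) = ?E K \<tau>' \<rho> * g K ^ psize \<tau>' * chain_term ?E g K \<sigma> \<tau>' \<tau>" for \<tau>' \<tau>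
    unfolding F_def using chain_term_Suc[OF Suc.hyps(1)] by simp
  \<comment> \<open>The last partition \<open>\<tau>'\<close> of the chain is split off as the outer summation variable.\<close>
  have transport: "(F has_sum x) (UNIV \<times> ?T K) \<longleftrightarrow> (chain_term ?E g (Suc K) \<sigma> \<rho> has_sum x) (?T (Suc K))" for x
  proof (rule has_sum_reindex_bij_witness[of "UNIV \<times> ?T K" "\<lambda>\<tau>. (\<tau> K, \<tau>(K := undefined))" "\<lambda>p. (snd p)(K := fst p)"])
    fix p :: "partition \<times> (nat \<Rightarrow> partition)" assume "p \<in> UNIV \<times> ?T K"
    then show "(((snd p)(K := fst p)) K, ((snd p)(K := fst p))(K := undefined)) = p"
      "(snd p)(K := fst p) \<in> ?T (Suc K)"
      using Suc.hyps by (auto simp: PiE_iff extensional_def fun_eq_iff)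
    show "chain_term ?E g (Suc K) \<sigma> \<rho> ((snd p)(K := fst p)) = F p"
      by (simp add: F_def split_beta)
  next
    fix \<tau> :: "nat \<Rightarrow> partition" assume "\<tau> \<in> ?T (Suc K)"
    then show "(snd (\<tau> K, \<tau>(K := undefined)))(K := fst (\<tau> K, \<tau>(K := undefined))) = \<tau>"
      "(\<tau> K, \<tau>(K := undefined)) \<in> UNIV \<times> ?T K"
      by (auto simp: PiE_iff extensional_def)
  qed simp
  have "chain_term ?E g (Suc K) \<sigma> \<rho> summable_on ?T (Suc K)"
    by (rule chain_term_summable) (use ord g in \<open>auto intro: ord_block_el\<close>)
  then have summ: "F summable_on UNIV \<times> ?T K" using transport by (auto simp: summable_on_def)
  have inner: "((\<lambda>\<tau>. F (\<tau>', \<tau>)) has_sum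
     (?E K \<tau>' \<rho> * g K ^ psize \<tau>' * (CK * v (K - 1) ^ psize \<tau>' * chain_el v a b K \<sigma> \<tau>'))) (?T K)" for \<tau>'
    unfolding F CK_def using Suc by (intro has_sum_cmult_right) auto
  have vK: "v K = v (K - 1) * g K" using v(2)[of "K - 1"] Suc.hyps by simp
  \<comment> \<open>The outer summand is a finite combination of products of a matrix entry of the collected annihilation operators
    with one of the new creation operators, to which the assumption on commutation applies.\<close>
  have outer_eq: "?E K \<tau>' \<rho> * g K ^ psize \<tau>' * (CK * v (K - 1) ^ psize \<tau>' * chain_el v a b K \<sigma> \<tau>') =
     (\<Sum>\<nu> | psize \<nu> \<le> psize \<rho>. \<Sum>\<mu> | psize \<mu> \<le> psize \<sigma>.
       (CK * v K ^ psize \<rho> * ?b \<rho> \<nu> * ?A \<sigma> \<mu>) * (?B \<tau>' \<mu> * ?a \<tau>' \<nu>))" for \<tau>'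
  proof -
    have e: "v K ^ psize \<tau>' * ?E K \<tau>' \<rho> = (\<Sum>\<nu> | psize \<nu> \<le> psize \<rho>. v K ^ psize \<rho> * ?b \<rho> \<nu> * ?a \<tau>' \<nu>)"
      unfolding block_el_swap[OF un] sum_distrib_left
    proof (rule sum.cong)
      fix \<nu> assume \<nu>: "\<nu> \<in> {\<nu>. psize \<nu> \<le> psize \<rho>}"
      show "v K ^ psize \<tau>' * (a K \<tau>' \<nu> * b K \<rho> \<nu>) = v K ^ psize \<rho> * ?b \<rho> \<nu> * ?a \<tau>' \<nu>"
      proof (cases "psize \<tau>' < psize \<nu>")
        case True
        then show ?thesis by (simp add: unitri_0[OF un(1)] scal_def)
      next
        case False
        have "v K ^ psize \<rho> * inverse (v K) ^ (psize \<rho> - psize \<nu>) * v K ^ (psize \<tau>' - psize \<nu>) =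
            v K ^ psize \<nu> * v K ^ (psize \<tau>' - psize \<nu>)"
          using \<nu> v(3) by (simp add: power_inverse field_simps flip: power_add)
        also have "\<dots> = v K ^ psize \<tau>'" using False by (simp flip: power_add)
        finally show ?thesis by (simp add: scal_def mult_ac)
      qed
    qed simp
    have "?E K \<tau>' \<rho> * g K ^ psize \<tau>' * (CK * v (K - 1) ^ psize \<tau>' * chain_el v a b K \<sigma> \<tau>') =
      CK * ((v K ^ psize \<tau>' * ?E K \<tau>' \<rho>) * chain_el v a b K \<sigma> \<tau>')"
      by (simp add: vK power_mult_distrib mult_ac)
    also have "\<dots> = CK * ((\<Sum>\<nu> | psize \<nu> \<le> psize \<rho>. v K ^ psize \<rho> * ?b \<rho> \<nu> * ?a \<tau>' \<nu>) *
       (\<Sum>\<mu> | psize \<mu> \<le> psize \<sigma>. ?A \<sigma> \<mu> * ?B \<tau>' \<mu>))"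
      unfolding e by (simp only: chain_el_def block_el_def)
    also have "\<dots> = (\<Sum>\<nu> | psize \<nu> \<le> psize \<rho>. \<Sum>\<mu> | psize \<mu> \<le> psize \<sigma>.
       (CK * v K ^ psize \<rho> * ?b \<rho> \<nu> * ?A \<sigma> \<mu>) * (?B \<tau>' \<mu> * ?a \<tau>' \<nu>))"
      by (simp only: sum_product sum_distrib_left mult_ac) (rule sum.swap)
    finally show ?thesis .
  qed
  have "((\<lambda>\<tau>'. \<Sum>\<nu> | psize \<nu> \<le> psize \<rho>. \<Sum>\<mu> | psize \<mu> \<le> psize \<sigma>.
       (CK * v K ^ psize \<rho> * ?b \<rho> \<nu> * ?A \<sigma> \<mu>) * (?B \<tau>' \<mu> * ?a \<tau>' \<nu>)) has_sum
     (\<Sum>\<nu> | psize \<nu> \<le> psize \<rho>. \<Sum>\<mu> | psize \<mu> \<le> psize \<sigma>. (CK * v K ^ psize \<rho> * ?b \<rho> \<nu> * ?A \<sigma> \<mu>) *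
       (C K * (\<Sum>\<pi> | psize \<pi> \<le> psize \<mu>. ?a \<mu> \<pi> * ?B \<nu> \<pi>)))) UNIV"
    using Suc by (intro has_sum_sum has_sum_cmult_right comm) auto
  also have "(\<Sum>\<nu> | psize \<nu> \<le> psize \<rho>. \<Sum>\<mu> | psize \<mu> \<le> psize \<sigma>. (CK * v K ^ psize \<rho> * ?b \<rho> \<nu> * ?A \<sigma> \<mu>) *
       (C K * (\<Sum>\<pi> | psize \<pi> \<le> psize \<mu>. ?a \<mu> \<pi> * ?B \<nu> \<pi>))) =
     (\<Sum>\<nu> | psize \<nu> \<le> psize \<rho>. \<Sum>\<mu> | psize \<mu> \<le> psize \<sigma>. (CK * v K ^ psize \<rho> * ?b \<rho> \<nu> * ?A \<sigma> \<mu>) *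
       (C K * (\<Sum>\<pi> | psize \<pi> \<le> psize \<sigma>. ?a \<mu> \<pi> * ?B \<nu> \<pi>)))"
    by (intro sum.cong refl arg_cong2[of _ _ _ _ "(*)"] sum_psize_restrict[symmetric])
       (auto simp: unitri_0[OF unitri_scal[OF un(1)]])
  also have "\<dots> = CK * C K * v K ^ psize \<rho> * (\<Sum>\<pi> | psize \<pi> \<le> psize \<sigma>.
       (\<Sum>\<mu> | psize \<mu> \<le> psize \<sigma>. ?A \<sigma> \<mu> * ?a \<mu> \<pi>) * (\<Sum>\<nu> | psize \<nu> \<le> psize \<rho>. ?b \<rho> \<nu> * ?B \<nu> \<pi>))"
  proof -
    have "(\<Sum>\<pi> | psize \<pi> \<le> psize \<sigma>.
       (\<Sum>\<mu> | psize \<mu> \<le> psize \<sigma>. ?A \<sigma> \<mu> * ?a \<mu> \<pi>) * (\<Sum>\<nu> | psize \<nu> \<le> psize \<rho>. ?b \<rho> \<nu> * ?B \<nu> \<pi>)) =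
     (\<Sum>\<pi> | psize \<pi> \<le> psize \<sigma>. \<Sum>\<nu> | psize \<nu> \<le> psize \<rho>. \<Sum>\<mu> | psize \<mu> \<le> psize \<sigma>.
        (?A \<sigma> \<mu> * ?a \<mu> \<pi>) * (?b \<rho> \<nu> * ?B \<nu> \<pi>))"
      by (subst sum_product, subst sum.swap) simp
    also have "\<dots> = (\<Sum>\<nu> | psize \<nu> \<le> psize \<rho>. \<Sum>\<mu> | psize \<mu> \<le> psize \<sigma>. \<Sum>\<pi> | psize \<pi> \<le> psize \<sigma>.
        (?A \<sigma> \<mu> * ?a \<mu> \<pi>) * (?b \<rho> \<nu> * ?B \<nu> \<pi>))"
      by (subst sum.swap, rule sum.cong[OF refl], rule sum.swap)
    finally show ?thesis by (simp add: sum_distrib_left mult_ac)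
  qed
  also have "\<dots> = (\<Prod>k\<in>{1..<Suc K}. C k) * v (Suc K - 1) ^ psize \<rho> * chain_el v a b (Suc K) \<sigma> \<rho>"
    using Suc.hyps by (simp add: CK_def chain_el_def block_el_def mmul_def prod.atLeastLessThan_Suc)
  finally have outer: "((\<lambda>\<tau>'. ?E K \<tau>' \<rho> * g K ^ psize \<tau>' * (CK * v (K - 1) ^ psize \<tau>' * chain_el v a b K \<sigma> \<tau>')) has_sum
     ((\<Prod>k\<in>{1..<Suc K}. C k) * v (Suc K - 1) ^ psize \<rho> * chain_el v a b (Suc K) \<sigma> \<rho>)) UNIV"
    unfolding outer_eq .
  have "(F has_sum ((\<Prod>k\<in>{1..<Suc K}. C k) * v (Suc K - 1) ^ psize \<rho> * chain_el v a b (Suc K) \<sigma> \<rho>))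
      (UNIV \<times> ?T K)"
  proof (rule has_sum_SigmaI)
    show "((\<lambda>\<tau>. F (\<tau>', \<tau>)) has_sum
     (?E K \<tau>' \<rho> * g K ^ psize \<tau>' * (CK * v (K - 1) ^ psize \<tau>' * chain_el v a b K \<sigma> \<tau>'))) (?T K)" for \<tau>'
      by (rule inner)
  qed (rule outer, rule summ)
  then show ?case using transport by simp
qed

section \<open>The resolution vertex in closed form\<close>

lemma field_hom_gconst: "field_hom (gconst :: 'c::field \<Rightarrow> 'c gseries)"
  unfolding field_hom_def gconst_def
proof (intro conjI allI)
  fix a b :: 'c
  let ?s = "Poly_Mapping.single (0 :: nat \<Rightarrow>\<^sub>0 nat)"
  have "Fract (?s (a + b)) 1 = Fract (?s a) 1 + Fract (?s b) 1" by (simp add: single_add)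
  then show "fls_const (Fract (?s (a + b)) 1) = fls_const (Fract (?s a) 1) + fls_const (Fract (?s b) 1)"
    by (simp add: fls_plus_const)
  have "Fract (?s (a * b)) 1 = Fract (?s a) 1 * Fract (?s b) 1" by (simp add: mult_single)
  then show "fls_const (Fract (?s (a * b)) 1) = fls_const (Fract (?s a) 1) * fls_const (Fract (?s b) 1)"
    by (simp add: fls_const_mult_const)
  have "Fract (?s (1 :: 'c)) 1 = 1" by (simp add: One_fract_def)
  then show "fls_const (Fract (?s (1 :: 'c)) 1) = 1" by simp
qed

lemma gvar_props:
  fixes i :: nat
  shows "gvar i \<noteq> (0 :: 'c::idom gseries)" "fls_subdegree (gvar i :: 'c gseries) = 1"
proof -
  define c where "c = Fract (Poly_Mapping.single (Poly_Mapping.single i (1::nat)) (1::'c)) 1"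
  have "Poly_Mapping.single (Poly_Mapping.single i (1::nat)) (1::'c) \<noteq> 0"
    by (metis lookup_single_eq lookup_zero zero_neq_one)
  then have "c \<noteq> 0" by (simp add: c_def Zero_fract_def eq_fract)
  then have "fls_const c \<noteq> 0" by simp
  moreover have g: "gvar i = fls_const c * fls_X" by (simp add: gvar_def c_def)
  ultimately show "gvar i \<noteq> (0 :: 'c gseries)" "fls_subdegree (gvar i :: 'c gseries) = 1" by simp_all
qed

lemma ord_gconst: "ord_ge 0 (gconst c)"
  by (simp add: gconst_def ord_ge_def)

lemma vprod_gvar_ord: "vprod gvar k \<noteq> (0 :: 'c::idom gseries)" "fls_subdegree (vprod gvar k :: 'c gseries) = int k"
proof -
  have "vprod gvar k \<noteq> (0 :: 'c gseries) \<and> fls_subdegree (vprod gvar k :: 'c gseries) = int k"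
    by (induction k) (simp_all add: vprod_Suc gvar_props)
  then show "vprod gvar k \<noteq> (0 :: 'c gseries)" "fls_subdegree (vprod gvar k :: 'c gseries) = int k" by blast+
qed

lemma qY_nonzero: "qY \<noteq> 0"
proof -
  have "gconst (inverse fls_X :: rat fls) * qY = 1"
    unfolding qY_def field_hom_simps(2)[OF field_hom_gconst, symmetric] by (simp add: field_hom_simps[OF field_hom_gconst])
  then show ?thesis by auto
qed

lemma creation_block_qY: "creation_block qY L H \<sigma> \<tau> = gconst (creation_block fls_X L H \<sigma> \<tau>)"
  by (simp add: qY_def field_hom_creation_block[OF field_hom_gconst])

lemma ord_creation_block_qY: "ord_ge 0 (creation_block qY L H \<sigma> \<tau>)"
  by (simp add: creation_block_qY ord_gconst)

lemma fps_dilate_1: "fps_dilate s 1 = 1"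
  by (rule fps_ext) (simp add: fps_dilate_def)

lemma fps_dilate_mult: "fps_dilate s (c * d) = fps_dilate s c * fps_dilate s d"
proof (rule fps_ext)
  fix i
  show "fps_nth (fps_dilate s (c * d)) i = fps_nth (fps_dilate s c * fps_dilate s d) i"
    unfolding fps_mult_nth fps_dilate_def fps_nth_Abs_fps sum_distrib_left
  proof (rule sum.cong)
    fix j assume "j \<in> {0..i}"
    then have "s ^ i = s ^ j * s ^ (i - j)" by (simp flip: power_add)
    then show "s ^ i * (fps_nth c j * fps_nth d (i - j)) = s ^ j * fps_nth c j * (s ^ (i - j) * fps_nth d (i - j))"
      by (simp add: mult_ac)
  qed simp
qed

lemma fps_dilate_prod: "fps_dilate s (prod f I) = (\<Prod>i\<in>I. fps_dilate s (f i))"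
  by (induction I rule: infinite_finite_induct) (simp_all add: fps_dilate_1 fps_dilate_mult)

lemma fps_dilate_power: "fps_dilate s (c ^ k) = fps_dilate s c ^ k"
  by (induction k) (simp_all add: fps_dilate_1 fps_dilate_mult)

lemma fps_dilate_lin: "fps_dilate s (lin a) = lin (s * a)"
proof (rule fps_ext)
  fix i show "fps_nth (fps_dilate s (lin a)) i = fps_nth (lin (s * a)) i"
    by (cases i) (simp_all add: fps_dilate_def lin_def fps_X_def)
qed

text \<open>Moving several annihilation blocks through one creation block; conjugating a block dilates its scalar.\<close>

lemma comm_rel_blocksR:
  assumes un: "\<And>k. unitri (b k)" "unitri A" and rel: "\<And>k. k < K \<Longrightarrow> comm_rel (b k) A (c k)"
  shows "comm_rel (blocksR (\<lambda>k. scal (s k) (b k)) K) A (\<Prod>k<K. fps_dilate (s k) (c k))"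
  using rel
proof (induction K)
  case 0
  then show ?case by (simp add: comm_rel_idm_left un)
next
  case (Suc K)
  have "comm_rel (mmul (scal (s K) (b K)) (blocksR (\<lambda>k. scal (s k) (b k)) K)) A
      (fps_dilate (s K) (c K) * (\<Prod>k<K. fps_dilate (s k) (c k)))"
    by (intro comm_rel_mmul_left comm_rel_scal_left unitri_scal unitri_blocksR un Suc) auto
  then show ?case by (simp add: mult.commute)
qed

lemma hom_ord_0I:
  assumes "unitri A" "\<And>\<sigma> \<tau>. ord_ge 0 (A \<sigma> \<tau>)"
  shows "hom_ord 0 A"
  using assms by (simp add: hom_ord_def)

lemma hom_ord_mono:
  fixes A :: "partition \<Rightarrow> partition \<Rightarrow> 'a::comm_ring_1 fls"
  assumes "hom_ord a A" "unitri A" "b \<le> a"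
  shows "hom_ord b A"
  unfolding hom_ord_def
proof (intro allI)
  fix \<sigma> \<tau>
  show "ord_ge (b * (int (psize \<sigma>) - int (psize \<tau>))) (A \<sigma> \<tau>)"
  proof (cases "psize \<sigma> < psize \<tau>")
    case True
    then show ?thesis by (simp add: unitri_0[OF assms(2)])
  next
    case False
    then have "b * (int (psize \<sigma>) - int (psize \<tau>)) \<le> a * (int (psize \<sigma>) - int (psize \<tau>))"
      using assms(3) by (intro mult_right_mono) auto
    then show ?thesis using hom_ordD[OF assms(1)] ord_ge_mono by blast
  qed
qed

lemma hom_ord_blocksR:
  fixes M :: "nat \<Rightarrow> partition \<Rightarrow> partition \<Rightarrow> 'a::comm_ring_1 fls"
  shows "(\<And>k. k < K \<Longrightarrow> hom_ord a (M k)) \<Longrightarrow> hom_ord a (blocksR M K)"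
  by (induction K) (auto intro: hom_ord_idm hom_ord_mmul)

text \<open>The variables \<open>gvar k\<close> have order one, so that the scalars of the conjugated blocks may be evaluated at
$z = 1$ although those of the original blocks in general may not.\<close>

lemma block_commutation:
  fixes a b :: "nat \<Rightarrow> partition \<Rightarrow> partition \<Rightarrow> 'c::field gseries"
  assumes un: "\<And>k. unitri (a k)" "\<And>k. unitri (b k)"
    and ord: "\<And>k \<sigma> \<tau>. ord_ge 0 (a k \<sigma> \<tau>)" "\<And>k \<sigma> \<tau>. ord_ge 0 (b k \<sigma> \<tau>)"
    and rel: "\<And>k. k < K \<Longrightarrow> comm_rel (b k) (a K) (c k)" and K: "1 \<le> K"
  obtains C where "evals_to (fps_dilate (vprod gvar K) (\<Prod>k<K. fps_dilate (inverse (vprod gvar k)) (c k))) C"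
    "C \<noteq> 0"
    "\<And>\<mu> \<nu>. ((\<lambda>\<tau>. blocksR (\<lambda>k. scal (inverse (vprod gvar k)) (b k)) K \<tau> \<mu> * scal (vprod gvar K) (a K) \<tau> \<nu>) has_sum
       C * (\<Sum>\<pi> | psize \<pi> \<le> psize \<mu>. scal (vprod gvar K) (a K) \<mu> \<pi> * blocksR (\<lambda>k. scal (inverse (vprod gvar k)) (b k)) K \<nu> \<pi>)) UNIV"
proof -
  let ?v = "vprod gvar :: nat \<Rightarrow> 'c gseries"
  let ?B = "blocksR (\<lambda>k. scal (inverse (?v k)) (b k)) K"
  have unB: "unitri ?B" by (intro unitri_blocksR unitri_scal un)
  have r1: "comm_rel ?B (a K) (\<Prod>k<K. fps_dilate (inverse (?v k)) (c k))"
    by (intro comm_rel_blocksR un rel)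
  have r2: "comm_rel (scal (?v K) (a K)) ?B (fps_dilate (?v K) (\<Prod>k<K. fps_dilate (inverse (?v k)) (c k)))"
    by (rule comm_rel_scal_left[OF unB un(1) comm_rel_sym[OF un(1) unB r1]])
  have rel': "comm_rel ?B (scal (?v K) (a K)) (fps_dilate (?v K) (\<Prod>k<K. fps_dilate (inverse (?v k)) (c k)))"
    by (rule comm_rel_sym[OF unB unitri_scal[OF un(1)] r2])
  have ordA: "hom_ord (0 + int K) (scal (?v K) (a K))"
    by (intro hom_ord_scal hom_ord_0I un ord) (simp add: ord_ge_iff vprod_gvar_ord)
  have ordB: "hom_ord (1 - int K) ?B"
  proof (rule hom_ord_blocksR)
    fix k assume k: "k < K"
    have "hom_ord (0 + - int k) (scal (inverse (?v k)) (b k))"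
      by (intro hom_ord_scal hom_ord_0I un ord) (simp add: ord_ge_iff vprod_gvar_ord)
    then show "hom_ord (1 - int K) (scal (inverse (?v k)) (b k))"
      by (rule hom_ord_mono) (use k un in auto)
  qed
  obtain C where C: "evals_to (fps_dilate (?v K) (\<Prod>k<K. fps_dilate (inverse (?v k)) (c k))) C" "ord_ge 1 (C - 1)"
    "\<And>\<mu> \<nu>. ((\<lambda>\<tau>. ?B \<tau> \<mu> * scal (?v K) (a K) \<tau> \<nu>) has_sum
       C * (\<Sum>\<pi> | psize \<pi> \<le> psize \<mu>. scal (?v K) (a K) \<mu> \<pi> * ?B \<nu> \<pi>)) UNIV"
    by (rule comm_rel_evaluate[OF unitri_scal[OF un(1)] unB rel' ordA ordB]) auto
  show ?thesis by (rule that[OF C(1) near_1_subdegree(2)[OF C(2)] C(3)])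
qed

text \<open>The ordering factors of the pairs in one block.\<close>

definition self_factor :: "'a::field \<Rightarrow> nat \<Rightarrow> int set \<Rightarrow> 'a" where
  "self_factor Q L S = (\<Prod>d\<in>{- 2 * int L..2 * int L}. (if 0 < d then 1 - Q powi d else 1) ^ dcount S S d)"

text \<open>The ordering factors between the particles of one block and the holes of a later one when all these particles stand
to the left of all these holes, whatever their distance; \<open>w\<close> is the quotient of the two scales.\<close>

definition cross_factor :: "'a::field \<Rightarrow> 'a \<Rightarrow> nat \<Rightarrow> int set \<Rightarrow> int set \<Rightarrow> 'a" where
  "cross_factor Q w L S S' = (\<Prod>d\<in>{- 2 * int L..2 * int L}. (1 - Q powi d * w) ^ dcount S S' d)"

definition slope_bound :: "nat \<Rightarrow> int set \<Rightarrow> bool" where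
  "slope_bound L S \<longleftrightarrow> slope_like L S \<and> cofin_above L (uminus ` S) \<and> cofin_above L (- S)"

lemma slope_bound_Suc: "slope_like L S \<Longrightarrow> slope_bound (Suc L) S"
  unfolding slope_bound_def using slope_like_mono[of L S "Suc L"] cofin_above_slope_like[of L S] by simp

text \<open>The scalars of \<open>chain_has_sum\<close> for the given configurations and for the empty ones, and their quotient.\<close>

lemma block_scalars:
  assumes S: "\<And>k. k < n \<Longrightarrow> slope_bound L (S k)" and S0: "slope_bound L {..<0}" and K: "1 \<le> K" "K < n"
  defines "v \<equiv> vprod gvar :: nat \<Rightarrow> rat fls gseries"
  obtains C C0 where "C \<noteq> 0" "C0 \<noteq> 0" "(\<Prod>k<K. cross_factor qY (v K / v k) L (S k) (S K)) * C = C0"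
    "\<And>\<mu> \<nu>. ((\<lambda>\<tau>. blocksR (\<lambda>k. scal (inverse (v k)) (creation_block qY L (uminus ` S k))) K \<tau> \<mu> * scal (v K) (creation_block qY L (- S K)) \<tau> \<nu>) has_sum
       C * (\<Sum>\<pi> | psize \<pi> \<le> psize \<mu>. scal (v K) (creation_block qY L (- S K)) \<mu> \<pi> * blocksR (\<lambda>k. scal (inverse (v k)) (creation_block qY L (uminus ` S k))) K \<nu> \<pi>)) UNIV"
    "\<And>\<mu> \<nu>. ((\<lambda>\<tau>. blocksR (\<lambda>k. scal (inverse (v k)) (creation_block qY L (uminus ` {..<0}))) K \<tau> \<mu> * scal (v K) (creation_block qY L (- {..<0})) \<tau> \<nu>) has_sum
       C0 * (\<Sum>\<pi> | psize \<pi> \<le> psize \<mu>. scal (v K) (creation_block qY L (- {..<0})) \<mu> \<pi> * blocksR (\<lambda>k. scal (inverse (v k)) (creation_block qY L (uminus ` {..<0}))) K \<nu> \<pi>)) UNIV"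
proof -
  have X: "fls_X \<noteq> (0 :: rat fls)" "ord_ge 1 (fls_X :: rat fls)" by (simp_all add: ord_ge_iff)
  define h where "h c = Abs_fps (\<lambda>i. gconst (fps_nth c i))" for c :: "rat fls fps"
  note hom = field_hom_gconst[where 'c = "rat fls"]
  have h_mult: "h (c * d) = h c * h d" for c d unfolding h_def by (rule field_hom_fps_mult[OF hom])
  have h_lin': "h (lin a) = lin (gconst a)" for a
    by (rule fps_ext) (simp add: h_def lin_def fps_X_def field_hom_simps[OF hom])
  have h_lin: "h (lin (fls_X powi d)) = lin (qY powi d)" for d
    by (simp only: h_lin' qY_def field_hom_simps(10)[OF hom])
  have h_1: "h 1 = 1" by (rule fps_ext) (simp add: h_def field_hom_simps[OF hom])
  have h_pow: "h (c ^ k) = h c ^ k" for c k by (induction k) (simp_all add: h_1 h_mult)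
  have h_prod: "h (prod f I) = (\<Prod>i\<in>I. h (f i))" for f :: "int \<Rightarrow> _" and I
    by (induction I rule: infinite_finite_induct) (simp_all add: h_1 h_mult)
  have rel: "comm_rel (creation_block qY L H) (creation_block qY L H') (h c)" if "comm_rel (creation_block fls_X L H) (creation_block fls_X L H') c" for H H' c
    using field_hom_comm_rel[OF hom that] unfolding h_def creation_block_qY .
  note S0' = S0[unfolded slope_bound_def]
  obtain c0 where c0: "comm_rel (creation_block fls_X L (uminus ` {..<0})) (creation_block fls_X L (- {..<0})) (c0 :: rat fls fps)"
    using comm_rel_creation_block[OF X slope_like_empty slope_like_empty] S0' by metis
  define good where "good k c \<longleftrightarrow> comm_rel (creation_block fls_X L (uminus ` S k)) (creation_block fls_X L (- S K)) (c :: rat fls fps) \<and>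
      (\<Prod>d\<in>{- 2 * int L..2 * int L}. lin (fls_X powi d) ^ dcount (S k) (S K) d) * c = c0" for k c
  have "\<exists>c. good k c" if "k < K" for k
  proof -
    have s: "slope_like L (S k)" "slope_like L (S K)" "cofin_above L (uminus ` S k)" "cofin_above L (- S K)"
      using S[of k] S[of K] that K by (auto simp: slope_bound_def)
    show ?thesis unfolding good_def
      by (rule comm_rel_creation_block[OF X s]) (use c0 S0' in blast)
  qed
  then obtain c where good: "\<And>k. k < K \<Longrightarrow> good k (c k)" by metis
  have c: "comm_rel (creation_block fls_X L (uminus ` S k)) (creation_block fls_X L (- S K)) (c k :: rat fls fps)"
    "(\<Prod>d\<in>{- 2 * int L..2 * int L}. lin (fls_X powi d) ^ dcount (S k) (S K) d) * c k = c0" if "k < K" for k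
    using good[OF that] by (auto simp: good_def)
  obtain C where C: "evals_to (fps_dilate (v K) (\<Prod>k<K. fps_dilate (inverse (v k)) (h (c k)))) C" "C \<noteq> 0"
    "\<And>\<mu> \<nu>. ((\<lambda>\<tau>. blocksR (\<lambda>k. scal (inverse (v k)) (creation_block qY L (uminus ` S k))) K \<tau> \<mu> * scal (v K) (creation_block qY L (- S K)) \<tau> \<nu>) has_sum
       C * (\<Sum>\<pi> | psize \<pi> \<le> psize \<mu>. scal (v K) (creation_block qY L (- S K)) \<mu> \<pi> * blocksR (\<lambda>k. scal (inverse (v k)) (creation_block qY L (uminus ` S k))) K \<nu> \<pi>)) UNIV"
    unfolding v_def
    by (rule block_commutation[of "\<lambda>k. creation_block qY L (- S k)" "\<lambda>k. creation_block qY L (uminus ` S k)" K "\<lambda>k. h (c k)"])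
       (use rel[OF c(1)] K in \<open>auto simp: ord_creation_block_qY\<close>)
  obtain C0 where C0: "evals_to (fps_dilate (v K) (\<Prod>k<K. fps_dilate (inverse (v k)) (h c0))) C0" "C0 \<noteq> 0"
    "\<And>\<mu> \<nu>. ((\<lambda>\<tau>. blocksR (\<lambda>k. scal (inverse (v k)) (creation_block qY L (uminus ` {..<0}))) K \<tau> \<mu> * scal (v K) (creation_block qY L (- {..<0})) \<tau> \<nu>) has_sum
       C0 * (\<Sum>\<pi> | psize \<pi> \<le> psize \<mu>. scal (v K) (creation_block qY L (- {..<0})) \<mu> \<pi> * blocksR (\<lambda>k. scal (inverse (v k)) (creation_block qY L (uminus ` {..<0}))) K \<nu> \<pi>)) UNIV"
    unfolding v_def
    by (rule block_commutation[of "\<lambda>k. creation_block qY L (- {..<0})" "\<lambda>k. creation_block qY L (uminus ` {..<0})" K "\<lambda>k. h c0"])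
       (use rel[OF c0] K in \<open>auto simp: ord_creation_block_qY\<close>)
  let ?D = "{- 2 * int L..2 * int L}"
  let ?x = "\<lambda>k d. v K * (inverse (v k) * qY powi d)"
  have "fps_dilate (v K) (\<Prod>k<K. fps_dilate (inverse (v k)) (h c0)) =
     (\<Prod>k<K. \<Prod>d\<in>?D. lin (?x k d) ^ dcount (S k) (S K) d) * fps_dilate (v K) (\<Prod>k<K. fps_dilate (inverse (v k)) (h (c k)))"
    unfolding fps_dilate_prod prod.distrib[symmetric]
  proof (rule prod.cong)
    fix k assume k: "k \<in> {..<K}"
    have "h c0 = (\<Prod>d\<in>?D. lin (qY powi d) ^ dcount (S k) (S K) d) * h (c k)"
      using c(2)[of k] k by (simp only: lessThan_iff flip: h_mult h_lin h_pow h_prod)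
    then show "fps_dilate (v K) (fps_dilate (inverse (v k)) (h c0)) = (\<Prod>d\<in>?D. lin (?x k d) ^ dcount (S k) (S K) d) *
       fps_dilate (v K) (fps_dilate (inverse (v k)) (h (c k)))"
      by (simp only: fps_dilate_mult fps_dilate_prod fps_dilate_power fps_dilate_lin)
  qed simp
  also have "(\<Prod>k<K. \<Prod>d\<in>?D. lin (?x k d) ^ dcount (S k) (S K) d) =
      (\<Prod>p\<in>{..<K} \<times> ?D. (1 - fps_const (?x (fst p) (snd p)) * fps_X) ^ dcount (S (fst p)) (S K) (snd p))"
    by (simp add: prod.cartesian_product lin_def split_beta)
  finally have "evals_to (fps_dilate (v K) (\<Prod>k<K. fps_dilate (inverse (v k)) (h c0)))
      ((\<Prod>p\<in>{..<K} \<times> ?D. (1 - ?x (fst p) (snd p)) ^ dcount (S (fst p)) (S K) (snd p)) * C)"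
    using evals_to_linear_prod[OF C(1)] by simp
  then have "(\<Prod>p\<in>{..<K} \<times> ?D. (1 - ?x (fst p) (snd p)) ^ dcount (S (fst p)) (S K) (snd p)) * C = C0"
    using C0(1) evals_to_unique by blast
  moreover have "(\<Prod>p\<in>{..<K} \<times> ?D. (1 - ?x (fst p) (snd p)) ^ dcount (S (fst p)) (S K) (snd p)) =
      (\<Prod>k<K. cross_factor qY (v K / v k) L (S k) (S K))"
    unfolding cross_factor_def
    by (simp add: prod.cartesian_product split_beta divide_inverse mult_ac)
  ultimately show ?thesis using that[OF C(2) C0(2) _ C(3) C0(3)] by simp
qed

lemma matel_eq_chain_el:
  "matel Q v n L S = chain_el v (\<lambda>k. creation_block Q L (- S k)) (\<lambda>k. creation_block Q L (uminus ` S k)) n"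
  by (intro ext) (simp add: matel_def chain_el_def block_el_def)

lemma P1_formula:
  assumes "slope_bound L (slope_set lam)"
  shows "P1 \<rho>p \<rho>m lam = fls_X powi (- int (psize \<rho>p)) * inverse (self_factor fls_X L (slope_set lam)) *
    block_el (creation_block fls_X L (- slope_set lam)) (creation_block fls_X L (uminus ` slope_set lam)) (conj_partition \<rho>m) \<rho>p"
proof -
  have "P1 \<rho>p \<rho>m lam = fls_X powi (- int (psize \<rho>p)) *
    inverse (pair_product_factor (\<Prod>k<(1::nat). fls_X) (vprod (\<lambda>_. fls_X)) 1 L (\<lambda>k. slope_set lam)) *
    matel (\<Prod>k<(1::nat). fls_X) (vprod (\<lambda>_. fls_X)) 1 L (\<lambda>k. slope_set lam) (conj_partition \<rho>m) \<rho>p"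
    unfolding P1_def
    by (rule P_formula[where n = 1 and q = "\<lambda>_. fls_X :: rat fls" and l = "\<lambda>_. lam"])
       (use assms is_quotient_1 in \<open>auto simp: slope_bound_def\<close>)
  then show ?thesis
    by (simp add: matel_eq_chain_el chain_el_def pair_product_factor_def self_factor_def pair_factor_def cong: if_cong)
qed

lemma gconst_P1:
  assumes "slope_bound L (slope_set lam)"
  shows "gconst (P1 \<rho>p \<rho>m lam) = qY powi (- int (psize \<rho>p)) * inverse (self_factor qY L (slope_set lam)) *
    block_el (creation_block qY L (- slope_set lam)) (creation_block qY L (uminus ` slope_set lam)) (conj_partition \<rho>m) \<rho>p"
proof -
  note hom = field_hom_simps[OF field_hom_gconst] field_hom_sum[OF field_hom_gconst] field_hom_prod[OF field_hom_gconst]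
  have "gconst (self_factor fls_X L (slope_set lam)) = self_factor qY L (slope_set lam)"
    unfolding self_factor_def hom by (intro prod.cong refl arg_cong2[of _ _ _ _ "(^)"]) (simp only: hom qY_def if_distrib[of gconst] cong: if_cong)
  moreover have "gconst (block_el (creation_block fls_X L (- slope_set lam)) (creation_block fls_X L (uminus ` slope_set lam)) (conj_partition \<rho>m) \<rho>p) =
    block_el (creation_block qY L (- slope_set lam)) (creation_block qY L (uminus ` slope_set lam)) (conj_partition \<rho>m) \<rho>p"
    unfolding block_el_def creation_block_qY by (simp only: hom)
  ultimately show ?thesis unfolding P1_formula[OF assms] by (simp only: hom qY_def)
qed

text \<open>The common closed form, as an expression in \<open>Q\<close> and the partial products \<open>v k\<close> of the variables over an arbitrary field; it is used for
both fields of series.\<close>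

definition res_expr :: "'a::field \<Rightarrow> (nat \<Rightarrow> 'a) \<Rightarrow> nat \<Rightarrow> nat \<Rightarrow> (nat \<Rightarrow> partition) \<Rightarrow> partition \<Rightarrow> partition \<Rightarrow> 'a" where
  "res_expr Q v n L l \<sigma> \<rho> = (\<Prod>k<n. \<Prod>(i, j)\<in>boxes (l k). Q ^ i) *
     (\<Prod>k<n. inverse (self_factor Q L (slope_set (l k)))) * (v (n - 1) / Q) ^ psize \<rho> *
     (\<Prod>K\<in>{1..<n}. \<Prod>k<K. inverse (cross_factor Q (v K / v k) L (slope_set (l k)) (slope_set (l K)))) *
     matel Q v n L (\<lambda>k. slope_set (l k)) \<sigma> \<rho>"

context
  fixes n :: nat and L :: nat
  assumes n: "1 \<le> n" and S0: "slope_bound L {..<0}"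
begin

lemma PY_formula:
  assumes l: "\<And>k. k < n \<Longrightarrow> slope_bound L (slope_set (l k))"
    and S: "\<And>k. k < n \<Longrightarrow> S k = slope_set (l k)"
    and C: "\<And>K \<mu> \<nu>. 1 \<le> K \<Longrightarrow> K < n \<Longrightarrow>
      ((\<lambda>\<tau>. blocksR (\<lambda>k. scal (inverse (vprod gvar k)) (creation_block qY L (uminus ` S k))) K \<tau> \<mu> * scal (vprod gvar K) (creation_block qY L (- S K)) \<tau> \<nu>) has_sum
       C K * (\<Sum>\<pi> | psize \<pi> \<le> psize \<mu>. scal (vprod gvar K) (creation_block qY L (- S K)) \<mu> \<pi> * blocksR (\<lambda>k. scal (inverse (vprod gvar k)) (creation_block qY L (uminus ` S k))) K \<nu> \<pi>)) UNIV"
  shows "PY n \<rho>p \<rho>m l = (\<Prod>k<n. inverse (self_factor qY L (S k))) * qY powi (- int (psize \<rho>p)) *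
    ((\<Prod>k\<in>{1..<n}. C k) * vprod gvar (n - 1) ^ psize \<rho>p *
      chain_el (vprod gvar) (\<lambda>k. creation_block qY L (- S k)) (\<lambda>k. creation_block qY L (uminus ` S k)) n (conj_partition \<rho>m) \<rho>p)"
proof -
  let ?a = "\<lambda>k. creation_block qY L (- S k)" and ?b = "\<lambda>k. creation_block qY L (uminus ` S k)"
  let ?c = "(\<Prod>k<n. inverse (self_factor qY L (S k))) * qY powi (- int (psize \<rho>p))"
  define end' where "end' \<tau> k = (if k = n - 1 then \<rho>p else \<tau> (k + 1))" for \<tau> :: "nat \<Rightarrow> partition" and k
  have "((\<lambda>\<tau>. ?c * chain_term (\<lambda>k. block_el (?a k) (?b k)) gvar n (conj_partition \<rho>m) \<rho>p \<tau>) has_sum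
     ?c * ((\<Prod>k\<in>{1..<n}. C k) * vprod gvar (n - 1) ^ psize \<rho>p * chain_el (vprod gvar) ?a ?b n (conj_partition \<rho>m) \<rho>p))
     (PiE {1..<n} (\<lambda>_. UNIV))"
  proof (rule has_sum_cmult_right, rule chain_has_sum[where n = n])
    show "ord_ge 1 (gvar k :: rat fls gseries)" for k by (simp add: ord_ge_iff gvar_props)
  qed (use n C in \<open>simp_all add: vprod_Suc vprod_gvar_ord ord_creation_block_qY\<close>)
  moreover have "(\<Prod>k<n. gconst (P1 (if k = n - 1 then \<rho>p else \<tau> (k + 1)) (if k = 0 then \<rho>m else conj_partition (\<tau> k)) (l k))) *
     (\<Prod>k\<in>{1..<n}. (qY * gvar k) ^ psize (\<tau> k)) = ?c * chain_term (\<lambda>k. block_el (?a k) (?b k)) gvar n (conj_partition \<rho>m) \<rho>p \<tau>" for \<tau>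
  proof -
    have "(\<Prod>k<n. gconst (P1 (if k = n - 1 then \<rho>p else \<tau> (k + 1)) (if k = 0 then \<rho>m else conj_partition (\<tau> k)) (l k))) =
      (\<Prod>k<n. qY powi (- int (psize (end' \<tau> k))) * inverse (self_factor qY L (S k)) *
        block_el (?a k) (?b k) (if k = 0 then conj_partition \<rho>m else \<tau> k) (end' \<tau> k))"
      by (rule prod.cong) (auto simp: gconst_P1[OF l] S end'_def)
    also have "\<dots> = (\<Prod>k<n. qY powi (- int (psize (end' \<tau> k)))) * (\<Prod>k<n. inverse (self_factor qY L (S k))) *
        (\<Prod>k<n. block_el (?a k) (?b k) (if k = 0 then conj_partition \<rho>m else \<tau> k) (end' \<tau> k))"
      by (simp only: prod.distrib)
    finally have 1: "(\<Prod>k<n. gconst (P1 (if k = n - 1 then \<rho>p else \<tau> (k + 1)) (if k = 0 then \<rho>m else conj_partition (\<tau> k)) (l k))) = \<dots>" .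
    have 2: "(\<Prod>k<n. qY powi (- int (psize (end' \<tau> k)))) * (\<Prod>k\<in>{1..<n}. qY ^ psize (\<tau> k)) = qY powi (- int (psize \<rho>p))"
    proof -
      obtain n' where n': "n = Suc n'" using n by (cases n) auto
      have "(\<Prod>k\<in>{1..<n}. qY ^ psize (\<tau> k)) = (\<Prod>k<n'. qY ^ psize (\<tau> (Suc k)))"
        unfolding n' One_nat_def prod.atLeast_Suc_lessThan_Suc_shift by (simp add: comp_def atLeast0LessThan)
      moreover have "(\<Prod>k<n. qY powi (- int (psize (end' \<tau> k)))) = (\<Prod>k<n'. qY powi (- int (psize (\<tau> (Suc k))))) * qY powi (- int (psize \<rho>p))"
        by (simp add: n' end'_def)
      moreover have "(\<Prod>k<n'. qY powi (- int (psize (\<tau> (Suc k))))) * (\<Prod>k<n'. qY ^ psize (\<tau> (Suc k))) = 1"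
        unfolding prod.distrib[symmetric] using qY_nonzero by (simp add: power_int_minus)
      ultimately show ?thesis by (simp add: mult_ac)
    qed
    have "(\<Prod>k\<in>{1..<n}. (qY * gvar k) ^ psize (\<tau> k)) = (\<Prod>k\<in>{1..<n}. qY ^ psize (\<tau> k)) * (\<Prod>k\<in>{1..<n}. gvar k ^ psize (\<tau> k))"
      by (simp only: power_mult_distrib prod.distrib)
    then have "(\<Prod>k<n. gconst (P1 (if k = n - 1 then \<rho>p else \<tau> (k + 1)) (if k = 0 then \<rho>m else conj_partition (\<tau> k)) (l k))) *
     (\<Prod>k\<in>{1..<n}. (qY * gvar k) ^ psize (\<tau> k)) =
      ((\<Prod>k<n. qY powi (- int (psize (end' \<tau> k)))) * (\<Prod>k\<in>{1..<n}. qY ^ psize (\<tau> k))) * (\<Prod>k<n. inverse (self_factor qY L (S k))) *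
      ((\<Prod>k<n. block_el (?a k) (?b k) (if k = 0 then conj_partition \<rho>m else \<tau> k) (end' \<tau> k)) * (\<Prod>k\<in>{1..<n}. gvar k ^ psize (\<tau> k)))"
      unfolding 1 by (simp only: mult_ac)
    also have "\<dots> = ?c * chain_term (\<lambda>k. block_el (?a k) (?b k)) gvar n (conj_partition \<rho>m) \<rho>p \<tau>"
      unfolding 2 by (simp only: chain_term_def end'_def mult_ac)
    finally show ?thesis .
  qed
  ultimately show ?thesis unfolding PY_def by (simp only: infsumI)
qed

text \<open>Numerator and denominator are evaluated by \<open>chain_has_sum\<close>; the scalars enter only through their quotients, and the
matrix element of the empty configurations is \<open>1\<close>.\<close>

theorem PY_ratio:
  assumes l: "\<And>k. k < n \<Longrightarrow> slope_bound L (slope_set (l k))"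
  shows "PY_tilde n \<rho>p \<rho>m l / PY_tilde n empty_partition empty_partition (\<lambda>_. empty_partition) =
    res_expr qY (vprod gvar) n L l (conj_partition \<rho>m) \<rho>p"
proof -
  define S where "S k = slope_set (l k)" for k
  define v where "v = (vprod gvar :: nat \<Rightarrow> rat fls gseries)"
  define commutes where "commutes T K c \<longleftrightarrow> (\<forall>\<mu> \<nu>.
      ((\<lambda>\<tau>. blocksR (\<lambda>k. scal (inverse (v k)) (creation_block qY L (uminus ` T k))) K \<tau> \<mu> * scal (v K) (creation_block qY L (- T K)) \<tau> \<nu>) has_sum
       c * (\<Sum>\<pi> | psize \<pi> \<le> psize \<mu>. scal (v K) (creation_block qY L (- T K)) \<mu> \<pi> * blocksR (\<lambda>k. scal (inverse (v k)) (creation_block qY L (uminus ` T k))) K \<nu> \<pi>)) UNIV)"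
    for T :: "nat \<Rightarrow> int set" and K c
  define R where "R K = (\<Prod>k<K. cross_factor qY (v K / v k) L (S k) (S K))" for K
  define good where "good K C C0 \<longleftrightarrow> C \<noteq> 0 \<and> C0 \<noteq> 0 \<and> R K * C = C0 \<and> commutes S K C \<and> commutes (\<lambda>_. {..<0}) K C0" for K C C0
  have "\<exists>C C0. good K C C0" if K: "1 \<le> K" "K < n" for K
  proof (rule block_scalars[where S = S and K = K and n = n and L = L])
    show "slope_bound L (S k)" if "k < n" for k using l[OF that] by (simp add: S_def)
    fix C C0 assume *: "C \<noteq> 0" "C0 \<noteq> 0" "(\<Prod>k<K. cross_factor qY (vprod gvar K / vprod gvar k) L (S k) (S K)) * C = C0"
      "\<And>\<mu> \<nu>. ((\<lambda>\<tau>. blocksR (\<lambda>k. scal (inverse (vprod gvar k)) (creation_block qY L (uminus ` S k))) K \<tau> \<mu> * scal (vprod gvar K) (creation_block qY L (- S K)) \<tau> \<nu>) has_sum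
       C * (\<Sum>\<pi> | psize \<pi> \<le> psize \<mu>. scal (vprod gvar K) (creation_block qY L (- S K)) \<mu> \<pi> * blocksR (\<lambda>k. scal (inverse (vprod gvar k)) (creation_block qY L (uminus ` S k))) K \<nu> \<pi>)) UNIV"
      "\<And>\<mu> \<nu>. ((\<lambda>\<tau>. blocksR (\<lambda>k. scal (inverse (vprod gvar k)) (creation_block qY L (uminus ` {..<0}))) K \<tau> \<mu> * scal (vprod gvar K) (creation_block qY L (- {..<0})) \<tau> \<nu>) has_sum
       C0 * (\<Sum>\<pi> | psize \<pi> \<le> psize \<mu>. scal (vprod gvar K) (creation_block qY L (- {..<0})) \<mu> \<pi> * blocksR (\<lambda>k. scal (inverse (vprod gvar k)) (creation_block qY L (uminus ` {..<0}))) K \<nu> \<pi>)) UNIV"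
    have "good K C C0" unfolding good_def R_def commutes_def v_def using * by (intro conjI allI) auto
    then show ?thesis by blast
  qed (use K S0 in auto)
  then obtain C C0 where good: "\<And>K. 1 \<le> K \<Longrightarrow> K < n \<Longrightarrow> good K (C K) (C0 K)" by metis
  note C = this[unfolded good_def]
  have PYl: "PY n \<rho>p \<rho>m l = (\<Prod>k<n. inverse (self_factor qY L (S k))) * qY powi (- int (psize \<rho>p)) *
    ((\<Prod>k\<in>{1..<n}. C k) * v (n - 1) ^ psize \<rho>p *
      chain_el v (\<lambda>k. creation_block qY L (- S k)) (\<lambda>k. creation_block qY L (uminus ` S k)) n (conj_partition \<rho>m) \<rho>p)"
    unfolding v_def by (rule PY_formula[where S = S]) (use C l in \<open>auto simp: S_def commutes_def v_def\<close>)
  have "PY n empty_partition empty_partition (\<lambda>_. empty_partition) =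
    (\<Prod>k<n. inverse (self_factor qY L {..<0})) * qY powi (- int (psize empty_partition)) *
    ((\<Prod>k\<in>{1..<n}. C0 k) * v (n - 1) ^ psize empty_partition *
      chain_el v (\<lambda>k. creation_block qY L (- {..<0})) (\<lambda>k. creation_block qY L (uminus ` {..<0})) n (conj_partition empty_partition) empty_partition)"
    unfolding v_def by (rule PY_formula[where S = "\<lambda>_. {..<0}"]) (use C S0 in \<open>auto simp: slope_set_empty commutes_def v_def\<close>)
  also have "chain_el v (\<lambda>k. creation_block qY L (- {..<0})) (\<lambda>k. creation_block qY L (uminus ` {..<0})) n (conj_partition empty_partition) empty_partition = 1"
    using matel_empty[of qY v n L "\<lambda>_. {..<0}"] by (simp add: matel_eq_chain_el)
  finally have PY0: "PY n empty_partition empty_partition (\<lambda>_. empty_partition) = (\<Prod>k\<in>{1..<n}. C0 k)"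
    by (simp add: self_factor_def dcount_empty)
  have ratio: "(\<Prod>k\<in>{1..<n}. C k) / (\<Prod>k\<in>{1..<n}. C0 k) = (\<Prod>K\<in>{1..<n}. inverse (R K))"
    unfolding prod_dividef[symmetric]
  proof (rule prod.cong)
    fix K assume "K \<in> {1..<n}"
    then have "C K \<noteq> 0" "C0 K \<noteq> 0" "R K * C K = C0 K" using C[of K] by auto
    then have "R K \<noteq> 0" "C0 K = R K * C K" by auto
    with \<open>C K \<noteq> 0\<close> show "C K / C0 K = inverse (R K)" by (simp add: divide_simps)
  qed simp
  have "inverse (R K) = (\<Prod>k<K. inverse (cross_factor qY (v K / v k) L (S k) (S K)))" for K
    unfolding R_def by (rule prod_inversef[unfolded comp_def, symmetric])
  note ratio' = ratio[unfolded this]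
  have pw: "qY powi (- int (psize \<rho>p)) * v (n - 1) ^ psize \<rho>p = (v (n - 1) / qY) ^ psize \<rho>p"
    using qY_nonzero by (simp add: power_int_minus divide_inverse power_mult_distrib power_inverse mult.commute)
  let ?bx = "\<Prod>k<n. \<Prod>(i, j)\<in>boxes (l k). qY ^ i"
  let ?sf = "\<Prod>k<n. inverse (self_factor qY L (S k))"
  let ?me = "chain_el v (\<lambda>k. creation_block qY L (- S k)) (\<lambda>k. creation_block qY L (uminus ` S k)) n (conj_partition \<rho>m) \<rho>p"
  have "PY_tilde n \<rho>p \<rho>m l / PY_tilde n empty_partition empty_partition (\<lambda>_. empty_partition) =
     ?bx * ?sf * (qY powi (- int (psize \<rho>p)) * v (n - 1) ^ psize \<rho>p) * ((\<Prod>k\<in>{1..<n}. C k) / (\<Prod>k\<in>{1..<n}. C0 k)) * ?me"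
    unfolding PY_tilde_def PYl PY0 by (simp add: mult_ac)
  then show ?thesis
    unfolding pw ratio' res_expr_def matel_eq_chain_el by (simp only: S_def v_def)
qed

end

section \<open>Comparing the two orderings\<close>

text \<open>The product of \<open>- frak_q t' / frak_q t\<close> over all particles \<open>t\<close> of a block \<open>k\<close> and holes \<open>t'\<close> of a later block \<open>K\<close>
such that the hole is \<open>e \<ge> 1\<close> steps to the left of the particle in the coordinates of the quotient.\<close>

definition swap_monomial :: "'a::field \<Rightarrow> (nat \<Rightarrow> 'a) \<Rightarrow> nat \<Rightarrow> nat \<Rightarrow> (nat \<Rightarrow> int set) \<Rightarrow> 'a" where
  "swap_monomial Q v n L S = (\<Prod>K\<in>{1..<n}. \<Prod>k<K. \<Prod>e\<in>{1..2 * int L}. (- (Q powi (- e) * (v K / v k))) ^ hcount (S k) (S K) (- e))"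

lemma prod_pairs_triangle:
  fixes F :: "nat \<Rightarrow> nat \<Rightarrow> 'a::comm_monoid_mult"
  shows "(\<Prod>k<n. \<Prod>k'<n. F k k') = (\<Prod>k<n. F k k) * (\<Prod>K\<in>{1..<n}. \<Prod>k<K. F k K * F K k)"
proof -
  have "(\<Prod>k<n. \<Prod>k'<n. F k k') = (\<Prod>k<n. F k k) * (\<Prod>K<n. \<Prod>k<K. F k K * F K k)"
  proof (induction n)
    case (Suc n)
    have "(\<Prod>k<Suc n. \<Prod>k'<Suc n. F k k') = (\<Prod>k<n. \<Prod>k'<n. F k k') * (\<Prod>k<n. F k n) * ((\<Prod>k<n. F n k) * F n n)"
      by (simp add: prod.distrib mult_ac)
    then show ?case using Suc by (simp add: prod.distrib mult_ac)
  qed simp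
  also have "(\<Prod>K<n. \<Prod>k<K. F k K * F K k) = (\<Prod>K\<in>{1..<n}. \<Prod>k<K. F k K * F K k)"
    by (rule prod.mono_neutral_right) (auto simp: not_le less_Suc_eq_0_disj)
  finally show ?thesis .
qed

lemma dcount_transpose:
  assumes "0 < e"
  shows "dcount S' S e = hcount S S' (- e)"
proof -
  have "bij_betw (\<lambda>m. m + e) {m. m \<notin> S' \<and> m + e \<in> S} {m. m \<in> S \<and> m + (- e) \<notin> S'}"
    by (rule bij_betwI[of _ _ _ "\<lambda>m. m - e"]) auto
  then show ?thesis using assms by (simp add: dcount_def hcount_def bij_betw_same_card)
qed

text \<open>For \<open>d < 0\<close> the factor \<open>1 - x\<close> of the resolution, with \<open>x = Q powi d * (v K / v k)\<close>, faces the orbifold factor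
\<open>1 - 1 / x\<close> of the opposite pair of blocks, and \<open>1 - x = - x * (1 - 1 / x)\<close>.\<close>

lemma cross_factor_split:
  fixes Q :: "'a::field"
  assumes "k < K" "K < n" and Q: "Q \<noteq> 0" and w: "v K \<noteq> 0" "v k \<noteq> 0"
  shows "cross_factor Q (v K / v k) L (S k) (S K) =
    (\<Prod>d\<in>{- 2 * int L..2 * int L}. pair_factor Q v n k K d ^ dcount (S k) (S K) d) *
    (\<Prod>d\<in>{- 2 * int L..2 * int L}. pair_factor Q v n K k d ^ dcount (S K) (S k) d) *
    (\<Prod>e\<in>{1..2 * int L}. (- (Q powi (- e) * (v K / v k))) ^ hcount (S k) (S K) (- e))"
proof -
  let ?D = "{- 2 * int L..2 * int L}" and ?w = "v K / v k"
  have pos: "0 < int n * d + int K - int k \<longleftrightarrow> 0 \<le> d" for d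
  proof
    assume *: "0 < int n * d + int K - int k"
    show "0 \<le> d"
    proof (rule ccontr)
      assume "\<not> 0 \<le> d"
      then have "int n * d \<le> int n * (- 1)" by (intro mult_left_mono) auto
      then show False using * assms by linarith
    qed
  next
    assume "0 \<le> d"
    then have "0 \<le> int n * d" by simp
    then show "0 < int n * d + int K - int k" using assms by linarith
  qed
  have neg: "0 < int n * d + int k - int K \<longleftrightarrow> 1 \<le> d" for d
  proof
    assume *: "0 < int n * d + int k - int K"
    show "1 \<le> d"
    proof (rule ccontr)
      assume "\<not> 1 \<le> d"
      then have "int n * d \<le> int n * 0" by (intro mult_left_mono) auto
      then show False using * assms by linarith
    qed
  next
    assume "1 \<le> d"
    then have "int n * 1 \<le> int n * d" by (intro mult_left_mono) auto
    then show "0 < int n * d + int k - int K" using assms by linarith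
  qed
  have D: "?D = {0..2 * int L} \<union> uminus ` {1..2 * int L}"
  proof -
    have "uminus ` {1..2 * int L} = {- 2 * int L..- 1}" by simp
    then show ?thesis by auto
  qed
  have "cross_factor Q ?w L (S k) (S K) = (\<Prod>d\<in>{0..2 * int L}. (1 - Q powi d * ?w) ^ dcount (S k) (S K) d) *
      (\<Prod>d\<in>uminus ` {1..2 * int L}. (1 - Q powi d * ?w) ^ dcount (S k) (S K) d)"
    unfolding cross_factor_def D by (rule prod.union_disjoint) auto
  also have "(\<Prod>d\<in>uminus ` {1..2 * int L}. (1 - Q powi d * ?w) ^ dcount (S k) (S K) d) =
      (\<Prod>e\<in>{1..2 * int L}. (1 - Q powi (- e) * ?w) ^ hcount (S k) (S K) (- e))"
    by (subst prod.reindex) (auto simp: dcount_def inj_on_def intro!: prod.cong)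
  also have "\<dots> = (\<Prod>e\<in>{1..2 * int L}. (1 - Q powi e * (v k / v K)) ^ dcount (S K) (S k) e) *
      (\<Prod>e\<in>{1..2 * int L}. (- (Q powi (- e) * ?w)) ^ hcount (S k) (S K) (- e))"
    unfolding prod.distrib[symmetric]
  proof (rule prod.cong)
    fix e assume e: "e \<in> {1..2 * int L}"
    have "1 - Q powi (- e) * ?w = (1 - Q powi e * (v k / v K)) * (- (Q powi (- e) * ?w))"
      using Q w by (simp add: power_int_minus field_simps)
    then show "(1 - Q powi (- e) * ?w) ^ hcount (S k) (S K) (- e) =
      (1 - Q powi e * (v k / v K)) ^ dcount (S K) (S k) e * (- (Q powi (- e) * ?w)) ^ hcount (S k) (S K) (- e)"
      using e by (simp only: power_mult_distrib dcount_transpose[of e "S K" "S k"] atLeastAtMost_iff) (simp add: dcount_transpose power_mult_distrib)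
  qed simp
  also have "(\<Prod>d\<in>{0..2 * int L}. (1 - Q powi d * ?w) ^ dcount (S k) (S K) d) =
      (\<Prod>d\<in>?D. pair_factor Q v n k K d ^ dcount (S k) (S K) d)"
    using pos by (intro prod.mono_neutral_cong_left) (auto simp: pair_factor_def)
  also have "(\<Prod>e\<in>{1..2 * int L}. (1 - Q powi e * (v k / v K)) ^ dcount (S K) (S k) e) =
      (\<Prod>d\<in>?D. pair_factor Q v n K k d ^ dcount (S K) (S k) d)"
    using neg by (intro prod.mono_neutral_cong_left) (auto simp: pair_factor_def)
  finally show ?thesis by (simp only: mult_ac)
qed

lemma inverse_pair_product_factor:
  fixes Q :: "'a::field"
  assumes Q: "Q \<noteq> 0" and v: "\<And>k. v k \<noteq> 0"
  shows "inverse (pair_product_factor Q v n L S) = (\<Prod>k<n. inverse (self_factor Q L (S k))) *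
    (\<Prod>K\<in>{1..<n}. \<Prod>k<K. inverse (cross_factor Q (v K / v k) L (S k) (S K))) * swap_monomial Q v n L S"
proof -
  let ?F = "\<lambda>k k'. \<Prod>d\<in>{- 2 * int L..2 * int L}. pair_factor Q v n k k' d ^ dcount (S k) (S k') d"
  let ?m = "\<lambda>k K. \<Prod>e\<in>{1..2 * int L}. (- (Q powi (- e) * (v K / v k))) ^ hcount (S k) (S K) (- e)"
  have self: "?F k k = self_factor Q L (S k)" if "k < n" for k
    unfolding self_factor_def using that v by (intro prod.cong) (auto simp: pair_factor_def zero_less_mult_iff)
  have "inverse (?F k K * ?F K k) = inverse (cross_factor Q (v K / v k) L (S k) (S K)) * ?m k K" if "k < K" "K < n" for k K
  proof -
    have "?m k K \<noteq> 0" using Q v by auto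
    moreover have "cross_factor Q (v K / v k) L (S k) (S K) = ?F k K * ?F K k * ?m k K"
      by (rule cross_factor_split[OF that Q v v])
    ultimately show ?thesis by (simp only:) (simp add: divide_simps)
  qed
  then have cross: "(\<Prod>K\<in>{1..<n}. \<Prod>k<K. inverse (?F k K * ?F K k)) =
    (\<Prod>K\<in>{1..<n}. \<Prod>k<K. inverse (cross_factor Q (v K / v k) L (S k) (S K)) * ?m k K)"
    by (intro prod.cong refl) auto
  have "inverse (pair_product_factor Q v n L S) = (\<Prod>k<n. inverse (?F k k)) * (\<Prod>K\<in>{1..<n}. \<Prod>k<K. inverse (?F k K * ?F K k))"
    unfolding pair_product_factor_def prod_pairs_triangle[of ?F n]
    by (simp only: inverse_mult_distrib prod_inversef[unfolded comp_def, symmetric])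
  also have "(\<Prod>k<n. inverse (?F k k)) = (\<Prod>k<n. inverse (self_factor Q L (S k)))"
    using self by (intro prod.cong) auto
  finally show ?thesis unfolding cross by (simp only: prod.distrib swap_monomial_def mult_ac)
qed

section \<open>Rational expressions with values on both sides\<close>

definition mono_eval :: "(nat \<Rightarrow> 'a) \<Rightarrow> (nat \<Rightarrow>\<^sub>0 nat) \<Rightarrow> 'a::comm_ring_1" where
  "mono_eval y m = (\<Prod>i\<in>Poly_Mapping.keys m. y i ^ Poly_Mapping.lookup m i)"

lemma mono_eval_superset:
  "finite S \<Longrightarrow> Poly_Mapping.keys m \<subseteq> S \<Longrightarrow> mono_eval y m = (\<Prod>i\<in>S. y i ^ Poly_Mapping.lookup m i)"
  unfolding mono_eval_def by (rule prod.mono_neutral_left) (auto simp: in_keys_iff)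

lemma mono_eval_add: "mono_eval y (a + b) = mono_eval y a * mono_eval y b"
proof -
  let ?S = "Poly_Mapping.keys a \<union> Poly_Mapping.keys b"
  have "Poly_Mapping.keys (a + b) \<subseteq> ?S" by (rule keys_add)
  then show ?thesis
    using mono_eval_superset[of ?S "a + b" y] mono_eval_superset[of ?S a y] mono_eval_superset[of ?S b y]
    by (simp add: lookup_add power_add prod.distrib)
qed

lemma mpoly_eval_superset:
  "finite S \<Longrightarrow> Poly_Mapping.keys p \<subseteq> S \<Longrightarrow>
    mpoly_eval y p = (\<Sum>m\<in>S. of_int (Poly_Mapping.lookup p m) * mono_eval y m)"
  unfolding mpoly_eval_def mono_eval_def[symmetric]
  by (rule sum.mono_neutral_left) (auto simp: in_keys_iff)

lemma mpoly_eval_add: "mpoly_eval y (p + q) = mpoly_eval y p + mpoly_eval y q"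
proof -
  let ?S = "Poly_Mapping.keys p \<union> Poly_Mapping.keys q"
  have "Poly_Mapping.keys (p + q) \<subseteq> ?S" by (rule keys_add)
  then show ?thesis
    using mpoly_eval_superset[of ?S "p + q" y] mpoly_eval_superset[of ?S p y] mpoly_eval_superset[of ?S q y]
    by (simp add: lookup_add distrib_right sum.distrib)
qed

lemma mpoly_eval_0: "mpoly_eval y 0 = 0"
  by (simp add: mpoly_eval_def)

lemma mpoly_eval_sum: "mpoly_eval y (sum f I) = (\<Sum>i\<in>I. mpoly_eval y (f i))"
  by (induction I rule: infinite_finite_induct) (simp_all add: mpoly_eval_0 mpoly_eval_add)

lemma mpoly_eval_single: "mpoly_eval y (Poly_Mapping.single m c) = of_int c * mono_eval y m"
  using mpoly_eval_superset[of "{m}" "Poly_Mapping.single m c" y] by (simp add: split: if_splits)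

lemma mpoly_sum_monomials:
  fixes p :: mpoly_int
  shows "p = (\<Sum>m\<in>Poly_Mapping.keys p. Poly_Mapping.single m (Poly_Mapping.lookup p m))"
proof (rule poly_mapping_eqI)
  fix k
  have "Poly_Mapping.lookup (\<Sum>m\<in>Poly_Mapping.keys p. Poly_Mapping.single m (Poly_Mapping.lookup p m)) k =
     (\<Sum>m\<in>Poly_Mapping.keys p. if m = k then Poly_Mapping.lookup p m else 0)"
    unfolding lookup_sum by (rule sum.cong) (auto simp: lookup_single when_def)
  also have "\<dots> = Poly_Mapping.lookup p k" by (simp add: in_keys_iff)
  finally show "Poly_Mapping.lookup p k = Poly_Mapping.lookup (\<Sum>m\<in>Poly_Mapping.keys p. Poly_Mapping.single m (Poly_Mapping.lookup p m)) k" ..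
qed

lemma mpoly_eval_mult: "mpoly_eval y (p * q) = mpoly_eval y p * mpoly_eval y q"
proof -
  let ?l = Poly_Mapping.lookup and ?k = Poly_Mapping.keys
  have "p * q = (\<Sum>a\<in>?k p. Poly_Mapping.single a (?l p a)) * (\<Sum>b\<in>?k q. Poly_Mapping.single b (?l q b))"
    using mpoly_sum_monomials[of p] mpoly_sum_monomials[of q] by simp
  also have "\<dots> = (\<Sum>a\<in>?k p. \<Sum>b\<in>?k q. Poly_Mapping.single (a + b) (?l p a * ?l q b))"
    by (simp add: sum_product mult_single)
  finally have "mpoly_eval y (p * q) = (\<Sum>a\<in>?k p. \<Sum>b\<in>?k q. of_int (?l p a) * mono_eval y a * (of_int (?l q b) * mono_eval y b))"
    by (simp add: mpoly_eval_sum mpoly_eval_single mono_eval_add mult_ac)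
  then show ?thesis by (simp add: mpoly_eval_def mono_eval_def[symmetric] sum_product)
qed

lemma mpoly_vars_add: "mpoly_vars (p + q) \<subseteq> mpoly_vars p \<union> mpoly_vars q"
  unfolding mpoly_vars_def using keys_add[of p q] by blast

lemma mpoly_vars_mult: "mpoly_vars (p * q) \<subseteq> mpoly_vars p \<union> mpoly_vars q"
proof
  fix i assume "i \<in> mpoly_vars (p * q)"
  then obtain m where m: "m \<in> Poly_Mapping.keys (p * q)" "i \<in> Poly_Mapping.keys m" by (auto simp: mpoly_vars_def)
  then obtain a b where ab: "m = a + b" "a \<in> Poly_Mapping.keys p" "b \<in> Poly_Mapping.keys q"
    using keys_mult[of p q] by blast
  then have "i \<in> Poly_Mapping.keys a \<union> Poly_Mapping.keys b" using m(2) keys_add[of a b] by blast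
  then show "i \<in> mpoly_vars p \<union> mpoly_vars q" using ab by (auto simp: mpoly_vars_def)
qed

definition evalX :: "nat \<Rightarrow> mpoly_int \<Rightarrow> rat gseries" where
  "evalX n = mpoly_eval (\<lambda>i. if i = 0 then qX n else gvar i)"

definition evalY :: "mpoly_int \<Rightarrow> rat fls gseries" where
  "evalY = mpoly_eval (\<lambda>i. if i = 0 then qY else gvar i)"

text \<open>The two series \<open>x\<close> and \<open>y\<close> are expansions of one rational function in the variables with index below \<open>n\<close>, the
variable with index \<open>0\<close> standing for \<open>q\<close>.  The relation is closed under the field operations, with the
proviso for inverses that \<open>x\<close> and \<open>y\<close> vanish simultaneously.\<close>

definition same_rat :: "nat \<Rightarrow> rat gseries \<Rightarrow> rat fls gseries \<Rightarrow> bool" where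
  "same_rat n x y \<longleftrightarrow> (\<exists>A B. mpoly_vars A \<subseteq> {..<n} \<and> mpoly_vars B \<subseteq> {..<n} \<and> evalX n B \<noteq> 0 \<and> evalY B \<noteq> 0 \<and>
     x = evalX n A / evalX n B \<and> y = evalY A / evalY B)"

lemma same_ratI:
  "mpoly_vars A \<subseteq> {..<n} \<Longrightarrow> mpoly_vars B \<subseteq> {..<n} \<Longrightarrow> evalX n B \<noteq> 0 \<Longrightarrow> evalY B \<noteq> 0 \<Longrightarrow>
    same_rat n (evalX n A / evalX n B) (evalY A / evalY B)"
  unfolding same_rat_def by blast

lemma same_rat_poly:
  assumes "mpoly_vars A \<subseteq> {..<n}"
  shows "same_rat n (evalX n A) (evalY A)"
proof -
  have "mpoly_vars (Poly_Mapping.single 0 1) = {}" by (auto simp: mpoly_vars_def)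
  moreover have "evalX n (Poly_Mapping.single 0 1) = 1" "evalY (Poly_Mapping.single 0 1) = 1"
    by (simp_all add: evalX_def evalY_def mpoly_eval_single mono_eval_def del: single_one)
  ultimately show ?thesis using same_ratI[OF assms, of "Poly_Mapping.single 0 1"] by simp
qed

lemma same_rat_of_int: "same_rat n (of_int c) (of_int c)"
proof -
  have "mpoly_vars (Poly_Mapping.single 0 c) = {}" by (auto simp: mpoly_vars_def)
  then show ?thesis using same_rat_poly[of "Poly_Mapping.single 0 c" n]
    by (simp add: evalX_def evalY_def mpoly_eval_single mono_eval_def)
qed

lemma same_rat_0: "same_rat n 0 0" and same_rat_1: "same_rat n 1 1"
  using same_rat_of_int[of n 0] same_rat_of_int[of n 1] by simp_all

lemma mpoly_eval_var: "mpoly_eval y (Poly_Mapping.single (Poly_Mapping.single i 1) 1) = y i"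
  using mono_eval_superset[of "{i}" "Poly_Mapping.single i 1" y]
  by (simp only: mpoly_eval_single) (simp add: lookup_single_eq)

lemma same_rat_var:
  assumes "i < n"
  shows "same_rat n (if i = 0 then qX n else gvar i) (if i = 0 then qY else gvar i)"
proof -
  have "mpoly_vars (Poly_Mapping.single (Poly_Mapping.single i 1) 1) \<subseteq> {..<n}"
    using assms by (auto simp: mpoly_vars_def split: if_splits)
  from same_rat_poly[OF this] show ?thesis by (simp only: evalX_def evalY_def mpoly_eval_var)
qed

lemma same_rat_mult:
  assumes "same_rat n x y" "same_rat n x' y'"
  shows "same_rat n (x * x') (y * y')"
proof -
  obtain A B where 1: "mpoly_vars A \<subseteq> {..<n}" "mpoly_vars B \<subseteq> {..<n}" "evalX n B \<noteq> 0" "evalY B \<noteq> 0"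
    "x = evalX n A / evalX n B" "y = evalY A / evalY B" using assms(1) by (auto simp: same_rat_def)
  obtain A' B' where 2: "mpoly_vars A' \<subseteq> {..<n}" "mpoly_vars B' \<subseteq> {..<n}" "evalX n B' \<noteq> 0" "evalY B' \<noteq> 0"
    "x' = evalX n A' / evalX n B'" "y' = evalY A' / evalY B'" using assms(2) by (auto simp: same_rat_def)
  have e: "evalX n (p * q) = evalX n p * evalX n q" "evalY (p * q) = evalY p * evalY q" for p q
    by (simp_all add: evalX_def evalY_def mpoly_eval_mult)
  have v: "mpoly_vars (A * A') \<subseteq> {..<n}" "mpoly_vars (B * B') \<subseteq> {..<n}"
    using 1 2 mpoly_vars_mult[of A A'] mpoly_vars_mult[of B B'] by blast+
  have "same_rat n (evalX n (A * A') / evalX n (B * B')) (evalY (A * A') / evalY (B * B'))"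
    by (rule same_ratI[OF v]) (use 1 2 in \<open>auto simp: e\<close>)
  then show ?thesis using 1 2 by (simp add: e)
qed

lemma same_rat_add:
  assumes "same_rat n x y" "same_rat n x' y'"
  shows "same_rat n (x + x') (y + y')"
proof -
  obtain A B where 1: "mpoly_vars A \<subseteq> {..<n}" "mpoly_vars B \<subseteq> {..<n}" "evalX n B \<noteq> 0" "evalY B \<noteq> 0"
    "x = evalX n A / evalX n B" "y = evalY A / evalY B" using assms(1) by (auto simp: same_rat_def)
  obtain A' B' where 2: "mpoly_vars A' \<subseteq> {..<n}" "mpoly_vars B' \<subseteq> {..<n}" "evalX n B' \<noteq> 0" "evalY B' \<noteq> 0"
    "x' = evalX n A' / evalX n B'" "y' = evalY A' / evalY B'" using assms(2) by (auto simp: same_rat_def)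
  have e: "evalX n (p * q) = evalX n p * evalX n q" "evalY (p * q) = evalY p * evalY q"
    "evalX n (p + q) = evalX n p + evalX n q" "evalY (p + q) = evalY p + evalY q" for p q
    by (simp_all add: evalX_def evalY_def mpoly_eval_mult mpoly_eval_add)
  have v: "mpoly_vars (A * B' + A' * B) \<subseteq> {..<n}" "mpoly_vars (B * B') \<subseteq> {..<n}"
    using 1 2 mpoly_vars_mult[of A B'] mpoly_vars_mult[of A' B] mpoly_vars_mult[of B B'] mpoly_vars_add[of "A * B'" "A' * B"]
    by blast+
  have "same_rat n (evalX n (A * B' + A' * B) / evalX n (B * B')) (evalY (A * B' + A' * B) / evalY (B * B'))"
    by (rule same_ratI[OF v]) (use 1 2 in \<open>auto simp: e\<close>)
  then show ?thesis using 1 2 by (simp add: e add_frac_eq)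
qed

lemma same_rat_inverse:
  assumes "same_rat n x y" "x = 0 \<longleftrightarrow> y = 0"
  shows "same_rat n (inverse x) (inverse y)"
proof (cases "x = 0")
  case True
  then show ?thesis using assms same_rat_0 by simp
next
  case False
  obtain A B where 1: "mpoly_vars A \<subseteq> {..<n}" "mpoly_vars B \<subseteq> {..<n}" "evalX n B \<noteq> 0" "evalY B \<noteq> 0"
    "x = evalX n A / evalX n B" "y = evalY A / evalY B" using assms(1) by (auto simp: same_rat_def)
  have "evalX n A \<noteq> 0" "evalY A \<noteq> 0" using False assms(2) 1 by auto
  then have "same_rat n (evalX n B / evalX n A) (evalY B / evalY A)" by (intro same_ratI 1)
  then show ?thesis using 1 by simp
qed

lemma same_rat_minus: "same_rat n x y \<Longrightarrow> same_rat n (- x) (- y)"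
  using same_rat_mult[OF same_rat_of_int[of n "- 1"], of x y] by simp

lemma same_rat_diff: "same_rat n x y \<Longrightarrow> same_rat n x' y' \<Longrightarrow> same_rat n (x - x') (y - y')"
  using same_rat_add[OF _ same_rat_minus, of n x y x' y'] by simp

lemma same_rat_divide: "same_rat n x y \<Longrightarrow> same_rat n x' y' \<Longrightarrow> x' = 0 \<longleftrightarrow> y' = 0 \<Longrightarrow> same_rat n (x / x') (y / y')"
  using same_rat_mult[OF _ same_rat_inverse] by (simp add: divide_inverse)

lemma same_rat_power: "same_rat n x y \<Longrightarrow> same_rat n (x ^ k) (y ^ k)"
  by (induction k) (simp_all add: same_rat_1 same_rat_mult)

lemma same_rat_power_int: "same_rat n x y \<Longrightarrow> x = 0 \<longleftrightarrow> y = 0 \<Longrightarrow> same_rat n (x powi k) (y powi k)"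
  by (simp add: power_int_def same_rat_power same_rat_inverse)

lemma same_rat_sum: "(\<And>i. i \<in> I \<Longrightarrow> same_rat n (f i) (g i)) \<Longrightarrow> same_rat n (sum f I) (sum g I)"
  by (induction I rule: infinite_finite_induct) (simp_all add: same_rat_0 same_rat_add)

lemma same_rat_prod: "(\<And>i. i \<in> I \<Longrightarrow> same_rat n (f i) (g i)) \<Longrightarrow> same_rat n (prod f I) (prod g I)"
  by (induction I rule: infinite_finite_induct) (simp_all add: same_rat_1 same_rat_mult)

definition same_mat :: "nat \<Rightarrow> (partition \<Rightarrow> partition \<Rightarrow> rat gseries) \<Rightarrow> (partition \<Rightarrow> partition \<Rightarrow> rat fls gseries) \<Rightarrow> bool" where
  "same_mat n A B \<longleftrightarrow> (\<forall>\<sigma> \<tau>. same_rat n (A \<sigma> \<tau>) (B \<sigma> \<tau>))"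

lemma same_mat_mmul: "same_mat n A B \<Longrightarrow> same_mat n A' B' \<Longrightarrow> same_mat n (mmul A A') (mmul B B')"
  by (simp add: same_mat_def mmul_def same_rat_sum same_rat_mult)

lemma same_mat_idm: "same_mat n idm idm"
  by (simp add: same_mat_def idm_def same_rat_0 same_rat_1)

lemma same_mat_scal: "same_rat n s t \<Longrightarrow> same_mat n A B \<Longrightarrow> same_mat n (scal s A) (scal t B)"
  by (simp add: same_mat_def scal_def same_rat_mult same_rat_power)

lemma same_mat_Hs: "same_rat n x y \<Longrightarrow> same_mat n (Hs x) (Hs y)"
  by (simp add: same_mat_def Hs_def same_rat_0 same_rat_power)

lemma same_mat_Hset:
  assumes "\<And>m. same_rat n (f m) (g m)"
  shows "same_mat n (Hset f H) (Hset g H)"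
proof -
  have "same_mat n (Hl (map f ms)) (Hl (map g ms))" for ms
    by (induction ms) (simp_all add: same_mat_idm same_mat_mmul same_mat_Hs assms)
  then show ?thesis by (simp add: Hset_def)
qed

text \<open>The recursion for \<open>hgeo\<close> only divides by \<open>1 - Q ^ j\<close>, which is nonzero on both sides.\<close>

lemma same_mat_hgeo:
  assumes "same_rat n Q R" "\<And>j. 0 < j \<Longrightarrow> Q ^ j \<noteq> 1" "\<And>j. 0 < j \<Longrightarrow> R ^ j \<noteq> 1"
  shows "same_mat n (hgeo Q) (hgeo R)"
proof -
  have "same_rat n (hgeo Q \<sigma> \<tau>) (hgeo R \<sigma> \<tau>)" for \<sigma> \<tau>
  proof (induction "psize \<sigma>" arbitrary: \<sigma> rule: less_induct)
    case less
    show ?case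
    proof (cases "psize \<sigma> \<le> psize \<tau>")
      case True
      then show ?thesis by (simp add: hgeo.simps same_rat_0 same_rat_1)
    next
      case False
      have Hs1: "same_rat n (Hs 1 \<sigma> \<kappa>) (Hs 1 \<sigma> \<kappa>)" for \<kappa>
        using same_mat_Hs[OF same_rat_1] by (simp add: same_mat_def)
      have "same_rat n (\<Sum>\<kappa>\<in>{\<kappa>. psize \<kappa> < psize \<sigma>}. Hs 1 \<sigma> \<kappa> * (Q ^ (psize \<kappa> - psize \<tau>) * hgeo Q \<kappa> \<tau>))
        (\<Sum>\<kappa>\<in>{\<kappa>. psize \<kappa> < psize \<sigma>}. Hs 1 \<sigma> \<kappa> * (R ^ (psize \<kappa> - psize \<tau>) * hgeo R \<kappa> \<tau>))"
        using less by (intro same_rat_sum same_rat_mult same_rat_power assms(1) Hs1) auto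
      moreover have "same_rat n (1 - Q ^ (psize \<sigma> - psize \<tau>)) (1 - R ^ (psize \<sigma> - psize \<tau>))"
        by (intro same_rat_diff same_rat_1 same_rat_power assms(1))
      moreover have "1 - Q ^ (psize \<sigma> - psize \<tau>) = 0 \<longleftrightarrow> 1 - R ^ (psize \<sigma> - psize \<tau>) = 0"
        using assms(2,3)[of "psize \<sigma> - psize \<tau>"] False by simp
      ultimately show ?thesis
        using False by (subst (1 2) hgeo.simps) (simp add: same_rat_divide)
    qed
  qed
  then show ?thesis by (simp add: same_mat_def)
qed

lemma same_mat_blocks: "(\<And>k. k < K \<Longrightarrow> same_mat n (M k) (M' k)) \<Longrightarrow> same_mat n (blocks M K) (blocks M' K)"
  by (induction K) (simp_all add: same_mat_idm same_mat_mmul)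

lemma same_mat_blocksR: "(\<And>k. k < K \<Longrightarrow> same_mat n (M k) (M' k)) \<Longrightarrow> same_mat n (blocksR M K) (blocksR M' K)"
  by (induction K) (simp_all add: same_mat_idm same_mat_mmul)

lemma subdegree_ne_0_imp_ne_1: "fls_subdegree x \<noteq> 0 \<Longrightarrow> 1 - x \<noteq> (0 :: 'a::field fls)"
  by auto

text \<open>The point is that the denominators vanish in neither field.  For \<open>1 - Q powi d * (v K / v k)\<close> this holds because
\<open>Q powi d * (v K / v k)\<close> has nonzero order: the order is \<open>n * d + K - k\<close> with \<open>0 < K - k < n\<close> in the orbifold field,
and \<open>K - k\<close> in the resolution field.\<close>

lemma same_rat_res_expr:
  assumes n: "1 \<le> n"
  shows "same_rat n (res_expr (qX n) (vprod gvar) n L l \<sigma> \<rho>) (res_expr qY (vprod gvar) n L l \<sigma> \<rho>)"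
proof -
  have qX: "qX n \<noteq> 0" "fls_subdegree (qX n) = int n"
  proof -
    have "(\<Prod>k<m. gvar k) \<noteq> (0 :: rat gseries) \<and> fls_subdegree (\<Prod>k<m. gvar k :: rat gseries) = int m" for m
      by (induction m) (simp_all add: gvar_props)
    then show "qX n \<noteq> 0" "fls_subdegree (qX n) = int n" by (simp_all add: qX_def)
  qed
  have Q: "same_rat n (qX n) qY" using same_rat_var[of 0 n] n by simp
  have v0: "vprod gvar k \<noteq> (0 :: rat gseries)" "vprod gvar k \<noteq> (0 :: rat fls gseries)" for k
    by (rule vprod_gvar_ord)+
  have v: "same_rat n (vprod gvar k) (vprod gvar k)" if "k < n" for k
    unfolding vprod_def
  proof (rule same_rat_prod)
    fix i assume "i \<in> {1..k}"
    then show "same_rat n (gvar i) (gvar i)" using same_rat_var[of i n] that by simp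
  qed
  have Q0: "qX n = 0 \<longleftrightarrow> qY = 0" using qX qY_nonzero by simp
  have pX: "qX n ^ j \<noteq> 1" if "0 < j" for j
  proof
    assume "qX n ^ j = 1"
    moreover have "ord_ge 1 (qX n)" using qX n by (simp add: ord_ge_iff)
    ultimately show False using power_ne_1(1)[of "qX n" j] that by blast
  qed
  have pY: "qY ^ j \<noteq> 1" if "0 < j" for j
  proof
    assume "qY ^ j = 1"
    then have "gconst (1 - fls_X ^ j :: rat fls) = 0" by (simp add: field_hom_simps[OF field_hom_gconst] qY_def)
    moreover have "1 - fls_X ^ j \<noteq> (0 :: rat fls)" using power_ne_1(1)[of "fls_X :: rat fls" j] that by (simp add: ord_ge_iff)
    then have "gconst (1 - fls_X ^ j :: rat fls) * gconst (inverse (1 - fls_X ^ j)) = 1"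
      unfolding field_hom_simps(2)[OF field_hom_gconst, symmetric] by (simp add: field_hom_simps(3)[OF field_hom_gconst])
    ultimately show False by simp
  qed
  have geo: "same_mat n (hgeo (qX n)) (hgeo qY)" by (rule same_mat_hgeo[OF Q pX pY])
  have A: "same_mat n (creation_block (qX n) L H) (creation_block qY L H)" for H
    unfolding creation_block_def by (intro same_mat_mmul same_mat_Hset same_mat_scal same_rat_power same_rat_power_int Q Q0 geo)
  have "same_mat n (blocks (\<lambda>k. scal (vprod gvar k) (creation_block (qX n) L (- slope_set (l k)))) n)
     (blocks (\<lambda>k. scal (vprod gvar k) (creation_block qY L (- slope_set (l k)))) n)"
    by (intro same_mat_blocks same_mat_scal A v)
  moreover have "same_mat n (blocksR (\<lambda>k. scal (inverse (vprod gvar k)) (creation_block (qX n) L (uminus ` slope_set (l k)))) n)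
     (blocksR (\<lambda>k. scal (inverse (vprod gvar k)) (creation_block qY L (uminus ` slope_set (l k)))) n)"
    by (intro same_mat_blocksR same_mat_scal A same_rat_inverse v) (auto simp: v0)
  ultimately have M: "same_rat n (matel (qX n) (vprod gvar) n L (\<lambda>k. slope_set (l k)) \<sigma> \<rho>) (matel qY (vprod gvar) n L (\<lambda>k. slope_set (l k)) \<sigma> \<rho>)"
    unfolding matel_def same_mat_def by (intro same_rat_sum same_rat_mult) auto
  have powi_pos: "q powi d = q ^ nat d" if "0 < d" for q :: "'a::field" and d
    using that by (simp add: power_int_def)
  have self: "same_rat n (inverse (self_factor (qX n) L S)) (inverse (self_factor qY L S))" for S
  proof (rule same_rat_inverse)
    show "same_rat n (self_factor (qX n) L S) (self_factor qY L S)"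
      unfolding self_factor_def
      by (auto intro!: same_rat_prod same_rat_power same_rat_diff same_rat_1 same_rat_power_int Q simp: Q0)
    show "self_factor (qX n) L S = 0 \<longleftrightarrow> self_factor qY L S = 0"
      using pX pY by (auto simp: self_factor_def powi_pos)
  qed
  have cross: "same_rat n (inverse (cross_factor (qX n) (vprod gvar K / vprod gvar k) L S S')) (inverse (cross_factor qY (vprod gvar K / vprod gvar k) L S S'))"
    if k: "k < K" "K < n" for k K S S'
  proof (rule same_rat_inverse)
    show "same_rat n (cross_factor (qX n) (vprod gvar K / vprod gvar k) L S S') (cross_factor qY (vprod gvar K / vprod gvar k) L S S')"
      unfolding cross_factor_def
      by (intro same_rat_prod same_rat_power same_rat_diff same_rat_1 same_rat_mult same_rat_power_int same_rat_divide Q Q0 v)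
         (use k v0 in auto)
    have x: "1 - qX n powi d * (vprod gvar K / vprod gvar k) \<noteq> 0" for d
    proof (rule subdegree_ne_0_imp_ne_1)
      have "fls_subdegree (qX n powi d) = int n * d"
      proof -
        have p: "fls_subdegree (qX n ^ j) = int n * int j" for j
          using qX by (induction j) (simp_all add: fls_subdegree_mult algebra_simps)
        show ?thesis
        proof (cases "0 \<le> d")
          case True
          then show ?thesis using p[of "nat d"] by (simp add: power_int_def)
        next
          case False
          then show ?thesis using p[of "nat (- d)"] qX by (simp add: power_int_def power_inverse fls_inverse_subdegree)
        qed
      qed
      then have "fls_subdegree (qX n powi d * (vprod gvar K / vprod gvar k)) = int n * d + (int K - int k)"
        using v0 qX by (simp add: vprod_gvar_ord fls_divide_subdegree)
      moreover have "int n * d + (int K - int k) \<noteq> 0"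
      proof
        assume *: "int n * d + (int K - int k) = 0"
        then have "int n dvd int K - int k" by (metis dvd_add_right_iff dvd_0_right dvd_triv_left)
        then show False using k zdvd_imp_le[of "int n" "int K - int k"] by simp
      qed
      ultimately show "fls_subdegree (qX n powi d * (vprod gvar K / vprod gvar k)) \<noteq> 0" by simp
    qed
    have y: "1 - qY powi d * (vprod gvar K / vprod gvar k) \<noteq> 0" for d
    proof (rule subdegree_ne_0_imp_ne_1)
      have c: "fls_subdegree (gconst c) = 0" for c :: "rat fls" by (simp add: gconst_def)
      have "qY powi d = gconst (fls_X powi d)" by (simp only: qY_def field_hom_simps(10)[OF field_hom_gconst])
      then have "fls_subdegree (qY powi d) = 0" using c by simp
      moreover have "qY powi d \<noteq> 0" using qY_nonzero by simp
      ultimately have "fls_subdegree (qY powi d * (vprod gvar K / vprod gvar k)) = int K - int k"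
        using v0 by (simp add: vprod_gvar_ord fls_divide_subdegree)
      then show "fls_subdegree (qY powi d * (vprod gvar K / vprod gvar k)) \<noteq> 0" using k by simp
    qed
    show "cross_factor (qX n) (vprod gvar K / vprod gvar k) L S S' = 0 \<longleftrightarrow> cross_factor qY (vprod gvar K / vprod gvar k) L S S' = 0"
    proof -
      have "cross_factor (qX n) (vprod gvar K / vprod gvar k) L S S' \<noteq> 0"
        unfolding cross_factor_def using x by (simp del: times_divide_eq_right right_minus_eq)
      moreover have "cross_factor qY (vprod gvar K / vprod gvar k) L S S' \<noteq> 0"
        unfolding cross_factor_def using y by (simp del: times_divide_eq_right right_minus_eq)
      ultimately show ?thesis by simp
    qed
  qed
  have bx: "same_rat n (\<Prod>k<n. \<Prod>(i, j)\<in>boxes (l k). qX n ^ i) (\<Prod>k<n. \<Prod>(i, j)\<in>boxes (l k). qY ^ i)"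
    by (intro same_rat_prod) (auto intro!: same_rat_power Q)
  have pw: "same_rat n ((vprod gvar (n - 1) / qX n) ^ psize \<rho>) ((vprod gvar (n - 1) / qY) ^ psize \<rho>)"
    using n by (intro same_rat_power same_rat_divide v Q Q0) auto
  show ?thesis
    unfolding res_expr_def
    by (intro same_rat_mult bx pw M same_rat_prod self cross) auto
qed

section \<open>Border strips and slope sequences\<close>

text \<open>The particles of a partition in decreasing order.\<close>

definition beta :: "partition \<Rightarrow> nat \<Rightarrow> int" where
  "beta \<rho> i = int (row \<rho> i) - int i - 1"

lemma slope_set_range: "slope_set \<rho> = range (beta \<rho>)"
  by (auto simp: slope_set_def beta_def)

lemma beta_less_iff: "beta \<rho> j < beta \<rho> i \<longleftrightarrow> i < j"
proof -
  have *: "beta \<rho> j < beta \<rho> i" if "i < j" for i j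
    using row_antimono[of i j \<rho>] that by (simp add: beta_def)
  show ?thesis using *[of i j] *[of j i] by (cases i j rule: linorder_cases) auto
qed

lemma beta_eq_iff [simp]: "beta \<rho> i = beta \<rho> j \<longleftrightarrow> i = j"
  using beta_less_iff[of \<rho> i j] beta_less_iff[of \<rho> j i] by (cases i j rule: linorder_cases) auto

lemma beta_le_iff: "beta \<rho> j \<le> beta \<rho> i \<longleftrightarrow> i \<le> j"
  using beta_less_iff[of \<rho> i j] by (simp add: linorder_not_less[symmetric])

lemma partition_from_beta:
  fixes b :: "nat \<Rightarrow> int"
  assumes dec: "\<And>i. b (Suc i) < b i" and ev: "\<And>i. K \<le> i \<Longrightarrow> b i = - int i - 1"
  obtains \<sigma> where "beta \<sigma> = b"
proof
  define f where "f i = nat (b i + int i + 1)" for i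
  have wd: "antimono (\<lambda>i. b i + int i + 1)"
    unfolding antimono_iff_le_Suc
  proof
    show "b (Suc i) + int (Suc i) + 1 \<le> b i + int i + 1" for i using dec[of i] by simp
  qed
  have pos: "0 \<le> b i + int i + 1" for i
    using antimonoD[OF wd, of i "max i K"] ev[of "max i K"] by simp
  have "antimono f"
    unfolding f_def by (rule antimonoI) (use antimonoD[OF wd] in \<open>simp add: nat_mono\<close>)
  moreover have "{i. f i \<noteq> 0} \<subseteq> {..<K}" using ev by (force simp: f_def linorder_not_less[symmetric])
  ultimately have r: "row (Partition f) = f" by (intro row_Partition) (auto intro: finite_subset)
  show "beta (Partition f) = b" by (rule ext) (simp add: beta_def r f_def pos)
qed

text \<open>The rank of a particle among all particles is its row index.\<close>

lemma slope_set_inject: "slope_set \<rho> = slope_set \<sigma> \<longleftrightarrow> \<rho> = \<sigma>"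
proof
  assume S: "slope_set \<rho> = slope_set \<sigma>"
  have card: "{u \<in> slope_set \<rho>. beta \<rho> i < u} = beta \<rho> ` {..<i}" for \<rho> i
    by (auto simp: slope_set_range beta_less_iff)
  have inj: "inj (beta \<rho>)" for \<rho> by (rule injI) simp
  have "beta \<rho> i = beta \<sigma> i" for i
  proof -
    obtain j where j: "beta \<rho> i = beta \<sigma> j" using S by (auto simp: slope_set_range)
    have "beta \<rho> ` {..<i} = beta \<sigma> ` {..<j}" using card[of \<rho> i] card[of \<sigma> j] j S by simp
    then have "card {..<i} = card {..<j}" using inj by (metis card_image inj_on_subset subset_UNIV)
    then show ?thesis using j by simp
  qed
  then show "\<rho> = \<sigma>" by (intro partition_eqI) (simp add: beta_def)
qed simp

text \<open>The shape of a pair \<open>\<sigma> \<subseteq> \<rho>\<close> whose difference is a border strip in the rows \<open>r, \<dots>, s\<close>: in terms of particles, the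
one of row \<open>r\<close> is taken out, the next ones move up by one index, and a new one
appears in row \<open>s\<close>.\<close>

definition strip_rows :: "partition \<Rightarrow> partition \<Rightarrow> nat \<Rightarrow> nat \<Rightarrow> bool" where
  "strip_rows \<rho> \<sigma> r s \<longleftrightarrow> r \<le> s \<and> (\<forall>i. i < r \<or> s < i \<longrightarrow> beta \<sigma> i = beta \<rho> i) \<and>
     (\<forall>i. r \<le> i \<and> i < s \<longrightarrow> beta \<sigma> i = beta \<rho> (Suc i)) \<and> beta \<sigma> s < beta \<rho> s"

text \<open>The absence of a square bounds the overlap of consecutive rows of the strip from above by one box, and
connectedness bounds it from below.\<close>

lemma border_strip_rows:
  assumes strip: "border_strip \<rho> \<nu>" and \<sigma>: "boxes \<sigma> = boxes \<rho> - \<nu>"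
  obtains r s where "strip_rows \<rho> \<sigma> r s"
proof -
  have \<nu>: "\<nu> \<noteq> {}" "\<nu> \<subseteq> boxes \<rho>" "connected_boxes \<nu>"
    and sq: "\<And>i j. \<not> {(i, j), (Suc i, j), (i, Suc j), (Suc i, Suc j)} \<subseteq> \<nu>"
    using strip by (auto simp: border_strip_def)
  have mem: "(i, j) \<in> \<nu> \<longleftrightarrow> row \<sigma> i \<le> j \<and> j < row \<rho> i" for i j
  proof -
    have "(i, j) \<in> boxes \<sigma> \<longleftrightarrow> (i, j) \<in> boxes \<rho> - \<nu>" by (simp add: \<sigma>)
    moreover have "(i, j) \<in> \<nu> \<Longrightarrow> (i, j) \<in> boxes \<rho>" using \<nu>(2) by blast
    ultimately show ?thesis by (auto simp: boxes_def)
  qed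
  have le: "row \<sigma> i \<le> row \<rho> i" for i
  proof (rule ccontr)
    assume "\<not> row \<sigma> i \<le> row \<rho> i"
    then have "(i, row \<rho> i) \<in> boxes \<sigma>" by (simp add: boxes_def)
    then show False by (simp add: \<sigma>) (simp add: boxes_def)
  qed
  \<comment> \<open>Boxes of row \<open>Suc i\<close> in the columns \<open>row \<sigma> i\<close> and \<open>row \<sigma> i + 1\<close> would form a square with
    the boxes above them.\<close>
  have up: "row \<rho> (Suc i) \<le> Suc (row \<sigma> i)" for i
  proof (rule ccontr)
    assume *: "\<not> row \<rho> (Suc i) \<le> Suc (row \<sigma> i)"
    have "row \<sigma> (Suc i) \<le> row \<sigma> i" "row \<rho> (Suc i) \<le> row \<rho> i" by (simp_all add: row_antimono)
    then show False using sq[of i "row \<sigma> i"] * by (auto simp: mem)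
  qed
  define R where "R = fst ` \<nu>"
  have R: "i \<in> R \<longleftrightarrow> row \<sigma> i < row \<rho> i" for i
  proof
    assume "i \<in> R"
    then obtain j where "(i, j) \<in> \<nu>" by (auto simp: R_def)
    then show "row \<sigma> i < row \<rho> i" by (simp add: mem)
  next
    assume "row \<sigma> i < row \<rho> i"
    then have "(i, row \<sigma> i) \<in> \<nu>" by (simp add: mem)
    then show "i \<in> R" by (force simp: R_def)
  qed
  have finR: "finite R" using \<nu>(2) finite_subset[OF _ finite_boxes] by (auto simp: R_def)
  have neR: "R \<noteq> {}" using \<nu>(1) by (simp add: R_def)
  define r where "r = Min R"
  define s where "s = Max R"
  have rs: "r \<in> R" "s \<in> R" "\<And>i. i \<in> R \<Longrightarrow> r \<le> i \<and> i \<le> s"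
    using finR neR by (auto simp: r_def s_def)
  \<comment> \<open>A path in \<open>\<nu>\<close> from row \<open>r\<close> to row \<open>s\<close> passes from row \<open>i\<close> to the next one in some column.\<close>
  have down: "row \<rho> (Suc i) = Suc (row \<sigma> i)" if i: "r \<le> i" "i < s" for i
  proof (rule ccontr)
    assume "row \<rho> (Suc i) \<noteq> Suc (row \<sigma> i)"
    then have gap: "row \<rho> (Suc i) \<le> row \<sigma> i" using up[of i] by simp
    obtain a b where ab: "a \<in> \<nu>" "b \<in> \<nu>" "fst a = r" "fst b = s" using rs by (auto simp: R_def)
    have "(a, b) \<in> {(x, y). x \<in> \<nu> \<and> y \<in> \<nu> \<and> adjacent x y}\<^sup>*"
      using \<nu>(3) ab by (auto simp: connected_boxes_def)
    then have "fst b \<le> i"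
    proof (induction rule: rtrancl_induct)
      case base
      then show ?case using ab i by simp
    next
      case (step x y)
      then have xy: "x \<in> \<nu>" "y \<in> \<nu>" "adjacent x y" by auto
      obtain x1 x2 y1 y2 where eq: "x = (x1, x2)" "y = (y1, y2)" by (cases x, cases y)
      show ?case
      proof (rule ccontr)
        assume "\<not> fst y \<le> i"
        then have "x1 = i" "y1 = Suc i" "x2 = y2" using step.IH xy(3) by (auto simp: adjacent_def eq)
        then show False using xy(1,2) gap by (simp add: mem eq)
      qed
    qed
    then show False using ab i by simp
  qed
  have "strip_rows \<rho> \<sigma> r s"
    unfolding strip_rows_def
  proof (intro conjI allI impI)
    show "r \<le> s" using rs by simp
    show "beta \<sigma> s < beta \<rho> s" using rs(2) by (simp add: R beta_def)
  next
    fix i assume "i < r \<or> s < i"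
    then have "i \<notin> R" using rs(3)[of i] by auto
    then show "beta \<sigma> i = beta \<rho> i" using le[of i] by (simp add: R beta_def)
  next
    fix i assume "r \<le> i \<and> i < s"
    then show "beta \<sigma> i = beta \<rho> (Suc i)" using down[of i] by (simp add: beta_def)
  qed
  then show thesis by (rule that)
qed

context
  fixes \<rho> \<sigma> :: partition and r s :: nat
  assumes rows: "strip_rows \<rho> \<sigma> r s"
begin

lemma strip_rows_cases:
  shows "r \<le> s" "i < r \<or> s < i \<Longrightarrow> beta \<sigma> i = beta \<rho> i" "r \<le> i \<Longrightarrow> i < s \<Longrightarrow> beta \<sigma> i = beta \<rho> (Suc i)"
    "beta \<sigma> s < beta \<rho> s"
  using rows by (auto simp: strip_rows_def)

lemma strip_beta_le: "beta \<sigma> i \<le> beta \<rho> i" and strip_beta_Suc: "beta \<rho> (Suc i) \<le> beta \<sigma> i"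
proof -
  consider "i < r \<or> s < i" | "r \<le> i \<and> i < s" | "i = s" by linarith
  then have "beta \<sigma> i \<le> beta \<rho> i \<and> beta \<rho> (Suc i) \<le> beta \<sigma> i"
  proof cases
    case 1
    then show ?thesis using strip_rows_cases(2)[of i] beta_le_iff[of \<rho> "Suc i" i] by simp
  next
    case 2
    then show ?thesis using strip_rows_cases(3)[of i] beta_le_iff[of \<rho> "Suc i" i] by simp
  next
    case 3
    then show ?thesis using strip_rows_cases(2)[of "Suc s"] strip_rows_cases(4) beta_le_iff[of \<sigma> "Suc s" s] by simp
  qed
  then show "beta \<sigma> i \<le> beta \<rho> i" "beta \<rho> (Suc i) \<le> beta \<sigma> i" by auto
qed

lemma strip_boxes_subset: "boxes \<sigma> \<subseteq> boxes \<rho>"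
proof
  fix b assume "b \<in> boxes \<sigma>"
  then obtain i j where b: "b = (i, j)" "j < row \<sigma> i" by (auto simp: boxes_def)
  then show "b \<in> boxes \<rho>" using strip_beta_le[of i] by (simp add: boxes_def beta_def)
qed

lemma strip_mem: "(i, j) \<in> boxes \<rho> - boxes \<sigma> \<longleftrightarrow> beta \<sigma> i < int j - int i \<and> int j - int i \<le> beta \<rho> i"
  by (auto simp: boxes_def beta_def)

text \<open>The intervals of contents that the rows of the strip occupy are disjoint and decreasing, and the ends of the rows
are particles of \<open>\<sigma>\<close>; the row can therefore be recovered from the content by counting particles.\<close>

lemma strip_row_index:
  assumes "beta \<sigma> i < c" "c \<le> beta \<rho> i"
  shows "card {u \<in> slope_set \<sigma>. c \<le> u} = i"
proof -
  have "c \<le> beta \<sigma> i' \<longleftrightarrow> i' < i" for i'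
  proof
    assume "i' < i"
    then have "beta \<rho> i \<le> beta \<rho> (Suc i')" by (simp add: beta_le_iff)
    then show "c \<le> beta \<sigma> i'" using assms strip_beta_Suc[of i'] by simp
  next
    assume "c \<le> beta \<sigma> i'"
    then have "beta \<sigma> i < beta \<sigma> i'" using assms by simp
    then show "i' < i" by (simp add: beta_less_iff)
  qed
  then have "{u \<in> slope_set \<sigma>. c \<le> u} = beta \<sigma> ` {..<i}" by (auto simp: slope_set_range)
  moreover have "inj (beta \<sigma>)" by (rule injI) simp
  ultimately show ?thesis by (simp add: card_image inj_on_subset)
qed

lemma strip_less: "beta \<sigma> s < beta \<rho> r"
  using strip_rows_cases(1,4) beta_le_iff[of \<rho> s r] by simp

lemma strip_contents:
  assumes "beta \<sigma> s < c" "c \<le> beta \<rho> r"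
  obtains i where "r \<le> i" "i \<le> s" "beta \<sigma> i < c" "c \<le> beta \<rho> i"
proof -
  \<comment> \<open>The interval of contents of row \<open>i\<close> ends where that of the preceding row begins, so that the first row that
    starts below \<open>c\<close> contains \<open>c\<close>.\<close>
  define i where "i = (LEAST i. beta \<sigma> i < c)"
  have i: "beta \<sigma> i < c" unfolding i_def using assms(1) by (rule LeastI)
  have il: "i \<le> s" unfolding i_def using assms(1) by (rule Least_le)
  have min: "c \<le> beta \<sigma> i'" if "i' < i" for i' using not_less_Least[of i' "\<lambda>i. beta \<sigma> i < c"] that by (simp add: i_def linorder_not_less)
  have ri: "r \<le> i"
  proof (rule ccontr)
    assume "\<not> r \<le> i"
    then have "beta \<sigma> i = beta \<rho> i" "beta \<rho> r < beta \<rho> i" using strip_rows_cases(2)[of i] by (simp_all add: beta_less_iff)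
    then show False using i assms(2) by simp
  qed
  have "c \<le> beta \<rho> i"
  proof (cases "i = r")
    case False
    then obtain i' where "i = Suc i'" "r \<le> i'" "i' < s" using ri il by (cases i) auto
    then show ?thesis using min[of i'] strip_rows_cases(3)[of i'] by simp
  qed (use assms in simp)
  then show thesis using that i il ri by blast
qed

text \<open>A border strip contains exactly one box of each content between its end points.\<close>

lemma strip_bij: "bij_betw (\<lambda>(i, j). int j - int i) (boxes \<rho> - boxes \<sigma>) {beta \<sigma> s<..beta \<rho> r}"
proof (rule bij_betw_imageI)
  show "inj_on (\<lambda>(i, j). int j - int i) (boxes \<rho> - boxes \<sigma>)"
  proof (rule inj_onI)
    fix x y assume x: "x \<in> boxes \<rho> - boxes \<sigma>" and y: "y \<in> boxes \<rho> - boxes \<sigma>"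
      and eq: "(\<lambda>(i, j). int j - int i) x = (\<lambda>(i, j). int j - int i) y"
    obtain i j i' j' where xy: "x = (i, j)" "y = (i', j')" by (cases x, cases y)
    have "card {u \<in> slope_set \<sigma>. int j - int i \<le> u} = i" "card {u \<in> slope_set \<sigma>. int j' - int i' \<le> u} = i'"
      using x y unfolding xy strip_mem by (auto intro!: strip_row_index)
    then show "x = y" using eq by (simp add: xy)
  qed
  show "(\<lambda>(i, j). int j - int i) ` (boxes \<rho> - boxes \<sigma>) = {beta \<sigma> s<..beta \<rho> r}"
  proof (intro set_eqI iffI)
    fix c assume "c \<in> (\<lambda>(i, j). int j - int i) ` (boxes \<rho> - boxes \<sigma>)"
    then obtain i j where ij: "(i, j) \<in> boxes \<rho> - boxes \<sigma>" and c: "c = int j - int i"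
      by (metis (mono_tags, lifting) imageE case_prod_conv surj_pair)
    have 1: "beta \<sigma> i < c" "c \<le> beta \<rho> i" using ij unfolding strip_mem c by auto
    then have "r \<le> i \<and> i \<le> s" using strip_rows_cases(2)[of i] by (metis linorder_not_less)
    then have "beta \<sigma> s \<le> beta \<sigma> i" "beta \<rho> i \<le> beta \<rho> r" by (simp_all add: beta_le_iff)
    then show "c \<in> {beta \<sigma> s<..beta \<rho> r}" using 1 by simp
  next
    fix c assume "c \<in> {beta \<sigma> s<..beta \<rho> r}"
    then obtain i where i: "beta \<sigma> i < c" "c \<le> beta \<rho> i" using strip_contents[of c] by auto
    then have "0 \<le> c + int i" by (simp add: beta_def)
    then have "c = int (nat (c + int i)) - int i" by simp
    moreover from this have "(i, nat (c + int i)) \<in> boxes \<rho> - boxes \<sigma>" unfolding strip_mem using i by simp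
    ultimately show "c \<in> (\<lambda>(i, j). int j - int i) ` (boxes \<rho> - boxes \<sigma>)" by (metis (mono_tags, lifting) case_prod_conv image_eqI)
  qed
qed

lemma strip_card: "int (card (boxes \<rho> - boxes \<sigma>)) = beta \<rho> r - beta \<sigma> s"
  using bij_betw_same_card[OF strip_bij] strip_less by simp

lemma strip_row_of: "(i, j) \<in> boxes \<rho> - boxes \<sigma> \<Longrightarrow> card {u \<in> slope_set \<sigma>. int j - int i \<le> u} = i"
  unfolding strip_mem by (rule strip_row_index) auto

lemma strip_prod:
  fixes f :: "int \<Rightarrow> 'b::comm_monoid_mult"
  shows "(\<Prod>(i, j)\<in>boxes \<rho> - boxes \<sigma>. f (int j - int i) ^ i) =
     (\<Prod>c\<in>{beta \<sigma> s<..beta \<rho> r}. f c ^ card {u \<in> slope_set \<sigma>. c \<le> u})"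
proof -
  have "(\<Prod>(i, j)\<in>boxes \<rho> - boxes \<sigma>. f (int j - int i) ^ i) =
     (\<Prod>b\<in>boxes \<rho> - boxes \<sigma>. (\<lambda>c. f c ^ card {u \<in> slope_set \<sigma>. c \<le> u}) ((\<lambda>(i, j). int j - int i) b))"
  proof (rule prod.cong[OF refl])
    fix b assume b: "b \<in> boxes \<rho> - boxes \<sigma>"
    obtain i j where "b = (i, j)" by (cases b)
    then show "(case b of (i, j) \<Rightarrow> f (int j - int i) ^ i) =
       (\<lambda>c. f c ^ card {u \<in> slope_set \<sigma>. c \<le> u}) ((\<lambda>(i, j). int j - int i) b)"
      using strip_row_of[of i j] b by simp
  qed
  also have "\<dots> = (\<Prod>c\<in>{beta \<sigma> s<..beta \<rho> r}. f c ^ card {u \<in> slope_set \<sigma>. c \<le> u})"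
    by (rule prod.reindex_bij_betw[OF strip_bij])
  finally show ?thesis .
qed

lemma strip_slope_set:
  shows "beta \<sigma> s \<notin> slope_set \<rho>" "beta \<rho> r \<in> slope_set \<rho>"
    "slope_set \<sigma> = insert (beta \<sigma> s) (slope_set \<rho> - {beta \<rho> r})"
proof -
  have s1: "beta \<rho> (Suc s) < beta \<sigma> s"
    using strip_rows_cases(2)[of "Suc s"] beta_less_iff[of \<sigma> "Suc s" s] by simp
  show t: "beta \<sigma> s \<notin> slope_set \<rho>"
  proof
    assume "beta \<sigma> s \<in> slope_set \<rho>"
    then obtain i where i: "beta \<sigma> s = beta \<rho> i" by (auto simp: slope_set_range)
    then have "i < Suc s" "s < i" using s1 strip_rows_cases(4) by (metis beta_less_iff)+
    then show False by simp
  qed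
  show "beta \<rho> r \<in> slope_set \<rho>" by (simp add: slope_set_range)
  show "slope_set \<sigma> = insert (beta \<sigma> s) (slope_set \<rho> - {beta \<rho> r})"
  proof (intro equalityI subsetI)
    fix u assume "u \<in> slope_set \<sigma>"
    then obtain i where u: "u = beta \<sigma> i" by (auto simp: slope_set_range)
    consider "i < r \<or> s < i" | "r \<le> i \<and> i < s" | "i = s" by linarith
    then show "u \<in> insert (beta \<sigma> s) (slope_set \<rho> - {beta \<rho> r})"
    proof cases
      case 1
      then show ?thesis using strip_rows_cases(1) strip_rows_cases(2)[of i] u by (auto simp: slope_set_range)
    next
      case 2
      then show ?thesis using strip_rows_cases(3)[of i] u by (auto simp: slope_set_range)
    qed (simp add: u)
  next
    fix u assume u: "u \<in> insert (beta \<sigma> s) (slope_set \<rho> - {beta \<rho> r})"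
    show "u \<in> slope_set \<sigma>"
    proof (cases "u = beta \<sigma> s")
      case False
      then obtain i where i: "u = beta \<rho> i" "i \<noteq> r" using u by (auto simp: slope_set_range)
      show ?thesis
      proof (cases "i < r \<or> s < i")
        case True
        then have "u = beta \<sigma> i" using strip_rows_cases(2)[of i] i by simp
        then show ?thesis by (simp add: slope_set_range)
      next
        case False
        then obtain i' where "i = Suc i'" "r \<le> i'" "i' < s" using i by (cases i) auto
        then have "u = beta \<sigma> i'" using strip_rows_cases(3)[of i'] i by simp
        then show ?thesis by (simp add: slope_set_range)
      qed
    qed (simp add: slope_set_range)
  qed
qed

text \<open>All rows of the strip but the first one contribute a particle that the moving particle jumps over.\<close>

lemma strip_rows_height: "strip_height (boxes \<rho> - boxes \<sigma>) = card (slope_set \<rho> \<inter> {beta \<sigma> s<..<beta \<rho> r})"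
proof -
  have row: "i \<in> fst ` (boxes \<rho> - boxes \<sigma>) \<longleftrightarrow> beta \<sigma> i < beta \<rho> i" for i
  proof
    assume "i \<in> fst ` (boxes \<rho> - boxes \<sigma>)"
    then obtain j where "(i, j) \<in> boxes \<rho> - boxes \<sigma>" by auto
    then show "beta \<sigma> i < beta \<rho> i" unfolding strip_mem by simp
  next
    assume "beta \<sigma> i < beta \<rho> i"
    then have "(i, row \<sigma> i) \<in> boxes \<rho> - boxes \<sigma>" unfolding strip_mem by (simp add: beta_def)
    then show "i \<in> fst ` (boxes \<rho> - boxes \<sigma>)" by force
  qed
  have "fst ` (boxes \<rho> - boxes \<sigma>) = {r..s}"
  proof (intro set_eqI)
    fix i
    consider "i < r \<or> s < i" | "r \<le> i \<and> i < s" | "i = s" by linarith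
    then show "i \<in> fst ` (boxes \<rho> - boxes \<sigma>) \<longleftrightarrow> i \<in> {r..s}"
      unfolding row
    proof cases
      case 1
      then show "beta \<sigma> i < beta \<rho> i \<longleftrightarrow> i \<in> {r..s}" using strip_rows_cases(2)[of i] by auto
    next
      case 2
      then show "beta \<sigma> i < beta \<rho> i \<longleftrightarrow> i \<in> {r..s}" using strip_rows_cases(3)[of i] beta_less_iff[of \<rho> "Suc i" i] by simp
    next
      case 3
      then show "beta \<sigma> i < beta \<rho> i \<longleftrightarrow> i \<in> {r..s}" using strip_rows_cases(1,4) by simp
    qed
  qed
  moreover have "slope_set \<rho> \<inter> {beta \<sigma> s<..<beta \<rho> r} = beta \<rho> ` {r<..s}"
  proof (intro equalityI subsetI)
    fix u assume "u \<in> slope_set \<rho> \<inter> {beta \<sigma> s<..<beta \<rho> r}"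
    then obtain i where i: "u = beta \<rho> i" "beta \<rho> i < beta \<rho> r" "beta \<sigma> s < beta \<rho> i" by (auto simp: slope_set_range)
    have "i \<le> s"
    proof (rule ccontr)
      assume "\<not> i \<le> s"
      then have "beta \<rho> i = beta \<sigma> i" "beta \<sigma> i < beta \<sigma> s" using strip_rows_cases(2)[of i] by (simp, subst beta_less_iff, simp)
      then show False using i by simp
    qed
    then show "u \<in> beta \<rho> ` {r<..s}" using i by (simp add: beta_less_iff)
  next
    fix u assume "u \<in> beta \<rho> ` {r<..s}"
    then obtain i where i: "u = beta \<rho> i" "r < i" "i \<le> s" by auto
    have "beta \<rho> s \<le> beta \<rho> i" using i by (simp add: beta_le_iff)
    then show "u \<in> slope_set \<rho> \<inter> {beta \<sigma> s<..<beta \<rho> r}"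
      using i strip_rows_cases(4) by (auto simp: slope_set_range beta_less_iff)
  qed
  moreover have "inj (beta \<rho>)" by (rule injI) simp
  ultimately show ?thesis by (simp add: strip_height_def card_image inj_on_subset)
qed

text \<open>Boxes of consecutive contents are adjacent, so that walking along the contents connects the strip.\<close>

lemma strip_rows_border: "border_strip \<rho> (boxes \<rho> - boxes \<sigma>)"
proof -
  let ?\<nu> = "boxes \<rho> - boxes \<sigma>"
  let ?c = "\<lambda>(i, j). int j - int (i::nat)"
  let ?E = "{(x, y). x \<in> ?\<nu> \<and> y \<in> ?\<nu> \<and> adjacent x y}"
  have inj: "inj_on ?c ?\<nu>" using strip_bij by (simp add: bij_betw_def)
  \<comment> \<open>Boxes of consecutive contents are adjacent.\<close>
  have adj: "\<exists>y\<in>?\<nu>. ?c y = ?c x + 1 \<and> adjacent x y" if x: "x \<in> ?\<nu>" "?c x + 1 \<le> beta \<rho> r" for x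
  proof -
    obtain i j where ij: "x = (i, j)" by (cases x)
    have m: "beta \<sigma> i < int j - int i" "int j - int i \<le> beta \<rho> i" using x(1) unfolding ij strip_mem by auto
    show ?thesis
    proof (cases "int j - int i + 1 \<le> beta \<rho> i")
      case True
      then have "(i, Suc j) \<in> ?\<nu>" unfolding strip_mem using m by simp
      then show ?thesis by (intro bexI[of _ "(i, Suc j)"]) (auto simp: ij adjacent_def)
    next
      case False
      then have e: "int j - int i = beta \<rho> i" using m by simp
      have "beta \<sigma> s < int j - int i + 1" using bij_betwE[OF strip_bij, THEN bspec, OF x(1)] ij by simp
      then obtain i' where i': "r \<le> i'" "i' \<le> s" "beta \<sigma> i' < int j - int i + 1" "int j - int i + 1 \<le> beta \<rho> i'"
        using strip_contents[of "int j - int i + 1"] x(2) ij by auto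
      have "i' < i" using i' e by (metis beta_less_iff zless_add1_eq linorder_not_less zle_add1_eq_le)
      moreover have "\<not> Suc i' < i"
      proof
        assume "Suc i' < i"
        then have "beta \<rho> i < beta \<rho> (Suc i')" by (simp add: beta_less_iff)
        then show False using i' e strip_beta_Suc[of i'] by simp
      qed
      ultimately have "i = Suc i'" by simp
      then have "(i', j) \<in> ?\<nu>" unfolding strip_mem using i' by simp
      then show ?thesis using \<open>i = Suc i'\<close> by (intro bexI[of _ "(i', j)"]) (auto simp: ij adjacent_def)
    qed
  qed
  have up: "(x, y) \<in> ?E\<^sup>*" if "x \<in> ?\<nu>" "y \<in> ?\<nu>" "?c y = ?c x + int k" for x y k
    using that
  proof (induction k arbitrary: x)
    case 0
    then show ?case using inj_onD[OF inj, of x y] by simp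
  next
    case (Suc k)
    have "?c y \<le> beta \<rho> r" using bij_betwE[OF strip_bij, THEN bspec, OF Suc.prems(2)] by simp
    then obtain z where z: "z \<in> ?\<nu>" "?c z = ?c x + 1" "adjacent x z" using adj[OF Suc.prems(1)] Suc.prems(3) by auto
    then have "(z, y) \<in> ?E\<^sup>*" using Suc.IH[OF z(1) Suc.prems(2)] Suc.prems(3) by simp
    moreover have "(x, z) \<in> ?E" using z Suc.prems(1) by simp
    ultimately show ?case by (rule converse_rtrancl_into_rtrancl[rotated])
  qed
  have sym: "sym (?E\<^sup>*)" by (rule sym_rtrancl) (auto simp: sym_def adjacent_def)
  have "connected_boxes ?\<nu>"
    unfolding connected_boxes_def
  proof (intro ballI)
    fix x y assume xy: "x \<in> ?\<nu>" "y \<in> ?\<nu>"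
    show "(x, y) \<in> ?E\<^sup>*"
    proof (cases "?c x \<le> ?c y")
      case True
      then show ?thesis using up[of x y "nat (?c y - ?c x)"] xy by simp
    next
      case False
      then show ?thesis using up[of y x "nat (?c x - ?c y)"] xy symD[OF sym] by simp
    qed
  qed
  moreover have "?\<nu> \<noteq> {}"
  proof
    assume "?\<nu> = {}"
    then have "int (card ?\<nu>) = 0" by simp
    then show False using strip_card strip_less by simp
  qed
  moreover have "\<not> {(i, j), (Suc i, j), (i, Suc j), (Suc i, Suc j)} \<subseteq> ?\<nu>" for i j
  proof
    assume "{(i, j), (Suc i, j), (i, Suc j), (Suc i, Suc j)} \<subseteq> ?\<nu>"
    then have "(i, j) \<in> ?\<nu>" "(Suc i, Suc j) \<in> ?\<nu>" by auto
    then show False unfolding strip_mem using strip_beta_Suc[of i] by simp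
  qed
  moreover have "boxes \<sigma> = boxes \<rho> - ?\<nu>" using strip_boxes_subset by blast
  ultimately show ?thesis unfolding border_strip_def by blast
qed

end

text \<open>A particle can jump from \<open>t + n\<close> to any free place \<open>t\<close>.  The last row of the strip is the last one whose particle lies to
the right of \<open>t\<close>.\<close>

lemma strip_exists:
  assumes n: "1 \<le> n" and t: "t \<notin> slope_set \<rho>" "t + int n \<in> slope_set \<rho>"
  obtains \<sigma> r s where "strip_rows \<rho> \<sigma> r s" "beta \<sigma> s = t" "beta \<rho> r = t + int n"
proof -
  obtain r where r: "beta \<rho> r = t + int n" using t by (auto simp: slope_set_range)
  obtain K where K: "\<And>i. i \<ge> K \<Longrightarrow> row \<rho> i = 0" using rows_eventually_0 by metis
  have "t < beta \<rho> i \<Longrightarrow> i < K + nat (- t)" for i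
    using K[of i] by (rule_tac ccontr) (simp add: beta_def linorder_not_less)
  then have fin: "finite {i. t < beta \<rho> i}" by (auto intro: finite_subset[of _ "{..<K + nat (- t)}"])
  have rin: "r \<in> {i. t < beta \<rho> i}" using r n by simp
  define s where "s = Max {i. t < beta \<rho> i}"
  have rs: "r \<le> s" using fin rin by (simp add: s_def)
  have s: "t < beta \<rho> s" using Max_in[OF fin] rin by (auto simp: s_def)
  have s1: "beta \<rho> (Suc s) < t"
  proof -
    have "\<not> t < beta \<rho> (Suc s)" using Max_ge[OF fin, of "Suc s"] by (auto simp: s_def)
    moreover have "beta \<rho> (Suc s) \<noteq> t" using t by (auto simp: slope_set_range)
    ultimately show ?thesis by simp
  qed
  define b where "b i = (if i < r \<or> s < i then beta \<rho> i else if i < s then beta \<rho> (Suc i) else t)" for i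
  have dec: "beta \<rho> (Suc i) < beta \<rho> i" for i by (simp add: beta_less_iff)
  have "b (Suc i) < b i" for i
  proof -
    have i: "beta \<rho> (Suc i) < beta \<rho> i" "beta \<rho> (Suc (Suc i)) < beta \<rho> (Suc i)" by (rule dec)+
    consider "Suc i < r" | "Suc i = r" | "r \<le> i" "Suc i < s" | "r \<le> i" "Suc i = s" | "i = s" | "s < i" by linarith
    then show ?thesis
    proof cases
      case 2
      then show ?thesis using i rs s by (cases "r = s") (simp_all add: b_def)
    qed (use i rs s s1 in \<open>auto simp: b_def\<close>)
  qed
  moreover have "b i = - int i - 1" if "K + Suc s \<le> i" for i
    using that K[of i] by (simp add: b_def beta_def)
  ultimately obtain \<sigma> where \<sigma>: "beta \<sigma> = b" using partition_from_beta[of b "K + Suc s"] by blast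
  have "strip_rows \<rho> \<sigma> r s" using rs s by (simp add: strip_rows_def \<sigma> b_def)
  then show thesis using that[of \<sigma> r s] r rs by (simp add: \<sigma> b_def)
qed

section \<open>Moving one particle of the quotient\<close>

lemma is_quotientI:
  assumes n: "1 \<le> n" and S: "\<And>k m. k < n \<Longrightarrow> int n * m + int k \<in> slope_set \<rho> \<longleftrightarrow> m \<in> slope_set (l k)"
  shows "is_quotient n \<rho> l"
  unfolding is_quotient_def
proof
  fix t
  obtain m k where t: "t = int n * m + int k" "k < n" using int_cases_divmod[OF n] .
  then show "slope \<rho> t = slope (l (nat (t mod int n))) ((t - t mod int n) div int n)"
    using S[of k m] by (simp add: slope_def divmod_block)
qed

lemma block_eq_iff:
  assumes "k < n" "k' < n"
  shows "int n * m + int k = int n * m' + int k' \<longleftrightarrow> m = m' \<and> k = k'"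
  using divmod_block[OF assms(1), of m] divmod_block[OF assms(2), of m'] by auto

text \<open>A jump by \<open>n\<close> of a particle with residue \<open>k\<close> is a jump by one in the component \<open>k\<close>.\<close>

lemma is_quotient_move:
  assumes l: "is_quotient n \<rho> l" and k: "k < n"
    and \<sigma>: "slope_set \<sigma> = insert (int n * m + int k) (slope_set \<rho> - {int n * m + int k + int n})"
    and \<kappa>: "slope_set \<kappa> = insert m (slope_set (l k) - {m + 1})"
  shows "is_quotient n \<sigma> (l(k := \<kappa>))"
proof (rule is_quotientI)
  show "1 \<le> n" using k by simp
  fix k' m' assume k': "k' < n"
  have e: "int n * m + int k + int n = int n * (m + 1) + int k" by (simp add: algebra_simps)
  show "int n * m' + int k' \<in> slope_set \<sigma> \<longleftrightarrow> m' \<in> slope_set ((l(k := \<kappa>)) k')"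
    using slope_set_quotient[OF l k'] k k' by (simp only: \<sigma> e) (auto simp: \<kappa> block_eq_iff)
qed

lemma quotient_empty_components:
  assumes "is_quotient n empty_partition l" "k < n"
  shows "l k = empty_partition"
proof -
  have "m \<in> slope_set (l k) \<longleftrightarrow> m < 0" for m
  proof -
    have "m \<in> slope_set (l k) \<longleftrightarrow> int n * m + int k < 0"
      using slope_set_quotient[OF assms, of m] by (simp add: slope_set_empty)
    also have "\<dots> \<longleftrightarrow> (int n * m + int k) div int n < 0"
      using le_div_int_iff[of n 0 "int n * m + int k"] assms(2) by (simp add: linorder_not_le[symmetric])
    finally show ?thesis by (simp only: divmod_block[OF assms(2)])
  qed
  then have "slope_set (l k) = slope_set empty_partition" by (auto simp: slope_set_empty)
  then show ?thesis by (simp add: slope_set_inject)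
qed

text \<open>The particle of the last nonempty row can move one step to the left.\<close>

lemma removable_particle:
  assumes "\<rho> \<noteq> empty_partition"
  obtains m where "m \<notin> slope_set \<rho>" "m + 1 \<in> slope_set \<rho>"
proof -
  obtain i0 where i0: "row \<rho> i0 \<noteq> 0" using assms partition_eqI[of \<rho> empty_partition] by auto
  have fin: "finite {i. row \<rho> i \<noteq> 0}" by (rule finite_row_support)
  define i where "i = Max {i. row \<rho> i \<noteq> 0}"
  have i: "row \<rho> i \<noteq> 0" using Max_in[OF fin] i0 by (auto simp: i_def)
  have i1: "row \<rho> (Suc i) = 0" using Max_ge[OF fin, of "Suc i"] by (auto simp: i_def)
  have "beta \<rho> i - 1 \<notin> slope_set \<rho>"
  proof
    assume "beta \<rho> i - 1 \<in> slope_set \<rho>"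
    then obtain j where j: "beta \<rho> i - 1 = beta \<rho> j" by (auto simp: slope_set_range)
    then have "beta \<rho> j < beta \<rho> i" by simp
    then have "Suc i \<le> j" by (simp add: beta_less_iff)
    then have "beta \<rho> j \<le> beta \<rho> (Suc i)" by (simp add: beta_le_iff)
    then show False using i i1 j by (simp add: beta_def)
  qed
  then show thesis using that[of "beta \<rho> i - 1"] by (simp add: slope_set_range)
qed

text \<open>Unless all components of the quotient are empty, some particle of some component can move by one step, that is, a
strip of \<open>n\<close> boxes can be removed.\<close>

lemma strip_decomposition_exists:
  assumes "1 \<le> n" "is_quotient n \<rho> l"
  shows "\<exists>\<nu>s. strip_decomposition n \<rho> \<nu>s"
  using assms(2)
proof (induction "psize \<rho>" arbitrary: \<rho> l rule: less_induct)
  case less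
  show ?case
  proof (cases "\<forall>k<n. l k = empty_partition")
    case True
    have "t \<in> slope_set \<rho> \<longleftrightarrow> t \<in> slope_set empty_partition" for t
    proof -
      obtain m k where t: "t = int n * m + int k" "k < n" using int_cases_divmod[OF assms(1)] .
      then show ?thesis using slope_set_quotient[OF less.prems t(2), of m]
          slope_set_quotient[OF is_quotient_empty[OF assms(1)] t(2), of m] True by simp
    qed
    then have "\<rho> = empty_partition" using slope_set_inject by blast
    then show ?thesis using strip_decomposition.Nil by blast
  next
    case False
    then obtain k where k: "k < n" "l k \<noteq> empty_partition" by blast
    obtain m where m: "m \<notin> slope_set (l k)" "m + 1 \<in> slope_set (l k)" using removable_particle[OF k(2)] .
    define t where "t = int n * m + int k"
    have t: "t \<notin> slope_set \<rho>" "t + int n \<in> slope_set \<rho>"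
      using slope_set_quotient[OF less.prems k(1), of m] slope_set_quotient[OF less.prems k(1), of "m + 1"] m
      by (simp_all add: t_def algebra_simps)
    obtain \<sigma> r s where \<sigma>: "strip_rows \<rho> \<sigma> r s" "beta \<sigma> s = t" "beta \<rho> r = t + int n"
      using strip_exists[OF assms(1) t] .
    obtain \<kappa> r' s' where \<kappa>: "strip_rows (l k) \<kappa> r' s'" "beta \<kappa> s' = m" "beta (l k) r' = m + 1"
      using strip_exists[of 1 m "l k"] m by auto
    have "is_quotient n \<sigma> (l(k := \<kappa>))"
      by (rule is_quotient_move[OF less.prems k(1)])
         (use strip_slope_set(3)[OF \<sigma>(1)] strip_slope_set(3)[OF \<kappa>(1)] \<sigma> \<kappa> in \<open>simp_all add: t_def\<close>)
    moreover have c: "card (boxes \<rho> - boxes \<sigma>) = n" using strip_card[OF \<sigma>(1)] \<sigma> by simp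
    moreover have "psize \<sigma> < psize \<rho>"
      using c assms(1) strip_boxes_subset[OF \<sigma>(1)] card_Diff_subset[of "boxes \<sigma>" "boxes \<rho>"] by (simp add: psize_def)
    ultimately obtain \<nu>s where "strip_decomposition n \<sigma> \<nu>s" using less.hyps by blast
    then have "strip_decomposition n \<rho> ((boxes \<rho> - boxes \<sigma>) # \<nu>s)"
      by (rule strip_decomposition.Cons[OF strip_rows_border[OF \<sigma>(1)] c, rotated])
         (use strip_boxes_subset[OF \<sigma>(1)] in blast)
    then show ?thesis by blast
  qed
qed

lemma slope_like_move:
  assumes S: "slope_like L S" and m: "m \<notin> S" "m + 1 \<in> S"
  shows "slope_like L (insert m (S - {m + 1}))"
proof -
  have b: "- int L \<le> m" "m + 1 < int L" using slope_like_ge[OF S m(1)] slope_like_less[OF S m(2)] by auto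
  have fin: "finite (S \<inter> {- int L..})" using slope_like_finite[OF S] .
  have "insert m (S - {m + 1}) \<inter> {- int L..} = insert m ((S \<inter> {- int L..}) - {m + 1})" using b by auto
  moreover have "card (insert m ((S \<inter> {- int L..}) - {m + 1})) = card (S \<inter> {- int L..})"
    using card_Suc_Diff1[OF fin, of "m + 1"] m b fin by simp
  ultimately show ?thesis using S b by (auto simp: slope_like_def)
qed

section \<open>The swap factor under the move\<close>

text \<open>The contribution of one pair of blocks to \<open>swap_monomial\<close>.\<close>

definition swap_pair :: "'a::field \<Rightarrow> nat \<Rightarrow> int set \<Rightarrow> int set \<Rightarrow> 'a \<Rightarrow> 'a" where
  "swap_pair Q L S S' a = (\<Prod>e\<in>{1..2 * int L}. (- (Q powi (- e) * a)) ^ hcount S S' (- e))"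

text \<open>The same product, indexed by the particles and holes themselves instead of their distances.\<close>

lemma swap_pair_eq:
  assumes S: "slope_like L S" "slope_like L S'"
  shows "swap_pair Q L S S' a = (\<Prod>x\<in>S \<inter> {- int L..<int L}. \<Prod>y\<in>{- int L..<int L} - S'. if y < x then - (Q powi (y - x) * a) else 1)"
proof -
  let ?W = "{- int L..<int L}"
  have "swap_pair Q L S S' a = (\<Prod>e\<in>{1..2 * int L}. \<Prod>x\<in>S \<inter> ?W. if x - e \<notin> S' then - (Q powi (- e) * a) else 1)"
    unfolding swap_pair_def
  proof (rule prod.cong[OF refl])
    fix e assume e: "e \<in> {1..2 * int L}"
    have "x \<in> ?W" if "x \<in> S" "x - e \<notin> S'" for x
      using slope_like_less[OF S(1) that(1)] slope_like_ge[OF S(2) that(2)] e by simp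
    then have "{x \<in> S. x + - e \<notin> S'} = {x \<in> S \<inter> ?W. x - e \<notin> S'}" by auto
    then show "(- (Q powi (- e) * a)) ^ hcount S S' (- e) = (\<Prod>x\<in>S \<inter> ?W. if x - e \<notin> S' then - (Q powi (- e) * a) else 1)"
      by (simp add: hcount_def prod.If_cases Int_def)
  qed
  also have "\<dots> = (\<Prod>x\<in>S \<inter> ?W. \<Prod>e\<in>{1..2 * int L}. if x - e \<notin> S' then - (Q powi (- e) * a) else 1)"
    by (rule prod.swap)
  also have "\<dots> = (\<Prod>x\<in>S \<inter> ?W. \<Prod>y\<in>?W - S'. if y < x then - (Q powi (y - x) * a) else 1)"
  proof (rule prod.cong[OF refl])
    fix x assume x: "x \<in> S \<inter> ?W"
    have "(\<Prod>e\<in>{1..2 * int L}. if x - e \<notin> S' then - (Q powi (- e) * a) else 1) = (\<Prod>e\<in>{e\<in>{1..2 * int L}. x - e \<notin> S'}. - (Q powi (- e) * a))"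
      by (rule prod.inter_filter[symmetric]) simp
    also have "\<dots> = (\<Prod>y\<in>{y\<in>?W - S'. y < x}. - (Q powi (y - x) * a))"
    proof (rule prod.reindex_bij_witness[of _ "\<lambda>y. x - y" "\<lambda>e. x - e"])
      fix e assume "e \<in> {e \<in> {1..2 * int L}. x - e \<notin> S'}"
      then show "x - e \<in> {y \<in> ?W - S'. y < x}" using slope_like_ge[OF S(2), of "x - e"] x by simp
    qed (use x in auto)
    also have "\<dots> = (\<Prod>y\<in>?W - S'. if y < x then - (Q powi (y - x) * a) else 1)"
      by (rule prod.inter_filter) simp
    finally show "(\<Prod>e\<in>{1..2 * int L}. if x - e \<notin> S' then - (Q powi (- e) * a) else 1) = (\<Prod>y\<in>?W - S'. if y < x then - (Q powi (y - x) * a) else 1)" .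
  qed
  finally show ?thesis .
qed

lemma prod_exchange:
  fixes f :: "'b \<Rightarrow> 'a::comm_monoid_mult"
  assumes "finite A" "x \<in> A" "y \<notin> A"
  shows "prod f (insert y (A - {x})) * f x = prod f A * f y"
proof -
  have "prod f A = f x * prod f (A - {x})" using assms by (rule_tac prod.remove) auto
  moreover have "prod f (insert y (A - {x})) = f y * prod f (A - {x})" using assms by simp
  ultimately show ?thesis by (simp add: mult_ac)
qed

text \<open>A particle of the first configuration moves from \<open>m + 1\<close> to \<open>m\<close>.  Its distance to each hole on its left drops by
one, which accounts for the power of \<open>Q\<close>, and it loses its pairing with a hole at \<open>m\<close>.\<close>

lemma swap_pair_move_left:
  assumes Q: "Q \<noteq> 0" and a: "a \<noteq> 0" and S: "slope_like L S" "slope_like L S'" and m: "m \<notin> S" "m + 1 \<in> S"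
  shows "swap_pair Q L S S' a = swap_pair Q L (insert m (S - {m + 1})) S' a *
    (if m \<in> S' then 1 else - a) * Q powi (- int (card {y. y \<le> m \<and> y \<notin> S'}))"
proof -
  let ?W = "{- int L..<int L}" and ?T = "insert m (S - {m + 1})"
  have b: "- int L \<le> m" "m + 1 < int L" using slope_like_ge[OF S(1) m(1)] slope_like_less[OF S(1) m(2)] by auto
  define g where "g x = (\<Prod>y\<in>?W - S'. if y < x then - (Q powi (y - x) * a) else 1)" for x
  have g: "g x = (\<Prod>y\<in>{y\<in>?W - S'. y < x}. - (Q powi (y - x) * a))" for x
    unfolding g_def by (rule prod.inter_filter[symmetric]) simp
  have "?T \<inter> ?W = insert m ((S \<inter> ?W) - {m + 1})" using b by auto
  then have ex: "swap_pair Q L ?T S' a * g (m + 1) = swap_pair Q L S S' a * g m"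
    unfolding swap_pair_eq[OF S] swap_pair_eq[OF slope_like_move[OF S(1) m] S(2)] g_def[symmetric]
    using prod_exchange[of "S \<inter> ?W" "m + 1" m g] m b by simp
  have g0: "g m \<noteq> 0" using Q a by (auto simp: g_def split: if_splits)
  have fin: "finite {y\<in>?W - S'. y < m}" by (rule finite_subset[of _ ?W]) auto
  have H: "{y. y \<le> m \<and> y \<notin> S'} = {y\<in>?W - S'. y < m + 1}" using slope_like_ge[OF S(2)] b by auto
  have "g (m + 1) = (\<Prod>y\<in>{y\<in>?W - S'. y < m + 1}. inverse Q * - (Q powi (y - m) * a))"
    unfolding g
  proof (rule prod.cong[OF refl])
    fix y
    have "Q powi (y - (m + 1)) = Q powi ((y - m) - 1)" by (rule arg_cong[of _ _ "\<lambda>z. Q powi z"]) simp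
    also have "\<dots> = Q powi (y - m) * inverse Q" by (simp only: power_int_diff[OF disjI1[OF Q]] power_int_1_right divide_inverse)
    finally show "- (Q powi (y - (m + 1)) * a) = inverse Q * - (Q powi (y - m) * a)" by simp
  qed
  also have "\<dots> = inverse Q ^ card {y\<in>?W - S'. y < m + 1} * (\<Prod>y\<in>{y\<in>?W - S'. y < m + 1}. - (Q powi (y - m) * a))"
    by (simp only: prod.distrib prod_constant)
  also have "(\<Prod>y\<in>{y\<in>?W - S'. y < m + 1}. - (Q powi (y - m) * a)) = (if m \<in> S' then 1 else - a) * g m"
  proof (cases "m \<in> S'")
    case True
    then have "{y\<in>?W - S'. y < m + 1} = {y\<in>?W - S'. y < m}" by (auto simp: order_less_le)
    then show ?thesis using True by (simp add: g)
  next
    case False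
    then have "{y\<in>?W - S'. y < m + 1} = insert m {y\<in>?W - S'. y < m}" using b by auto
    moreover have nin: "m \<notin> {y\<in>?W - S'. y < m}" by simp
    ultimately show ?thesis using False by (simp only: g prod.insert[OF fin nin]) simp
  qed
  finally have "g (m + 1) = Q powi (- int (card {y. y \<le> m \<and> y \<notin> S'})) * ((if m \<in> S' then 1 else - a) * g m)"
    by (simp add: H power_int_minus power_inverse)
  then have "swap_pair Q L S S' a * g m = (swap_pair Q L ?T S' a * (if m \<in> S' then 1 else - a) * Q powi (- int (card {y. y \<le> m \<and> y \<notin> S'}))) * g m"
    using ex by (simp only: mult_ac)
  then show ?thesis using g0 by (metis mult_cancel_right)
qed

text \<open>A particle of the second configuration moves from \<open>m + 1\<close> to \<open>m\<close>, hence a hole moves from \<open>m\<close> to \<open>m + 1\<close>.  Its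
distance to each particle of the first configuration on its right drops by one, and it loses its pairing with a
particle at \<open>m + 1\<close>.\<close>

lemma swap_pair_move_right:
  assumes Q: "Q \<noteq> 0" and a: "a \<noteq> 0" and S: "slope_like L S" "slope_like L S'" and m: "m \<notin> S" "m + 1 \<in> S"
  shows "swap_pair Q L S' S a = swap_pair Q L S' (insert m (S - {m + 1})) a *
    (if m + 1 \<in> S' then - a else 1) * Q powi (- int (card {x \<in> S'. m + 1 \<le> x}))"
proof -
  let ?W = "{- int L..<int L}" and ?T = "insert m (S - {m + 1})"
  have b: "- int L \<le> m" "m + 1 < int L" using slope_like_ge[OF S(1) m(1)] slope_like_less[OF S(1) m(2)] by auto
  define g where "g y = (\<Prod>x\<in>S' \<inter> ?W. if y < x then - (Q powi (y - x) * a) else 1)" for y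
  have g: "g y = (\<Prod>x\<in>{x\<in>S' \<inter> ?W. y < x}. - (Q powi (y - x) * a))" for y
    unfolding g_def by (rule prod.inter_filter[symmetric]) simp
  have sw: "swap_pair Q L S' U a = (\<Prod>y\<in>?W - U. g y)" if "slope_like L U" for U
    unfolding swap_pair_eq[OF S(2) that] g_def by (rule prod.swap)
  have "?W - S = insert m ((?W - ?T) - {m + 1})" using b m by auto
  then have ex: "swap_pair Q L S' S a * g (m + 1) = swap_pair Q L S' ?T a * g m"
    unfolding sw[OF S(1)] sw[OF slope_like_move[OF S(1) m]]
    using prod_exchange[of "?W - ?T" "m + 1" m g] m b by simp
  have g0: "g (m + 1) \<noteq> 0" using Q a by (auto simp: g_def split: if_splits)
  have fin: "finite {x\<in>S' \<inter> ?W. m + 1 < x}" by (rule finite_subset[of _ ?W]) auto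
  have H: "{x \<in> S'. m + 1 \<le> x} = {x\<in>S' \<inter> ?W. m < x}" using slope_like_less[OF S(2)] b by auto
  have "g m = (\<Prod>x\<in>{x\<in>S' \<inter> ?W. m < x}. inverse Q * - (Q powi (m + 1 - x) * a))"
    unfolding g
  proof (rule prod.cong[OF refl])
    fix x
    have "Q powi (m - x) = Q powi ((m + 1 - x) - 1)" by (rule arg_cong[of _ _ "\<lambda>z. Q powi z"]) simp
    also have "\<dots> = Q powi (m + 1 - x) * inverse Q" by (simp only: power_int_diff[OF disjI1[OF Q]] power_int_1_right divide_inverse)
    finally show "- (Q powi (m - x) * a) = inverse Q * - (Q powi (m + 1 - x) * a)" by simp
  qed
  also have "\<dots> = inverse Q ^ card {x\<in>S' \<inter> ?W. m < x} * (\<Prod>x\<in>{x\<in>S' \<inter> ?W. m < x}. - (Q powi (m + 1 - x) * a))"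
    by (simp only: prod.distrib prod_constant)
  also have "(\<Prod>x\<in>{x\<in>S' \<inter> ?W. m < x}. - (Q powi (m + 1 - x) * a)) = (if m + 1 \<in> S' then - a else 1) * g (m + 1)"
  proof (cases "m + 1 \<in> S'")
    case True
    then have "{x\<in>S' \<inter> ?W. m < x} = insert (m + 1) {x\<in>S' \<inter> ?W. m + 1 < x}" using b by auto
    moreover have nin: "m + 1 \<notin> {x\<in>S' \<inter> ?W. m + 1 < x}" by simp
    ultimately show ?thesis using True by (simp only: g prod.insert[OF fin nin]) simp
  next
    case False
    then have "{x\<in>S' \<inter> ?W. m < x} = {x\<in>S' \<inter> ?W. m + 1 < x}" by (auto simp: order_less_le)
    then show ?thesis using False by (simp add: g)
  qed
  finally have "g m = Q powi (- int (card {x \<in> S'. m + 1 \<le> x})) * ((if m + 1 \<in> S' then - a else 1) * g (m + 1))"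
    by (simp add: H power_int_minus power_inverse)
  then have "swap_pair Q L S' S a * g (m + 1) = (swap_pair Q L S' ?T a * (if m + 1 \<in> S' then - a else 1) * Q powi (- int (card {x \<in> S'. m + 1 \<le> x}))) * g (m + 1)"
    using ex by (simp only: mult_ac)
  then show ?thesis using g0 by (metis mult_cancel_right)
qed

text \<open>The case of \<open>hcount_balance\<close> in which one of the configurations is empty.\<close>

lemma charge:
  assumes "slope_like L S"
  shows "int (card {x \<in> S. c \<le> x}) - int (card {y. y \<le> c - 1 \<and> y \<notin> S}) = - c"
proof -
  have 1: "{m. m \<in> S \<and> m + (- c) \<notin> {..<0}} = {x \<in> S. c \<le> x}" by auto
  have "card {m. m \<notin> S \<and> m + (- c) \<in> {..<0}} = card {y. y \<le> c - 1 \<and> y \<notin> S}"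
    by (rule arg_cong[of _ _ card]) auto
  then show ?thesis using hcount_balance[OF assms slope_like_empty[of L], of "- c"] unfolding 1 by simp
qed

section \<open>The sign and the monomial\<close>

lemma card_slope_blocks:
  assumes n: "1 \<le> n" and l: "is_quotient n \<sigma> l"
  shows "card {u \<in> slope_set \<sigma>. c \<le> u} = (\<Sum>k<n. card {x \<in> slope_set (l k). c \<le> int n * x + int k})"
proof -
  let ?T = "{u \<in> slope_set \<sigma>. c \<le> u}"
  obtain L where L: "slope_like L (slope_set \<sigma>)" using slope_like_slope_set .
  have "?T = slope_set \<sigma> \<inter> {c..}" by auto
  then have fin: "finite ?T" using slope_like_finite[OF L] by simp
  have eq: "{x \<in> slope_set (l k). c \<le> int n * x + int k} = {x. int n * x + int k \<in> ?T}" if "k < n" for k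
    using slope_set_quotient[OF l that] by auto
  have "(\<Sum>k<n. card {x \<in> slope_set (l k). c \<le> int n * x + int k}) = (\<Sum>k<n. card {x. int n * x + int k \<in> ?T})"
    by (rule sum.cong[OF refl]) (simp only: eq lessThan_iff)
  also have "\<dots> = card (SIGMA k:{..<n}. {x. int n * x + int k \<in> ?T})"
    using finite_block[OF n fin] by (intro card_SigmaI[symmetric]) auto
  also have "\<dots> = card ?T"
    by (rule bij_betw_same_card, rule bij_betw_byWitness[where f = "\<lambda>(k, x). int n * x + int k" and f' = "\<lambda>t. (nat (t mod int n), t div int n)"])
       (use n in \<open>auto simp: divmod_block nat_less_iff\<close>)
  finally show ?thesis ..
qed

lemma prod_cyc_interval:
  fixes q :: "nat \<Rightarrow> 'a::field"
  assumes q: "\<And>i. q i \<noteq> 0" and st: "s \<le> t"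
  shows "(\<Prod>c\<in>{s<..t}. cyc n q c) = frak_q n q t / frak_q n q s"
proof -
  have nz: "frak_q n q u \<noteq> 0" for u
    using q by (simp add: frak_q_def cyc_def)
  have "(\<Prod>c\<in>{s<..t}. cyc n q c) * frak_q n q s = frak_q n q t"
    using st
  proof (induction t rule: int_ge_induct)
    case base
    then show ?case by simp
  next
    case (step t)
    have "{s<..t + 1} = insert (t + 1) {s<..t}" using step.hyps by auto
    then have "(\<Prod>c\<in>{s<..t + 1}. cyc n q c) * frak_q n q s = cyc n q (t + 1) * frak_q n q t"
      using step.IH by (simp add: mult.assoc)
    also have "\<dots> = frak_q n q (t + 1)" using frak_q_rec[of q n "t + 1"] q by simp
    finally show ?case .
  qed
  then show ?thesis using nz by (simp add: field_simps)
qed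

text \<open>The variable \<open>q m\<close> divides the quotients with \<open>k' = m, \<dots>, n - 1\<close>, which are \<open>n - m\<close> many.\<close>

lemma prod_vprod_quotients:
  fixes q :: "nat \<Rightarrow> 'a::field"
  assumes q: "\<And>i. q i \<noteq> 0"
  shows "(\<Prod>m\<in>{k + 1..<n}. q m ^ (n - m)) = (\<Prod>k'\<in>{k + 1..<n}. vprod q k' / vprod q k)"
proof (induction n)
  case (Suc n)
  show ?case
  proof (cases "k + 1 \<le> n")
    case True
    have step: "{k + 1..<Suc n} = insert n {k + 1..<n}" using True by auto
    have v: "vprod q (k + d) / vprod q k = (\<Prod>m\<in>{k + 1..<Suc (k + d)}. q m)" for d
      by (induction d) (simp_all add: vprod_Suc vprod_nonzero[OF q] divide_simps)
    have "(\<Prod>m\<in>{k + 1..<Suc n}. q m ^ (Suc n - m)) = (\<Prod>m\<in>{k + 1..<Suc n}. q m ^ (n - m) * q m)"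
      by (rule prod.cong) (auto simp: Suc_diff_le)
    also have "\<dots> = (\<Prod>m\<in>{k + 1..<n}. q m ^ (n - m)) * (vprod q n / vprod q k)"
      using v[of "n - k"] True by (simp add: prod.distrib step)
    finally show ?thesis using Suc.IH True by (simp add: step)
  qed simp
qed simp

lemma prod_collect:
  "prod a A * prod b A * (M * prod c A) = (\<Prod>x\<in>A. a x * b x * c x) * (M :: 'a::comm_monoid_mult)"
  by (simp add: prod.distrib mult_ac)

lemma component_above:
  fixes A :: "'a::comm_ring_1"
  assumes "A * B = R"
  shows "(if b then - 1 else 1) * (A * (if b then w else 1)) * ((if b then 1 else - w) * B) = - 1 * R * w"
  unfolding assms[symmetric] by (simp add: mult_ac)

lemma component_below:
  fixes A :: "'a::comm_ring_1"
  assumes "A * B = 1" "w * u = 1"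
  shows "(if b then - 1 else 1) * (A * (if b then w else 1)) * ((if b then - u else 1) * B) = 1"
proof -
  have "(A * w) * (u * B) = (A * B) * (w * u)" by (simp only: mult_ac)
  then show ?thesis using assms by simp
qed

context
  fixes n :: nat and q :: "nat \<Rightarrow> 'a::field" and \<rho> \<sigma> \<kappa> :: partition and l :: "nat \<Rightarrow> partition"
    and k :: nat and m :: int and L :: nat
  assumes n: "1 \<le> n" and q: "\<And>i. q i \<noteq> 0" and k: "k < n"
    and quot: "is_quotient n \<rho> l" and L: "\<And>k. k < n \<Longrightarrow> slope_like L (slope_set (l k))"
    and m: "m \<notin> slope_set (l k)" "m + 1 \<in> slope_set (l k)"
    and \<sigma>: "slope_set \<sigma> = insert (int n * m + int k) (slope_set \<rho> - {int n * m + int k + int n})"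
    and \<kappa>: "slope_set \<kappa> = insert m (slope_set (l k) - {m + 1})"
begin

abbreviation (input) "Qq \<equiv> \<Prod>k<n. q k"
abbreviation (input) "vq \<equiv> vprod q"
abbreviation (input) "tt \<equiv> int n * m + int k"
abbreviation (input) "nabove k' \<equiv> card {x \<in> slope_set ((l(k := \<kappa>)) k'). m + 1 \<le> x}"

lemma Qq_nonzero: "Qq \<noteq> 0" using q by simp

lemma block_less: "x < m \<Longrightarrow> int n * x \<le> int n * m - int n" "m < x \<Longrightarrow> int n * m + int n \<le> int n * x"
  using mult_left_mono[of x "m - 1" "int n"] mult_left_mono[of "m + 1" x "int n"] by (simp_all add: algebra_simps)

lemma prod_period: "(\<Prod>c\<in>{tt<..tt + int n}. cyc n q c) = Qq"
proof -
  have e: "tt + int n = int n * (m + 1) + int k" by (simp add: algebra_simps)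
  have "(\<Prod>c\<in>{tt<..int n * (m + 1) + int k}. cyc n q c) = frak_q n q (int n * (m + 1) + int k) / frak_q n q tt"
    by (rule prod_cyc_interval[OF q]) (simp add: algebra_simps)
  then show ?thesis
    unfolding e frak_q_block[OF n q k] using Qq_nonzero vprod_nonzero[where q = q and k = k] q by (simp add: power_int_add)
qed

text \<open>The boxes of the strip run through one full period of contents.  A particle \<open>x\<close> of component \<open>k'\<close> contributes the
variables of all contents of the strip that do not exceed its position: the full period if \<open>x > m + 1\<close>, nothing if
\<open>x < m\<close>, and otherwise a possibly empty or full part of the period, which telescopes to a quotient of partial products.\<close>

lemma strip_weight_component:
  assumes k': "k' < n"
  shows "(\<Prod>c\<in>{tt<..tt + int n}. cyc n q c ^ card {x \<in> slope_set ((l(k := \<kappa>)) k'). c \<le> int n * x + int k'}) =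
    Qq ^ nabove k' * (if k < k' then (if m \<in> slope_set (l k') then vq k' / vq k else 1)
      else if k' < k then (if m + 1 \<in> slope_set (l k') then vq k' / vq k else 1) else 1)"
proof -
  let ?S = "slope_set ((l(k := \<kappa>)) k')" and ?I = "{tt<..tt + int n}"
  let ?N = "\<lambda>c. card {x \<in> ?S. c \<le> int n * x + int k'}"
  obtain L' where L': "slope_like L' ?S" using slope_like_slope_set .
  have "{x \<in> ?S. m + 1 \<le> x} = ?S \<inter> {m + 1..}" by auto
  then have fin: "finite {x \<in> ?S. m + 1 \<le> x}" using slope_like_finite[OF L'] by simp
  have v0: "vq i \<noteq> 0" for i by (rule vprod_nonzero[OF q])
  have Qpow: "(\<Prod>c\<in>?I. cyc n q c ^ a) = Qq ^ a" for a
    unfolding prod_period[symmetric] by (rule prod_power_distrib[symmetric])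
  consider "k' = k" | "k < k'" | "k' < k" by linarith
  then show ?thesis
  proof cases
    case 1
    have "?N c = nabove k'" if "c \<in> ?I" for c
    proof -
      have "c \<le> int n * x + int k' \<longleftrightarrow> m + 1 \<le> x" for x
        using block_less[of x] that 1 by (cases x m rule: linorder_cases) auto
      then show ?thesis by simp
    qed
    then have "(\<Prod>c\<in>?I. cyc n q c ^ ?N c) = (\<Prod>c\<in>?I. cyc n q c ^ nabove k')" by (intro prod.cong) auto
    then show ?thesis using 1 Qpow by simp
  next
    case 2
    have S: "?S = slope_set (l k')" using 2 by simp
    have N: "?N c = nabove k' + (if m \<in> ?S \<and> c \<le> int n * m + int k' then 1 else 0)" if c: "c \<in> ?I" for c
    proof -
      define b where "b \<longleftrightarrow> c \<le> int n * m + int k'"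
      have iff: "c \<le> int n * x + int k' \<longleftrightarrow> m + 1 \<le> x \<or> x = m \<and> b" for x
        using block_less[of x] c 2 k' by (cases x m rule: linorder_cases) (auto simp: b_def)
      show ?thesis
      proof (cases "m \<in> ?S \<and> b")
        case True
        then have "{x \<in> ?S. c \<le> int n * x + int k'} = insert m {x \<in> ?S. m + 1 \<le> x}" unfolding iff by auto
        then show ?thesis using fin True by (simp add: b_def)
      next
        case False
        then have "{x \<in> ?S. c \<le> int n * x + int k'} = {x \<in> ?S. m + 1 \<le> x}" unfolding iff by auto
        then show ?thesis using False by (simp add: b_def)
      qed
    qed
    have "(\<Prod>c\<in>?I. cyc n q c ^ ?N c) = (\<Prod>c\<in>?I. cyc n q c ^ nabove k' * (if m \<in> ?S \<and> c \<le> int n * m + int k' then cyc n q c else 1))"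
    proof (rule prod.cong[OF refl])
      fix c assume c: "c \<in> ?I"
      show "cyc n q c ^ ?N c = cyc n q c ^ nabove k' * (if m \<in> ?S \<and> c \<le> int n * m + int k' then cyc n q c else 1)"
        unfolding N[OF c] by (simp add: power_add del: fun_upd_apply)
    qed
    also have "\<dots> = Qq ^ nabove k' * (\<Prod>c\<in>?I. if m \<in> ?S \<and> c \<le> int n * m + int k' then cyc n q c else 1)"
      by (simp only: prod.distrib Qpow)
    also have "(\<Prod>c\<in>?I. if m \<in> ?S \<and> c \<le> int n * m + int k' then cyc n q c else 1) = (if m \<in> ?S then vq k' / vq k else 1)"
    proof (cases "m \<in> ?S")
      case True
      have "(\<Prod>c\<in>?I. if m \<in> ?S \<and> c \<le> int n * m + int k' then cyc n q c else 1) = (\<Prod>c\<in>{c\<in>?I. c \<le> int n * m + int k'}. cyc n q c)"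
        by (simp only: True simp_thms prod.inter_filter[OF finite_greaterThanAtMost_int])
      also have "{c\<in>?I. c \<le> int n * m + int k'} = {tt<..int n * m + int k'}" using k' by auto
      also have "(\<Prod>c\<in>{tt<..int n * m + int k'}. cyc n q c) = vq k' / vq k"
        using prod_cyc_interval[where q = q and n = n and s = tt and t = "int n * m + int k'"] q 2
        unfolding frak_q_block[OF n q k] frak_q_block[OF n q k'] using Qq_nonzero by simp
      finally show ?thesis using True by simp
    qed simp
    finally show ?thesis using 2 S by simp
  next
    case 3
    let ?u = "int n * (m + 1) + int k'"
    have S: "?S = slope_set (l k')" using 3 by simp
    have N: "nabove k' = ?N c + (if m + 1 \<in> ?S \<and> ?u < c then 1 else 0)" if c: "c \<in> ?I" for c
    proof -
      have iff: "c \<le> int n * x + int k' \<longleftrightarrow> m + 1 \<le> x \<and> \<not> (x = m + 1 \<and> ?u < c)" for x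
      proof (cases "x = m + 1")
        case False
        have "m + 1 < x \<Longrightarrow> int n * (m + 1) + int n \<le> int n * x"
          using mult_left_mono[of "m + 2" x "int n"] by (simp add: algebra_simps)
        moreover have "int n * (m + 1) = int n * m + int n" by (simp add: algebra_simps)
        ultimately show ?thesis using block_less[of x] c 3 k False by (cases x m rule: linorder_cases) auto
      qed auto
      show ?thesis
      proof (cases "m + 1 \<in> ?S \<and> ?u < c")
        case True
        then have "{x \<in> ?S. m + 1 \<le> x} = insert (m + 1) {x \<in> ?S. c \<le> int n * x + int k'}" unfolding iff by auto
        moreover have "finite {x \<in> ?S. c \<le> int n * x + int k'}" by (rule finite_subset[OF _ fin]) (auto simp: iff)
        moreover have "m + 1 \<notin> {x \<in> ?S. c \<le> int n * x + int k'}" using True by simp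
        ultimately show ?thesis using True by (simp only: card_insert_disjoint) simp
      next
        case False
        then have "{x \<in> ?S. c \<le> int n * x + int k'} = {x \<in> ?S. m + 1 \<le> x}" unfolding iff by auto
        then show ?thesis using False by simp
      qed
    qed
    have "Qq ^ nabove k' = (\<Prod>c\<in>?I. cyc n q c ^ ?N c * (if m + 1 \<in> ?S \<and> ?u < c then cyc n q c else 1))"
      unfolding Qpow[symmetric]
    proof (rule prod.cong[OF refl])
      fix c assume c: "c \<in> ?I"
      show "cyc n q c ^ nabove k' = cyc n q c ^ ?N c * (if m + 1 \<in> ?S \<and> ?u < c then cyc n q c else 1)"
        unfolding N[OF c] by (simp add: power_add del: fun_upd_apply)
    qed
    also have "\<dots> = (\<Prod>c\<in>?I. cyc n q c ^ ?N c) * (\<Prod>c\<in>?I. if m + 1 \<in> ?S \<and> ?u < c then cyc n q c else 1)"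
      by (rule prod.distrib)
    also have "(\<Prod>c\<in>?I. if m + 1 \<in> ?S \<and> ?u < c then cyc n q c else 1) = (if m + 1 \<in> ?S then vq k / vq k' else 1)"
    proof (cases "m + 1 \<in> ?S")
      case True
      have e: "tt + int n = int n * (m + 1) + int k" by (simp add: algebra_simps)
      have "(\<Prod>c\<in>?I. if m + 1 \<in> ?S \<and> ?u < c then cyc n q c else 1) = (\<Prod>c\<in>{c\<in>?I. ?u < c}. cyc n q c)"
        by (simp only: True simp_thms prod.inter_filter[OF finite_greaterThanAtMost_int])
      also have "{c\<in>?I. ?u < c} = {?u<..int n * (m + 1) + int k}"
        unfolding e using k 3 by (auto simp: algebra_simps)
      also have "(\<Prod>c\<in>{?u<..int n * (m + 1) + int k}. cyc n q c) = vq k / vq k'"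
        using prod_cyc_interval[where q = q and n = n and s = ?u and t = "int n * (m + 1) + int k"] q 3
        unfolding frak_q_block[OF n q k] frak_q_block[OF n q k'] using Qq_nonzero by simp
      finally show ?thesis using True by simp
    qed simp
    finally have "(\<Prod>c\<in>?I. cyc n q c ^ ?N c) * (if m + 1 \<in> ?S then vq k / vq k' else 1) = Qq ^ nabove k'" ..
    then have "(\<Prod>c\<in>?I. cyc n q c ^ ?N c) = Qq ^ nabove k' * (if m + 1 \<in> ?S then vq k' / vq k else 1)"
      using v0 by (simp add: field_simps split: if_splits)
    then show ?thesis using 3 S by simp
  qed
qed

lemma strip_weight:
  "(\<Prod>c\<in>{tt<..tt + int n}. cyc n q c ^ card {u \<in> slope_set \<sigma>. c \<le> u}) =
    (\<Prod>k'<n. Qq ^ nabove k' * (if k < k' then (if m \<in> slope_set (l k') then vq k' / vq k else 1)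
      else if k' < k then (if m + 1 \<in> slope_set (l k') then vq k' / vq k else 1) else 1))"
proof -
  have quot': "is_quotient n \<sigma> (l(k := \<kappa>))" by (rule is_quotient_move[OF quot k \<sigma> \<kappa>])
  have "(\<Prod>c\<in>{tt<..tt + int n}. cyc n q c ^ card {u \<in> slope_set \<sigma>. c \<le> u}) =
    (\<Prod>c\<in>{tt<..tt + int n}. \<Prod>k'<n. cyc n q c ^ card {x \<in> slope_set ((l(k := \<kappa>)) k'). c \<le> int n * x + int k'})"
    by (simp only: card_slope_blocks[OF n quot'] power_sum)
  also have "\<dots> = (\<Prod>k'<n. \<Prod>c\<in>{tt<..tt + int n}. cyc n q c ^ card {x \<in> slope_set ((l(k := \<kappa>)) k'). c \<le> int n * x + int k'})"
    by (rule prod.swap)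
  also have "\<dots> = (\<Prod>k'<n. Qq ^ nabove k' * (if k < k' then (if m \<in> slope_set (l k') then vq k' / vq k else 1)
      else if k' < k then (if m + 1 \<in> slope_set (l k') then vq k' / vq k else 1) else 1))"
    by (rule prod.cong[OF refl]) (simp only: strip_weight_component lessThan_iff)
  finally show ?thesis .
qed

lemma strip_sign:
  "(- 1 :: 'a) ^ card (slope_set \<rho> \<inter> {tt<..<tt + int n}) =
    (\<Prod>k'<n. if k < k' then (if m \<in> slope_set (l k') then - 1 else 1)
      else if k' < k then (if m + 1 \<in> slope_set (l k') then - 1 else 1) else 1)"
proof -
  let ?T = "{tt<..<tt + int n}" and ?f = "\<lambda>u. if u \<in> slope_set \<rho> then - 1 else (1 :: 'a)"
  have "(- 1 :: 'a) ^ card (slope_set \<rho> \<inter> ?T) = prod ?f ?T"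
    by (simp add: prod.If_cases Int_commute)
  also have "\<dots> = (\<Prod>k'<n. \<Prod>x\<in>{x. int n * x + int k' \<in> ?T}. ?f (int n * x + int k'))"
    by (rule prod_blocks[OF n]) simp
  also have "\<dots> = (\<Prod>k'<n. if k < k' then (if m \<in> slope_set (l k') then - 1 else 1)
      else if k' < k then (if m + 1 \<in> slope_set (l k') then - 1 else 1) else 1)"
  proof (rule prod.cong[OF refl])
    fix k' assume "k' \<in> {..<n}"
    then have k': "k' < n" by simp
    have e: "int n * (m + 1) = int n * m + int n" by (simp add: algebra_simps)
    have far: "m + 1 < x \<Longrightarrow> int n * m + int n + int n \<le> int n * x" for x
      using mult_left_mono[of "m + 2" x "int n"] by (simp add: algebra_simps)
    have set: "{x. int n * x + int k' \<in> ?T} = (if k < k' then {m} else if k' < k then {m + 1} else {})"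
    proof (rule set_eqI)
      fix x
      consider "x < m" | "x = m" | "x = m + 1" | "m + 1 < x" by linarith
      then show "x \<in> {x. int n * x + int k' \<in> ?T} \<longleftrightarrow> x \<in> (if k < k' then {m} else if k' < k then {m + 1} else {})"
        using block_less[of x] far[of x] k k' e by cases auto
    qed
    show "(\<Prod>x\<in>{x. int n * x + int k' \<in> ?T}. ?f (int n * x + int k')) =
      (if k < k' then (if m \<in> slope_set (l k') then - 1 else 1)
      else if k' < k then (if m + 1 \<in> slope_set (l k') then - 1 else 1) else 1)"
      unfolding set by (simp add: slope_set_quotient[OF quot k'])
  qed
  finally show ?thesis .
qed

text \<open>Only the pairs of blocks that involve \<open>k\<close> change, once as the earlier and once as the later block.\<close>

lemma swap_monomial_move:
  "swap_monomial Qq vq n L (\<lambda>j. slope_set (l j)) = swap_monomial Qq vq n L (\<lambda>j. slope_set ((l(k := \<kappa>)) j)) *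
    (\<Prod>k'<n. if k < k' then (if m \<in> slope_set (l k') then 1 else - (vq k' / vq k)) * Qq powi (- int (card {y. y \<le> m \<and> y \<notin> slope_set (l k')}))
      else if k' < k then (if m + 1 \<in> slope_set (l k') then - (vq k / vq k') else 1) * Qq powi (- int (nabove k')) else 1)"
proof -
  let ?S = "\<lambda>j. slope_set (l j)" and ?S' = "\<lambda>j. slope_set ((l(k := \<kappa>)) j)"
  let ?left = "\<lambda>K. (if m \<in> slope_set (l K) then 1 else - (vq K / vq k)) * Qq powi (- int (card {y. y \<le> m \<and> y \<notin> slope_set (l K)}))"
  let ?right = "\<lambda>j. (if m + 1 \<in> slope_set (l j) then - (vq k / vq j) else 1) * Qq powi (- int (nabove j))"
  have v0: "vq i \<noteq> 0" for i by (rule vprod_nonzero[OF q])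
  have tri: "swap_monomial Qq vq n L U = (\<Prod>K<n. \<Prod>j<n. if j < K then swap_pair Qq L (U j) (U K) (vq K / vq j) else 1)" for U
  proof -
    have "(\<Prod>K\<in>{1..<n}. \<Prod>j<K. swap_pair Qq L (U j) (U K) (vq K / vq j)) = (\<Prod>K<n. \<Prod>j<K. swap_pair Qq L (U j) (U K) (vq K / vq j))"
      by (rule prod.mono_neutral_left) (auto simp: Suc_le_eq)
    also have "\<dots> = (\<Prod>K<n. \<Prod>j<n. if j < K then swap_pair Qq L (U j) (U K) (vq K / vq j) else 1)"
    proof (rule prod.cong[OF refl])
      fix K assume "K \<in> {..<n}"
      then have "{..<K} = {j \<in> {..<n}. j < K}" by auto
      then show "(\<Prod>j<K. swap_pair Qq L (U j) (U K) (vq K / vq j)) = (\<Prod>j<n. if j < K then swap_pair Qq L (U j) (U K) (vq K / vq j) else 1)"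
        by (simp only: prod.inter_filter[OF finite_lessThan])
    qed
    finally show ?thesis by (simp add: swap_monomial_def swap_pair_def)
  qed
  have pair: "swap_pair Qq L (?S j) (?S K) (vq K / vq j) = swap_pair Qq L (?S' j) (?S' K) (vq K / vq j) *
      ((if j = k then ?left K else 1) * (if K = k then ?right j else 1))" if jK: "j < K" "K < n" for j K
  proof -
    have a0: "vq K / vq j \<noteq> 0" using v0 by simp
    consider "j = k" | "K = k" | "j \<noteq> k" "K \<noteq> k" by blast
    then show ?thesis
    proof cases
      case 1
      then have "K \<noteq> k" using jK by simp
      then show ?thesis using 1 swap_pair_move_left[OF Qq_nonzero a0 L L m, of K] jK k by (simp add: \<kappa> mult.assoc)
    next
      case 2
      then have "j \<noteq> k" using jK by simp
      then show ?thesis using 2 swap_pair_move_right[OF Qq_nonzero a0 L L m, of j] jK k by (simp add: \<kappa> mult.assoc)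
    qed simp
  qed
  have "swap_monomial Qq vq n L ?S = (\<Prod>K<n. \<Prod>j<n. (if j < K then swap_pair Qq L (?S' j) (?S' K) (vq K / vq j) else 1) *
      ((if j = k then (if k < K then ?left K else 1) else 1) * (if K = k then (if j < k then ?right j else 1) else 1)))"
    unfolding tri
  proof (intro prod.cong[OF refl])
    fix K j assume "K \<in> {..<n}" "j \<in> {..<n}"
    then have K: "K < n" by simp
    have if_and: "(if j = k then (if k < K then x else 1) else 1) = (if j = k then x else (1 :: 'a))"
      "(if K = k then (if j < k then x else 1) else 1) = (if K = k then x else (1 :: 'a))" if "j < K" for x
      using that by auto
    have if_and': "(if j = k then (if k < K then x else 1) else 1) = (1 :: 'a)"
      "(if K = k then (if j < k then x else 1) else 1) = (1 :: 'a)" if "\<not> j < K" for x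
      using that by auto
    show "(if j < K then swap_pair Qq L (?S j) (?S K) (vq K / vq j) else 1) =
      (if j < K then swap_pair Qq L (?S' j) (?S' K) (vq K / vq j) else 1) *
      ((if j = k then (if k < K then ?left K else 1) else 1) * (if K = k then (if j < k then ?right j else 1) else 1))"
    proof (cases "j < K")
      case True
      show ?thesis unfolding if_and[OF True] using pair[OF True K] by (simp only: True if_True)
    next
      case False
      show ?thesis unfolding if_and'[OF False] by (simp only: False if_False mult_1_right)
    qed
  qed
  also have "\<dots> = swap_monomial Qq vq n L ?S' *
     ((\<Prod>K<n. \<Prod>j<n. if j = k then (if k < K then ?left K else 1) else 1) *
      (\<Prod>K<n. \<Prod>j<n. if K = k then (if j < k then ?right j else 1) else 1))"
    unfolding tri by (simp only: prod.distrib)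
  also have "(\<Prod>K<n. \<Prod>j<n. if j = k then (if k < K then ?left K else 1) else 1) = (\<Prod>K<n. if k < K then ?left K else 1)"
    using k by (intro prod.cong[OF refl]) (simp add: prod.delta)
  also have "(\<Prod>K<n. \<Prod>j<n. if K = k then (if j < k then ?right j else 1) else 1) = (\<Prod>j<n. if j < k then ?right j else 1)"
    using k by (subst prod.swap, intro prod.cong[OF refl]) (simp add: prod.delta)
  also have "(\<Prod>K<n. if k < K then ?left K else 1) * (\<Prod>j<n. if j < k then ?right j else 1) =
      (\<Prod>k'<n. if k < k' then ?left k' else if k' < k then ?right k' else 1)"
    unfolding prod.distrib[symmetric] by (rule prod.cong[OF refl]) auto
  finally show ?thesis .
qed

text \<open>For a component \<open>k' < k\<close> the changes of sign, strip weight and \<open>swap_monomial\<close> cancel.  For \<open>k' > k\<close> exactly one of the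
sign and the \<open>swap_monomial\<close> contributes \<open>-1\<close>, exactly one of the strip weight and the
\<open>swap_monomial\<close> contributes \<open>v k' / v k\<close>, and the powers of \<open>q\<close> combine to \<open>- (m + 1)\<close> because the charge is zero.
The component \<open>k\<close> itself yields the row of the box that disappears from it.\<close>

lemma move_weight:
  "(- 1 :: 'a) ^ card (slope_set \<rho> \<inter> {tt<..<tt + int n}) *
    (\<Prod>c\<in>{tt<..tt + int n}. cyc n q c ^ card {u \<in> slope_set \<sigma>. c \<le> u}) *
    swap_monomial Qq vq n L (\<lambda>j. slope_set (l j)) =
   Qq ^ nabove k * ((- 1) ^ (n - k - 1) * Qq powi ((int n - int k - 1) * (- (m + 1))) * (\<Prod>i\<in>{k + 1..<n}. q i ^ (n - i))) *
    swap_monomial Qq vq n L (\<lambda>j. slope_set ((l(k := \<kappa>)) j))"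
proof -
  have v0: "vq i \<noteq> 0" for i by (rule vprod_nonzero[OF q])
  note Q0 = Qq_nonzero
  let ?h = "\<lambda>k'. card {y. y \<le> m \<and> y \<notin> slope_set (l k')}"
  have comp: "(if k < k' then (if m \<in> slope_set (l k') then - 1 else 1)
      else if k' < k then (if m + 1 \<in> slope_set (l k') then - 1 else 1) else 1) *
    (Qq ^ nabove k' * (if k < k' then (if m \<in> slope_set (l k') then vq k' / vq k else 1)
      else if k' < k then (if m + 1 \<in> slope_set (l k') then vq k' / vq k else 1) else 1)) *
    (if k < k' then (if m \<in> slope_set (l k') then 1 else - (vq k' / vq k)) * Qq powi (- int (?h k'))
      else if k' < k then (if m + 1 \<in> slope_set (l k') then - (vq k / vq k') else 1) * Qq powi (- int (nabove k')) else 1) =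
    (if k' = k then Qq ^ nabove k else 1) * (if k < k' then - 1 * Qq powi (- (m + 1)) * (vq k' / vq k) else 1)"
    if k': "k' < n" for k'
  proof -
    consider "k' = k" | "k < k'" | "k' < k" by linarith
    then show ?thesis
    proof cases
      case 1
      then show ?thesis by simp
    next
      case 2
      have "int (nabove k') - int (?h k') = - (m + 1)"
        using charge[OF L[OF k'], of "m + 1"] 2 by simp
      then have "Qq powi (int (nabove k')) * Qq powi (- int (?h k')) = Qq powi (- (m + 1))"
        using Q0 by (simp only: power_int_add[OF disjI1[OF Q0], symmetric]) simp
      then have *: "Qq ^ nabove k' * Qq powi (- int (?h k')) = Qq powi (- (m + 1))" by (simp only: power_int_of_nat)
      have c: "(k < k') = True" "(k' < k) = False" "(k' = k) = False" using 2 by auto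
      show ?thesis by (simp only: c if_True if_False mult_1_left component_above[OF *])
    next
      case 3
      have "Qq ^ nabove k' * Qq powi (- int (nabove k')) = 1"
        using Q0 by (simp add: power_int_minus del: fun_upd_apply)
      moreover have "vq k' / vq k * (vq k / vq k') = 1" using v0 by simp
      ultimately have *: "(if b then - 1 else 1) * (Qq ^ nabove k' * (if b then vq k' / vq k else 1)) *
        ((if b then - (vq k / vq k') else 1) * Qq powi (- int (nabove k'))) = 1" for b
        by (rule component_below)
      have c: "(k < k') = False" "(k' < k) = True" "(k' = k) = False" using 3 by auto
      show ?thesis by (simp only: c if_True if_False mult_1_left *)
    qed
  qed
  have "(- 1 :: 'a) ^ card (slope_set \<rho> \<inter> {tt<..<tt + int n}) *
    (\<Prod>c\<in>{tt<..tt + int n}. cyc n q c ^ card {u \<in> slope_set \<sigma>. c \<le> u}) *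
    swap_monomial Qq vq n L (\<lambda>j. slope_set (l j)) =
    (\<Prod>k'<n. (if k' = k then Qq ^ nabove k else 1) * (if k < k' then - 1 * Qq powi (- (m + 1)) * (vq k' / vq k) else 1)) *
    swap_monomial Qq vq n L (\<lambda>j. slope_set ((l(k := \<kappa>)) j))"
    unfolding strip_sign strip_weight swap_monomial_move prod_collect
    by (rule arg_cong2[of _ _ _ _ "(*)", OF prod.cong[OF refl] refl], rule comp) (simp only: lessThan_iff)
  also have "(\<Prod>k'<n. (if k' = k then Qq ^ nabove k else 1) * (if k < k' then - 1 * Qq powi (- (m + 1)) * (vq k' / vq k) else 1)) =
    Qq ^ nabove k * (\<Prod>k'\<in>{k + 1..<n}. - 1 * Qq powi (- (m + 1)) * (vq k' / vq k))"
  proof -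
    have "(\<Prod>k'<n. if k' = k then Qq ^ nabove k else 1) = Qq ^ nabove k" using k by (simp add: prod.delta)
    moreover have "(\<Prod>k'<n. if k < k' then - 1 * Qq powi (- (m + 1)) * (vq k' / vq k) else 1) =
      (\<Prod>k'\<in>{k'\<in>{..<n}. k < k'}. - 1 * Qq powi (- (m + 1)) * (vq k' / vq k))"
      by (rule prod.inter_filter[symmetric]) simp
    moreover have "{k'\<in>{..<n}. k < k'} = {k + 1..<n}" by auto
    ultimately show ?thesis by (simp only: prod.distrib)
  qed
  also have "(\<Prod>k'\<in>{k + 1..<n}. - 1 * Qq powi (- (m + 1)) * (vq k' / vq k)) =
    (- 1) ^ (n - k - 1) * Qq powi ((int n - int k - 1) * (- (m + 1))) * (\<Prod>i\<in>{k + 1..<n}. q i ^ (n - i))"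
  proof -
    have "(Qq powi (- (m + 1))) ^ (n - k - 1) = Qq powi (- (m + 1) * int (n - k - 1))"
      by (simp only: power_int_mult power_int_of_nat)
    also have "- (m + 1) * int (n - k - 1) = (int n - int k - 1) * (- (m + 1))" using k by (simp add: of_nat_diff algebra_simps)
    finally have pw: "(Qq powi (- (m + 1))) ^ (n - k - 1) = Qq powi ((int n - int k - 1) * (- (m + 1)))" .
    show ?thesis
      unfolding prod_vprod_quotients[OF q]
      by (simp only: prod.distrib prod_constant card_atLeastLessThan diff_diff_left[symmetric] pw)
  qed
  finally show ?thesis .
qed

end

section \<open>Removing the border strips one by one\<close>

text \<open>By induction on the strips.  The box that leaves the component \<open>k\<close> has content \<open>m + 1\<close>, and its row index is the number of
particles from \<open>m + 1\<close> on; these are the quantities in \<open>move_weight\<close>.\<close>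

lemma sign_box_identity:
  fixes q :: "nat \<Rightarrow> 'a::field"
  assumes "strip_decomposition n \<rho> \<nu>s"
    and n: "1 \<le> n" and q: "\<And>i. q i \<noteq> 0"
    and "is_quotient n \<rho> l" and "\<And>k. k < n \<Longrightarrow> slope_like L (slope_set (l k))"
  shows "(- 1) ^ (\<Sum>\<nu>\<leftarrow>\<nu>s. strip_height \<nu>) * (\<Prod>(i, j)\<in>boxes \<rho>. cyc n q (int j - int i) ^ i) *
      swap_monomial (\<Prod>k<n. q k) (vprod q) n L (\<lambda>k. slope_set (l k)) =
    (\<Prod>k<n. \<Prod>(i, j)\<in>boxes (l k). (\<Prod>k<n. q k) ^ i * ((- 1) ^ (n - k - 1) *
      (\<Prod>k<n. q k) powi ((int n - int k - 1) * (int i - int j)) * (\<Prod>m\<in>{k + 1..<n}. q m ^ (n - m))))"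
  using assms(1,4,5)
proof (induction arbitrary: l rule: strip_decomposition.induct)
  case Nil
  have l: "l k = empty_partition" if "k < n" for k using quotient_empty_components[OF Nil.prems(1) that] .
  have h: "hcount {..<0} {..<0} (- e) = 0" if "1 \<le> e" for e
  proof -
    have "{m::int. m \<in> {..<0} \<and> m + - e \<notin> {..<0}} = {}" using that by auto
    then show ?thesis by (simp only: hcount_def card.empty)
  qed
  have "swap_monomial (\<Prod>k<n. q k) (vprod q) n L (\<lambda>k. slope_set (l k)) = 1"
    unfolding swap_monomial_def by (intro prod.neutral ballI) (simp add: l slope_set_empty h)
  then show ?case by (simp add: l)
next
  case (Cons \<rho> \<nu> \<sigma> \<nu>s)
  let ?Q = "\<Prod>k<n. q k"
  define H where "H k = (\<lambda>(i, j). ?Q ^ i * ((- 1) ^ (n - k - 1) * ?Q powi ((int n - int k - 1) * (int i - int j)) *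
    (\<Prod>m\<in>{k + 1..<n}. q m ^ (n - m))))" for k
  obtain r s where rows: "strip_rows \<rho> \<sigma> r s" using border_strip_rows[OF Cons.hyps(1,3)] .
  have \<nu>: "\<nu> = boxes \<rho> - boxes \<sigma>" using Cons.hyps(1,3) by (auto simp: border_strip_def)
  obtain m k where t: "beta \<sigma> s = int n * m + int k" and k: "k < n" using int_cases_divmod[OF n] .
  have r: "beta \<rho> r = int n * m + int k + int n" using strip_card[OF rows] Cons.hyps(2) t \<nu> by simp
  have "int n * m + int k \<notin> slope_set \<rho>" "int n * m + int k + int n \<in> slope_set \<rho>"
    using strip_slope_set(1,2)[OF rows] t r by simp_all
  moreover have "int n * m + int k + int n = int n * (m + 1) + int k" by (simp add: algebra_simps)
  ultimately have m: "m \<notin> slope_set (l k)" "m + 1 \<in> slope_set (l k)"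
    using slope_set_quotient[OF Cons.prems(1) k] by simp_all
  obtain \<kappa> r' s' where \<kappa>: "strip_rows (l k) \<kappa> r' s'" "beta \<kappa> s' = m" "beta (l k) r' = m + 1"
    using strip_exists[of 1 m "l k"] m by auto
  have S\<sigma>: "slope_set \<sigma> = insert (int n * m + int k) (slope_set \<rho> - {int n * m + int k + int n})"
    using strip_slope_set(3)[OF rows] t r by simp
  have S\<kappa>: "slope_set \<kappa> = insert m (slope_set (l k) - {m + 1})" using strip_slope_set(3)[OF \<kappa>(1)] \<kappa> by simp
  define l' where "l' = l(k := \<kappa>)"
  have quot': "is_quotient n \<sigma> l'" unfolding l'_def by (rule is_quotient_move[OF Cons.prems(1) k S\<sigma> S\<kappa>])
  have L': "slope_like L (slope_set (l' k'))" if "k' < n" for k'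
    using Cons.prems(2)[OF that] slope_like_move[OF Cons.prems(2)[OF k] m] by (simp add: l'_def S\<kappa>)
  note IH = Cons.IH[OF quot' L', folded H_def]
  \<comment> \<open>The component \<open>k\<close> loses exactly one box, of content \<open>m + 1\<close>.\<close>
  obtain i j where box: "boxes (l k) - boxes \<kappa> = {(i, j)}"
  proof -
    have "card (boxes (l k) - boxes \<kappa>) = 1" using strip_card[OF \<kappa>(1)] \<kappa> by simp
    then show thesis using that by (metis card_1_singletonE surj_pair)
  qed
  have ij: "(i, j) \<in> boxes (l k) - boxes \<kappa>" using box by blast
  have content: "int j - int i = m + 1"
    using bij_betwE[OF strip_bij[OF \<kappa>(1)], THEN bspec, OF ij] \<kappa> by simp
  have i: "i = card {x \<in> slope_set ((l(k := \<kappa>)) k). m + 1 \<le> x}"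
    using strip_row_of[OF \<kappa>(1) ij] content by simp
  have "boxes (l k) = insert (i, j) (boxes \<kappa>)" "(i, j) \<notin> boxes \<kappa>"
    using box strip_boxes_subset[OF \<kappa>(1)] by blast+
  then have Hk: "prod (H k) (boxes (l k)) = H k (i, j) * prod (H k) (boxes \<kappa>)" by simp
  have G: "(\<Prod>k'<n. prod (H k') (boxes (l k'))) = H k (i, j) * (\<Prod>k'<n. prod (H k') (boxes (l' k')))"
  proof -
    have "(\<Prod>k'<n. prod (H k') (boxes (l k'))) = (\<Prod>k'<n. (if k' = k then H k (i, j) else 1) * prod (H k') (boxes (l' k')))"
      by (rule prod.cong[OF refl]) (simp add: l'_def Hk)
    then show ?thesis using k by (simp add: prod.distrib prod.delta)
  qed
  have \<rho>: "boxes \<rho> = \<nu> \<union> boxes \<sigma>" "\<nu> \<inter> boxes \<sigma> = {}" using Cons.hyps(3) strip_boxes_subset[OF rows] \<nu> by auto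
  have F: "(\<Prod>(i, j)\<in>boxes \<rho>. cyc n q (int j - int i) ^ i) =
    (\<Prod>c\<in>{int n * m + int k<..int n * m + int k + int n}. cyc n q c ^ card {u \<in> slope_set \<sigma>. c \<le> u}) *
    (\<Prod>(i, j)\<in>boxes \<sigma>. cyc n q (int j - int i) ^ i)"
  proof -
    have "finite \<nu>" by (simp add: \<nu>)
    then have "(\<Prod>(i, j)\<in>boxes \<rho>. cyc n q (int j - int i) ^ i) =
      (\<Prod>(i, j)\<in>\<nu>. cyc n q (int j - int i) ^ i) * (\<Prod>(i, j)\<in>boxes \<sigma>. cyc n q (int j - int i) ^ i)"
      unfolding \<rho>(1) using \<rho>(2) by (intro prod.union_disjoint) simp_all
    then show ?thesis unfolding \<nu> strip_prod[OF rows] t r .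
  qed
  have ht: "strip_height \<nu> = card (slope_set \<rho> \<inter> {int n * m + int k<..<int n * m + int k + int n})"
    using strip_rows_height[OF rows] by (simp only: \<nu> t r)
  have Hij: "H k (i, j) = ?Q ^ card {x \<in> slope_set ((l(k := \<kappa>)) k). m + 1 \<le> x} * ((- 1) ^ (n - k - 1) *
      ?Q powi ((int n - int k - 1) * (- (m + 1))) * (\<Prod>i\<in>{k + 1..<n}. q i ^ (n - i)))"
  proof -
    have "int i - int j = - (m + 1)" using content by simp
    then show ?thesis unfolding H_def prod.case by (simp only: i[symmetric])
  qed
  define Y where "Y = (- 1) ^ (\<Sum>\<nu>\<leftarrow>\<nu>s. strip_height \<nu>) * (\<Prod>(i, j)\<in>boxes \<sigma>. cyc n q (int j - int i) ^ i)"
  have "(- 1) ^ (\<Sum>\<nu>\<leftarrow>\<nu> # \<nu>s. strip_height \<nu>) * (\<Prod>(i, j)\<in>boxes \<rho>. cyc n q (int j - int i) ^ i) *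
      swap_monomial ?Q (vprod q) n L (\<lambda>k. slope_set (l k)) =
     Y * ((- 1) ^ card (slope_set \<rho> \<inter> {int n * m + int k<..<int n * m + int k + int n}) *
      (\<Prod>c\<in>{int n * m + int k<..int n * m + int k + int n}. cyc n q c ^ card {u \<in> slope_set \<sigma>. c \<le> u}) *
      swap_monomial ?Q (vprod q) n L (\<lambda>k. slope_set (l k)))"
    unfolding F Y_def by (simp only: list.map sum_list.Cons power_add ht mult_ac)
  also have "\<dots> = Y * (H k (i, j) * swap_monomial ?Q (vprod q) n L (\<lambda>j. slope_set (l' j)))"
    unfolding Hij l'_def
    by (subst move_weight[OF n q k Cons.prems m S\<sigma> S\<kappa>]) simp_all
  also have "\<dots> = H k (i, j) * (Y * swap_monomial ?Q (vprod q) n L (\<lambda>j. slope_set (l' j)))"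
    by (simp only: mult_ac)
  also have "\<dots> = H k (i, j) * (\<Prod>k'<n. prod (H k') (boxes (l' k')))"
    unfolding Y_def by (simp only: IH)
  also have "\<dots> = (\<Prod>k'<n. prod (H k') (boxes (l k')))" by (rule G[symmetric])
  finally show ?case unfolding H_def .
qed

theorem theorem3p1:
  fixes n :: nat and \<rho>p \<rho>m lam :: partition and l :: "nat \<Rightarrow> partition"
  assumes "n \<ge> 1"
    and "balanced n lam"
    and "is_quotient n lam l"
  shows "\<exists>A B :: mpoly_int.
    mpoly_vars A \<subseteq> {..<n} \<and> mpoly_vars B \<subseteq> {..<n} \<and> B \<noteq> 0 \<and>
    PY_tilde n \<rho>p \<rho>m l / PY_tilde n empty_partition empty_partition (\<lambda>_. empty_partition) =
      mpoly_eval (\<lambda>i. if i = 0 then qY else gvar i) A /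
      mpoly_eval (\<lambda>i. if i = 0 then qY else gvar i) B \<and>
    PX_tilde n \<rho>p \<rho>m lam =
      mpoly_eval (\<lambda>i. if i = 0 then qX n else gvar i) A /
      mpoly_eval (\<lambda>i. if i = 0 then qX n else gvar i) B *
      (\<Prod>k<n. \<Prod>(i, j)\<in>boxes (l k).
         (-1) ^ (n - k - 1) * qX n powi ((int n - int k - 1) * (int i - int j)) *
         (\<Prod>m\<in>{k + 1..<n}. gvar m ^ (n - m)))"
proof -
  note n = assms(1) and quot = assms(3)
  define L0 where "L0 k = (SOME L. slope_like L (slope_set (l k)))" for k
  have L0: "slope_like (L0 k) (slope_set (l k))" for k
    unfolding L0_def using slope_like_slope_set[of "l k"] by (metis someI)
  \<comment> \<open>A cutoff that is good for all components at once; the successor makes room for \<open>cofin_above\<close>.\<close>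
  define L where "L = Suc (\<Sum>k<n. L0 k)"
  have bound: "slope_bound L (slope_set (l k))" if "k < n" for k
  proof -
    have "L0 k \<le> (\<Sum>k<n. L0 k)" using that by (intro member_le_sum) auto
    then show ?thesis unfolding L_def by (intro slope_bound_Suc slope_like_mono[OF L0])
  qed
  have bound0: "slope_bound L {..<0}" unfolding L_def by (intro slope_bound_Suc slope_like_empty)
  have gv: "gvar i \<noteq> (0 :: rat gseries)" "fls_subdegree (gvar i :: rat gseries) = 1" for i
    by (rule gvar_props)+
  let ?E = "res_expr (qX n) (vprod gvar) n L l (conj_partition \<rho>m) \<rho>p"
  let ?R = "\<Prod>k<n. \<Prod>(i, j)\<in>boxes (l k). (-1) ^ (n - k - 1) * qX n powi ((int n - int k - 1) * (int i - int j)) *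
         (\<Prod>m\<in>{k + 1..<n}. gvar m ^ (n - m))"
  have ratio: "PY_tilde n \<rho>p \<rho>m l / PY_tilde n empty_partition empty_partition (\<lambda>_. empty_partition) =
    res_expr qY (vprod gvar) n L l (conj_partition \<rho>m) \<rho>p"
    by (rule PY_ratio[OF n bound0 bound])
  have PX: "PX_tilde n \<rho>p \<rho>m lam = ?E * ?R"
  proof -
    let ?v = "vprod gvar :: nat \<Rightarrow> rat gseries"
    have Q: "qX n = (\<Prod>k<n. gvar k)" by (simp add: qX_def)
    have Q0: "qX n \<noteq> 0" using gv by (simp add: Q)
    have v0: "?v k \<noteq> 0" for k by (rule vprod_nonzero[OF gv(1)])
    obtain \<nu>s where "strip_decomposition n lam \<nu>s" using strip_decomposition_exists[OF n quot] by blast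
    then have dec: "strip_decomposition n lam (SOME \<nu>s. strip_decomposition n lam \<nu>s)" by (rule someI)
    have sign: "of_int (chi_sign n lam) * (\<Prod>(i, j)\<in>boxes lam. cyc n gvar (int j - int i) ^ i) *
        swap_monomial (qX n) ?v n L (\<lambda>k. slope_set (l k)) = (\<Prod>k<n. \<Prod>(i, j)\<in>boxes (l k). qX n ^ i) * ?R"
    proof -
      have "of_int (chi_sign n lam) * (\<Prod>(i, j)\<in>boxes lam. cyc n gvar (int j - int i) ^ i) *
        swap_monomial (qX n) ?v n L (\<lambda>k. slope_set (l k)) =
        (\<Prod>k<n. \<Prod>(i, j)\<in>boxes (l k). qX n ^ i * ((-1) ^ (n - k - 1) * qX n powi ((int n - int k - 1) * (int i - int j)) *
         (\<Prod>m\<in>{k + 1..<n}. gvar m ^ (n - m))))"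
        using sign_box_identity[OF dec n gv(1) quot, of L] bound
        by (simp add: chi_sign_def Q slope_bound_def)
      also have "\<dots> = (\<Prod>k<n. \<Prod>(i, j)\<in>boxes (l k). qX n ^ i) * ?R"
        unfolding prod.distrib[symmetric] by (intro prod.cong refl) (simp add: split_beta)
      finally show ?thesis .
    qed
    have P: "P n gvar \<rho>p \<rho>m lam = gvar 0 powi (- int (psize \<rho>p)) *
      inverse (pair_product_factor (qX n) ?v n L (\<lambda>k. slope_set (l k))) *
      matel (qX n) ?v n L (\<lambda>k. slope_set (l k)) (conj_partition \<rho>m) \<rho>p"
      unfolding Q by (rule P_formula[OF n gv quot]) (use bound in \<open>simp_all add: slope_bound_def\<close>)
    \<comment> \<open>The prefactors of the two closed forms agree since \<open>q\<close> is the product of \<open>gvar 0\<close> and the other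
      variables.\<close>
    have g0: "gvar 0 powi (- int (psize \<rho>p)) = (?v (n - 1) / qX n) ^ psize \<rho>p"
    proof -
      have "?v (n - 1) / qX n = inverse (gvar 0)"
        unfolding Q prod_lessThan_vprod[OF n] using v0[of "n - 1"] gv by (simp add: field_simps)
      then show ?thesis by (simp add: power_int_minus power_inverse)
    qed
    let ?I = "\<Prod>k<n. inverse (self_factor (qX n) L (slope_set (l k)))"
    let ?J = "\<Prod>K\<in>{1..<n}. \<Prod>k<K. inverse (cross_factor (qX n) (?v K / ?v k) L (slope_set (l k)) (slope_set (l K)))"
    let ?S = "swap_monomial (qX n) ?v n L (\<lambda>k. slope_set (l k))"
    let ?M = "matel (qX n) ?v n L (\<lambda>k. slope_set (l k)) (conj_partition \<rho>m) \<rho>p"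
    have "PX_tilde n \<rho>p \<rho>m lam = (of_int (chi_sign n lam) * (\<Prod>(i, j)\<in>boxes lam. cyc n gvar (int j - int i) ^ i) * ?S) *
      ((?v (n - 1) / qX n) ^ psize \<rho>p * (?I * ?J) * ?M)"
      unfolding PX_tilde_def P g0 inverse_pair_product_factor[OF Q0 v0] by (simp only: mult_ac)
    also have "\<dots> = ?E * ?R"
      unfolding sign res_expr_def by (simp only: mult_ac)
    finally show ?thesis .
  qed
  obtain A B where AB: "mpoly_vars A \<subseteq> {..<n}" "mpoly_vars B \<subseteq> {..<n}" "evalX n B \<noteq> 0"
    "?E = evalX n A / evalX n B" "res_expr qY (vprod gvar) n L l (conj_partition \<rho>m) \<rho>p = evalY A / evalY B"
    using same_rat_res_expr[OF n, of L l "conj_partition \<rho>m" \<rho>p] unfolding same_rat_def by blast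
  have "B \<noteq> 0" using AB(3) by (auto simp: evalX_def mpoly_eval_0)
  then show ?thesis
    using AB ratio PX unfolding evalX_def evalY_def
    by (intro exI[of _ A] exI[of _ B] conjI) simp_all
qed

end
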